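(* Fix $r\ge1$. There exist a universal admissible ring $\overline R_0$ and a universal admissible integral domain $\overline R_+$ (that is, admissible ground rings, the second an integral domain, each with parameters denoted $\bar\rho,\bar q,\bar\delta_j\ (j\ge0),\bar u_1,\dots,\bar u_r$) with the following properties: (1) There is a morphism of ground rings from $\overline R_0$ to $\overline R_+$. (2) $\overline R_0$ (and hence also $\overline R_+$) is generated as a unital ring by $\bar q^{\pm1},\bar\rho^{\pm1},\bar\delta_0^{\pm1},\bar\delta_1,\dots,\bar\delta_{r-1},\bar u_1^{\pm1},\dots,\bar u_r^{\pm1}$. (3) The parameters $\bar q,\bar u_1,\dots,\bar u_r$ of $\overline R_+$ (hence also those of $\overline R_0$) are algebraically independent over $\mathbb Z$. (4) Whenever $S$ is a ring with admissible parameters, there exists a morphism of ground rings from $\overline R_0$ to $S$. If $S$ is also an integral domain, then the morphism of ground rings can be chosen to factor through $\overline R_+$. (5) $\overline R_+[(\bar q-\bar q^{-1})^{-1}]$ is isomorphic to the universal $u$-admissible ring $\overline S$ by an isomorphism of ground rings.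
   Context: **Ground ring.** A ground ring $S$ is a commutative unital ring with distinguished elements (parameters) $\rho$, $q$, $\delta_j$ ($j\ge 0$), $u_1,\dots,u_r$, with $\rho,q,\delta_0,u_1,\dots,u_r$ invertible and $\rho^{-1}-\rho=(q^{-1}-q)(\delta_0-1)$. **Morphism of ground rings.** A unital ring homomorphism $S\to S'$ between ground rings is a morphism of ground rings if it maps either [$\rho\mapsto\rho'$, and $q\mapsto q'$ or $q\mapsto-q'^{-1}$] or [$\rho\mapsto-\rho'$, and $q\mapsto-q'$ or $q\mapsto q'^{-1}$], and strictly preserves all other parameters ($\delta_j\mapsto\delta_j'$, $u_i\mapsto u_i'$). **The algebra $W_{2,S,r}$.** The unital $S$-algebra with generators $y_1^{\pm1},g^{\pm1},e$ and relations: $gg^{-1}=g^{-1}g=1$, $y_1y_1^{-1}=y_1^{-1}y_1=1$; $e^2=\delta_0e$; $y_1gy_1g=gy_1gy_1$; $ey_1^je=\delta_je$ ($j\ge1$); $g-g^{-1}=(q-q^{-1})(1-e)$; $ge=eg=\rho^{-1}e$; $ey_1gy_1=\rho e=y_1gy_1e$; $(y_1-u_1)\cdots(y_1-u_r)=0$. **Weak admissibility.** For $j\ge1$ define $\delta_{-j}$ by $\delta_{-1}=\rho^{-2}\delta_1$ and $\delta_{-j}=\rho^{-2}\delta_j+(q^{-1}-q)\rho^{-1}\sum_{k=1}^{j-1}(\delta_k\delta_{k-j}-\delta_{2k-j})$ for $j\ge 2$. $S$ is weakly admissible if $\sum_{k=0}^r(-1)^{r-k}\varepsilon_{r-k}(u_1,\dots,u_r)\,\delta_{k+a}=0$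 for all $a\in\mathbb Z$ ($\varepsilon_i$ = $i$-th elementary symmetric function). **Admissibility.** $S$ is admissible if $q-q^{-1}$ is non-zero and not a zero-divisor in $S$, $S$ is weakly admissible, and $\{e,y_1e,\dots,y_1^{r-1}e\}\subseteq W_{2,S,r}$ is linearly independent over $S$. **The universal $u$-admissible ring $\overline S$.** Let $q,u_1,\dots,u_r$ be algebraically independent over $\mathbb Z$, $S_0=\mathbb Z[q^{\pm1},u_1^{\pm1},\dots,u_r^{\pm1}][(q^{-1}-q)^{-1}]$, $p=\prod_ju_j$, $\rho=p$ if $r$ is odd, $\rho=q^{-1}p$ if $r$ is even, $$\gamma_j=\prod_{\ell\ne j}\frac{u_\ell u_j-1}{u_j-u_\ell}\left(\frac{1-u_j^2}{\rho(q^{-1}-q)}\prod_{\ell\neq j}u_\ell+\begin{cases}1&r\text{ odd}\\-u_j&r\text{ even}\end{cases}\right),$$ $\delta_a=\sum_j\gamma_ju_j^a$ ($a\ge0$), which lie in $S_0$, and $\overline S=S_0[\delta_0^{-1}]$, a ground ring with these parameters. *)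

theory Defs
  imports
    "HOL-Algebra.Algebra"
    "HOL-Algebra.Algebraic_Closure_Type"
    "HOL-Algebra.Chinese_Remainder"
    "HOL-Library.Poly_Mapping"
begin

section \<open>Ground rings and their morphisms\<close>

text \<open>A ring together with distinguished elements. Only the values of \<open>par_u\<close> at the
  indices \<open>1, ..., r\<close> are meaningful.\<close>

record 'a param_ring = "'a ring" +
  par_rho :: 'a
  par_q :: 'a
  par_delta :: "nat \<Rightarrow> 'a"
  par_u :: "nat \<Rightarrow> 'a"

locale ground_ring = cring S
  for r :: nat and S :: "('a, 'm) param_ring_scheme" (structure) +
  assumes rho_unit: "par_rho S \<in> Units S"
    and q_unit: "par_q S \<in> Units S"
    and delta_closed: "\<And>j. par_delta S j \<in> carrier S"
    and delta0_unit: "par_delta S 0 \<in> Units S"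
    and u_unit: "\<And>i. i \<in> {1..r} \<Longrightarrow> par_u S i \<in> Units S"
    and ground_relation:
      "inv (par_rho S) \<ominus> par_rho S
         = (inv (par_q S) \<ominus> par_q S) \<otimes> (par_delta S 0 \<ominus> \<one>)"

definition ground_morphism ::
  "nat \<Rightarrow> ('a, 'm) param_ring_scheme \<Rightarrow> ('b, 'n) param_ring_scheme \<Rightarrow> ('a \<Rightarrow> 'b) \<Rightarrow> bool"
where
  "ground_morphism r S T \<phi> \<longleftrightarrow>
     ground_ring r S \<and> ground_ring r T \<and> \<phi> \<in> ring_hom S T \<and>
     ((\<phi> (par_rho S) = par_rho T \<and>
         (\<phi> (par_q S) = par_q T \<or> \<phi> (par_q S) = \<ominus>\<^bsub>T\<^esub> (inv\<^bsub>T\<^esub> (par_q T))))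
      \<or> (\<phi> (par_rho S) = \<ominus>\<^bsub>T\<^esub> (par_rho T) \<and>
         (\<phi> (par_q S) = \<ominus>\<^bsub>T\<^esub> (par_q T) \<or> \<phi> (par_q S) = inv\<^bsub>T\<^esub> (par_q T)))) \<and>
     (\<forall>j. \<phi> (par_delta S j) = par_delta T j) \<and>
     (\<forall>i\<in>{1..r}. \<phi> (par_u S i) = par_u T i)"

definition ground_iso ::
  "nat \<Rightarrow> ('a, 'm) param_ring_scheme \<Rightarrow> ('b, 'n) param_ring_scheme \<Rightarrow> ('a \<Rightarrow> 'b) \<Rightarrow> bool"
where
  "ground_iso r S T \<phi> \<longleftrightarrow>
     ground_morphism r S T \<phi> \<and> bij_betw \<phi> (carrier S) (carrier T)"


section \<open>The algebra $W_{2,S,r}$\<close>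

text \<open>The free associative algebra over \<open>S\<close> on the generators \<open>'g\<close>: finitely supported
  coefficient functions on words, multiplied by convolution.\<close>

definition free_algebra :: "('a, 'm) ring_scheme \<Rightarrow> ('g list \<Rightarrow> 'a) ring" where
  "free_algebra S =
     \<lparr> carrier = {f. (\<forall>w. f w \<in> carrier S) \<and> finite {w. f w \<noteq> \<zero>\<^bsub>S\<^esub>}},
       monoid.mult = (\<lambda>f g w. \<Oplus>\<^bsub>S\<^esub>k\<in>{..length w}. f (take k w) \<otimes>\<^bsub>S\<^esub> g (drop k w)),
       one = (\<lambda>w. if w = [] then \<one>\<^bsub>S\<^esub> else \<zero>\<^bsub>S\<^esub>),
       ring.zero = (\<lambda>w. \<zero>\<^bsub>S\<^esub>),
       add = (\<lambda>f g w. f w \<oplus>\<^bsub>S\<^esub> g w) \<rparr>"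

definition free_const :: "('a, 'm) ring_scheme \<Rightarrow> 'a \<Rightarrow> 'g list \<Rightarrow> 'a" where
  "free_const S c = (\<lambda>w. if w = [] then c else \<zero>\<^bsub>S\<^esub>)"

definition free_gen :: "('a, 'm) ring_scheme \<Rightarrow> 'g \<Rightarrow> 'g list \<Rightarrow> 'a" where
  "free_gen S x = (\<lambda>w. if w = [x] then \<one>\<^bsub>S\<^esub> else \<zero>\<^bsub>S\<^esub>)"

datatype W2_gen = Gen_y | Gen_y_inv | Gen_g | Gen_g_inv | Gen_e

text \<open>A pair \<open>(a, b)\<close> stands for the relation \<open>a = b\<close>.\<close>

definition W2_relations ::
  "nat \<Rightarrow> ('a, 'm) param_ring_scheme \<Rightarrow> ((W2_gen list \<Rightarrow> 'a) \<times> (W2_gen list \<Rightarrow> 'a)) set"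
where
  "W2_relations r S =
    (let A = free_algebra S;
         y = free_gen S Gen_y; y' = free_gen S Gen_y_inv;
         g = free_gen S Gen_g; g' = free_gen S Gen_g_inv;
         e = free_gen S Gen_e;
         c = free_const S;
         \<rho> = par_rho S; q = par_q S
     in {(g \<otimes>\<^bsub>A\<^esub> g', \<one>\<^bsub>A\<^esub>), (g' \<otimes>\<^bsub>A\<^esub> g, \<one>\<^bsub>A\<^esub>),
         (y \<otimes>\<^bsub>A\<^esub> y', \<one>\<^bsub>A\<^esub>), (y' \<otimes>\<^bsub>A\<^esub> y, \<one>\<^bsub>A\<^esub>),
         (e \<otimes>\<^bsub>A\<^esub> e, c (par_delta S 0) \<otimes>\<^bsub>A\<^esub> e),
         (y \<otimes>\<^bsub>A\<^esub> g \<otimes>\<^bsub>A\<^esub> y \<otimes>\<^bsub>A\<^esub> g, g \<otimes>\<^bsub>A\<^esub> y \<otimes>\<^bsub>A\<^esub> g \<otimes>\<^bsub>A\<^esub> y),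
         (g \<ominus>\<^bsub>A\<^esub> g', c (q \<ominus>\<^bsub>S\<^esub> inv\<^bsub>S\<^esub> q) \<otimes>\<^bsub>A\<^esub> (\<one>\<^bsub>A\<^esub> \<ominus>\<^bsub>A\<^esub> e)),
         (g \<otimes>\<^bsub>A\<^esub> e, c (inv\<^bsub>S\<^esub> \<rho>) \<otimes>\<^bsub>A\<^esub> e),
         (e \<otimes>\<^bsub>A\<^esub> g, c (inv\<^bsub>S\<^esub> \<rho>) \<otimes>\<^bsub>A\<^esub> e),
         (e \<otimes>\<^bsub>A\<^esub> y \<otimes>\<^bsub>A\<^esub> g \<otimes>\<^bsub>A\<^esub> y, c \<rho> \<otimes>\<^bsub>A\<^esub> e),
         (y \<otimes>\<^bsub>A\<^esub> g \<otimes>\<^bsub>A\<^esub> y \<otimes>\<^bsub>A\<^esub> e, c \<rho> \<otimes>\<^bsub>A\<^esub> e),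
         (foldr (\<lambda>i p. (y \<ominus>\<^bsub>A\<^esub> c (par_u S i)) \<otimes>\<^bsub>A\<^esub> p) [1..<Suc r] \<one>\<^bsub>A\<^esub>, \<zero>\<^bsub>A\<^esub>)}
        \<union> {(e \<otimes>\<^bsub>A\<^esub> (y [^]\<^bsub>A\<^esub> j) \<otimes>\<^bsub>A\<^esub> e, c (par_delta S j) \<otimes>\<^bsub>A\<^esub> e) | j :: nat. j \<ge> 1})"

definition W2_ideal :: "nat \<Rightarrow> ('a, 'm) param_ring_scheme \<Rightarrow> (W2_gen list \<Rightarrow> 'a) set" where
  "W2_ideal r S =
     Idl\<^bsub>free_algebra S\<^esub> {a \<ominus>\<^bsub>free_algebra S\<^esub> b | a b. (a, b) \<in> W2_relations r S}"

definition W2 :: "nat \<Rightarrow> ('a, 'm) param_ring_scheme \<Rightarrow> (W2_gen list \<Rightarrow> 'a) set ring" where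
  "W2 r S = free_algebra S Quot W2_ideal r S"

definition W2_gen :: "nat \<Rightarrow> ('a, 'm) param_ring_scheme \<Rightarrow> W2_gen \<Rightarrow> (W2_gen list \<Rightarrow> 'a) set" where
  "W2_gen r S x = W2_ideal r S +>\<^bsub>free_algebra S\<^esub> free_gen S x"

definition W2_scalar :: "nat \<Rightarrow> ('a, 'm) param_ring_scheme \<Rightarrow> 'a \<Rightarrow> (W2_gen list \<Rightarrow> 'a) set" where
  "W2_scalar r S c = W2_ideal r S +>\<^bsub>free_algebra S\<^esub> free_const S c"

text \<open>Linear independence over \<open>S\<close> of the family \<open>e, y\<^sub>1 e, ..., y\<^sub>1\<^sup>r\<^sup>-\<^sup>1 e\<close>.\<close>

definition W2_independent :: "nat \<Rightarrow> ('a, 'm) param_ring_scheme \<Rightarrow> bool" where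
  "W2_independent r S \<longleftrightarrow>
     (\<forall>c. (\<forall>i<r. c i \<in> carrier S) \<longrightarrow>
        (\<Oplus>\<^bsub>W2 r S\<^esub>i\<in>{..<r}. W2_scalar r S (c i) \<otimes>\<^bsub>W2 r S\<^esub>
            (W2_gen r S Gen_y [^]\<^bsub>W2 r S\<^esub> (i::nat) \<otimes>\<^bsub>W2 r S\<^esub> W2_gen r S Gen_e)) = \<zero>\<^bsub>W2 r S\<^esub> \<longrightarrow>
        (\<forall>i<r. c i = \<zero>\<^bsub>S\<^esub>))"


section \<open>Admissibility\<close>

lemma foldSetD_cong_imp:
  assumes "(A, z) \<in> foldSetD D f e" and "\<And>x. x \<in> A \<Longrightarrow> f x = g x"
  shows "(A, z) \<in> foldSetD D g e"
  using assms
proof (induction rule: foldSetD.induct)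
  case emptyI
  then show ?case by (simp add: foldSetD.emptyI)
next
  case (insertI x A y)
  then show ?case using foldSetD.insertI[of x A g y D e] by simp
qed

text \<open>Needed for recursion under \<open>\<Oplus>\<close> below.\<close>

lemma finsum_fundef_cong [fundef_cong]:
  assumes "G = H" and "A = B" and "\<And>x. x \<in> B \<Longrightarrow> f x = g x"
  shows "finsum G f A = finsum H g B"
proof -
  let ?f = "monoid.mult (add_monoid H) \<circ> f" and ?g = "monoid.mult (add_monoid H) \<circ> g"
  have "(B, z) \<in> foldSetD D ?f e \<longleftrightarrow> (B, z) \<in> foldSetD D ?g e" for D e z
    using foldSetD_cong_imp[of B z D ?f e ?g] foldSetD_cong_imp[of B z D ?g e ?f] assms(3)
    by auto
  then show ?thesis
    unfolding finsum_def finprod_def foldD_def using assms(1,2) by simp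
qed

text \<open>The family $\delta_a$ for all integers $a$. For $a = -1$ the sum is empty, so that the
  formula gives $\delta_{-1} = \rho^{-2}\delta_1$.\<close>

function deltaZ :: "('a, 'm) param_ring_scheme \<Rightarrow> int \<Rightarrow> 'a" where
  "deltaZ S a =
     (if a \<ge> 0 then par_delta S (nat a)
      else (inv\<^bsub>S\<^esub> (par_rho S) [^]\<^bsub>S\<^esub> (2::nat) \<otimes>\<^bsub>S\<^esub> par_delta S (nat (- a)))
        \<oplus>\<^bsub>S\<^esub> ((inv\<^bsub>S\<^esub> (par_q S) \<ominus>\<^bsub>S\<^esub> par_q S) \<otimes>\<^bsub>S\<^esub> inv\<^bsub>S\<^esub> (par_rho S) \<otimes>\<^bsub>S\<^esub>
            (\<Oplus>\<^bsub>S\<^esub>k\<in>{1..- a - 1}.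
               (par_delta S (nat k) \<otimes>\<^bsub>S\<^esub> deltaZ S (k + a)) \<ominus>\<^bsub>S\<^esub> deltaZ S (2 * k + a))))"
  by auto
termination
  by (relation "measure (\<lambda>(S, a). nat (- a))") auto

declare deltaZ.simps [simp del]

definition elem_sym :: "('a, 'm) ring_scheme \<Rightarrow> nat \<Rightarrow> (nat \<Rightarrow> 'a) \<Rightarrow> nat \<Rightarrow> 'a" where
  "elem_sym S r u i = (\<Oplus>\<^bsub>S\<^esub>A\<in>{A. A \<subseteq> {1..r} \<and> card A = i}. \<Otimes>\<^bsub>S\<^esub>j\<in>A. u j)"

definition weakly_admissible :: "nat \<Rightarrow> ('a, 'm) param_ring_scheme \<Rightarrow> bool" where
  "weakly_admissible r S \<longleftrightarrow>
     (\<forall>a::int. (\<Oplus>\<^bsub>S\<^esub>k\<in>{0..r}. (\<ominus>\<^bsub>S\<^esub> \<one>\<^bsub>S\<^esub>) [^]\<^bsub>S\<^esub> (r - k) \<otimes>\<^bsub>S\<^esub> elem_sym S r (par_u S) (r - k)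
                \<otimes>\<^bsub>S\<^esub> deltaZ S (int k + a)) = \<zero>\<^bsub>S\<^esub>)"

definition q_diff :: "('a, 'm) param_ring_scheme \<Rightarrow> 'a" where
  "q_diff S = par_q S \<ominus>\<^bsub>S\<^esub> inv\<^bsub>S\<^esub> (par_q S)"

definition admissible :: "nat \<Rightarrow> ('a, 'm) param_ring_scheme \<Rightarrow> bool" where
  "admissible r S \<longleftrightarrow>
     ground_ring r S \<and>
     q_diff S \<noteq> \<zero>\<^bsub>S\<^esub> \<and>
     (\<forall>x\<in>carrier S. q_diff S \<otimes>\<^bsub>S\<^esub> x = \<zero>\<^bsub>S\<^esub> \<longrightarrow> x = \<zero>\<^bsub>S\<^esub>) \<and>
     weakly_admissible r S \<and>
     W2_independent r S"


section \<open>Generation, algebraic independence, localization\<close>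

definition param_gens :: "nat \<Rightarrow> ('a, 'm) param_ring_scheme \<Rightarrow> 'a set" where
  "param_gens r S =
     {par_q S, inv\<^bsub>S\<^esub> (par_q S), par_rho S, inv\<^bsub>S\<^esub> (par_rho S),
      par_delta S 0, inv\<^bsub>S\<^esub> (par_delta S 0)}
     \<union> {par_delta S j | j. j \<in> {1..<r}}
     \<union> {par_u S i | i. i \<in> {1..r}} \<union> {inv\<^bsub>S\<^esub> (par_u S i) | i. i \<in> {1..r}}"

text \<open>Polynomials over the integers in the indeterminates indexed by the natural numbers; a
  monomial is a finitely supported exponent function.\<close>

type_synonym int_mpoly = "(nat \<Rightarrow>\<^sub>0 nat) \<Rightarrow>\<^sub>0 int"

definition mpoly_eval :: "('a, 'm) ring_scheme \<Rightarrow> (nat \<Rightarrow> 'a) \<Rightarrow> int_mpoly \<Rightarrow> 'a" where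
  "mpoly_eval R x P =
     (\<Oplus>\<^bsub>R\<^esub>m\<in>Poly_Mapping.keys P.
        [Poly_Mapping.lookup P m] \<cdot>\<^bsub>R\<^esub>
          (\<Otimes>\<^bsub>R\<^esub>i\<in>Poly_Mapping.keys m. x i [^]\<^bsub>R\<^esub> Poly_Mapping.lookup m i))"

definition alg_independent_int ::
  "('a, 'm) ring_scheme \<Rightarrow> nat set \<Rightarrow> (nat \<Rightarrow> 'a) \<Rightarrow> bool"
where
  "alg_independent_int R I x \<longleftrightarrow>
     (\<forall>P. (\<forall>m\<in>Poly_Mapping.keys P. Poly_Mapping.keys m \<subseteq> I) \<longrightarrow>
          mpoly_eval R x P = \<zero>\<^bsub>R\<^esub> \<longrightarrow> P = 0)"

text \<open>The family $q, u_1, \dots, u_r$, with \<open>q\<close> at index 0.\<close>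

definition qu_family :: "('a, 'm) param_ring_scheme \<Rightarrow> nat \<Rightarrow> 'a" where
  "qu_family S i = (if i = 0 then par_q S else par_u S i)"

text \<open>The localization $R[z^{-1}]$ as a ring of fractions: \<open>frac_class R z a n\<close> is the
  equivalence class of $a / z^n$, and the parameters are the images of those of \<open>R\<close>.\<close>

definition frac_class :: "('a, 'm) ring_scheme \<Rightarrow> 'a \<Rightarrow> 'a \<Rightarrow> nat \<Rightarrow> ('a \<times> nat) set" where
  "frac_class R z a m =
     {(b, n). b \<in> carrier R \<and>
        (\<exists>k::nat. z [^]\<^bsub>R\<^esub> k \<otimes>\<^bsub>R\<^esub> ((a \<otimes>\<^bsub>R\<^esub> z [^]\<^bsub>R\<^esub> n) \<ominus>\<^bsub>R\<^esub> (b \<otimes>\<^bsub>R\<^esub> z [^]\<^bsub>R\<^esub> m)) = \<zero>\<^bsub>R\<^esub>)}"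

definition localize ::
  "('a, 'm) param_ring_scheme \<Rightarrow> 'a \<Rightarrow> ('a \<times> nat) set param_ring"
where
  "localize R z =
     \<lparr> carrier = {frac_class R z a n | a n. a \<in> carrier R},
       monoid.mult = (\<lambda>A B. \<Union>x\<in>A. \<Union>y\<in>B.
                frac_class R z (fst x \<otimes>\<^bsub>R\<^esub> fst y) (snd x + snd y)),
       one = frac_class R z \<one>\<^bsub>R\<^esub> 0,
       ring.zero = frac_class R z \<zero>\<^bsub>R\<^esub> 0,
       add = (\<lambda>A B. \<Union>x\<in>A. \<Union>y\<in>B.
                frac_class R z
                  ((fst x \<otimes>\<^bsub>R\<^esub> z [^]\<^bsub>R\<^esub> snd y) \<oplus>\<^bsub>R\<^esub> (fst y \<otimes>\<^bsub>R\<^esub> z [^]\<^bsub>R\<^esub> snd x))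
                  (snd x + snd y)),
       par_rho = frac_class R z (par_rho R) 0,
       par_q = frac_class R z (par_q R) 0,
       par_delta = (\<lambda>j. frac_class R z (par_delta R j) 0),
       par_u = (\<lambda>i. frac_class R z (par_u R i) 0) \<rparr>"


section \<open>The universal $u$-admissible ring\<close>

text \<open>It is realized inside the field of fractions of $\mathbb{Z}[X_0, X_1, X_2, \dots]$, with
  $q = X_0$ and $u_i = X_i$; all rings involved use only the indeterminates
  $X_0, \dots, X_r$.\<close>

type_synonym ratfun = "int_mpoly fract"

definition indet :: "nat \<Rightarrow> ratfun" where
  "indet i = Fract (Poly_Mapping.single (Poly_Mapping.single i 1) 1) 1"

definition rho_bar :: "nat \<Rightarrow> ratfun" where
  "rho_bar r = (let p = (\<Prod>j\<in>{1..r}. indet j) in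
     if odd r then p else inverse (indet 0) * p)"

definition gamma_bar :: "nat \<Rightarrow> nat \<Rightarrow> ratfun" where
  "gamma_bar r j =
     (\<Prod>l\<in>{1..r} - {j}. (indet l * indet j - 1) / (indet j - indet l)) *
     ((1 - indet j ^ 2) / (rho_bar r * (inverse (indet 0) - indet 0)) *
        (\<Prod>l\<in>{1..r} - {j}. indet l)
      + (if odd r then 1 else - indet j))"

definition delta_bar :: "nat \<Rightarrow> nat \<Rightarrow> ratfun" where
  "delta_bar r a = (\<Sum>j\<in>{1..r}. gamma_bar r j * indet j ^ a)"

definition S0_carrier :: "nat \<Rightarrow> ratfun set" where
  "S0_carrier r = generate_ring ring_of_type_algebra
     ({indet i | i. i \<in> {0..r}} \<union> {inverse (indet i) | i. i \<in> {0..r}}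
      \<union> {inverse (inverse (indet 0) - indet 0)})"

definition S_bar :: "nat \<Rightarrow> ratfun param_ring" where
  "S_bar r =
     \<lparr> carrier = generate_ring ring_of_type_algebra
                   (S0_carrier r \<union> {inverse (delta_bar r 0)}),
       monoid.mult = (*), one = 1, ring.zero = 0, add = (+),
       par_rho = rho_bar r, par_q = indet 0, par_delta = delta_bar r, par_u = indet \<rparr>"


section \<open>The universal admissible rings\<close>

text \<open>The subring generated by the parameters.\<close>

definition param_subring ::
  "nat \<Rightarrow> ('a, 'm) param_ring_scheme \<Rightarrow> ('a, 'm) param_ring_scheme"
where
  "param_subring r S = S\<lparr>carrier := generate_ring S (param_gens r S)\<rparr>"

definition param_prod ::
  "('a, 'm) param_ring_scheme \<Rightarrow> ('b, 'n) param_ring_scheme \<Rightarrow> ('a \<times> 'b) param_ring"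
where
  "param_prod S T =
     \<lparr> carrier = carrier (RDirProd S T), monoid.mult = monoid.mult (RDirProd S T),
       one = one (RDirProd S T), ring.zero = ring.zero (RDirProd S T), add = add (RDirProd S T),
       par_rho = (par_rho S, par_rho T), par_q = (par_q S, par_q T),
       par_delta = (\<lambda>j. (par_delta S j, par_delta T j)),
       par_u = (\<lambda>i. (par_u S i, par_u T i)) \<rparr>"

definition param_twist :: "('a, 'm) param_ring_scheme \<Rightarrow> ('a, 'm) param_ring_scheme" where
  "param_twist S = S\<lparr>par_rho := \<ominus>\<^bsub>S\<^esub> (par_rho S), par_q := inv\<^bsub>S\<^esub> (par_q S)\<rparr>"

definition R_plus :: "nat \<Rightarrow> ratfun param_ring" where
  "R_plus r = param_subring r (S_bar r)"

text \<open>With $p = u_1 \cdots u_r$, the parameters of an admissible ring satisfy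
  $(\rho - p)(\rho + p) = 0$ for odd \<open>r\<close> and
  $(\rho - q^{-1}p)(\rho + qp) = 0$ for even \<open>r\<close>.
  The parameters of \<open>S_bar r\<close> make the first factor vanish, those of its twist the second one.
  The universal admissible ring covers both branches. It is given explicitly, rather than by an
  existential quantifier, because universality refers to admissible rings over arbitrary types,
  and a type variable cannot be quantified inside the scope of an existential.\<close>

definition R_zero :: "nat \<Rightarrow> (ratfun \<times> ratfun) param_ring" where
  "R_zero r = param_subring r (param_prod (S_bar r) (param_twist (S_bar r)))"

end

theory Submission
  imports Defs
begin

text \<open>Write $z = q - q^{-1}$, $p = u_1 \cdots u_r$ and let $a_j$ be the coefficients of
  $\prod_i (t - u_i)$. Multiplying $\sum_j a_j y_1^j e = 0$ by $y_1 g$ and eliminating the exponents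
  outside $1-r, \dots, 0$ turns linear independence of $e, \dots, y_1^{r-1} e$ into \<open>r\<close> relations
  among the parameters. They determine $z \delta_0, \dots, z \delta_{r-1}$, and weak admissibility determines all
  further $\delta_j$. The relation for $\delta_0$ and the ground relation give a quadratic equation for
  $\rho$ with the two roots seen in \<open>R_zero\<close>.

  Conversely, over the field of rational functions $y_1 = \mathrm{diag}(u_i)$, $e = (\gamma_j)_{ij}$ and
  $g_{ij} = z (\gamma_j - [i = j]) / (u_i u_j - 1)$ represent $W_2$ on $F^r$. The relations for \<open>g\<close> amount
  to two identities for sums of $\gamma_j / (u_i u_j - 1)$ and of its squares, which are Lagrange
  interpolation sums. The all-ones vector is an eigenvector of \<open>e\<close>, and a polynomial of degree
  below \<open>r\<close> with the roots $u_1, \dots, u_r$ is zero, whence independence; this makes \<open>R_plus\<close> and \<open>R_zero\<close> admissible.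

  For universality, every element of the subring of $R \times S$ generated by the pairs of parameters
  is, up to a non-zero-divisor, of the form $\alpha + \beta \rho$ with integer polynomials
  $\alpha, \beta$ in $q, u_1, \dots, u_r$. If $\alpha + \beta \rho = 0$ in \<open>R\<close> implies the same in \<open>S\<close>,
  this subring is therefore the graph of a homomorphism on the subring generated by the parameters
  of \<open>R\<close>. In \<open>R_zero\<close> such a relation forces $\alpha = \beta = 0$; in \<open>R_plus\<close> it is a multiple
  of the linear equation for $\rho$, which holds in a domain up to a twist.\<close>

section \<open>Interpolation identities for $\gamma_j$\<close>

text \<open>A ring presented by generators and relations would map to every admissible ring, but
  regularity of \<open>q - 1/q\<close> and the independence are not visible in it. Subrings of a
  field and of its square show both, and the difficulty moves to the maps out of them: the target
  \<open>S\<close> may have zero divisors, and the \<open>\<delta>\<^sub>j\<close> are determined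
  only after multiplication by \<open>q - 1/q\<close>. Hence the graph in
  \<open>R \<times> S\<close>, where this element is regular because it is so in both factors.

  The closed formulas for \<open>\<delta>\<^sub>j\<close> are never compared with the relations. The
  field is itself admissible by the representation, so the relations derived for all admissible
  rings hold in it.

  The interpolation identities contain \<open>\<rho>\<close> and \<open>z\<close> only as
  \<open>\<rho> z\<close> and \<open>z\<^sup>2\<close>, so the same \<open>\<gamma>\<^sub>j\<close>
  serve for the parameters \<open>(-\<rho>, 1/q)\<close>. The second factor of the square carries
  these; evaluation at both roots of the quadratic equation is what makes 1 and
  \<open>\<rho>\<close> independent over the integer polynomials.\<close>

lemma lagrange_sum_eq_0:
  fixes h :: "'f::field poly"
  assumes "finite A" and "degree h + 1 < card A"
  shows "(\<Sum>a\<in>A. poly h a / (\<Prod>b\<in>A-{a}. a - b)) = 0"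
proof -
  define n where "n = card A - 1"
  define N where "N a = (\<Prod>b\<in>A-{a}. [:-b, 1:])" for a
  define L where "L = (\<Sum>a\<in>A. smult (poly h a / (\<Prod>b\<in>A-{a}. a - b)) (N a))"
  have n: "degree h < n" using assms unfolding n_def by linarith
  have degN: "degree (N a) = n" if "a \<in> A" for a
    unfolding N_def using that assms(1)
    by (subst degree_prod_eq_sum_degree) (auto simp: n_def)
  have monicN: "coeff (N a) n = 1" if "a \<in> A" for a
  proof -
    have "lead_coeff (N a) = 1" unfolding N_def lead_coeff_prod by simp
    then show ?thesis using degN[OF that] by simp
  qed
  \<comment> \<open>\<open>L\<close> is the Lagrange interpolant of \<open>h\<close> at the nodes
    \<open>A\<close>. Both degrees are below \<open>card A\<close>, so \<open>L\<close> is
    \<open>h\<close> itself, and the sum in question is the coefficient of \<open>L\<close> in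
    degree \<open>n\<close>, which \<open>h\<close> does not reach.\<close>
  have "L = h"
  proof (rule poly_eqI_degree[of A])
    fix x assume x: "x \<in> A"
    have Nz: "poly (N a) x = 0" if "a \<in> A - {x}" for a
      using that x assms(1) unfolding N_def poly_prod by auto
    have Nx: "poly (N x) x = (\<Prod>b\<in>A-{x}. x - b)"
      unfolding N_def poly_prod by simp
    have nz: "(\<Prod>b\<in>A-{x}. x - b) \<noteq> 0" using assms(1) by auto
    have "poly L x = (\<Sum>a\<in>A. poly h a / (\<Prod>b\<in>A-{a}. a - b) * poly (N a) x)"
      unfolding L_def poly_sum by simp
    also have "\<dots> = poly h x / (\<Prod>b\<in>A-{x}. x - b) * poly (N x) x"
      using assms(1) x Nz by (subst sum.remove[of _ x]) auto
    finally show "poly L x = poly h x" using nz Nx by simp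
  next
    have "degree L \<le> n" unfolding L_def
      by (rule degree_sum_le) (use assms degN in \<open>auto simp: degree_smult_le le_trans\<close>)
    then show "degree L < card A" using n n_def by linarith
  qed (use assms in auto)
  then have "coeff L n = 0" using n by (simp add: coeff_eq_0)
  then show ?thesis unfolding L_def coeff_sum using monicN by simp
qed

text \<open>The nodes are split into the \<open>u j\<close> and auxiliary ones in \<open>B\<close>.
  The sum over the \<open>u j\<close> is the one of interest; the finitely many terms of
  \<open>B\<close> are the contributions of the remaining poles and are computed one by one.\<close>

lemma lagrange_sum_family:
  fixes h :: "'f::field poly" and u :: "'i \<Rightarrow> 'f"
  assumes "finite I" "inj_on u I" "finite B" "u ` I \<inter> B = {}" "degree h + 1 < card I + card B"
  shows "(\<Sum>j\<in>I. poly h (u j) / ((\<Prod>l\<in>I-{j}. u j - u l) * (\<Prod>b\<in>B. u j - b)))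
       + (\<Sum>b\<in>B. poly h b / ((\<Prod>l\<in>I. b - u l) * (\<Prod>b'\<in>B-{b}. b - b'))) = 0"
proof -
  let ?A = "u ` I \<union> B"
  have "(\<Sum>a\<in>?A. poly h a / (\<Prod>b\<in>?A-{a}. a - b)) = 0"
    using assms by (intro lagrange_sum_eq_0) (auto simp: card_Un_disjoint card_image)
  also have "(\<Sum>a\<in>?A. poly h a / (\<Prod>b\<in>?A-{a}. a - b))
     = (\<Sum>a\<in>u ` I. poly h a / (\<Prod>b\<in>?A-{a}. a - b)) + (\<Sum>a\<in>B. poly h a / (\<Prod>b\<in>?A-{a}. a - b))"
    using assms by (intro sum.union_disjoint) auto
  also have "(\<Sum>a\<in>u ` I. poly h a / (\<Prod>b\<in>?A-{a}. a - b))
     = (\<Sum>j\<in>I. poly h (u j) / ((\<Prod>l\<in>I-{j}. u j - u l) * (\<Prod>b\<in>B. u j - b)))"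
    unfolding sum.reindex[OF assms(2)] o_def
  proof (rule sum.cong[OF refl])
    fix j assume j: "j \<in> I"
    have "?A - {u j} = u ` (I - {j}) \<union> B" using assms j by (auto dest: inj_onD)
    then have "(\<Prod>b\<in>?A-{u j}. u j - b) = (\<Prod>b\<in>u ` (I - {j}). u j - b) * (\<Prod>b\<in>B. u j - b)"
      using assms by (simp only:) (intro prod.union_disjoint, auto)
    also have "(\<Prod>b\<in>u ` (I - {j}). u j - b) = (\<Prod>l\<in>I-{j}. u j - u l)"
      by (subst prod.reindex) (auto intro: inj_on_subset[OF assms(2)])
    finally show "poly h (u j) / (\<Prod>b\<in>?A-{u j}. u j - b)
       = poly h (u j) / ((\<Prod>l\<in>I-{j}. u j - u l) * (\<Prod>b\<in>B. u j - b))" by simp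
  qed
  also have "(\<Sum>a\<in>B. poly h a / (\<Prod>b\<in>?A-{a}. a - b))
     = (\<Sum>b\<in>B. poly h b / ((\<Prod>l\<in>I. b - u l) * (\<Prod>b'\<in>B-{b}. b - b')))"
  proof (rule sum.cong[OF refl])
    fix c assume c: "c \<in> B"
    have "?A - {c} = u ` I \<union> (B - {c})" using assms c by auto
    then have "(\<Prod>b\<in>?A-{c}. c - b) = (\<Prod>b\<in>u ` I. c - b) * (\<Prod>b\<in>B-{c}. c - b)"
      using assms by (simp only:) (intro prod.union_disjoint, auto)
    also have "(\<Prod>b\<in>u ` I. c - b) = (\<Prod>l\<in>I. c - u l)"
      by (subst prod.reindex[OF assms(2)]) auto
    finally show "poly h c / (\<Prod>b\<in>?A-{c}. c - b)
       = poly h c / ((\<Prod>l\<in>I. c - u l) * (\<Prod>b'\<in>B-{c}. c - b'))" by simp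
  qed
  finally show ?thesis .
qed

section \<open>Rational identities behind the contributions of the nodes 1, -1 and
  \<open>1 / u i\<close>\<close>

lemma frac_sum_pm1: fixes x :: "'f::field" assumes "1 - x \<noteq> 0" "1 + x \<noteq> 0" "(2::'f) \<noteq> 0"
 shows "1 / (1 - x) / 2 + 1 / (1 + x) / 2 = - (1 / (x\<^sup>2 - 1))"
proof -
  define a b where "a = 1 - x" and "b = 1 + x"
  have nz: "a \<noteq> 0" "b \<noteq> 0" using assms by (auto simp: a_def b_def)
  have "1 / a / 2 + 1 / b / 2 = ((a + b) / 2) / (a * b)" using nz assms(3) by (simp add: field_simps)
  also have "(a + b) / 2 = 1" using assms(3) by (simp add: a_def b_def)
  also have "a * b = - (x\<^sup>2 - 1)" by (simp add: a_def b_def algebra_simps power2_eq_square)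
  finally show ?thesis unfolding a_def b_def by (simp only: minus_divide_right)
qed

lemma frac_sum_pm1_sq:  fixes x :: "'f::field" assumes "1 - x \<noteq> 0" "1 + x \<noteq> 0" "(2::'f) \<noteq> 0" "x \<noteq> 0"
 shows "1 / (1 - x) / 2 / (- ((1 - x) / x)) + 1 / (1 + x) / 2 / (- ((1 + x) / x))
      = - (x * (x\<^sup>2 + 1) / ((1 - x)\<^sup>2 * (1 + x)\<^sup>2))"
proof -
  define a b where "a = 1 - x" and "b = 1 + x"
  have nz: "a \<noteq> 0" "b \<noteq> 0" using assms by (auto simp: a_def b_def)
  have "1 / a / 2 / (- (a / x)) + 1 / b / 2 / (- (b / x)) = - (x * ((a\<^sup>2 + b\<^sup>2) / 2) / (a\<^sup>2 * b\<^sup>2))"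
    using nz assms(3,4) by (simp add: field_simps power2_eq_square)
  also have "(a\<^sup>2 + b\<^sup>2) / 2 = x\<^sup>2 + 1" using assms(3)
    unfolding a_def b_def by (simp add: field_simps power2_eq_square)
  finally show ?thesis unfolding a_def b_def .
qed

lemma kappa_quad_odd:  fixes x :: "'f::field" assumes  "x \<noteq> 0" "z \<noteq> 0"
  shows "((x\<^sup>2 - 1) * (1 / z / x) + 1) * ((1 - x\<^sup>2) * (1 / z / x) + 1) * x\<^sup>2
    = x\<^sup>2 - (x\<^sup>2 - 1)\<^sup>2 / z\<^sup>2"
proof -
  have "((x\<^sup>2 - 1) * (1 / z / x) + 1) * x = (x\<^sup>2 - 1) / z + x" using assms by (simp add: field_simps)
  moreover have "((1 - x\<^sup>2) * (1 / z / x) + 1) * x = x - (x\<^sup>2 - 1) / z" using assms by (simp add: field_simps)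
  ultimately have "((x\<^sup>2 - 1) * (1 / z / x) + 1) * ((1 - x\<^sup>2) * (1 / z / x) + 1) * x\<^sup>2 = ((x\<^sup>2 - 1) / z + x) * (x - (x\<^sup>2 - 1) / z)"
    by (metis (no_types, lifting) mult.assoc mult.left_commute power2_eq_square)
  also have "\<dots> = x\<^sup>2 - ((x\<^sup>2 - 1) / z)\<^sup>2" by (simp add: algebra_simps power2_eq_square)
  finally show ?thesis by (simp add: power_divide)
qed

text \<open>The assumption on \<open>q\<close> is \<open>z = q - 1/q\<close>, multiplied by
  \<open>q\<close>. It makes the even case end in the same right-hand side as the odd one, although
  \<open>q / z\<close> replaces \<open>1 / z\<close> and \<open>- x\<close> replaces 1.\<close>

lemma kappa_quad_even:  fixes x :: "'f::field" assumes  "x \<noteq> 0" "z \<noteq> 0" "q * q = 1 + q * z"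
  shows "((x\<^sup>2 - 1) * (q / z / x) + - x) * ((1 - x\<^sup>2) * (q / z / x) + - (1/x)) * x\<^sup>2
    = x\<^sup>2 - (x\<^sup>2 - 1)\<^sup>2 / z\<^sup>2"
proof -
  define s where "s = x\<^sup>2 - 1"
  have s': "1 - x\<^sup>2 = - s" "x\<^sup>2 = s + 1" by (simp_all add: s_def)
  have e1: "(s * (q / z / x) + - x) * x = s * q / z - (s + 1)" using assms s' by (simp add: field_simps power2_eq_square)
  have e2: "(- s * (q / z / x) + - (1/x)) * x = - (s * q / z) - 1" using assms by (simp add: field_simps power2_eq_square)
  have "(s * (q / z / x) + - x) * (- s * (q / z / x) + - (1/x)) * x\<^sup>2
    = ((s * (q / z / x) + - x) * x) * ((- s * (q / z / x) + - (1/x)) * x)"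
    by (simp only: power2_eq_square mult_ac)
  also have "\<dots> = (s * q / z - (s + 1)) * (- (s * q / z) - 1)" unfolding e1 e2 ..
  also have "\<dots> = s + 1 - s\<^sup>2 * (q * q - q * z) / z\<^sup>2" using assms(2)
    by (simp add: field_simps power2_eq_square)
  finally show ?thesis unfolding assms(3) s_def by simp
qed

lemma residue_quotient:  fixes x :: "'f::field" assumes  "x \<noteq> 0" "S \<noteq> 0" "N \<noteq> 0" "D \<noteq> 0" "y \<noteq> 0"
  shows "N / D * K1 * (S * D * (K2 / x) / (S * N * (y\<^sup>2 / x^4))) = K1 * K2 * x\<^sup>2 * x / y\<^sup>2"
  using assms by (simp add: divide_simps) (simp add: power2_eq_square power4_eq_xxxx)
lemma residue_denom:  fixes x :: "'f::field" assumes  "x \<noteq> 0"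
  shows "(1 - x\<^sup>2) / x * ((-1)^(r-1) * N / x^(r-1)) * (1/x * ((1/x)\<^sup>2 - 1)) = (-1)^(r-1) / x^(r-1) * N * ((1 - x\<^sup>2)\<^sup>2 / x^4)"
proof -
  have *: "1/x * ((1/x)\<^sup>2 - 1) = (1 - x\<^sup>2) / (x * x * x)" using assms by (simp add: field_simps power2_eq_square)
  show ?thesis unfolding * using assms by (simp add: power2_eq_square power4_eq_xxxx mult_ac)
qed

lemma residue_numer:  fixes x :: "'f::field" assumes  "x \<noteq> 0"
  shows "(-1)^(r-1) * D / x^(r-1) * (c * ((1/x)\<^sup>2 - 1) + k * (1/x)) = (-1)^(r-1) / x^(r-1) * D * (((1 - x\<^sup>2) * (c / x) + k)/ x)"
proof -
  have "c * ((1/x)\<^sup>2 - 1) + k * (1/x) = ((1 - x\<^sup>2) * (c / x) + k)/ x" using assms by (simp add: field_simps power2_eq_square)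
  then show ?thesis by simp
qed

text \<open>\<open>one_neq\<close> excludes characteristic 2: the auxiliary nodes 1 and -1 have to
  be distinct, and their contributions carry a factor 1/2. \<open>uu_neq\<close> includes
  \<open>i = j\<close>, so that no \<open>u i\<close> is 1 or -1.\<close>

locale gamma_data =
  fixes r :: nat and u :: "nat \<Rightarrow> 'f::field" and q :: 'f
  assumes r_pos: "r \<ge> 1"
    and one_neq: "(1::'f) \<noteq> -1"
    and q_nz: "q \<noteq> 0" and q_sq: "q * q \<noteq> 1"
    and u_nz: "i \<in> {1..r} \<Longrightarrow> u i \<noteq> 0"
    and u_inj: "inj_on u {1..r}"
    and uu_neq: "\<lbrakk>i \<in> {1..r}; j \<in> {1..r}\<rbrakk> \<Longrightarrow> u i * u j \<noteq> 1"
begin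

definition "p = (\<Prod>l\<in>{1..r}. u l)"
definition "\<rho> = (if odd r then p else inverse q * p)"
definition "z = q - inverse q"
text \<open>Equal to \<open>1 / z\<close> for odd \<open>r\<close> and to \<open>q / z\<close> for
  even \<open>r\<close>. It absorbs the product of the \<open>u l\<close> with
  \<open>l \<noteq> j\<close> in \<open>\<gamma> j\<close>, which is \<open>p / u j\<close>.\<close>

definition "c = p / (\<rho> * z)"
definition "\<kappa> = (if odd r then 1 else [:0,-1:] :: 'f poly)"
definition "\<gamma> j =
     (\<Prod>l\<in>{1..r} - {j}. (u l * u j - 1) / (u j - u l)) *
     ((1 - u j ^ 2) / (\<rho> * (inverse q - q)) * (\<Prod>l\<in>{1..r} - {j}. u l)
      + (if odd r then 1 else - u j))"
text \<open>Chosen so that the Lagrange term of \<open>H i\<close> at \<open>u j\<close>, with the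
  \<open>u l\<close> and 0, 1, -1 as nodes, is \<open>\<gamma> j / (u i * u j - 1)\<close>. The
  omitted factor \<open>l = i\<close> produces this denominator. The degree is at most
  \<open>r + 1\<close>, and \<open>r + 3\<close> nodes are just enough.\<close>

definition "H i = (\<Prod>l\<in>{1..r}-{i}. [:-1, u l:]) * ([:-c, 0, c:] + \<kappa> * [:0, 1:])"

lemma p_nz: "p \<noteq> 0" using u_nz by (auto simp: p_def)
lemma \<rho>_nz: "\<rho> \<noteq> 0" using p_nz q_nz by (auto simp: \<rho>_def)
lemma z_nz: "z \<noteq> 0"
  using q_nz q_sq by (auto simp: z_def field_simps)
lemma c_p: "c / p = 1 / (\<rho> * z)" using p_nz by (simp add: c_def)

lemma u_sq: "i \<in> {1..r} \<Longrightarrow> (u i)\<^sup>2 - 1 \<noteq> 0"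
  using uu_neq[of i i] by (simp add: power2_eq_square)

lemma u_pm1:
  assumes "i \<in> {1..r}"
  shows "u i \<noteq> 1" "u i \<noteq> -1" "1 - u i \<noteq> 0" "1 + u i \<noteq> 0" "u i - 1 \<noteq> 0" "u i + 1 \<noteq> 0"
    "-1 - u i \<noteq> 0"
proof -
  show "u i \<noteq> 1" "u i \<noteq> -1" using uu_neq[OF assms assms] by auto
  then show "1 - u i \<noteq> 0" "1 + u i \<noteq> 0" "u i - 1 \<noteq> 0" "u i + 1 \<noteq> 0" "-1 - u i \<noteq> 0"
    by (metis eq_iff_diff_eq_0, metis add.commute eq_neg_iff_add_eq_0, metis eq_iff_diff_eq_0,
        metis eq_neg_iff_add_eq_0, metis eq_iff_diff_eq_0)
qed

lemma gamma_alt: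
  assumes "j \<in> {1..r}"
  shows "\<gamma> j = (\<Prod>l\<in>{1..r}-{j}. u l * u j - 1) / (\<Prod>l\<in>{1..r}-{j}. u j - u l)
     * (c * ((u j)\<^sup>2 - 1) / u j + poly \<kappa> (u j))"
proof -
  have "p = u j * (\<Prod>l\<in>{1..r} - {j}. u l)"
    unfolding p_def using assms by (intro prod.remove) auto
  then have 1: "(\<Prod>l\<in>{1..r} - {j}. u l) = p / u j" using u_nz[OF assms] by simp
  have 2: "inverse q - q = - z" by (simp add: z_def)
  have "(1 - u j ^ 2) / (\<rho> * (inverse q - q)) * (\<Prod>l\<in>{1..r} - {j}. u l)
    = c * ((u j)\<^sup>2 - 1) / u j"
    unfolding 1 2 c_def using \<rho>_nz z_nz u_nz[OF assms] by (simp add: field_simps)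
  then show ?thesis unfolding \<gamma>_def \<kappa>_def by (simp add: prod_dividef)
qed

lemma degree_H:
  assumes "i \<in> {1..r}" shows "degree (H i) \<le> r + 1"
proof -
  have 1: "degree (\<Prod>l\<in>{1..r}-{i}. [:-1, u l:]) = r - 1"
    using assms u_nz by (subst degree_prod_eq_sum_degree) auto
  have 2: "degree ([:-c, 0, c:] + \<kappa> * [:0, 1:]) \<le> 2"
    by (rule degree_add_le) (auto simp: \<kappa>_def)
  show ?thesis unfolding H_def
    using degree_mult_le[of "\<Prod>l\<in>{1..r}-{i}. [:-1, u l:]" "[:-c, 0, c:] + \<kappa> * [:0, 1:]"] 1 2 r_pos
    by linarith
qed

lemma poly_H:
  "poly (H i) x = (\<Prod>l\<in>{1..r}-{i}. u l * x - 1) * (c * (x\<^sup>2 - 1) + poly \<kappa> x * x)"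
  unfolding H_def by (simp add: poly_prod algebra_simps power2_eq_square)

lemma term_u_quotient:
  fixes N0 Y D s t w x k :: 'f
  assumes "N0 = s * Y / t" "w * x = k" "D \<noteq> 0" "x \<noteq> 0" "s \<noteq> 0" "t \<noteq> 0"
  shows "N0 * k / (D * s * x) = Y / D * w / t"
  using assms by (auto simp: field_simps)

lemma term_u:
  assumes i: "i \<in> {1..r}" and j: "j \<in> {1..r}"
  shows "poly (H i) (u j) / ((\<Prod>l\<in>{1..r}-{j}. u j - u l) * ((u j)\<^sup>2 - 1) * u j) = \<gamma> j / (u i * u j - 1)"
proof -
  define N0 where "N0 = (\<Prod>l\<in>{1..r}-{i}. u l * u j - 1)"
  define Y where "Y = (\<Prod>l\<in>{1..r}-{j}. u l * u j - 1)"
  define D where "D = (\<Prod>l\<in>{1..r}-{j}. u j - u l)"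
  have D: "D \<noteq> 0" unfolding D_def using u_inj j by (auto dest: inj_onD)
  have "(u i * u j - 1) * N0 = (\<Prod>l\<in>{1..r}. u l * u j - 1)"
    unfolding N0_def using i by (intro prod.remove[symmetric]) auto
  also have "\<dots> = (u j * u j - 1) * Y"
    unfolding Y_def using j by (intro prod.remove) auto
  finally have "N0 = ((u j)\<^sup>2 - 1) * Y / (u i * u j - 1)"
    using uu_neq[OF i j] by (simp add: field_simps power2_eq_square)
  moreover have "(c * ((u j)\<^sup>2 - 1) / u j + poly \<kappa> (u j)) * u j = c * ((u j)\<^sup>2 - 1) + poly \<kappa> (u j) * u j"
    using u_nz[OF j] by (simp add: field_simps)
  ultimately show ?thesis
    unfolding poly_H gamma_alt[OF j] N0_def[symmetric] Y_def[symmetric] D_def[symmetric]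
    using D u_nz[OF j] u_sq[OF j] uu_neq[OF i j]
    by (intro term_u_quotient) (auto simp: algebra_simps)
qed

lemma two_nz: "(2::'f) \<noteq> 0" using one_neq by (metis add_eq_0_iff one_add_one)

text \<open>The signs that make the contributions of the nodes 1 and -1 independent of the parity of
  \<open>r\<close>.\<close>

lemma poly_\<kappa>: "(-1)^r * poly \<kappa> 1 = -1" "poly \<kappa> (-1) = 1"
  unfolding \<kappa>_def by auto

lemma prod_m1:
  fixes f g :: "nat \<Rightarrow> 'f"
  assumes "finite A"
  shows "(\<Prod>l\<in>A. f l - g l) = (-1) ^ card A * (\<Prod>l\<in>A. g l - f l)"
proof -
  have "(\<Prod>l\<in>A. f l - g l) = (\<Prod>l\<in>A. (-1) * (g l - f l))" by (rule prod.cong) auto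
  then show ?thesis by (simp only: prod.distrib prod_constant)
qed

lemma minus_one_power_r: "(-1::'f)^r = - ((-1)^(r - 1))"
  using r_pos by (cases r) auto

lemma term_0:
  assumes i: "i \<in> {1..r}"
  shows "poly (H i) 0 / (\<Prod>l\<in>{1..r}. 0 - u l) = 1 / (\<rho> * z)"
proof -
  have "(\<Prod>l\<in>{1..r}. 0 - u l) = (-1)^r * p" unfolding p_def by (subst prod_m1) auto
  moreover have "poly (H i) 0 = (-1)^r * c"
    unfolding poly_H minus_one_power_r using i by simp
  ultimately show ?thesis using c_p by simp
qed

lemma term_1:
  assumes i: "i \<in> {1..r}"
  shows "poly (H i) 1 / (\<Prod>l\<in>{1..r}. 1 - u l) = 1 / (1 - u i)"
proof -
  define N0 where "N0 = (\<Prod>l\<in>{1..r}-{i}. 1 - u l)"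
  have N0: "N0 \<noteq> 0" unfolding N0_def using u_pm1 by auto
  have 1: "(\<Prod>l\<in>{1..r}. 1 - u l) = (1 - u i) * N0"
    unfolding N0_def using i by (intro prod.remove) auto
  have 2: "(\<Prod>l\<in>{1..r}-{i}. u l * 1 - 1) = (-1)^(r-1) * N0"
    unfolding N0_def mult_1_right by (subst prod_m1) (use i in auto)
  have "poly (H i) 1 = (-1)^(r-1) * N0 * poly \<kappa> 1"
    unfolding poly_H 2 by simp
  also have "\<dots> = N0" using poly_\<kappa>(1) unfolding minus_one_power_r by (simp add: algebra_simps)
  finally show ?thesis unfolding 1 using N0 by simp
qed

lemma term_m1:
  assumes i: "i \<in> {1..r}"
  shows "poly (H i) (-1) / (\<Prod>l\<in>{1..r}. -1 - u l) = 1 / (1 + u i)"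
proof -
  define N0 where "N0 = (\<Prod>l\<in>{1..r}-{i}. -1 - u l)"
  have N0: "N0 \<noteq> 0" unfolding N0_def using u_pm1 by auto
  have 1: "(\<Prod>l\<in>{1..r}. -1 - u l) = (-1 - u i) * N0"
    unfolding N0_def using i by (intro prod.remove) auto
  have 2: "(\<Prod>l\<in>{1..r}-{i}. u l * (-1) - 1) = N0"
    unfolding N0_def by (rule prod.cong) auto
  have "poly (H i) (-1) = - N0"
    unfolding poly_H 2 poly_\<kappa>(2) by simp
  then have "poly (H i) (-1) / (\<Prod>l\<in>{1..r}. -1 - u l) = - N0 / ((-1 - u i) * N0)"
    using 1 by simp
  also have "\<dots> = - 1 / (-1 - u i)" using N0 by (simp del: mult_minus_left)
  also have "\<dots> = 1 / (- (-1 - u i))" by (simp only: divide_minus_left minus_divide_right)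
  finally show ?thesis by simp
qed

lemma prod3: "(\<Prod>b\<in>{0,1,-1}. x - b) = x * (x\<^sup>2 - 1)" for x :: 'f
  using one_neq by (simp add: algebra_simps power2_eq_square)

lemma diff3:
  "{0,1,-1::'f} - {0} = {1,-1}" "{0,1,-1::'f} - {1} = {0,-1}" "{0,1,-1::'f} - {-1} = {0,1}"
  using one_neq by auto

lemma disj3: "u ` {1..r} \<inter> {0, 1, -1} = {}"
proof -
  have "u x \<notin> {0,1,-1}" if "x \<in> {1..r}" for x using that u_nz u_pm1(1,2) by auto
  then show ?thesis by blast
qed

lemma one_neq': "(-1::'f) \<noteq> 1" using one_neq by metis

lemma sum3: "(\<Sum>b\<in>{0,1,-1}. f b) = f 0 + f 1 + f (-1)" for f :: "'f \<Rightarrow> 'f"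
  using one_neq one_neq' by (simp add: add.assoc)

lemma prods3:
  "(\<Prod>b\<in>{0,1,-1::'f}-{0}. 0 - b) = -1" "(\<Prod>b\<in>{0,1,-1::'f}-{1}. 1 - b) = 2"
  "(\<Prod>b\<in>{0,1,-1::'f}-{-1}. -1 - b) = 2"
  unfolding diff3 using one_neq one_neq' by auto

text \<open>Interpolation of \<open>H i\<close> at the \<open>u j\<close> and 0, 1, -1. The node 0
  accounts for \<open>1 / (z * \<rho>)\<close>, the nodes 1 and -1 together for
  \<open>1 / ((u i)\<^sup>2 - 1)\<close>.\<close>

lemma gamma_linear:
  assumes i: "i \<in> {1..r}"
  shows "(\<Sum>j\<in>{1..r}. \<gamma> j / (u i * u j - 1)) = 1 / (z * \<rho>) + 1 / ((u i)\<^sup>2 - 1)"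
proof -
  have "(\<Sum>j\<in>{1..r}. poly (H i) (u j) / ((\<Prod>l\<in>{1..r}-{j}. u j - u l) * (\<Prod>b\<in>{0,1,-1}. u j - b)))
       + (\<Sum>b\<in>{0,1,-1}. poly (H i) b / ((\<Prod>l\<in>{1..r}. b - u l) * (\<Prod>b'\<in>{0,1,-1}-{b}. b - b'))) = 0"
    using u_inj disj3 degree_H[OF i] one_neq one_neq' by (intro lagrange_sum_family) auto
  also have "(\<Sum>j\<in>{1..r}. poly (H i) (u j) / ((\<Prod>l\<in>{1..r}-{j}. u j - u l) * (\<Prod>b\<in>{0,1,-1}. u j - b)))
    = (\<Sum>j\<in>{1..r}. \<gamma> j / (u i * u j - 1))"
    unfolding prod3 using term_u[OF i] by (intro sum.cong) (auto simp: mult_ac)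
  also have "(\<Sum>b\<in>{0,1,-1}. poly (H i) b / ((\<Prod>l\<in>{1..r}. b - u l) * (\<Prod>b'\<in>{0,1,-1}-{b}. b - b')))
    = poly (H i) 0 / (\<Prod>l\<in>{1..r}. 0 - u l) / (-1) + poly (H i) 1 / (\<Prod>l\<in>{1..r}. 1 - u l) / 2
      + poly (H i) (-1) / (\<Prod>l\<in>{1..r}. -1 - u l) / 2"
    unfolding sum3 prods3 by (simp only: divide_divide_eq_left)
  also have "\<dots> = - (1 / (\<rho> * z)) + 1 / (1 - u i) / 2 + 1 / (1 + u i) / 2"
    unfolding term_0[OF i] term_1[OF i] term_m1[OF i] by simp
  also have "- (1 / (\<rho> * z)) + 1 / (1 - u i) / 2 + 1 / (1 + u i) / 2
    = - (1 / (\<rho> * z)) + - (1 / ((u i)\<^sup>2 - 1))"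
    unfolding add.assoc using frac_sum_pm1[of "u i"] u_pm1[OF i] two_nz by metis
  finally show ?thesis by (simp add: algebra_simps)
qed

lemma kappa_quad:
  assumes "x \<noteq> 0" "d = c / x"
  shows "((x\<^sup>2 - 1) * d + poly \<kappa> x) * ((1 - x\<^sup>2) * d + poly \<kappa> (1 / x)) * x\<^sup>2
    = x\<^sup>2 - (x\<^sup>2 - 1)\<^sup>2 / z\<^sup>2"
proof (cases "odd r")
  case True
  have "c = 1 / z" using True p_nz by (simp add: c_def \<rho>_def)
  then show ?thesis using True assms(2) kappa_quad_odd[OF assms(1) z_nz] by (simp add: \<kappa>_def)
next
  case False
  have c: "c = q / z" using False p_nz q_nz by (simp add: c_def \<rho>_def divide_inverse)
  have z: "q * q = 1 + q * z" using q_nz by (simp add: z_def right_diff_distrib)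
  show ?thesis using False assms(2) c kappa_quad_even[OF assms(1) z_nz z] by (simp add: \<kappa>_def)
qed

text \<open>The contribution of the node \<open>1 / u i\<close> alone contains products over all
  \<open>l \<noteq> i\<close>. Up to signs and powers of \<open>u i\<close>, the factor
  \<open>\<gamma> i\<close> contains the same two products with numerator and denominator exchanged,
  so they cancel. This is why the quadratic identity carries the factor
  \<open>\<gamma> i\<close>.\<close>

lemma term_inv:
  assumes i: "i \<in> {1..r}"
  defines "v \<equiv> 1 / u i"
  shows "\<gamma> i * (poly (H i) v / ((\<Prod>l\<in>{1..r}. v - u l) * (v * (v\<^sup>2 - 1))))
    = u i * ((u i)\<^sup>2 / ((u i)\<^sup>2 - 1)\<^sup>2 - 1 / z\<^sup>2)"
proof -
  define x where "x = u i"
  define N where "N = (\<Prod>l\<in>{1..r}-{i}. u l * u i - 1)"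
  define D where "D = (\<Prod>l\<in>{1..r}-{i}. u i - u l)"
  have x: "x \<noteq> 0" "x\<^sup>2 - 1 \<noteq> 0" using u_nz[OF i] u_sq[OF i] by (auto simp: x_def)
  have N: "N \<noteq> 0" unfolding N_def using uu_neq i by auto
  have D: "D \<noteq> 0" unfolding D_def using u_inj i by (auto dest: inj_onD)
  have 1: "(\<Prod>l\<in>{1..r}-{i}. u l * v - 1) = (-1)^(r-1) * D / x^(r-1)"
  proof -
    have "(\<Prod>l\<in>{1..r}-{i}. u l * v - 1) = (\<Prod>l\<in>{1..r}-{i}. (u l - u i) / x)"
      unfolding v_def x_def using u_nz[OF i] by (intro prod.cong) (auto simp: field_simps)
    also have "\<dots> = (\<Prod>l\<in>{1..r}-{i}. u l - u i) / x^(r-1)"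
      using i by (simp add: prod_dividef)
    also have "(\<Prod>l\<in>{1..r}-{i}. u l - u i) = (-1)^(r-1) * D"
      unfolding D_def by (subst prod_m1) (use i in auto)
    finally show ?thesis .
  qed
  have 2: "(\<Prod>l\<in>{1..r}. v - u l) = (1 - x\<^sup>2) / x * ((-1)^(r-1) * N / x^(r-1))"
  proof -
    have "(\<Prod>l\<in>{1..r}. v - u l) = (v - u i) * (\<Prod>l\<in>{1..r}-{i}. v - u l)"
      using i by (intro prod.remove) auto
    also have "(\<Prod>l\<in>{1..r}-{i}. v - u l) = (\<Prod>l\<in>{1..r}-{i}. (1 - u l * u i) / x)"
      unfolding v_def x_def using u_nz[OF i] by (intro prod.cong) (auto simp: field_simps)
    also have "\<dots> = (\<Prod>l\<in>{1..r}-{i}. 1 - u l * u i) / x^(r-1)"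
      using i by (simp add: prod_dividef)
    also have "(\<Prod>l\<in>{1..r}-{i}. 1 - u l * u i) = (-1)^(r-1) * N"
      unfolding N_def by (subst prod_m1) (use i in auto)
    also have "v - u i = (1 - x\<^sup>2) / x"
      unfolding v_def x_def using u_nz[OF i] by (simp add: field_simps power2_eq_square)
    finally show ?thesis .
  qed
  define S where "S = (-1::'f)^(r-1) / x^(r-1)"
  have S: "S \<noteq> 0" unfolding S_def using x by simp
  define d where "d = c / x"
  define K1 K2 where "K1 = (x\<^sup>2 - 1) * d + poly \<kappa> x" and "K2 = (1 - x\<^sup>2) * d + poly \<kappa> (1 / x)"
  have g: "\<gamma> i = N / D * K1"
    unfolding gamma_alt[OF i] N_def[symmetric] D_def[symmetric] K1_def d_def x_def by (simp add: mult.commute)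
  have h: "poly (H i) v = S * D * (K2 / x)"
    unfolding poly_H 1 S_def K2_def d_def unfolding v_def x_def[symmetric] by (rule residue_numer[OF x(1)])
  have e: "(\<Prod>l\<in>{1..r}. v - u l) * (v * (v\<^sup>2 - 1)) = S * N * ((1 - x\<^sup>2)\<^sup>2 / x^4)"
    unfolding 2 S_def unfolding v_def x_def[symmetric] by (rule residue_denom[OF x(1)])
  have "1 - x\<^sup>2 \<noteq> 0" using x(2) by simp
  then have "\<gamma> i * (poly (H i) v / ((\<Prod>l\<in>{1..r}. v - u l) * (v * (v\<^sup>2 - 1))))
    = K1 * K2 * x\<^sup>2 * x / (1 - x\<^sup>2)\<^sup>2"
    unfolding g h e by (rule residue_quotient[OF x(1) S N D])
  also have "K1 * K2 * x\<^sup>2 = x\<^sup>2 - (x\<^sup>2 - 1)\<^sup>2 / z\<^sup>2"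
    unfolding K1_def K2_def by (rule kappa_quad[OF x(1) d_def])
  also have "(1 - x\<^sup>2)\<^sup>2 = (x\<^sup>2 - 1)\<^sup>2" by (rule power2_commute)
  also have "(x\<^sup>2 - (x\<^sup>2 - 1)\<^sup>2 / z\<^sup>2) * x / (x\<^sup>2 - 1)\<^sup>2 = x * (x\<^sup>2 / (x\<^sup>2 - 1)\<^sup>2 - 1 / z\<^sup>2)"
    using x z_nz by (simp add: diff_divide_distrib right_diff_distrib left_diff_distrib)
  finally show ?thesis unfolding x_def .
qed

text \<open>The further node \<open>v = 1 / u i\<close> squares the denominator
  \<open>u i * u j - 1\<close>. Its own contribution is \<open>term_inv\<close>; the terms at 0, 1,
  -1 are those of the linear identity divided by \<open>b - v\<close>.\<close>

lemma gamma_quadratic: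
  assumes i: "i \<in> {1..r}"
  shows "\<gamma> i * (\<Sum>j\<in>{1..r}. \<gamma> j / (u i * u j - 1)\<^sup>2)
    = \<gamma> i * (((u i)\<^sup>2 + 1) / ((u i)\<^sup>2 - 1)\<^sup>2 - 1 / (\<rho> * z)) + 1 / z\<^sup>2 - (u i)\<^sup>2 / ((u i)\<^sup>2 - 1)\<^sup>2"
proof -
  define v where "v = 1 / u i"
  define x where "x = u i"
  let ?B = "{0,1,-1::'f}"
  have x: "x \<noteq> 0" "x\<^sup>2 - 1 \<noteq> 0" using u_nz[OF i] u_sq[OF i] by (auto simp: x_def)
  have vx: "v * x = 1" using x by (simp add: v_def x_def)
  have vB: "v \<notin> ?B"
  proof
    assume "v \<in> ?B"
    then have "0 = (1::'f) \<or> x = 1 \<or> - x = 1" using vx by auto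
    moreover have "- x = 1 \<Longrightarrow> x = - 1" by (metis minus_minus)
    ultimately show False using u_pm1(1,2)[OF i] by (auto simp: x_def)
  qed
  have vu: "v \<notin> u ` {1..r}" using uu_neq[OF _ i] vx unfolding x_def by auto
  have "(\<Sum>j\<in>{1..r}. poly (H i) (u j) / ((\<Prod>l\<in>{1..r}-{j}. u j - u l) * (\<Prod>b\<in>insert v ?B. u j - b)))
       + (\<Sum>b\<in>insert v ?B. poly (H i) b / ((\<Prod>l\<in>{1..r}. b - u l) * (\<Prod>b'\<in>insert v ?B-{b}. b - b'))) = 0"
    using u_inj disj3 degree_H[OF i] one_neq one_neq' vB vu by (intro lagrange_sum_family) auto
  also have "(\<Sum>j\<in>{1..r}. poly (H i) (u j) / ((\<Prod>l\<in>{1..r}-{j}. u j - u l) * (\<Prod>b\<in>insert v ?B. u j - b)))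
    = x * (\<Sum>j\<in>{1..r}. \<gamma> j / (u i * u j - 1)\<^sup>2)"
    unfolding sum_distrib_left
  proof (rule sum.cong[OF refl])
    fix j assume j: "j \<in> {1..r}"
    have "(\<Prod>b\<in>insert v ?B. u j - b) = (u j - v) * (u j * ((u j)\<^sup>2 - 1))"
      unfolding prod3[symmetric] using vB by (intro prod.insert) auto
    also have "u j - v = (u i * u j - 1) / x" using x(1) unfolding v_def x_def[symmetric] by (simp add: diff_divide_distrib)
    finally have *: "(\<Prod>b\<in>insert v ?B. u j - b) = (u i * u j - 1) / x * (u j * ((u j)\<^sup>2 - 1))" .
    have "poly (H i) (u j) / ((\<Prod>l\<in>{1..r}-{j}. u j - u l) * (\<Prod>b\<in>insert v ?B. u j - b))
       = x * (poly (H i) (u j) / ((\<Prod>l\<in>{1..r}-{j}. u j - u l) * ((u j)\<^sup>2 - 1) * u j)) / (u i * u j - 1)"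
      unfolding * by (simp add: mult_ac)
    also have "\<dots> = x * (\<gamma> j / (u i * u j - 1)\<^sup>2)"
      unfolding term_u[OF i j] by (simp add: power2_eq_square)
    finally show "poly (H i) (u j) / ((\<Prod>l\<in>{1..r}-{j}. u j - u l) * (\<Prod>b\<in>insert v ?B. u j - b))
      = x * (\<gamma> j / (u i * u j - 1)\<^sup>2)" .
  qed
  also have "(\<Sum>b\<in>insert v ?B. poly (H i) b / ((\<Prod>l\<in>{1..r}. b - u l) * (\<Prod>b'\<in>insert v ?B-{b}. b - b')))
    = poly (H i) v / ((\<Prod>l\<in>{1..r}. v - u l) * (v * (v\<^sup>2 - 1)))
     + (poly (H i) 0 / (\<Prod>l\<in>{1..r}. 0 - u l) / (-1) / (0 - v) + poly (H i) 1 / (\<Prod>l\<in>{1..r}. 1 - u l) / 2 / (1 - v)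
      + poly (H i) (-1) / (\<Prod>l\<in>{1..r}. -1 - u l) / 2 / (-1 - v))"
  proof -
    have "insert v ?B - {v} = ?B" using vB by auto
    moreover have "insert v ?B - {b} = insert v (?B - {b})" if "b \<in> ?B" for b using vB that by auto
    moreover have "(\<Prod>b'\<in>insert v (?B - {b}). b - b') = (b - v) * (\<Prod>b'\<in>?B - {b}. b - b')" for b
      using vB by (intro prod.insert) auto
    ultimately have *: "(\<Sum>b\<in>?B. poly (H i) b / ((\<Prod>l\<in>{1..r}. b - u l) * (\<Prod>b'\<in>insert v ?B-{b}. b - b')))
      = (\<Sum>b\<in>?B. poly (H i) b / (\<Prod>l\<in>{1..r}. b - u l) / (\<Prod>b'\<in>?B - {b}. b - b') / (b - v))"
      by (intro sum.cong) (auto simp: mult_ac)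
    have "(\<Sum>b\<in>insert v ?B. poly (H i) b / ((\<Prod>l\<in>{1..r}. b - u l) * (\<Prod>b'\<in>insert v ?B-{b}. b - b')))
      = poly (H i) v / ((\<Prod>l\<in>{1..r}. v - u l) * (\<Prod>b'\<in>insert v ?B-{v}. v - b'))
       + (\<Sum>b\<in>?B. poly (H i) b / ((\<Prod>l\<in>{1..r}. b - u l) * (\<Prod>b'\<in>insert v ?B-{b}. b - b')))"
      using vB by (intro sum.insert) auto
    then show ?thesis unfolding * sum3 prods3 unfolding \<open>insert v ?B - {v} = ?B\<close> prod3 .
  qed
  also have "poly (H i) 0 / (\<Prod>l\<in>{1..r}. 0 - u l) / (-1) / (0 - v) + poly (H i) 1 / (\<Prod>l\<in>{1..r}. 1 - u l) / 2 / (1 - v)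
      + poly (H i) (-1) / (\<Prod>l\<in>{1..r}. -1 - u l) / 2 / (-1 - v)
    = x * (1 / (\<rho> * z) - (x\<^sup>2 + 1) / (x\<^sup>2 - 1)\<^sup>2)"
  proof -
    have 1: "1 - x \<noteq> 0" "1 + x \<noteq> 0" using u_pm1[OF i] by (auto simp: x_def)
    have e1: "1 - v = - ((1 - x) / x)" "-1 - v = - ((1 + x) / x)"
      using x(1) unfolding v_def x_def[symmetric] by (simp_all add: diff_divide_distrib add_divide_distrib)
    have e2: "(x\<^sup>2 - 1)\<^sup>2 = (1 - x)\<^sup>2 * (1 + x)\<^sup>2" by (simp add: algebra_simps power2_eq_square)
    note frac_sum_pm1_sq[OF 1 two_nz x(1)]
    moreover have "1 / (\<rho> * z) / (-1) / (0 - v) = x * (1 / (\<rho> * z))"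
      using x by (simp add: v_def x_def[symmetric])
    ultimately show ?thesis unfolding term_0[OF i] term_1[OF i] term_m1[OF i]
      unfolding x_def[symmetric] e1 e2 right_diff_distrib
      by (simp only: add.assoc times_divide_eq_right diff_conv_add_uminus)
  qed
  finally have "\<gamma> i * (x * (\<Sum>j\<in>{1..r}. \<gamma> j / (u i * u j - 1)\<^sup>2))
     + \<gamma> i * (poly (H i) v / ((\<Prod>l\<in>{1..r}. v - u l) * (v * (v\<^sup>2 - 1))))
     + \<gamma> i * (x * (1 / (\<rho> * z) - (x\<^sup>2 + 1) / (x\<^sup>2 - 1)\<^sup>2)) = 0"
    by (metis (no_types, lifting) add.assoc distrib_left mult_zero_right)
  moreover have "\<gamma> i * (poly (H i) v / ((\<Prod>l\<in>{1..r}. v - u l) * (v * (v\<^sup>2 - 1))))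
    = x * (x\<^sup>2 / (x\<^sup>2 - 1)\<^sup>2 - 1 / z\<^sup>2)"
    using term_inv[OF i] unfolding v_def x_def .
  ultimately have "x * (\<gamma> i * (\<Sum>j\<in>{1..r}. \<gamma> j / (u i * u j - 1)\<^sup>2)
     + (x\<^sup>2 / (x\<^sup>2 - 1)\<^sup>2 - 1 / z\<^sup>2) + \<gamma> i * (1 / (\<rho> * z) - (x\<^sup>2 + 1) / (x\<^sup>2 - 1)\<^sup>2)) = 0"
    by (simp only: distrib_left mult.left_commute[of "\<gamma> i" x])
  then have "\<gamma> i * (\<Sum>j\<in>{1..r}. \<gamma> j / (u i * u j - 1)\<^sup>2)
     + (x\<^sup>2 / (x\<^sup>2 - 1)\<^sup>2 - 1 / z\<^sup>2) + \<gamma> i * (1 / (\<rho> * z) - (x\<^sup>2 + 1) / (x\<^sup>2 - 1)\<^sup>2) = 0"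
    using x by simp
  then show ?thesis unfolding x_def by (simp add: algebra_simps)
qed

end

section \<open>The free algebra\<close>

context cring begin

text \<open>The multiplication of \<open>free_algebra\<close>, on plain functions, so that the
  algebraic laws can be proved apart from the finiteness of supports.\<close>

definition word_conv :: "('g list \<Rightarrow> 'a) \<Rightarrow> ('g list \<Rightarrow> 'a) \<Rightarrow> 'g list \<Rightarrow> 'a" where
  "word_conv f g w = (\<Oplus>k\<in>{..length w}. f (take k w) \<otimes> g (drop k w))"

abbreviation word_fun :: "('g list \<Rightarrow> 'a) \<Rightarrow> bool" where
  "word_fun f \<equiv> (\<forall>w. f w \<in> carrier R)"

lemma word_conv_Nil: "word_fun f \<Longrightarrow> word_fun g \<Longrightarrow> word_conv f g [] = f [] \<otimes> g []"
  by (simp add: word_conv_def)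

text \<open>Splits off the cut at position 0. With \<open>\<lambda>v. f (x # v)\<close> regarded as
  the derivative of \<open>f\<close> by the letter \<open>x\<close>, the laws of convolution become
  inductions on the word that never mention cut positions.\<close>

lemma word_conv_Cons:
  assumes "word_fun f" "word_fun g"
  shows "word_conv f g (x # w) = f [] \<otimes> g (x # w) \<oplus> word_conv (\<lambda>v. f (x # v)) g w"
proof -
  have "word_conv f g (x # w) = (\<Oplus>k\<in>{..Suc (length w)}. f (take k (x # w)) \<otimes> g (drop k (x # w)))"
    by (simp add: word_conv_def)
  also have "\<dots> = (\<Oplus>k\<in>{..length w}. f (take (Suc k) (x # w)) \<otimes> g (drop (Suc k) (x # w)))
      \<oplus> f (take 0 (x # w)) \<otimes> g (drop 0 (x # w))"
    using assms by (intro finsum_Suc2) auto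
  finally show ?thesis
    using assms by (simp add: word_conv_def a_comm)
qed

lemma word_conv_closed: "word_fun f \<Longrightarrow> word_fun g \<Longrightarrow> word_conv f g w \<in> carrier R"
  unfolding word_conv_def by (intro finsum_closed) auto

lemma word_conv_zero_left: "word_fun g \<Longrightarrow> word_conv (\<lambda>_. \<zero>) g w = \<zero>"
  by (induction w) (simp_all add: word_conv_Nil word_conv_Cons)

lemma word_conv_add_left:
  assumes "word_fun f" "word_fun f'" "word_fun g"
  shows "word_conv (\<lambda>w. f w \<oplus> f' w) g w = word_conv f g w \<oplus> word_conv f' g w"
  using assms
proof (induction w arbitrary: f f')
  case (Cons x w)
  have "word_conv f g (x # w) \<oplus> word_conv f' g (x # w)
      = (f [] \<otimes> g (x # w) \<oplus> word_conv (\<lambda>v. f (x # v)) g w)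
        \<oplus> (f' [] \<otimes> g (x # w) \<oplus> word_conv (\<lambda>v. f' (x # v)) g w)"
    using Cons.prems by (simp add: word_conv_Cons)
  also have "\<dots> = (f [] \<oplus> f' []) \<otimes> g (x # w)
     \<oplus> (word_conv (\<lambda>v. f (x # v)) g w \<oplus> word_conv (\<lambda>v. f' (x # v)) g w)"
    using Cons.prems by (simp add: word_conv_closed l_distr a_ac)
  finally show ?case
    using Cons.prems Cons.IH[of "\<lambda>v. f (x # v)" "\<lambda>v. f' (x # v)"]
    by (simp add: word_conv_Cons)
qed (simp add: word_conv_Nil l_distr)

lemma word_conv_add_right:
  assumes "word_fun f" "word_fun g" "word_fun g'"
  shows "word_conv f (\<lambda>w. g w \<oplus> g' w) w = word_conv f g w \<oplus> word_conv f g' w"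
  using assms
proof (induction w arbitrary: f)
  case (Cons x w)
  have "word_conv f g (x # w) \<oplus> word_conv f g' (x # w)
      = (f [] \<otimes> g (x # w) \<oplus> word_conv (\<lambda>v. f (x # v)) g w)
        \<oplus> (f [] \<otimes> g' (x # w) \<oplus> word_conv (\<lambda>v. f (x # v)) g' w)"
    using Cons.prems by (simp add: word_conv_Cons)
  also have "\<dots> = f [] \<otimes> (g (x # w) \<oplus> g' (x # w))
     \<oplus> (word_conv (\<lambda>v. f (x # v)) g w \<oplus> word_conv (\<lambda>v. f (x # v)) g' w)"
    using Cons.prems by (simp add: word_conv_closed r_distr a_ac)
  finally show ?case
    using Cons.prems Cons.IH[of "\<lambda>v. f (x # v)"]
    by (simp add: word_conv_Cons)
qed (simp add: word_conv_Nil r_distr)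

lemma word_conv_smult_left:
  assumes "word_fun f" "word_fun g" "a \<in> carrier R"
  shows "word_conv (\<lambda>w. a \<otimes> f w) g w = a \<otimes> word_conv f g w"
  using assms
proof (induction w arbitrary: f)
  case (Cons x w)
  then show ?case
    using Cons.IH[of "\<lambda>v. f (x # v)"]
    by (simp add: word_conv_Cons word_conv_closed r_distr m_assoc)
qed (simp add: word_conv_Nil m_assoc)

lemma word_conv_assoc:
  assumes "word_fun f" "word_fun g" "word_fun h"
  shows "word_conv (word_conv f g) h w = word_conv f (word_conv g h) w"
  using assms
proof (induction w arbitrary: f g)
  case Nil
  then show ?case by (simp add: word_conv_Nil word_conv_closed m_assoc)
next
  case (Cons x w)
  let ?fx = "\<lambda>v. f (x # v)" and ?gx = "\<lambda>v. g (x # v)"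
  \<comment> \<open>The derivative of the product of \<open>f\<close> and \<open>g\<close> by
    \<open>x\<close> is \<open>f []\<close> times \<open>?gx\<close> plus the product of
    \<open>?fx\<close> and \<open>g\<close>; the induction hypothesis is applied to
    \<open>?fx\<close>.\<close>
  have c: "word_fun ?fx" "word_fun ?gx" "word_fun (word_conv f g)" "word_fun (word_conv ?fx g)"
    using Cons.prems by (auto intro!: word_conv_closed)
  have "word_conv (word_conv f g) h (x # w)
      = f [] \<otimes> g [] \<otimes> h (x # w) \<oplus> word_conv (\<lambda>v. f [] \<otimes> ?gx v \<oplus> word_conv ?fx g v) h w"
    using Cons.prems c by (simp add: word_conv_Cons word_conv_Nil)
  also have "word_conv (\<lambda>v. f [] \<otimes> ?gx v \<oplus> word_conv ?fx g v) h w
      = f [] \<otimes> word_conv ?gx h w \<oplus> word_conv ?fx (word_conv g h) w"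
    using Cons.prems c Cons.IH[of ?fx g]
    by (simp add: word_conv_add_left word_conv_smult_left)
  also have "f [] \<otimes> g [] \<otimes> h (x # w) \<oplus> (f [] \<otimes> word_conv ?gx h w \<oplus> word_conv ?fx (word_conv g h) w)
     = f [] \<otimes> word_conv g h (x # w) \<oplus> word_conv ?fx (word_conv g h) w"
    using Cons.prems c by (simp add: word_conv_Cons word_conv_closed r_distr m_assoc a_assoc)
  also have "\<dots> = word_conv f (word_conv g h) (x # w)"
    using Cons.prems c by (simp add: word_conv_Cons word_conv_closed)
  finally show ?case .
qed

lemma word_conv_const_left:
  assumes "word_fun f" "a \<in> carrier R"
  shows "word_conv (free_const R a) f w = a \<otimes> f w"
proof (cases w)
  case (Cons x v)
  have "word_conv (free_const R a) f (x # v) = a \<otimes> f (x # v) \<oplus> word_conv (\<lambda>_. \<zero>) f v"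
    using assms by (subst word_conv_Cons) (auto simp: free_const_def)
  then show ?thesis using assms Cons by (simp add: word_conv_zero_left)
qed (use assms in \<open>simp add: word_conv_Nil free_const_def\<close>)

lemma word_conv_const_right:
  fixes f :: "'g list \<Rightarrow> 'a"
  assumes "word_fun f" "a \<in> carrier R"
  shows "word_conv f (free_const R a) w = a \<otimes> f w"
  using assms(1)
proof (induction w arbitrary: f)
  case (Cons x w)
  have 1: "word_fun (free_const R a :: 'g list \<Rightarrow> 'a)" using assms(2) by (auto simp: free_const_def)
  have "f [] \<otimes> free_const R a (x # w) = \<zero>" using Cons.prems by (simp add: free_const_def)
  then have "word_conv f (free_const R a) (x # w) = \<zero> \<oplus> a \<otimes> f (x # w)"
    using Cons.prems 1 Cons.IH[of "\<lambda>v. f (x # v)"] by (simp add: word_conv_Cons)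
  then show ?case using Cons.prems assms(2) by simp
qed (use assms in \<open>simp add: word_conv_Nil free_const_def m_comm\<close>)

lemma word_conv_support:
  assumes "word_fun f" "word_fun g"
  shows "{w. word_conv f g w \<noteq> \<zero>} \<subseteq> (\<lambda>(a, b). a @ b) ` ({w. f w \<noteq> \<zero>} \<times> {w. g w \<noteq> \<zero>})"
proof
  fix w assume w: "w \<in> {w. word_conv f g w \<noteq> \<zero>}"
  have "\<exists>k. f (take k w) \<noteq> \<zero> \<and> g (drop k w) \<noteq> \<zero>"
  proof (rule ccontr)
    assume "\<not> ?thesis"
    then have "f (take k w) \<otimes> g (drop k w) = \<zero>" for k
      using assms by (metis l_null r_null)
    then show False using w by (simp add: word_conv_def)
  qed
  then obtain k where k: "f (take k w) \<noteq> \<zero>" "g (drop k w) \<noteq> \<zero>" by blast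
  then show "w \<in> (\<lambda>(a, b). a @ b) ` ({w. f w \<noteq> \<zero>} \<times> {w. g w \<noteq> \<zero>})"
    by (intro image_eqI[of _ _ "(take k w, drop k w)"]) auto
qed

lemma finite_word_conv_support:
  assumes "word_fun f" "word_fun g" "finite {w. f w \<noteq> \<zero>}" "finite {w. g w \<noteq> \<zero>}"
  shows "finite {w. word_conv f g w \<noteq> \<zero>}"
  using word_conv_support[OF assms(1,2)] assms(3,4) by (meson finite_SigmaI finite_imageI finite_subset)

lemma free_algebra_simps:
  "carrier (free_algebra R) = {f. word_fun f \<and> finite {w. f w \<noteq> \<zero>}}"
  "f \<otimes>\<^bsub>free_algebra R\<^esub> g = word_conv f g"
  "\<one>\<^bsub>free_algebra R\<^esub> = free_const R \<one>"
  "\<zero>\<^bsub>free_algebra R\<^esub> = (\<lambda>w. \<zero>)"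
  "f \<oplus>\<^bsub>free_algebra R\<^esub> g = (\<lambda>w. f w \<oplus> g w)"
  by (simp_all add: free_algebra_def word_conv_def free_const_def fun_eq_iff)

lemma free_const_closed: "a \<in> carrier R \<Longrightarrow> free_const R a \<in> carrier (free_algebra R)"
  unfolding free_algebra_simps free_const_def by (auto intro: finite_subset[of _ "{[]}"])

lemma free_gen_closed: "free_gen R x \<in> carrier (free_algebra R)"
  unfolding free_algebra_simps free_gen_def by (auto intro: finite_subset[of _ "{[x]}"])

lemma free_algebra_ring: "ring (free_algebra R :: ('g list \<Rightarrow> 'a) ring)"
proof (rule ringI)
  show "abelian_group (free_algebra R :: ('g list \<Rightarrow> 'a) ring)"
  proof (rule abelian_groupI)
    fix f g :: "'g list \<Rightarrow> 'a"
    assume f: "f \<in> carrier (free_algebra R)" and g: "g \<in> carrier (free_algebra R)"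
    have "{w. f w \<oplus> g w \<noteq> \<zero>} \<subseteq> {w. f w \<noteq> \<zero>} \<union> {w. g w \<noteq> \<zero>}" by auto
    then show "f \<oplus>\<^bsub>free_algebra R\<^esub> g \<in> carrier (free_algebra R)"
      using f g unfolding free_algebra_simps
      by (auto intro: finite_subset[of _ "{w. f w \<noteq> \<zero>} \<union> {w. g w \<noteq> \<zero>}"])
    show "f \<oplus>\<^bsub>free_algebra R\<^esub> g = g \<oplus>\<^bsub>free_algebra R\<^esub> f"
      using f g by (simp add: free_algebra_simps a_comm)
    have "{w. \<ominus> f w \<noteq> \<zero>} = {w. f w \<noteq> \<zero>}" using f by (auto simp: free_algebra_simps)
    then have "(\<lambda>w. \<ominus> f w) \<in> carrier (free_algebra R)" using f by (simp add: free_algebra_simps)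
    then show "\<exists>g\<in>carrier (free_algebra R). g \<oplus>\<^bsub>free_algebra R\<^esub> f = \<zero>\<^bsub>free_algebra R\<^esub>"
      by (rule bexI[rotated]) (use f in \<open>simp add: free_algebra_simps l_neg\<close>)
  qed (auto simp: free_algebra_simps a_assoc)
  show "Group.monoid (free_algebra R :: ('g list \<Rightarrow> 'a) ring)"
  proof (rule Group.monoidI)
    fix f g :: "'g list \<Rightarrow> 'a"
    assume fg: "f \<in> carrier (free_algebra R)" "g \<in> carrier (free_algebra R)"
    then show "f \<otimes>\<^bsub>free_algebra R\<^esub> g \<in> carrier (free_algebra R)"
      by (simp add: free_algebra_simps word_conv_closed finite_word_conv_support)
    show "f \<otimes>\<^bsub>free_algebra R\<^esub> g \<otimes>\<^bsub>free_algebra R\<^esub> h = f \<otimes>\<^bsub>free_algebra R\<^esub> (g \<otimes>\<^bsub>free_algebra R\<^esub> h)"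
      if "h \<in> carrier (free_algebra R)" for h
      using fg that by (simp add: free_algebra_simps word_conv_assoc fun_eq_iff)
  next
    fix f :: "'g list \<Rightarrow> 'a"
    assume f: "f \<in> carrier (free_algebra R)"
    show "\<one>\<^bsub>free_algebra R\<^esub> \<otimes>\<^bsub>free_algebra R\<^esub> f = f" "f \<otimes>\<^bsub>free_algebra R\<^esub> \<one>\<^bsub>free_algebra R\<^esub> = f"
      using f by (auto simp: free_algebra_simps word_conv_const_left word_conv_const_right)
  next
    show "\<one>\<^bsub>free_algebra R\<^esub> \<in> carrier (free_algebra R :: ('g list \<Rightarrow> 'a) ring)"
      using free_const_closed[of \<one>] by (simp add: free_algebra_simps(3))
  qed
qed (auto simp: free_algebra_simps word_conv_add_left word_conv_add_right)

lemma free_const_add: "a \<in> carrier R \<Longrightarrow> b \<in> carrier R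
   \<Longrightarrow> free_const R (a \<oplus> b) = free_const R a \<oplus>\<^bsub>free_algebra R\<^esub> free_const R b"
  by (auto simp: free_algebra_simps free_const_def)

lemma free_const_mult: "a \<in> carrier R \<Longrightarrow> b \<in> carrier R
   \<Longrightarrow> free_const R (a \<otimes> b) = free_const R a \<otimes>\<^bsub>free_algebra R\<^esub> (free_const R b :: 'g list \<Rightarrow> 'a)"
proof -
  assume ab: "a \<in> carrier R" "b \<in> carrier R"
  then have "word_conv (free_const R a) (free_const R b) w = a \<otimes> free_const R b w" for w :: "'g list"
    by (intro word_conv_const_left) (auto simp: free_const_def)
  then show "free_const R (a \<otimes> b) = free_const R a \<otimes>\<^bsub>free_algebra R\<^esub> (free_const R b :: 'g list \<Rightarrow> 'a)"
    using ab by (auto simp: free_algebra_simps(2) free_const_def fun_eq_iff)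
qed

lemma free_const_hom: "free_const R \<in> ring_hom R (free_algebra R)"
  by (rule ring_hom_memI)
     (auto simp: free_const_closed free_const_mult free_const_add free_algebra_simps(3))

lemma free_const_central:
  assumes "a \<in> carrier R" "f \<in> carrier (free_algebra R)"
  shows "free_const R a \<otimes>\<^bsub>free_algebra R\<^esub> f = f \<otimes>\<^bsub>free_algebra R\<^esub> free_const R a"
  using assms by (simp add: free_algebra_simps word_conv_const_left word_conv_const_right fun_eq_iff)

end

section \<open>The algebra $W_2$\<close>

locale W2_alg = ground_ring r S for r and S :: "('a, 'm) param_ring_scheme" (structure)
begin

abbreviation "A \<equiv> (free_algebra S :: (W2_gen list \<Rightarrow> 'a) ring)"

sublocale A: ring A by (rule free_algebra_ring)

lemma W2_relations_closed:
  assumes "(a, b) \<in> W2_relations r S" shows "a \<in> carrier A \<and> b \<in> carrier A"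
proof -
  have fold: "foldr (\<lambda>i p. (free_gen S Gen_y \<ominus>\<^bsub>A\<^esub> free_const S (par_u S i)) \<otimes>\<^bsub>A\<^esub> p) is \<one>\<^bsub>A\<^esub> \<in> carrier A"
    if "set is \<subseteq> {1..r}" for "is"
    using that
  proof (induction "is")
    case (Cons i "is")
    then have "free_gen S Gen_y \<ominus>\<^bsub>A\<^esub> free_const S (par_u S i) \<in> carrier A"
      by (intro A.minus_closed free_gen_closed free_const_closed Units_closed[OF u_unit]) auto
    then show ?case using Cons by simp
  qed simp
  have c: "free_const S (par_rho S) \<in> carrier A" "free_const S (inv (par_rho S)) \<in> carrier A"
    "free_const S (par_q S \<ominus> inv (par_q S)) \<in> carrier A" "\<And>j. free_const S (par_delta S j) \<in> carrier A"
    by (auto intro!: free_const_closed delta_closed minus_closed Units_closed[OF rho_unit] Units_inv_closed[OF rho_unit] Units_closed[OF q_unit] Units_inv_closed[OF q_unit])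
  have "set [1..<Suc r] \<subseteq> {1..r}" by auto
  from fold[OF this] show ?thesis
    using assms c
    unfolding W2_relations_def Let_def by (auto simp: free_gen_closed simp del: upt_Suc)
qed

lemma W2_ideal_ideal: "ideal (W2_ideal r S) A"
  unfolding W2_ideal_def by (rule A.genideal_ideal) (auto dest: W2_relations_closed)

lemma W2_ring: "ring (W2 r S)"
  unfolding W2_def by (rule ideal.quotient_is_ring[OF W2_ideal_ideal])

sublocale I: ideal "W2_ideal r S" A by (rule W2_ideal_ideal)
sublocale W: ring "W2 r S" by (rule W2_ring)

definition quot where "quot f = W2_ideal r S +>\<^bsub>A\<^esub> f"

lemma quot_hom: "quot \<in> ring_hom A (W2 r S)"
  unfolding quot_def[abs_def] W2_def by (rule I.rcos_ring_hom)

sublocale Q: ring_hom_ring A "W2 r S" quot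
  by (rule ring_hom_ringI2[OF A.ring_axioms W2_ring quot_hom])

lemma quot_eqI: "(a, b) \<in> W2_relations r S \<Longrightarrow> quot a = quot b"
proof -
  assume ab: "(a, b) \<in> W2_relations r S"
  have "a \<ominus>\<^bsub>A\<^esub> b \<in> W2_ideal r S"
    unfolding W2_ideal_def
    by (rule subsetD[OF A.genideal_self]) (use ab in \<open>auto dest: W2_relations_closed\<close>)
  then show ?thesis
    unfolding quot_def using W2_relations_closed[OF ab] A.quotient_eq_iff_same_a_r_cos[OF W2_ideal_ideal, of a b] by blast
qed

lemma quot_surj: "x \<in> carrier (W2 r S) \<Longrightarrow> \<exists>f\<in>carrier A. x = quot f"
  unfolding W2_def FactRing_def A_RCOSETS_def' quot_def by auto

lemma gen_quot: "W2_gen r S x = quot (free_gen S x)" "W2_scalar r S c = quot (free_const S c)"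
  by (simp_all add: W2_gen_def W2_scalar_def quot_def)

lemma scalar_hom: "W2_scalar r S \<in> ring_hom S (W2 r S)"
proof -
  have "W2_scalar r S = quot \<circ> free_const S" by (auto simp: gen_quot)
  then show ?thesis using ring_hom_trans[OF free_const_hom quot_hom] by simp
qed

lemma scalar_central:
  assumes "c \<in> carrier S" "x \<in> carrier (W2 r S)"
  shows "W2_scalar r S c \<otimes>\<^bsub>W2 r S\<^esub> x = x \<otimes>\<^bsub>W2 r S\<^esub> W2_scalar r S c"
proof -
  obtain f where f: "f \<in> carrier A" "x = quot f" using quot_surj[OF assms(2)] by blast
  have c: "free_const S c \<in> carrier A" using free_const_closed assms(1) by blast
  show ?thesis
    unfolding f(2) gen_quot Q.hom_mult[OF c f(1), symmetric] Q.hom_mult[OF f(1) c, symmetric]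
    using free_const_central[OF assms(1) f(1)] by simp
qed

end

section \<open>Coefficients of a product of linear factors\<close>

text \<open>The recursion over a list follows the \<open>foldr\<close> in the last relation of
  \<open>W2\<close>, so that both sides are matched by a single induction.\<close>

primrec root_coeff :: "('a, 'm) ring_scheme \<Rightarrow> (nat \<Rightarrow> 'a) \<Rightarrow> nat list \<Rightarrow> nat \<Rightarrow> 'a" where
  "root_coeff R u [] j = (if j = 0 then \<one>\<^bsub>R\<^esub> else \<zero>\<^bsub>R\<^esub>)"
| "root_coeff R u (i # is) j =
     (if j = 0 then \<zero>\<^bsub>R\<^esub> else root_coeff R u is (j - 1)) \<ominus>\<^bsub>R\<^esub> u i \<otimes>\<^bsub>R\<^esub> root_coeff R u is j"

context cring begin

lemma root_coeff_closed [intro]: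
  "u \<in> set is \<rightarrow> carrier R \<Longrightarrow> root_coeff R u is j \<in> carrier R"
  by (induction "is" arbitrary: j) auto

lemma root_coeff_large:
  "u \<in> set is \<rightarrow> carrier R \<Longrightarrow> j > length is \<Longrightarrow> root_coeff R u is j = \<zero>"
  by (induction "is" arbitrary: j) (auto simp: Pi_def minus_eq)

lemma root_coeff_top:
  "u \<in> set is \<rightarrow> carrier R \<Longrightarrow> root_coeff R u is (length is) = \<one>"
  by (induction "is") (auto simp: root_coeff_large Pi_def minus_eq)

lemma root_coeff_0:
  "u \<in> set is \<rightarrow> carrier R \<Longrightarrow> distinct is \<Longrightarrow> root_coeff R u is 0 = (\<Otimes>i\<in>set is. \<ominus> u i)"
proof (induction "is")
  case (Cons i "is")
  have "root_coeff R u is 0 \<in> carrier R" using Cons.prems by (intro root_coeff_closed) auto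
  then show ?case using Cons by (simp add: Pi_def minus_eq l_minus)
qed simp

lemma finsum_if_unique:
  assumes "finite A" "k \<in> A" "f k \<in> carrier R" "\<And>j. j \<in> A \<Longrightarrow> P j \<longleftrightarrow> j = k"
  shows "(\<Oplus>j\<in>A. if P j then f j else \<zero>) = f k"
proof -
  have "(\<Oplus>j\<in>A. if P j then f j else \<zero>) = (\<Oplus>j\<in>A. if k = j then f k else \<zero>)"
    using assms by (intro finsum_cong') auto
  also have "\<dots> = f k" using assms by (intro finsum_singleton) auto
  finally show ?thesis .
qed

lemma finsum_if_none:
  assumes "\<And>j. j \<in> A \<Longrightarrow> \<not> P j"
  shows "(\<Oplus>j\<in>A. if P j then f j else \<zero>) = \<zero>"
proof -
  have "(\<Oplus>j\<in>A. if P j then f j else \<zero>) = (\<Oplus>j\<in>A. \<zero>)"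
    using assms by (intro finsum_cong') auto
  then show ?thesis by simp
qed

end

text \<open>With $v_i = y_1^i e$, \<open>wy_expr ... k\<close> is the coefficient of $v_{-k}$ in the relation obtained from
  $\sum_j a_j y_1 g v_j = 0$. The correction term \<open>wy_corr\<close> is the coefficient of $v_i$ in
  $\sum_{k<j} v_{j-1-2k} - \sum_{k<m} v_{j-1-2k}$ with $m = \lfloor r/2 \rfloor$; subtracting the second sum,
  whose combination with the $a_j$ vanishes, brings the exponents into the range $1-r, \dots, 0$.\<close>

definition wy_corr :: "('a, 'm) ring_scheme \<Rightarrow> nat \<Rightarrow> nat \<Rightarrow> int \<Rightarrow> 'a" where
  "wy_corr R r j i =
     (if even (int j - 1 - i) \<and> 0 \<le> int j - 1 - i \<and> int j - 1 - i < 2 * int j then \<one>\<^bsub>R\<^esub> else \<zero>\<^bsub>R\<^esub>)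
     \<ominus>\<^bsub>R\<^esub> (if even (int j - 1 - i) \<and> 0 \<le> int j - 1 - i \<and> int j - 1 - i < 2 * int (r div 2) then \<one>\<^bsub>R\<^esub> else \<zero>\<^bsub>R\<^esub>)"

definition wy_expr :: "nat \<Rightarrow> ('a, 'm) ring_scheme \<Rightarrow> 'a \<Rightarrow> 'a \<Rightarrow> (nat \<Rightarrow> 'a) \<Rightarrow> (nat \<Rightarrow> 'a) \<Rightarrow> nat \<Rightarrow> 'a" where
  "wy_expr r R \<rho>' z \<delta> a k =
     \<rho>' \<otimes>\<^bsub>R\<^esub> (a (k + 1) \<ominus>\<^bsub>R\<^esub> a 0 \<otimes>\<^bsub>R\<^esub> a (r - 1 - k))
     \<oplus>\<^bsub>R\<^esub> z \<otimes>\<^bsub>R\<^esub> (\<Oplus>\<^bsub>R\<^esub>j\<in>{..r}. a j \<otimes>\<^bsub>R\<^esub>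
          ((if k < j then \<delta> (j - 1 - k) else \<zero>\<^bsub>R\<^esub>) \<ominus>\<^bsub>R\<^esub> wy_corr R r j (- int k)))"

text \<open>Relations of \<open>W2\<close> for elements of an arbitrary ring \<open>W\<close> over
  the scalars \<open>R\<close>, so that the computation takes place without cosets.
  \<open>\<rho>'\<close> stands for the inverse of \<open>\<rho>\<close> and \<open>z\<close> for
  \<open>q - 1/q\<close>; \<open>eye\<close> includes \<open>j = 0\<close>, that is
  \<open>e e = \<delta>\<^sub>0 e\<close>.\<close>

locale skein = ring W + R: cring R
  for W :: "('w, 'n) ring_scheme" (structure) and R :: "('a, 'm) ring_scheme" +
  fixes \<sigma> :: "'a \<Rightarrow> 'w" and y y' g g' e :: 'w and r :: nat and \<rho> \<rho>' z :: 'a and \<delta> u :: "nat \<Rightarrow> 'a"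
  assumes r_pos: "r \<ge> 1"
    and sigma_hom: "\<sigma> \<in> ring_hom R W"
    and sigma_central: "\<lbrakk>c \<in> carrier R; x \<in> carrier W\<rbrakk> \<Longrightarrow> \<sigma> c \<otimes> x = x \<otimes> \<sigma> c"
    and gens [simp]: "y \<in> carrier W" "y' \<in> carrier W" "g \<in> carrier W" "g' \<in> carrier W" "e \<in> carrier W"
    and scalars [simp]: "\<rho> \<in> carrier R" "\<rho>' \<in> carrier R" "z \<in> carrier R" "\<And>j. \<delta> j \<in> carrier R"
      "\<And>i. i \<in> {1..r} \<Longrightarrow> u i \<in> carrier R"
    and rho': "\<rho> \<otimes>\<^bsub>R\<^esub> \<rho>' = \<one>\<^bsub>R\<^esub>"
    and gg': "g \<otimes> g' = \<one>" and yy': "y \<otimes> y' = \<one>" "y' \<otimes> y = \<one>"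
    and braid: "y \<otimes> g \<otimes> y \<otimes> g = g \<otimes> y \<otimes> g \<otimes> y"
    and skein_rel: "g \<ominus> g' = \<sigma> z \<otimes> (\<one> \<ominus> e)"
    and ge: "g \<otimes> e = \<sigma> \<rho>' \<otimes> e"
    and ygye: "y \<otimes> g \<otimes> y \<otimes> e = \<sigma> \<rho> \<otimes> e"
    and eye: "e \<otimes> y [^] (j::nat) \<otimes> e = \<sigma> (\<delta> j) \<otimes> e"
    and root_rel: "foldr (\<lambda>i p. (y \<ominus> \<sigma> (u i)) \<otimes> p) [1..<Suc r] \<one> = \<zero>"
begin

sublocale \<sigma>: ring_hom_ring R W \<sigma>
  by (rule ring_hom_ringI2[OF R.ring_axioms ring_axioms sigma_hom])

definition "a = root_coeff R u [1..<Suc r]"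

lemma a_closed [simp]: "a j \<in> carrier R"
  unfolding a_def by (rule R.root_coeff_closed) auto

lemma root_rel_list:
  assumes "set is \<subseteq> {1..r}"
  shows "foldr (\<lambda>i p. (y \<ominus> \<sigma> (u i)) \<otimes> p) is \<one> = (\<Oplus>j\<in>{..length is}. \<sigma> (root_coeff R u is j) \<otimes> y [^] j)"
  using assms
proof (induction "is")
  case (Cons i "is")
  let ?n = "length is" and ?c = "root_coeff R u is"
  have ui: "u i \<in> carrier R" and us: "u \<in> set is \<rightarrow> carrier R" using Cons.prems by auto
  have c [simp]: "?c j \<in> carrier R" for j using us by blast
  let ?s = "\<lambda>j. if j = 0 then \<zero>\<^bsub>R\<^esub> else ?c (j - 1)"
  have 1: "y \<otimes> (\<Oplus>j\<in>{..?n}. \<sigma> (?c j) \<otimes> y [^] j) = (\<Oplus>j\<in>{..Suc ?n}. \<sigma> (?s j) \<otimes> y [^] j)"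
  proof -
    have "y \<otimes> (\<Oplus>j\<in>{..?n}. \<sigma> (?c j) \<otimes> y [^] j) = (\<Oplus>j\<in>{..?n}. y \<otimes> (\<sigma> (?c j) \<otimes> y [^] j))"
      by (rule finsum_rdistr) auto
    also have "\<dots> = (\<Oplus>j\<in>{..?n}. \<sigma> (?s (Suc j)) \<otimes> y [^] Suc j)"
    proof (rule finsum_cong')
      fix j
      have "y \<otimes> (\<sigma> (?c j) \<otimes> y [^] j) = \<sigma> (?c j) \<otimes> (y \<otimes> y [^] j)"
        using sigma_central[of "?c j" y] by (simp add: m_assoc[symmetric])
      also have "y \<otimes> y [^] j = y [^] Suc j" by (rule nat_pow_Suc2[symmetric]) simp
      finally show "y \<otimes> (\<sigma> (?c j) \<otimes> y [^] j) = \<sigma> (?s (Suc j)) \<otimes> y [^] Suc j" by simp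
    qed auto
    also have "\<dots> = (\<Oplus>j\<in>{..Suc ?n}. \<sigma> (?s j) \<otimes> y [^] j)"
      by (subst finsum_Suc2) auto
    finally show ?thesis .
  qed
  have 2: "\<sigma> (u i) \<otimes> (\<Oplus>j\<in>{..?n}. \<sigma> (?c j) \<otimes> y [^] j) = (\<Oplus>j\<in>{..Suc ?n}. \<sigma> (u i \<otimes>\<^bsub>R\<^esub> ?c j) \<otimes> y [^] j)"
  proof -
    have "\<sigma> (u i) \<otimes> (\<Oplus>j\<in>{..?n}. \<sigma> (?c j) \<otimes> y [^] j) = (\<Oplus>j\<in>{..?n}. \<sigma> (u i) \<otimes> (\<sigma> (?c j) \<otimes> y [^] j))"
      by (rule finsum_rdistr) (auto simp: ui)
    also have "\<dots> = (\<Oplus>j\<in>{..?n}. \<sigma> (u i \<otimes>\<^bsub>R\<^esub> ?c j) \<otimes> y [^] j)"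
      using ui by (intro finsum_cong') (auto simp: m_assoc)
    also have "\<dots> = (\<Oplus>j\<in>{..Suc ?n}. \<sigma> (u i \<otimes>\<^bsub>R\<^esub> ?c j) \<otimes> y [^] j)"
      using ui us by (subst finsum_Suc) (auto simp: R.root_coeff_large)
    finally show ?thesis .
  qed
  have "foldr (\<lambda>i p. (y \<ominus> \<sigma> (u i)) \<otimes> p) (i # is) \<one>
      = (y \<ominus> \<sigma> (u i)) \<otimes> (\<Oplus>j\<in>{..?n}. \<sigma> (?c j) \<otimes> y [^] j)"
    using Cons by simp
  also have "\<dots> = (\<Oplus>j\<in>{..Suc ?n}. \<sigma> (?s j) \<otimes> y [^] j) \<ominus> (\<Oplus>j\<in>{..Suc ?n}. \<sigma> (u i \<otimes>\<^bsub>R\<^esub> ?c j) \<otimes> y [^] j)"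
    using ui unfolding 1[symmetric] 2[symmetric]
    by (simp add: minus_eq l_distr l_minus finsum_closed Pi_def)
  also have "\<dots> = (\<Oplus>j\<in>{..Suc ?n}. \<sigma> (?s j) \<otimes> y [^] j)
      \<oplus> (\<Oplus>j\<in>{..Suc ?n}. \<ominus> \<one> \<otimes> (\<sigma> (u i \<otimes>\<^bsub>R\<^esub> ?c j) \<otimes> y [^] j))"
    using ui by (subst finsum_rdistr[symmetric]) (auto simp: minus_eq l_minus finsum_closed Pi_def)
  also have "\<dots> = (\<Oplus>j\<in>{..Suc ?n}. \<sigma> (?s j) \<otimes> y [^] j \<oplus> \<ominus> \<one> \<otimes> (\<sigma> (u i \<otimes>\<^bsub>R\<^esub> ?c j) \<otimes> y [^] j))"
    using ui by (subst finsum_addf) auto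
  also have "\<dots> = (\<Oplus>j\<in>{..Suc ?n}. \<sigma> (root_coeff R u (i # is) j) \<otimes> y [^] j)"
    using ui by (intro finsum_cong') (auto simp: R.minus_eq minus_eq l_minus l_distr)
  finally show ?case by simp
qed auto

lemma root_poly: "(\<Oplus>j\<in>{..r}. \<sigma> (a j) \<otimes> y [^] j) = \<zero>"
proof -
  have "set [1..<Suc r] \<subseteq> {1..r}" by auto
  from root_rel_list[OF this] show ?thesis using root_rel by (simp add: a_def del: upt_Suc)
qed

section \<open>The action of \<open>y\<close> and \<open>g\<close> on the vectors
  \<open>y^i e\<close>, for all integers \<open>i\<close>\<close>

definition v :: "int \<Rightarrow> 'w" where
  "v i = (if i \<ge> 0 then y [^] nat i else y' [^] nat (- i)) \<otimes> e"

lemma v_closed [simp]: "v i \<in> carrier W"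
  unfolding v_def by (cases "i \<ge> 0") (simp_all only: if_True if_False, (intro m_closed nat_pow_closed gens)+)
lemma v_0: "v 0 = e" by (simp add: v_def)
lemma v_nat: "v (int n) = y [^] n \<otimes> e" by (simp add: v_def)
lemma v_neg: "v (- int n) = y' [^] n \<otimes> e" by (simp add: v_def)

lemma y_v: "y \<otimes> v i = v (i + 1)"
proof (cases "i \<ge> 0")
  case True
  then obtain n where n: "i = int n" using nonneg_int_cases by metis
  have "y \<otimes> v i = y [^] Suc n \<otimes> e" unfolding n v_nat nat_pow_Suc2[OF gens(1)] by (simp add: m_assoc)
  then show ?thesis unfolding n v_nat[of "Suc n", symmetric] by (simp add: add.commute)
next
  case False
  then have "i = - int (Suc (nat (- i) - 1))" by simp
  then obtain n where n: "i = - int (Suc n)" by blast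
  have "y \<otimes> v i = y \<otimes> y' \<otimes> y' [^] n \<otimes> e" unfolding n v_neg nat_pow_Suc2[OF gens(2)] by (simp add: m_assoc)
  then have "y \<otimes> v i = v (- int n)" by (simp add: yy' v_neg)
  then show ?thesis unfolding n by simp
qed

lemma y'_v: "y' \<otimes> v i = v (i - 1)"
proof -
  have "y' \<otimes> v i = y' \<otimes> (y \<otimes> v (i - 1))" by (simp add: y_v)
  then show ?thesis using yy' by (simp add: m_assoc[symmetric])
qed

lemma ypow_v: "y [^] n \<otimes> v i = v (i + int n)"
proof (induction n arbitrary: i)
  case (Suc n)
  have "y [^] Suc n \<otimes> v i = y [^] n \<otimes> (y \<otimes> v i)" by (simp add: m_assoc)
  then show ?case using Suc[of "i + 1"] by (simp add: y_v ac_simps)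
qed simp

lemma sigma_comm: "c \<in> carrier R \<Longrightarrow> x \<in> carrier W \<Longrightarrow> w \<in> carrier W \<Longrightarrow> x \<otimes> (\<sigma> c \<otimes> w) = \<sigma> c \<otimes> (x \<otimes> w)"
  using sigma_central[of c x] by (simp add: m_assoc[symmetric])

lemma rho_cancel: "w \<in> carrier W \<Longrightarrow> \<sigma> \<rho> \<otimes> (\<sigma> \<rho>' \<otimes> w) = w"
  by (simp add: m_assoc[symmetric] rho' flip: \<sigma>.hom_mult)

text \<open>The second Jucys-Murphy element: the braid relation says that it commutes with
  \<open>y\<close>, and on the vectors \<open>v i\<close> it acts like the inverse of
  \<open>y\<close>.\<close>

definition "y2 = g \<otimes> y \<otimes> g"

lemma y2_closed [simp]: "y2 \<in> carrier W" by (simp add: y2_def)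
lemma y2_y: "y2 \<otimes> y = y \<otimes> y2" using braid by (simp add: y2_def m_assoc)

lemma y2_y': "y2 \<otimes> y' = y' \<otimes> y2"
proof -
  have "y2 \<otimes> y' = y' \<otimes> y \<otimes> y2 \<otimes> y'" by (simp add: yy')
  also have "\<dots> = y' \<otimes> (y \<otimes> y2) \<otimes> y'" by (simp add: m_assoc)
  also have "\<dots> = y' \<otimes> (y2 \<otimes> (y \<otimes> y'))" unfolding y2_y[symmetric] by (simp add: m_assoc)
  finally show ?thesis by (simp add: yy')
qed

text \<open>\<open>y g y e = \<rho> e\<close> gives \<open>g y e = \<rho> y' e\<close>, and the
  inner factor \<open>g e = \<rho>' e\<close> cancels the scalar.\<close>

lemma y2_e: "y2 \<otimes> e = v (- 1)"
proof -
  have 1: "g \<otimes> (y \<otimes> e) = \<sigma> \<rho> \<otimes> (y' \<otimes> e)"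
  proof -
    have "g \<otimes> (y \<otimes> e) = y' \<otimes> (y \<otimes> g \<otimes> y \<otimes> e)" using yy' by (simp add: m_assoc[symmetric])
    then show ?thesis unfolding ygye by (simp add: sigma_comm)
  qed
  have "y2 \<otimes> e = g \<otimes> (y \<otimes> (g \<otimes> e))" by (simp add: y2_def m_assoc)
  also have "\<dots> = \<sigma> \<rho>' \<otimes> (g \<otimes> (y \<otimes> e))" unfolding ge by (simp add: sigma_comm)
  also have "\<dots> = \<sigma> \<rho> \<otimes> (\<sigma> \<rho>' \<otimes> (y' \<otimes> e))" unfolding 1
    by (rule sigma_comm[symmetric]) auto
  also have "\<dots> = v (- 1)" using v_neg[of 1] by (simp add: rho_cancel)
  finally show ?thesis .
qed

text \<open>\<open>y2\<close> commutes with \<open>y\<close> and \<open>y'\<close>, so the case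
  \<open>i = 0\<close> propagates in both directions.\<close>

lemma y2_v: "y2 \<otimes> v i = v (i - 1)"
proof (cases "i \<ge> 0")
  case True
  then obtain n where n: "i = int n" using nonneg_int_cases by metis
  have "y2 \<otimes> v (int n) = v (int n - 1)" for n
  proof (induction n)
    case 0 then show ?case by (simp add: v_0 y2_e)
  next
    case (Suc n)
    have "y2 \<otimes> v (int (Suc n)) = y2 \<otimes> (y \<otimes> v (int n))" by (simp add: y_v add.commute)
    also have "\<dots> = y \<otimes> (y2 \<otimes> v (int n))" using y2_y by (simp add: m_assoc[symmetric])
    finally show ?case unfolding Suc y_v by simp
  qed
  then show ?thesis using n by simp
next
  case False
  then have "i = - int (nat (- i))" by simp
  then obtain n where n: "i = - int n" by blast
  have "y2 \<otimes> v (- int n) = v (- int n - 1)" for n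
  proof (induction n)
    case 0 then show ?case by (simp add: v_0 y2_e)
  next
    case (Suc n)
    have n: "- int (Suc n) = - int n - 1" by simp
    have "y2 \<otimes> v (- int (Suc n)) = y2 \<otimes> (y' \<otimes> v (- int n))" unfolding n y'_v ..
    also have "\<dots> = y' \<otimes> (y2 \<otimes> v (- int n))" using y2_y' by (simp add: m_assoc[symmetric])
    finally show ?case unfolding Suc y'_v n .
  qed
  then show ?thesis using n by simp
qed

lemma e_v: "e \<otimes> v (int j) = \<sigma> (\<delta> j) \<otimes> v 0"
  using eye[of j] by (simp add: v_nat v_0 m_assoc)

text \<open>\<open>g y = (g y g) g' = y2 g'\<close>, and the skein relation replaces
  \<open>g'\<close> by \<open>g - z (1 - e)\<close>. Thus \<open>g\<close> passes one power of
  \<open>y\<close> at the price of \<open>y2\<close>, which lowers exponents.\<close>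

lemma g_v_Suc: "g \<otimes> v (int (Suc j)) = y2 \<otimes> (g \<otimes> v (int j))
   \<oplus> \<sigma> z \<otimes> (\<sigma> (\<delta> j) \<otimes> v (- 1) \<ominus> v (int j - 1))"
proof -
  let ?v = "v (int j)"
  have "g' = g \<ominus> (g \<ominus> g')" by (simp add: minus_eq minus_add a_assoc[symmetric] r_neg)
  then have g': "g' = g \<ominus> \<sigma> z \<otimes> (\<one> \<ominus> e)" unfolding skein_rel .
  have "g \<otimes> v (int (Suc j)) = g \<otimes> (y \<otimes> ?v)" by (simp add: y_v add.commute)
  also have "\<dots> = g \<otimes> y \<otimes> (g \<otimes> g') \<otimes> ?v" by (simp add: gg' m_assoc)
  also have "\<dots> = y2 \<otimes> (g' \<otimes> ?v)" by (simp add: y2_def m_assoc)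
  also have "g' \<otimes> ?v = g \<otimes> ?v \<oplus> \<sigma> z \<otimes> (\<sigma> (\<delta> j) \<otimes> v 0 \<ominus> ?v)"
    unfolding g' by (simp add: minus_eq l_distr r_distr l_minus r_minus minus_add m_assoc e_v a_comm)
  also have "y2 \<otimes> \<dots> = y2 \<otimes> (g \<otimes> ?v) \<oplus> \<sigma> z \<otimes> (y2 \<otimes> (\<sigma> (\<delta> j) \<otimes> v 0 \<ominus> ?v))"
    by (simp add: r_distr sigma_comm)
  also have "y2 \<otimes> (\<sigma> (\<delta> j) \<otimes> v 0 \<ominus> ?v) = \<sigma> (\<delta> j) \<otimes> v (- 1) \<ominus> v (int j - 1)"
    by (simp add: minus_eq r_distr r_minus sigma_comm y2_v)
  finally show ?thesis .
qed

text \<open>Iteration of \<open>g_v_Suc\<close>: each round applies \<open>y2\<close> to everything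
  collected so far and lowers all its exponents by one.\<close>

lemma g_v: "g \<otimes> v (int j) = \<sigma> \<rho>' \<otimes> v (- int j)
   \<oplus> (\<Oplus>k\<in>{..<j}. \<sigma> z \<otimes> (\<sigma> (\<delta> (j - 1 - k)) \<otimes> v (- int k - 1) \<ominus> v (int j - 2 * int k - 2)))"
proof (induction j)
  case 0 then show ?case by (simp add: v_0 ge)
next
  case (Suc j)
  let ?t = "\<lambda>j k. \<sigma> z \<otimes> (\<sigma> (\<delta> (j - 1 - k)) \<otimes> v (- int k - 1) \<ominus> v (int j - 2 * int k - 2))"
  have t [simp]: "?t j k \<in> carrier W" for j k by simp
  have "y2 \<otimes> (g \<otimes> v (int j)) = y2 \<otimes> (\<sigma> \<rho>' \<otimes> v (- int j)) \<oplus> y2 \<otimes> (\<Oplus>k\<in>{..<j}. ?t j k)"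
    unfolding Suc by (rule r_distr) (auto simp: finsum_closed Pi_def)
  also have "y2 \<otimes> (\<sigma> \<rho>' \<otimes> v (- int j)) = \<sigma> \<rho>' \<otimes> v (- int (Suc j))"
  proof -
    have j: "- int (Suc j) = - int j - 1" by simp
    show ?thesis unfolding j by (simp add: sigma_comm[of _ y2] y2_v)
  qed
  also have "y2 \<otimes> (\<Oplus>k\<in>{..<j}. ?t j k) = (\<Oplus>k\<in>{..<j}. y2 \<otimes> ?t j k)"
    by (rule finsum_rdistr) auto
  also have "\<dots> = (\<Oplus>k\<in>{..<j}. ?t (Suc j) (Suc k))"
  proof (rule finsum_cong')
    fix k
    have i: "- int (Suc k) - 1 = - int k - 1 - 1" "int (Suc j) - 2 * int (Suc k) - 2 = int j - 2 * int k - 2 - 1"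
      by auto
    have d: "Suc j - 1 - Suc k = j - 1 - k" by simp
    have "y2 \<otimes> ?t j k = \<sigma> z \<otimes> (y2 \<otimes> (\<sigma> (\<delta> (j - 1 - k)) \<otimes> v (- int k - 1) \<ominus> v (int j - 2 * int k - 2)))"
      by (rule sigma_comm) auto
    also have "y2 \<otimes> (\<sigma> (\<delta> (j - 1 - k)) \<otimes> v (- int k - 1) \<ominus> v (int j - 2 * int k - 2))
      = \<sigma> (\<delta> (j - 1 - k)) \<otimes> v (- int k - 1 - 1) \<ominus> v (int j - 2 * int k - 2 - 1)"
      by (simp add: minus_eq r_distr r_minus sigma_comm[of _ y2] y2_v)
    finally show "y2 \<otimes> ?t j k = ?t (Suc j) (Suc k)" unfolding i d .
  qed auto
  finally have 1: "y2 \<otimes> (g \<otimes> v (int j)) = \<sigma> \<rho>' \<otimes> v (- int (Suc j)) \<oplus> (\<Oplus>k\<in>{..<j}. ?t (Suc j) (Suc k))" .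
  have "(\<Oplus>k\<in>{..<Suc j}. ?t (Suc j) k) = ?t (Suc j) 0 \<oplus> (\<Oplus>k\<in>Suc ` {..<j}. ?t (Suc j) k)"
    unfolding lessThan_Suc_eq_insert_0 by (rule finsum_insert) auto
  also have "(\<Oplus>k\<in>Suc ` {..<j}. ?t (Suc j) k) = (\<Oplus>k\<in>{..<j}. ?t (Suc j) (Suc k))"
    by (rule finsum_reindex) auto
  finally have 2: "(\<Oplus>k\<in>{..<Suc j}. ?t (Suc j) k) = ?t (Suc j) 0 \<oplus> (\<Oplus>k\<in>{..<j}. ?t (Suc j) (Suc k))" .
  have 3: "?t (Suc j) 0 = \<sigma> z \<otimes> (\<sigma> (\<delta> j) \<otimes> v (- 1) \<ominus> v (int j - 1))"
    by simp
  have 4: "(\<Oplus>k\<in>{..<j}. ?t (Suc j) (Suc k)) \<in> carrier W" by (rule finsum_closed) auto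
  have 5: "p \<oplus> s \<oplus> t = p \<oplus> (t \<oplus> s)" if "p \<in> carrier W" "s \<in> carrier W" "t \<in> carrier W" for p s t
    using that by (simp add: a_assoc a_comm[of s t])
  show ?case unfolding g_v_Suc 1 2 3 by (rule 5[OF _ 4]) auto
qed

text \<open>Linear combinations of the $v_i$ in a window that contains all exponents arising below; the
  coefficients need not be unique.\<close>

definition lin :: "(int \<Rightarrow> 'a) \<Rightarrow> 'w" where
  "lin c = (\<Oplus>i\<in>{- int r - 1..int r + 1}. \<sigma> (c i) \<otimes> v i)"

definition rep :: "'w \<Rightarrow> (int \<Rightarrow> 'a) \<Rightarrow> bool" where
  "rep w c \<longleftrightarrow> (\<forall>i. c i \<in> carrier R) \<and> w = lin c"

lemma rep_v:
  assumes "\<bar>i\<bar> \<le> int r + 1"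
  shows "rep (v i) (\<lambda>k. if k = i then \<one>\<^bsub>R\<^esub> else \<zero>\<^bsub>R\<^esub>)"
proof -
  have "lin (\<lambda>k. if k = i then \<one>\<^bsub>R\<^esub> else \<zero>\<^bsub>R\<^esub>) = (\<Oplus>k\<in>{- int r - 1..int r + 1}. if i = k then v k else \<zero>)"
    unfolding lin_def by (intro finsum_cong') auto
  also have "\<dots> = v i" using assms by (intro finsum_singleton) auto
  finally show ?thesis by (simp add: rep_def)
qed

lemma rep_add: "rep w c \<Longrightarrow> rep w' c' \<Longrightarrow> rep (w \<oplus> w') (\<lambda>i. c i \<oplus>\<^bsub>R\<^esub> c' i)"
  unfolding rep_def lin_def by (auto simp: l_distr finsum_addf Pi_def)

lemma rep_smult: "rep w c \<Longrightarrow> s \<in> carrier R \<Longrightarrow> rep (\<sigma> s \<otimes> w) (\<lambda>i. s \<otimes>\<^bsub>R\<^esub> c i)"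
  unfolding rep_def lin_def by (auto simp: finsum_rdistr m_assoc Pi_def intro!: finsum_cong')

lemma rep_neg: assumes "rep w c" shows "rep (\<ominus> w) (\<lambda>i. \<ominus>\<^bsub>R\<^esub> c i)"
proof -
  have "w \<in> carrier W" "\<And>i. c i \<in> carrier R" using assms unfolding rep_def lin_def by (auto intro!: finsum_closed)
  then show ?thesis using rep_smult[OF assms, of "\<ominus>\<^bsub>R\<^esub> \<one>\<^bsub>R\<^esub>"] by (simp add: l_minus R.l_minus)
qed

lemma rep_diff: "rep w c \<Longrightarrow> rep w' c' \<Longrightarrow> rep (w \<ominus> w') (\<lambda>i. c i \<ominus>\<^bsub>R\<^esub> c' i)"
  using rep_add[OF _ rep_neg, of w c w' c'] by (simp add: minus_eq R.minus_eq)

lemma rep_zero: "rep \<zero> (\<lambda>i. \<zero>\<^bsub>R\<^esub>)"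
proof -
  have "lin (\<lambda>i. \<zero>\<^bsub>R\<^esub>) = (\<Oplus>i\<in>{- int r - 1..int r + 1}. \<zero>)"
    unfolding lin_def by (rule finsum_cong') auto
  then show ?thesis unfolding rep_def by simp
qed

lemma rep_closed: "rep w c \<Longrightarrow> w \<in> carrier W" "rep w c \<Longrightarrow> c i \<in> carrier R"
  unfolding rep_def lin_def by (auto intro!: finsum_closed)

lemma rep_finsum:
  assumes "finite A" "\<And>j. j \<in> A \<Longrightarrow> rep (w j) (c j)"
  shows "rep (\<Oplus>j\<in>A. w j) (\<lambda>i. \<Oplus>\<^bsub>R\<^esub>j\<in>A. c j i)"
  using assms
proof (induction A rule: finite_induct)
  case (insert x F)
  then have "w \<in> F \<rightarrow> carrier W" "w x \<in> carrier W" "\<And>i. (\<lambda>j. c j i) \<in> F \<rightarrow> carrier R" "\<And>i. c x i \<in> carrier R"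
    using rep_closed by blast+
  then show ?case using insert rep_add[of "w x" "c x"] by simp
qed (simp add: rep_zero)

lemma rep_cong: "rep w c \<Longrightarrow> (\<And>i. c i = c' i) \<Longrightarrow> rep w c'"
  by (metis ext)

text \<open>Coefficients of $\sum_{k<j} \delta_{j-1-k} v_{-k}$ and of $\sum_{k<n} v_{j-1-2k}$.\<close>

definition dcoef :: "nat \<Rightarrow> int \<Rightarrow> 'a" where
  "dcoef j i = (if i \<le> 0 \<and> nat (- i) < j then \<delta> (j - 1 - nat (- i)) else \<zero>\<^bsub>R\<^esub>)"

definition pcoef :: "nat \<Rightarrow> nat \<Rightarrow> int \<Rightarrow> 'a" where
  "pcoef j n i = (if even (int j - 1 - i) \<and> 0 \<le> int j - 1 - i \<and> int j - 1 - i < 2 * int n then \<one>\<^bsub>R\<^esub> else \<zero>\<^bsub>R\<^esub>)"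

lemma rep_delta_sum:
  assumes "j \<le> r"
  shows "rep (\<Oplus>k\<in>{..<j}. \<sigma> (\<delta> (j - 1 - k)) \<otimes> v (- int k)) (dcoef j)"
proof (rule rep_cong)
  show "rep (\<Oplus>k\<in>{..<j}. \<sigma> (\<delta> (j - 1 - k)) \<otimes> v (- int k))
    (\<lambda>i. \<Oplus>\<^bsub>R\<^esub>k\<in>{..<j}. \<delta> (j - 1 - k) \<otimes>\<^bsub>R\<^esub> (if i = - int k then \<one>\<^bsub>R\<^esub> else \<zero>\<^bsub>R\<^esub>))"
    using assms by (intro rep_finsum rep_smult rep_v) auto
  fix i
  have "(\<Oplus>\<^bsub>R\<^esub>k\<in>{..<j}. \<delta> (j - 1 - k) \<otimes>\<^bsub>R\<^esub> (if i = - int k then \<one>\<^bsub>R\<^esub> else \<zero>\<^bsub>R\<^esub>))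
    = (\<Oplus>\<^bsub>R\<^esub>k\<in>{..<j}. if i = - int k then \<delta> (j - 1 - k) else \<zero>\<^bsub>R\<^esub>)"
    by (intro R.finsum_cong') auto
  also have "\<dots> = dcoef j i"
  proof (cases "i \<le> 0 \<and> nat (- i) < j")
    case True
    then have "(\<Oplus>\<^bsub>R\<^esub>k\<in>{..<j}. if i = - int k then \<delta> (j - 1 - k) else \<zero>\<^bsub>R\<^esub>) = \<delta> (j - 1 - nat (- i))"
      by (intro R.finsum_if_unique) auto
    then show ?thesis using True by (simp add: dcoef_def)
  next
    case False
    then have "(\<Oplus>\<^bsub>R\<^esub>k\<in>{..<j}. if i = - int k then \<delta> (j - 1 - k) else \<zero>\<^bsub>R\<^esub>) = \<zero>\<^bsub>R\<^esub>"
      by (intro R.finsum_if_none) auto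
    then show ?thesis by (simp only: dcoef_def False if_False)
  qed
  finally show "(\<Oplus>\<^bsub>R\<^esub>k\<in>{..<j}. \<delta> (j - 1 - k) \<otimes>\<^bsub>R\<^esub> (if i = - int k then \<one>\<^bsub>R\<^esub> else \<zero>\<^bsub>R\<^esub>)) = dcoef j i" .
qed

text \<open>The exponents run from \<open>j - 1\<close> down to \<open>j + 1 - 2 n\<close>; either
  alternative of the last assumption keeps them at least \<open>1 - r\<close>, hence in the
  window.\<close>

lemma rep_power_sum:
  assumes "j \<le> r" "n \<le> r" "n \<le> j \<or> 2 * n \<le> r"
  shows "rep (\<Oplus>k\<in>{..<n}. v (int j - 1 - 2 * int k)) (pcoef j n)"
proof (rule rep_cong)
  show "rep (\<Oplus>k\<in>{..<n}. v (int j - 1 - 2 * int k))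
    (\<lambda>i. \<Oplus>\<^bsub>R\<^esub>k\<in>{..<n}. (if i = int j - 1 - 2 * int k then \<one>\<^bsub>R\<^esub> else \<zero>\<^bsub>R\<^esub>))"
    using assms by (intro rep_finsum rep_v) auto
  fix i
  show "(\<Oplus>\<^bsub>R\<^esub>k\<in>{..<n}. if i = int j - 1 - 2 * int k then \<one>\<^bsub>R\<^esub> else \<zero>\<^bsub>R\<^esub>) = pcoef j n i"
  proof (cases "even (int j - 1 - i) \<and> 0 \<le> int j - 1 - i \<and> int j - 1 - i < 2 * int n")
    case True
    then obtain t where t: "int j - 1 - i = 2 * t" by (blast elim: evenE)
    then have "(\<Oplus>\<^bsub>R\<^esub>k\<in>{..<n}. if i = int j - 1 - 2 * int k then \<one>\<^bsub>R\<^esub> else \<zero>\<^bsub>R\<^esub>) = \<one>\<^bsub>R\<^esub>"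
      using True by (intro R.finsum_if_unique[where k="nat t"]) auto
    then show ?thesis using True by (simp add: pcoef_def)
  next
    case False
    then have "(\<Oplus>\<^bsub>R\<^esub>k\<in>{..<n}. if i = int j - 1 - 2 * int k then \<one>\<^bsub>R\<^esub> else \<zero>\<^bsub>R\<^esub>) = \<zero>\<^bsub>R\<^esub>"
      by (intro R.finsum_if_none) auto
    then show ?thesis by (simp only: pcoef_def False if_False)
  qed
qed

text \<open>The additional factor \<open>y\<close> raises all exponents by one. Those of the
  \<open>\<delta>\<close> terms become \<open>0, ..., 1 - j\<close>, and those of the remaining
  string become symmetric about 0.\<close>

lemma y_g_v: "y \<otimes> (g \<otimes> v (int j)) = \<sigma> \<rho>' \<otimes> v (1 - int j)
   \<oplus> \<sigma> z \<otimes> ((\<Oplus>k\<in>{..<j}. \<sigma> (\<delta> (j - 1 - k)) \<otimes> v (- int k)) \<ominus> (\<Oplus>k\<in>{..<j}. v (int j - 1 - 2 * int k)))"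
proof -
  let ?s = "\<lambda>k. \<sigma> (\<delta> (j - 1 - k)) \<otimes> v (- int k - 1) \<ominus> v (int j - 2 * int k - 2)"
  let ?f = "\<lambda>k. \<sigma> (\<delta> (j - 1 - k)) \<otimes> v (- int k)" and ?h = "\<lambda>k. v (int j - 1 - 2 * int k)"
  have "y \<otimes> (g \<otimes> v (int j)) = y \<otimes> (\<sigma> \<rho>' \<otimes> v (- int j)) \<oplus> y \<otimes> (\<Oplus>k\<in>{..<j}. \<sigma> z \<otimes> ?s k)"
    unfolding g_v by (rule r_distr) (auto intro!: finsum_closed)
  also have "y \<otimes> (\<sigma> \<rho>' \<otimes> v (- int j)) = \<sigma> \<rho>' \<otimes> v (1 - int j)"
    using sigma_comm[of \<rho>' y "v (- int j)"] by (simp add: y_v)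
  also have "(\<Oplus>k\<in>{..<j}. \<sigma> z \<otimes> ?s k) = \<sigma> z \<otimes> (\<Oplus>k\<in>{..<j}. ?s k)"
    by (rule finsum_rdistr[symmetric]) auto
  also have "y \<otimes> (\<sigma> z \<otimes> (\<Oplus>k\<in>{..<j}. ?s k)) = \<sigma> z \<otimes> (y \<otimes> (\<Oplus>k\<in>{..<j}. ?s k))"
    by (rule sigma_comm) (auto intro!: finsum_closed)
  also have "y \<otimes> (\<Oplus>k\<in>{..<j}. ?s k) = (\<Oplus>k\<in>{..<j}. y \<otimes> ?s k)"
    by (rule finsum_rdistr) auto
  also have "\<dots> = (\<Oplus>k\<in>{..<j}. ?f k \<oplus> \<ominus> \<one> \<otimes> ?h k)"
  proof (rule finsum_cong')
    fix k
    have i: "- int k - 1 + 1 = - int k" "int j - 2 * int k - 2 + 1 = int j - 1 - 2 * int k" by auto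
    have "y \<otimes> ?s k = y \<otimes> (\<sigma> (\<delta> (j - 1 - k)) \<otimes> v (- int k - 1)) \<oplus> \<ominus> (y \<otimes> v (int j - 2 * int k - 2))"
      by (simp add: minus_eq r_distr r_minus)
    also have "y \<otimes> (\<sigma> (\<delta> (j - 1 - k)) \<otimes> v (- int k - 1)) = \<sigma> (\<delta> (j - 1 - k)) \<otimes> (y \<otimes> v (- int k - 1))"
      by (rule sigma_comm) auto
    finally show "y \<otimes> ?s k = ?f k \<oplus> \<ominus> \<one> \<otimes> ?h k" unfolding y_v i by (simp add: l_minus)
  qed auto
  also have "\<dots> = (\<Oplus>k\<in>{..<j}. ?f k) \<oplus> (\<Oplus>k\<in>{..<j}. \<ominus> \<one> \<otimes> ?h k)"
    by (rule finsum_addf) auto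
  also have "(\<Oplus>k\<in>{..<j}. \<ominus> \<one> \<otimes> ?h k) = \<ominus> \<one> \<otimes> (\<Oplus>k\<in>{..<j}. ?h k)"
    by (rule finsum_rdistr[symmetric]) auto
  finally show ?thesis by (simp add: minus_eq l_minus finsum_closed Pi_def)
qed

lemma root_v: "(\<Oplus>j\<in>{..r}. \<sigma> (a j) \<otimes> v (i + int j)) = \<zero>"
proof -
  have "(\<Oplus>j\<in>{..r}. \<sigma> (a j) \<otimes> v (i + int j)) = (\<Oplus>j\<in>{..r}. \<sigma> (a j) \<otimes> y [^] j \<otimes> v i)"
    by (rule finsum_cong') (auto simp: m_assoc ypow_v)
  also have "\<dots> = (\<Oplus>j\<in>{..r}. \<sigma> (a j) \<otimes> y [^] j) \<otimes> v i"
    by (rule finsum_ldistr[symmetric]) auto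
  finally show ?thesis unfolding root_poly by simp
qed

lemma root_g_v: "(\<Oplus>j\<in>{..r}. \<sigma> (a j) \<otimes> (y \<otimes> (g \<otimes> v (int j)))) = \<zero>"
proof -
  have "(\<Oplus>j\<in>{..r}. \<sigma> (a j) \<otimes> (y \<otimes> (g \<otimes> v (int j)))) = (\<Oplus>j\<in>{..r}. (y \<otimes> g) \<otimes> (\<sigma> (a j) \<otimes> v (int j)))"
  proof (rule finsum_cong')
    fix j
    have "(y \<otimes> g) \<otimes> (\<sigma> (a j) \<otimes> v (int j)) = \<sigma> (a j) \<otimes> ((y \<otimes> g) \<otimes> v (int j))"
      by (rule sigma_comm) auto
    then show "\<sigma> (a j) \<otimes> (y \<otimes> (g \<otimes> v (int j))) = (y \<otimes> g) \<otimes> (\<sigma> (a j) \<otimes> v (int j))"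
      by (simp add: m_assoc)
  qed auto
  also have "\<dots> = (y \<otimes> g) \<otimes> (\<Oplus>j\<in>{..r}. \<sigma> (a j) \<otimes> v (int j))"
    by (rule finsum_rdistr[symmetric]) auto
  finally show ?thesis using root_v[of 0] by simp
qed

text \<open>The length \<open>n\<close> of the string is the same for every \<open>j\<close>; this
  is what allows the double sum to split into instances of \<open>root_v\<close>.\<close>

lemma root_power_sum:
  "(\<Oplus>j\<in>{..r}. \<sigma> (a j) \<otimes> (\<Oplus>k\<in>{..<n}. v (int j - 1 - 2 * int k))) = \<zero>"
proof (induction n)
  case 0
  have "(\<Oplus>j\<in>{..r}. \<sigma> (a j) \<otimes> (\<Oplus>k\<in>{..<0::nat}. v (int j - 1 - 2 * int k))) = (\<Oplus>j\<in>{..r}. \<zero>)"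
    by (rule finsum_cong') auto
  then show ?case by simp
next
  case (Suc n)
  let ?s = "\<lambda>j. \<Oplus>k\<in>{..<n}. v (int j - 1 - 2 * int k)"
  have s: "?s j \<in> carrier W" for j by (rule finsum_closed) auto
  have "(\<Oplus>j\<in>{..r}. \<sigma> (a j) \<otimes> (\<Oplus>k\<in>{..<Suc n}. v (int j - 1 - 2 * int k)))
     = (\<Oplus>j\<in>{..r}. \<sigma> (a j) \<otimes> v (- 1 - 2 * int n + int j) \<oplus> \<sigma> (a j) \<otimes> ?s j)"
  proof (rule finsum_cong')
    fix j
    have "(\<Oplus>k\<in>{..<Suc n}. v (int j - 1 - 2 * int k)) = v (int j - 1 - 2 * int n) \<oplus> ?s j"
      unfolding lessThan_Suc by (rule finsum_insert) auto
    moreover have "int j - 1 - 2 * int n = - 1 - 2 * int n + int j" by simp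
    ultimately show "\<sigma> (a j) \<otimes> (\<Oplus>k\<in>{..<Suc n}. v (int j - 1 - 2 * int k))
      = \<sigma> (a j) \<otimes> v (- 1 - 2 * int n + int j) \<oplus> \<sigma> (a j) \<otimes> ?s j"
      using s[of j] by (simp add: r_distr)
  qed (use s in auto)
  also have "\<dots> = (\<Oplus>j\<in>{..r}. \<sigma> (a j) \<otimes> v (- 1 - 2 * int n + int j)) \<oplus> (\<Oplus>j\<in>{..r}. \<sigma> (a j) \<otimes> ?s j)"
    using s by (intro finsum_addf) auto
  finally show ?case unfolding Suc root_v by simp
qed

definition "ind k i = (if i = k then \<one>\<^bsub>R\<^esub> else \<zero>\<^bsub>R\<^esub>)" for k i :: int

definition total_coef :: "int \<Rightarrow> 'a" where
  "total_coef i = \<rho>' \<otimes>\<^bsub>R\<^esub> ((\<Oplus>\<^bsub>R\<^esub>j\<in>{..r}. a j \<otimes>\<^bsub>R\<^esub> ind (1 - int j) i)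
        \<ominus>\<^bsub>R\<^esub> a 0 \<otimes>\<^bsub>R\<^esub> (\<Oplus>\<^bsub>R\<^esub>j\<in>{..r}. a j \<otimes>\<^bsub>R\<^esub> ind (1 - int r + int j) i))
     \<oplus>\<^bsub>R\<^esub> z \<otimes>\<^bsub>R\<^esub> (\<Oplus>\<^bsub>R\<^esub>j\<in>{..r}. a j \<otimes>\<^bsub>R\<^esub> (dcoef j i \<ominus>\<^bsub>R\<^esub> wy_corr R r j i))"

lemma coef_closed [simp]: "ind k i \<in> carrier R" "dcoef j i \<in> carrier R" "pcoef j n i \<in> carrier R"
    "wy_corr R r j i \<in> carrier R"
  by (auto simp: ind_def dcoef_def pcoef_def wy_corr_def)

lemma wy_corr_pcoef: "wy_corr R r j i = pcoef j j i \<ominus>\<^bsub>R\<^esub> pcoef j (r div 2) i"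
  by (simp only: wy_corr_def pcoef_def)

lemma rep_total: "rep \<zero> total_coef"
proof -
  let ?m = "r div 2"
  \<comment> \<open>In \<open>y g v_j\<close> the string \<open>v (j - 1 - 2 k)\<close>,
    \<open>k < j\<close>, has coefficient \<open>- z\<close>. Adding \<open>z\<close> times a string
    of the fixed length \<open>?m\<close> for every \<open>j\<close> changes the total by
    zero.\<close>
  let ?w = "\<lambda>j. y \<otimes> (g \<otimes> v (int j)) \<oplus> \<sigma> z \<otimes> (\<Oplus>k\<in>{..<?m}. v (int j - 1 - 2 * int k))"
  let ?c = "\<lambda>j i. \<rho>' \<otimes>\<^bsub>R\<^esub> ind (1 - int j) i \<oplus>\<^bsub>R\<^esub> z \<otimes>\<^bsub>R\<^esub> (dcoef j i \<ominus>\<^bsub>R\<^esub> pcoef j j i) \<oplus>\<^bsub>R\<^esub> z \<otimes>\<^bsub>R\<^esub> pcoef j ?m i"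
  have rv: "rep (v k) (ind k)" if "\<bar>k\<bar> \<le> int r + 1" for k
    using rep_v[OF that] by (simp add: ind_def[abs_def])
  have w: "rep (?w j) (?c j)" if "j \<le> r" for j
    unfolding y_g_v using that
    by (intro rep_add rep_smult rep_diff rep_delta_sum rep_power_sum rv) auto
  have wc: "?w j \<in> carrier W" for j by (auto intro!: finsum_closed)
  have 1: "(\<Oplus>j\<in>{..r}. \<sigma> (a j) \<otimes> ?w j) = \<zero>"
  proof -
    let ?s = "\<lambda>j. \<Oplus>k\<in>{..<?m}. v (int j - 1 - 2 * int k)"
    have s [simp]: "?s j \<in> carrier W" for j by (rule finsum_closed) auto
    have "(\<Oplus>j\<in>{..r}. \<sigma> (a j) \<otimes> ?w j)
      = (\<Oplus>j\<in>{..r}. \<sigma> (a j) \<otimes> (y \<otimes> (g \<otimes> v (int j))) \<oplus> \<sigma> z \<otimes> (\<sigma> (a j) \<otimes> ?s j))"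
      by (rule finsum_cong') (auto simp: r_distr sigma_comm[of z "\<sigma> _"])
    also have "\<dots> = (\<Oplus>j\<in>{..r}. \<sigma> (a j) \<otimes> (y \<otimes> (g \<otimes> v (int j)))) \<oplus> (\<Oplus>j\<in>{..r}. \<sigma> z \<otimes> (\<sigma> (a j) \<otimes> ?s j))"
      by (rule finsum_addf) auto
    also have "(\<Oplus>j\<in>{..r}. \<sigma> z \<otimes> (\<sigma> (a j) \<otimes> ?s j)) = \<sigma> z \<otimes> (\<Oplus>j\<in>{..r}. \<sigma> (a j) \<otimes> ?s j)"
      by (rule finsum_rdistr[symmetric]) auto
    finally show ?thesis unfolding root_g_v root_power_sum by simp
  qed
  \<comment> \<open>The subtracted multiple of \<open>root_v\<close> removes \<open>v 1\<close>: the
    sum of the \<open>\<rho>' a_j v (1 - j)\<close> contains it with coefficient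
    \<open>\<rho>' a_0\<close>, and \<open>a_r = 1\<close> gives the same coefficient in the
    subtracted sum.\<close>
  have "rep ((\<Oplus>j\<in>{..r}. \<sigma> (a j) \<otimes> ?w j) \<ominus> \<sigma> (\<rho>' \<otimes>\<^bsub>R\<^esub> a 0) \<otimes> (\<Oplus>j\<in>{..r}. \<sigma> (a j) \<otimes> v (1 - int r + int j)))
     (\<lambda>i. (\<Oplus>\<^bsub>R\<^esub>j\<in>{..r}. a j \<otimes>\<^bsub>R\<^esub> ?c j i)
        \<ominus>\<^bsub>R\<^esub> (\<rho>' \<otimes>\<^bsub>R\<^esub> a 0) \<otimes>\<^bsub>R\<^esub> (\<Oplus>\<^bsub>R\<^esub>j\<in>{..r}. a j \<otimes>\<^bsub>R\<^esub> ind (1 - int r + int j) i))"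
    by (intro rep_diff rep_smult rep_finsum w rv) auto
  then have "rep \<zero> (\<lambda>i. (\<Oplus>\<^bsub>R\<^esub>j\<in>{..r}. a j \<otimes>\<^bsub>R\<^esub> ?c j i)
        \<ominus>\<^bsub>R\<^esub> (\<rho>' \<otimes>\<^bsub>R\<^esub> a 0) \<otimes>\<^bsub>R\<^esub> (\<Oplus>\<^bsub>R\<^esub>j\<in>{..r}. a j \<otimes>\<^bsub>R\<^esub> ind (1 - int r + int j) i))"
    unfolding 1 root_v by (simp add: minus_eq)
  then show ?thesis
  proof (rule rep_cong)
    fix i
    let ?A2 = "\<Oplus>\<^bsub>R\<^esub>j\<in>{..r}. a j \<otimes>\<^bsub>R\<^esub> ind (1 - int r + int j) i"
    let ?A1 = "\<Oplus>\<^bsub>R\<^esub>j\<in>{..r}. a j \<otimes>\<^bsub>R\<^esub> ind (1 - int j) i"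
    let ?A3 = "\<Oplus>\<^bsub>R\<^esub>j\<in>{..r}. a j \<otimes>\<^bsub>R\<^esub> (dcoef j i \<ominus>\<^bsub>R\<^esub> wy_corr R r j i)"
    have A: "?A1 \<in> carrier R" "?A2 \<in> carrier R" "?A3 \<in> carrier R" by (auto intro!: R.finsum_closed)
    have "(\<Oplus>\<^bsub>R\<^esub>j\<in>{..r}. a j \<otimes>\<^bsub>R\<^esub> ?c j i) = (\<Oplus>\<^bsub>R\<^esub>j\<in>{..r}. \<rho>' \<otimes>\<^bsub>R\<^esub> (a j \<otimes>\<^bsub>R\<^esub> ind (1 - int j) i)
        \<oplus>\<^bsub>R\<^esub> z \<otimes>\<^bsub>R\<^esub> (a j \<otimes>\<^bsub>R\<^esub> (dcoef j i \<ominus>\<^bsub>R\<^esub> wy_corr R r j i)))"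
    proof (rule R.finsum_cong')
      fix j
      have "a' \<otimes>\<^bsub>R\<^esub> (r' \<otimes>\<^bsub>R\<^esub> b \<oplus>\<^bsub>R\<^esub> z' \<otimes>\<^bsub>R\<^esub> (d \<ominus>\<^bsub>R\<^esub> p) \<oplus>\<^bsub>R\<^esub> z' \<otimes>\<^bsub>R\<^esub> p')
        = r' \<otimes>\<^bsub>R\<^esub> (a' \<otimes>\<^bsub>R\<^esub> b) \<oplus>\<^bsub>R\<^esub> z' \<otimes>\<^bsub>R\<^esub> (a' \<otimes>\<^bsub>R\<^esub> (d \<ominus>\<^bsub>R\<^esub> (p \<ominus>\<^bsub>R\<^esub> p')))"
        if "a' \<in> carrier R" "r' \<in> carrier R" "b \<in> carrier R" "z' \<in> carrier R" "d \<in> carrier R" "p \<in> carrier R" "p' \<in> carrier R"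
        for a' r' b z' d p p' using that by algebra
      then show "a j \<otimes>\<^bsub>R\<^esub> ?c j i = \<rho>' \<otimes>\<^bsub>R\<^esub> (a j \<otimes>\<^bsub>R\<^esub> ind (1 - int j) i)
        \<oplus>\<^bsub>R\<^esub> z \<otimes>\<^bsub>R\<^esub> (a j \<otimes>\<^bsub>R\<^esub> (dcoef j i \<ominus>\<^bsub>R\<^esub> wy_corr R r j i))"
        unfolding wy_corr_pcoef by simp
    qed auto
    also have "\<dots> = (\<Oplus>\<^bsub>R\<^esub>j\<in>{..r}. \<rho>' \<otimes>\<^bsub>R\<^esub> (a j \<otimes>\<^bsub>R\<^esub> ind (1 - int j) i))
        \<oplus>\<^bsub>R\<^esub> (\<Oplus>\<^bsub>R\<^esub>j\<in>{..r}. z \<otimes>\<^bsub>R\<^esub> (a j \<otimes>\<^bsub>R\<^esub> (dcoef j i \<ominus>\<^bsub>R\<^esub> wy_corr R r j i)))"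
      by (rule R.finsum_addf) auto
    also have "(\<Oplus>\<^bsub>R\<^esub>j\<in>{..r}. \<rho>' \<otimes>\<^bsub>R\<^esub> (a j \<otimes>\<^bsub>R\<^esub> ind (1 - int j) i)) = \<rho>' \<otimes>\<^bsub>R\<^esub> ?A1"
      by (rule R.finsum_rdistr[symmetric]) auto
    also have "(\<Oplus>\<^bsub>R\<^esub>j\<in>{..r}. z \<otimes>\<^bsub>R\<^esub> (a j \<otimes>\<^bsub>R\<^esub> (dcoef j i \<ominus>\<^bsub>R\<^esub> wy_corr R r j i))) = z \<otimes>\<^bsub>R\<^esub> ?A3"
      by (rule R.finsum_rdistr[symmetric]) auto
    finally have 2: "(\<Oplus>\<^bsub>R\<^esub>j\<in>{..r}. a j \<otimes>\<^bsub>R\<^esub> ?c j i) = \<rho>' \<otimes>\<^bsub>R\<^esub> ?A1 \<oplus>\<^bsub>R\<^esub> z \<otimes>\<^bsub>R\<^esub> ?A3" .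
    have 3: "r' \<otimes>\<^bsub>R\<^esub> x1 \<oplus>\<^bsub>R\<^esub> z' \<otimes>\<^bsub>R\<^esub> x3 \<ominus>\<^bsub>R\<^esub> (r' \<otimes>\<^bsub>R\<^esub> a') \<otimes>\<^bsub>R\<^esub> x2
       = r' \<otimes>\<^bsub>R\<^esub> (x1 \<ominus>\<^bsub>R\<^esub> a' \<otimes>\<^bsub>R\<^esub> x2) \<oplus>\<^bsub>R\<^esub> z' \<otimes>\<^bsub>R\<^esub> x3"
      if "x1 \<in> carrier R" "x2 \<in> carrier R" "x3 \<in> carrier R" "r' \<in> carrier R" "z' \<in> carrier R" "a' \<in> carrier R"
      for x1 x2 x3 r' z' a' using that by algebra
    show "(\<Oplus>\<^bsub>R\<^esub>j\<in>{..r}. a j \<otimes>\<^bsub>R\<^esub> ?c j i) \<ominus>\<^bsub>R\<^esub> (\<rho>' \<otimes>\<^bsub>R\<^esub> a 0) \<otimes>\<^bsub>R\<^esub> ?A2 = total_coef i"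
      unfolding 2 total_coef_def by (rule 3) (use A in auto)
  qed
qed

lemma sum_ind_down: "(\<Oplus>\<^bsub>R\<^esub>j\<in>{..r}. a j \<otimes>\<^bsub>R\<^esub> ind (1 - int j) i)
    = (if 1 - int r \<le> i \<and> i \<le> 1 then a (nat (1 - i)) else \<zero>\<^bsub>R\<^esub>)"
proof -
  have "(\<Oplus>\<^bsub>R\<^esub>j\<in>{..r}. a j \<otimes>\<^bsub>R\<^esub> ind (1 - int j) i) = (\<Oplus>\<^bsub>R\<^esub>j\<in>{..r}. if i = 1 - int j then a j else \<zero>\<^bsub>R\<^esub>)"
    by (rule R.finsum_cong') (auto simp: ind_def)
  also have "\<dots> = (if 1 - int r \<le> i \<and> i \<le> 1 then a (nat (1 - i)) else \<zero>\<^bsub>R\<^esub>)"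
  proof (cases "1 - int r \<le> i \<and> i \<le> 1")
    case True
    show ?thesis unfolding if_P[OF True]
      by (rule R.finsum_if_unique) (use True in auto)
  next
    case False
    show ?thesis unfolding if_not_P[OF False] by (rule R.finsum_if_none) (use False in auto)
  qed
  finally show ?thesis .
qed

lemma sum_ind_up: "(\<Oplus>\<^bsub>R\<^esub>j\<in>{..r}. a j \<otimes>\<^bsub>R\<^esub> ind (1 - int r + int j) i)
    = (if 1 - int r \<le> i \<and> i \<le> 1 then a (nat (i - 1 + int r)) else \<zero>\<^bsub>R\<^esub>)"
proof -
  have "(\<Oplus>\<^bsub>R\<^esub>j\<in>{..r}. a j \<otimes>\<^bsub>R\<^esub> ind (1 - int r + int j) i) = (\<Oplus>\<^bsub>R\<^esub>j\<in>{..r}. if i = 1 - int r + int j then a j else \<zero>\<^bsub>R\<^esub>)"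
    by (rule R.finsum_cong') (auto simp: ind_def)
  also have "\<dots> = (if 1 - int r \<le> i \<and> i \<le> 1 then a (nat (i - 1 + int r)) else \<zero>\<^bsub>R\<^esub>)"
  proof (cases "1 - int r \<le> i \<and> i \<le> 1")
    case True
    show ?thesis unfolding if_P[OF True]
      by (rule R.finsum_if_unique) (use True in auto)
  next
    case False
    show ?thesis unfolding if_not_P[OF False] by (rule R.finsum_if_none) (use False in auto)
  qed
  finally show ?thesis .
qed

text \<open>Both strings start at \<open>j - 1\<close>, so they differ only beyond the end of the
  shorter one. With \<open>m = r div 2\<close>, the exponents where they differ run from
  \<open>j - 1 - 2 m\<close> down to \<open>1 - j\<close> if \<open>j > m\<close>, and from
  \<open>- 1 - j\<close> down to \<open>j + 1 - 2 m\<close> if \<open>j < m\<close>. The choice of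
  \<open>m\<close> puts both ranges inside \<open>1 - r, ..., 0\<close>.\<close>

lemma wy_corr_outside:
  assumes "j \<le> r" "i \<notin> {1 - int r..0}"
  shows "wy_corr R r j i = \<zero>\<^bsub>R\<^esub>"
proof -
  have "(even (J - 1 - i) \<and> 0 \<le> J - 1 - i \<and> J - 1 - i < 2 * J) =
    (even (J - 1 - i) \<and> 0 \<le> J - 1 - i \<and> J - 1 - i < 2 * M)"
    if "0 \<le> J" "J \<le> N" "2 * M \<le> N" "N \<le> 2 * M + 1" "i \<ge> 1 \<or> i \<le> - N" for J M N :: int
    using that by presburger
  moreover have "2 * int (r div 2) \<le> int r" "int r \<le> 2 * int (r div 2) + 1" by linarith+
  moreover have "0 \<le> int j" "int j \<le> int r" "i \<ge> 1 \<or> i \<le> - int r" using assms by auto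
  ultimately have "(even (int j - 1 - i) \<and> 0 \<le> int j - 1 - i \<and> int j - 1 - i < 2 * int j) =
    (even (int j - 1 - i) \<and> 0 \<le> int j - 1 - i \<and> int j - 1 - i < 2 * int (r div 2))"
    by blast
  then show ?thesis unfolding wy_corr_def by (simp add: R.minus_eq R.r_neg)
qed

lemma total_coef_outside:
  assumes "i \<notin> {1 - int r..0}"
  shows "total_coef i = \<zero>\<^bsub>R\<^esub>"
proof -
  have "(\<Oplus>\<^bsub>R\<^esub>j\<in>{..r}. a j \<otimes>\<^bsub>R\<^esub> (dcoef j i \<ominus>\<^bsub>R\<^esub> wy_corr R r j i)) = (\<Oplus>\<^bsub>R\<^esub>j\<in>{..r}. \<zero>\<^bsub>R\<^esub>)"
  proof (rule R.finsum_cong')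
    fix j assume j: "j \<in> {..r}"
    have "dcoef j i = \<zero>\<^bsub>R\<^esub>" unfolding dcoef_def using assms j by auto
    then show "a j \<otimes>\<^bsub>R\<^esub> (dcoef j i \<ominus>\<^bsub>R\<^esub> wy_corr R r j i) = \<zero>\<^bsub>R\<^esub>"
      using wy_corr_outside[OF _ assms, of j] j by (simp add: R.minus_eq)
  qed auto
  moreover have "a r = \<one>\<^bsub>R\<^esub>"
    unfolding a_def using R.root_coeff_top[of u "[1..<Suc r]"] by (auto simp del: upt_Suc)
  ultimately show ?thesis
    using assms unfolding total_coef_def sum_ind_down sum_ind_up
    by (cases "i = 1") (auto simp: R.minus_eq R.r_neg)
qed

lemma wy_expr_total:
  assumes "k < r"
  shows "wy_expr r R \<rho>' z \<delta> a k = total_coef (- int k)"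
proof -
  have "dcoef j (- int k) = (if k < j then \<delta> (j - 1 - k) else \<zero>\<^bsub>R\<^esub>)" for j
    by (simp add: dcoef_def)
  moreover have "nat (1 - - int k) = k + 1" "nat (- int k - 1 + int r) = r - 1 - k"
    "1 - int r \<le> - int k" using assms by auto
  ultimately show ?thesis unfolding wy_expr_def total_coef_def sum_ind_down sum_ind_up by simp
qed

text \<open>Multiplication by \<open>y^(r - 1)\<close> moves the exponents
  \<open>1 - r, ..., 0\<close> to \<open>0, ..., r - 1\<close>, where the independence
  applies.\<close>

theorem wy_relation:
  assumes indep: "\<And>c. (\<forall>i<r. c i \<in> carrier R) \<Longrightarrow>
      (\<Oplus>i\<in>{..<r}. \<sigma> (c i) \<otimes> (y [^] i \<otimes> e)) = \<zero> \<Longrightarrow> \<forall>i<r. c i = \<zero>\<^bsub>R\<^esub>"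
    and k: "k < r"
  shows "wy_expr r R \<rho>' z \<delta> a k = \<zero>\<^bsub>R\<^esub>"
proof -
  define c where "c i = total_coef (int i + 1 - int r)" for i
  have tc [simp]: "total_coef i \<in> carrier R" for i using rep_closed(2)[OF rep_total] .
  let ?f = "\<lambda>i. \<sigma> (total_coef i) \<otimes> v i"
  have "\<zero> = (\<Oplus>i\<in>{- int r - 1..int r + 1}. ?f i)"
    using rep_total unfolding rep_def lin_def by simp
  also have "\<dots> = (\<Oplus>i\<in>{1 - int r..0}. ?f i)"
    by (rule add.finprod_mono_neutral_cong_right) (auto simp: total_coef_outside)
  finally have 1: "(\<Oplus>i\<in>{1 - int r..0}. ?f i) = \<zero>" by simp
  have im: "(\<lambda>i. int i + 1 - int r) ` {..<r} = {1 - int r..0}"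
  proof -
    have "x = int (nat (x - 1 + int r)) + 1 - int r \<and> nat (x - 1 + int r) < r" if "x \<in> {1 - int r..0}" for x
      using that by auto
    then have "{1 - int r..0} \<subseteq> (\<lambda>i. int i + 1 - int r) ` {..<r}"
      by (intro subsetI) (rule image_eqI[where x="nat (_ - 1 + int r)"], auto)
    then show ?thesis by auto
  qed
  have "(\<Oplus>i\<in>{..<r}. \<sigma> (c i) \<otimes> (y [^] i \<otimes> e)) = (\<Oplus>i\<in>{..<r}. y [^] (r - 1) \<otimes> ?f (int i + 1 - int r))"
  proof (rule finsum_cong')
    fix i assume "i \<in> {..<r}"
    have "y [^] (r - 1) \<otimes> ?f (int i + 1 - int r) = \<sigma> (c i) \<otimes> (y [^] (r - 1) \<otimes> v (int i + 1 - int r))"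
      unfolding c_def by (rule sigma_comm) auto
    also have "y [^] (r - 1) \<otimes> v (int i + 1 - int r) = v (int i)" using r_pos by (simp add: ypow_v)
    finally show "\<sigma> (c i) \<otimes> (y [^] i \<otimes> e) = y [^] (r - 1) \<otimes> ?f (int i + 1 - int r)" by (simp add: v_nat)
  qed auto
  also have "\<dots> = y [^] (r - 1) \<otimes> (\<Oplus>i\<in>{..<r}. ?f (int i + 1 - int r))"
    by (rule finsum_rdistr[symmetric]) auto
  also have "(\<Oplus>i\<in>{..<r}. ?f (int i + 1 - int r)) = (\<Oplus>i\<in>{1 - int r..0}. ?f i)"
    unfolding im[symmetric] by (rule finsum_reindex[symmetric]) (auto simp: inj_on_def)
  finally have "(\<Oplus>i\<in>{..<r}. \<sigma> (c i) \<otimes> (y [^] i \<otimes> e)) = \<zero>" unfolding 1 by simp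
  then have "\<forall>i<r. c i = \<zero>\<^bsub>R\<^esub>" by (intro indep) (auto simp: c_def)
  then have "c (r - 1 - k) = \<zero>\<^bsub>R\<^esub>" using k by simp
  moreover have "int (r - 1 - k) + 1 - int r = - int k" using k by simp
  ultimately show ?thesis unfolding wy_expr_total[OF k] c_def by simp
qed

end

context W2_alg begin

lemma W2_skein:
  assumes "r \<ge> 1"
  shows "skein (W2 r S) S (W2_scalar r S) (W2_gen r S Gen_y) (W2_gen r S Gen_y_inv) (W2_gen r S Gen_g)
    (W2_gen r S Gen_g_inv) (W2_gen r S Gen_e) r (par_rho S) (inv (par_rho S)) (q_diff S)
    (par_delta S) (par_u S)"
proof -
  have gc [simp]: "free_gen S x \<in> carrier A" for x by (rule free_gen_closed)
  have cc [simp]: "c \<in> carrier S \<Longrightarrow> free_const S c \<in> carrier A" for c by (rule free_const_closed)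
  have par [simp]: "par_rho S \<in> carrier S" "inv (par_rho S) \<in> carrier S" "par_q S \<in> carrier S"
    "inv (par_q S) \<in> carrier S" "\<And>j. par_delta S j \<in> carrier S" "\<And>i. i \<in> {1..r} \<Longrightarrow> par_u S i \<in> carrier S"
    using rho_unit q_unit delta_closed u_unit by auto
  have hpow: "quot (x [^]\<^bsub>A\<^esub> n) = quot x [^]\<^bsub>W2 r S\<^esub> n" if "x \<in> carrier A" for x and n :: nat
    using that by (induction n) auto
  have hdiff: "quot (x \<ominus>\<^bsub>A\<^esub> w) = quot x \<ominus>\<^bsub>W2 r S\<^esub> quot w" if "x \<in> carrier A" "w \<in> carrier A" for x w
    using that by (simp add: A.minus_eq W.minus_eq)
  have hfold: "foldr (\<lambda>i p. (free_gen S Gen_y \<ominus>\<^bsub>A\<^esub> free_const S (par_u S i)) \<otimes>\<^bsub>A\<^esub> p) is \<one>\<^bsub>A\<^esub> \<in> carrier A \<and>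
    quot (foldr (\<lambda>i p. (free_gen S Gen_y \<ominus>\<^bsub>A\<^esub> free_const S (par_u S i)) \<otimes>\<^bsub>A\<^esub> p) is \<one>\<^bsub>A\<^esub>)
    = foldr (\<lambda>i p. (quot (free_gen S Gen_y) \<ominus>\<^bsub>W2 r S\<^esub> quot (free_const S (par_u S i))) \<otimes>\<^bsub>W2 r S\<^esub> p) is \<one>\<^bsub>W2 r S\<^esub>"
    if "set is \<subseteq> {1..r}" for "is"
    using that by (induction "is") (auto simp: hdiff)
  have "set [1..<Suc r] \<subseteq> {1..r}" by auto
  note hfold = hfold[OF this]
  define Y Y' G G' E where "Y = free_gen S Gen_y" and "Y' = free_gen S Gen_y_inv"
    and "G = free_gen S Gen_g" and "G' = free_gen S Gen_g_inv" and "E = free_gen S Gen_e"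
  note gens = Y_def Y'_def G_def G'_def E_def
  have gc' [simp]: "Y \<in> carrier A" "Y' \<in> carrier A" "G \<in> carrier A" "G' \<in> carrier A" "E \<in> carrier A"
    by (simp_all add: gens)
  have sc: "W2_scalar r S c = quot (free_const S c)" for c by (rule gen_quot)
  note rel = quot_eqI[unfolded W2_relations_def Let_def, folded gens]
  have "quot (G \<otimes>\<^bsub>A\<^esub> G') = quot \<one>\<^bsub>A\<^esub>" "quot (Y \<otimes>\<^bsub>A\<^esub> Y') = quot \<one>\<^bsub>A\<^esub>" "quot (Y' \<otimes>\<^bsub>A\<^esub> Y) = quot \<one>\<^bsub>A\<^esub>"
    "quot (Y \<otimes>\<^bsub>A\<^esub> G \<otimes>\<^bsub>A\<^esub> Y \<otimes>\<^bsub>A\<^esub> G) = quot (G \<otimes>\<^bsub>A\<^esub> Y \<otimes>\<^bsub>A\<^esub> G \<otimes>\<^bsub>A\<^esub> Y)"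
    "quot (G \<ominus>\<^bsub>A\<^esub> G') = quot (free_const S (q_diff S) \<otimes>\<^bsub>A\<^esub> (\<one>\<^bsub>A\<^esub> \<ominus>\<^bsub>A\<^esub> E))"
    "quot (G \<otimes>\<^bsub>A\<^esub> E) = quot (free_const S (inv (par_rho S)) \<otimes>\<^bsub>A\<^esub> E)"
    "quot (Y \<otimes>\<^bsub>A\<^esub> G \<otimes>\<^bsub>A\<^esub> Y \<otimes>\<^bsub>A\<^esub> E) = quot (free_const S (par_rho S) \<otimes>\<^bsub>A\<^esub> E)"
    "quot (E \<otimes>\<^bsub>A\<^esub> E) = quot (free_const S (par_delta S 0) \<otimes>\<^bsub>A\<^esub> E)"
    unfolding q_diff_def by (rule rel, simp del: upt_Suc)+
  then have rels: "quot G \<otimes>\<^bsub>W2 r S\<^esub> quot G' = \<one>\<^bsub>W2 r S\<^esub>"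
    "quot Y \<otimes>\<^bsub>W2 r S\<^esub> quot Y' = \<one>\<^bsub>W2 r S\<^esub>" "quot Y' \<otimes>\<^bsub>W2 r S\<^esub> quot Y = \<one>\<^bsub>W2 r S\<^esub>"
    "quot Y \<otimes>\<^bsub>W2 r S\<^esub> quot G \<otimes>\<^bsub>W2 r S\<^esub> quot Y \<otimes>\<^bsub>W2 r S\<^esub> quot G = quot G \<otimes>\<^bsub>W2 r S\<^esub> quot Y \<otimes>\<^bsub>W2 r S\<^esub> quot G \<otimes>\<^bsub>W2 r S\<^esub> quot Y"
    "quot G \<ominus>\<^bsub>W2 r S\<^esub> quot G' = W2_scalar r S (q_diff S) \<otimes>\<^bsub>W2 r S\<^esub> (\<one>\<^bsub>W2 r S\<^esub> \<ominus>\<^bsub>W2 r S\<^esub> quot E)"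
    "quot G \<otimes>\<^bsub>W2 r S\<^esub> quot E = W2_scalar r S (inv (par_rho S)) \<otimes>\<^bsub>W2 r S\<^esub> quot E"
    "quot Y \<otimes>\<^bsub>W2 r S\<^esub> quot G \<otimes>\<^bsub>W2 r S\<^esub> quot Y \<otimes>\<^bsub>W2 r S\<^esub> quot E = W2_scalar r S (par_rho S) \<otimes>\<^bsub>W2 r S\<^esub> quot E"
    "quot E \<otimes>\<^bsub>W2 r S\<^esub> quot E = W2_scalar r S (par_delta S 0) \<otimes>\<^bsub>W2 r S\<^esub> quot E"
    by (simp_all add: sc hdiff q_diff_def)
  have eye: "quot E \<otimes>\<^bsub>W2 r S\<^esub> quot Y [^]\<^bsub>W2 r S\<^esub> j \<otimes>\<^bsub>W2 r S\<^esub> quot E = W2_scalar r S (par_delta S j) \<otimes>\<^bsub>W2 r S\<^esub> quot E" for j :: nat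
  \<comment> \<open>The relations list this form only for \<open>j \<ge> 1\<close>; for
    \<open>j = 0\<close> it is the relation \<open>e e = \<delta>\<^sub>0 e\<close>.\<close>
  proof (cases "j = 0")
    case False
    then have "quot (E \<otimes>\<^bsub>A\<^esub> (Y [^]\<^bsub>A\<^esub> j) \<otimes>\<^bsub>A\<^esub> E) = quot (free_const S (par_delta S j) \<otimes>\<^bsub>A\<^esub> E)"
      by (intro rel UnI2) auto
    then show ?thesis by (simp add: sc hpow)
  qed (use rels(8) in simp)
  have "quot (foldr (\<lambda>i p. (Y \<ominus>\<^bsub>A\<^esub> free_const S (par_u S i)) \<otimes>\<^bsub>A\<^esub> p) [1..<Suc r] \<one>\<^bsub>A\<^esub>) = quot \<zero>\<^bsub>A\<^esub>"
    by (rule rel) (simp del: upt_Suc)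
  then have fold: "foldr (\<lambda>i p. (quot Y \<ominus>\<^bsub>W2 r S\<^esub> W2_scalar r S (par_u S i)) \<otimes>\<^bsub>W2 r S\<^esub> p) [1..<Suc r] \<one>\<^bsub>W2 r S\<^esub>
     = \<zero>\<^bsub>W2 r S\<^esub>"
    using hfold[folded gens] by (simp add: sc del: upt_Suc)
  show ?thesis
    unfolding gen_quot(1) gens[symmetric]
    by (unfold_locales; (rule assms scalar_hom scalar_central eye fold rels, assumption?)?)
       (auto simp: q_diff_def Units_r_inv[OF rho_unit])
qed

lemma admissible_wy_relation:
  assumes "r \<ge> 1" "W2_independent r S" "k < r"
  shows "wy_expr r S (inv (par_rho S)) (q_diff S) (par_delta S) (root_coeff S (par_u S) [1..<Suc r]) k = \<zero>"
proof -
  interpret skein "W2 r S" S "W2_scalar r S" "W2_gen r S Gen_y" "W2_gen r S Gen_y_inv" "W2_gen r S Gen_g"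
    "W2_gen r S Gen_g_inv" "W2_gen r S Gen_e" r "par_rho S" "inv (par_rho S)" "q_diff S" "par_delta S" "par_u S"
    by (rule W2_skein[OF assms(1)])
  show ?thesis unfolding a_def[symmetric]
    by (rule wy_relation) (use assms(2,3) in \<open>auto simp: W2_independent_def\<close>)
qed

end

section \<open>The cell representation\<close>

text \<open>The interpolation identities are taken as the defining properties of
  \<open>\<gamma>\<close>. Since \<open>\<rho>\<close> and \<open>z\<close> enter them only through
  \<open>\<rho> z\<close> and \<open>z\<^sup>2\<close>, one \<open>\<gamma>\<close> gives an
  instance for \<open>(z, \<rho>)\<close> and another for \<open>(-z, -\<rho>)\<close>.\<close>

locale cell_rep =
  fixes r :: nat and u \<gamma> :: "nat \<Rightarrow> 'f::field" and z \<rho> :: 'f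
  assumes r_pos: "r \<ge> 1" and z_nz: "z \<noteq> 0" and \<rho>_nz: "\<rho> \<noteq> 0"
    and u_nz: "i \<in> {1..r} \<Longrightarrow> u i \<noteq> 0"
    and u_inj: "inj_on u {1..r}"
    and uu_neq: "\<lbrakk>i \<in> {1..r}; j \<in> {1..r}\<rbrakk> \<Longrightarrow> u i * u j \<noteq> 1"
    and lin: "i \<in> {1..r} \<Longrightarrow> (\<Sum>j\<in>{1..r}. \<gamma> j / (u i * u j - 1)) = 1 / (z * \<rho>) + 1 / ((u i)\<^sup>2 - 1)"
    and quad: "i \<in> {1..r} \<Longrightarrow> \<gamma> i * (\<Sum>j\<in>{1..r}. \<gamma> j / (u i * u j - 1)\<^sup>2)
      = \<gamma> i * (((u i)\<^sup>2 + 1) / ((u i)\<^sup>2 - 1)\<^sup>2 - 1 / (\<rho> * z)) + 1 / z\<^sup>2 - (u i)\<^sup>2 / ((u i)\<^sup>2 - 1)\<^sup>2"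
begin

text \<open>The matrix of \<open>g\<close> solves $u_i g_{ij} u_j = g_{ij} - z (1 - e)_{ij}$, that is $y_1 g y_1 = g^{-1}$;
  the matrix \<open>K\<close> is that of $g^{-1}$.\<close>

definition G :: "nat \<Rightarrow> nat \<Rightarrow> 'f" where
  "G i j = z * (\<gamma> j - (if i = j then 1 else 0)) / (u i * u j - 1)"
definition K :: "nat \<Rightarrow> nat \<Rightarrow> 'f" where
  "K i j = G i j - z * ((if i = j then 1 else 0) - \<gamma> j)"
definition d :: "int \<Rightarrow> 'f" where
  "d a = (\<Sum>j\<in>{1..r}. \<gamma> j * u j powi a)"

lemma uG_u:
  assumes "i \<in> {1..r}" "j \<in> {1..r}" shows "u i * G i j * u j = K i j"
proof -
  have "u i * u j - 1 \<noteq> 0" using uu_neq[OF assms] by simp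
  then show ?thesis unfolding K_def G_def by (simp add: divide_simps) (simp add: algebra_simps)
qed

text \<open>Every column of the matrix of \<open>e\<close> is a multiple of the all-ones vector, so
  \<open>g e = \<rho>\<^sup>-\<^sup>1 e\<close> is this eigenvector equation. It restates
  \<open>lin\<close>.\<close>

lemma G_ones:
  assumes i: "i \<in> {1..r}" shows "(\<Sum>j\<in>{1..r}. G i j) = 1 / \<rho>"
proof -
  have "(\<Sum>j\<in>{1..r}. G i j) = (\<Sum>j\<in>{1..r}. z * (\<gamma> j / (u i * u j - 1)) - (if i = j then z / (u i * u j - 1) else 0))"
    unfolding G_def by (rule sum.cong) (auto simp: diff_divide_distrib right_diff_distrib)
  also have "\<dots> = z * (\<Sum>j\<in>{1..r}. \<gamma> j / (u i * u j - 1)) - z / (u i * u i - 1)"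
    unfolding sum_subtractf sum_distrib_left[symmetric] using i by simp
  also have "\<dots> = 1 / \<rho>" unfolding lin[OF i] using z_nz by (simp add: power2_eq_square distrib_left)
  finally show ?thesis .
qed

text \<open>\<open>g\<close> is symmetric for the form with weights \<open>\<gamma> i\<close>, which
  turns right eigenvector equations into left ones.\<close>

lemma G_sym: "\<gamma> i * G i j = \<gamma> j * G j i"
  unfolding G_def by (auto simp: mult.commute)

lemma gamma_G:
  assumes j: "j \<in> {1..r}" shows "(\<Sum>i\<in>{1..r}. \<gamma> i * G i j) = \<gamma> j / \<rho>"
  unfolding G_sym[of _ j] sum_distrib_left[symmetric] G_ones[OF j] by simp

text \<open>What remains of \<open>G_square\<close> off the diagonal after division by
  \<open>z\<^sup>2 * \<gamma> j\<close>, with \<open>a = u i\<close>, \<open>b = u j\<close> and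
  \<open>s\<close> in place of \<open>1 / (z * \<rho>)\<close>.\<close>

lemma frac_off_diag:
  fixes a b s :: 'f
  assumes "a * b \<noteq> 1" "a\<^sup>2 \<noteq> 1" "b\<^sup>2 \<noteq> 1" "a \<noteq> b"
  shows "(b * (s + 1 / (b\<^sup>2 - 1)) - a * (s + 1 / (a\<^sup>2 - 1))) / (a - b)
    - 1 / ((a\<^sup>2 - 1) * (a * b - 1)) - 1 / ((a * b - 1) * (b\<^sup>2 - 1)) - 1 / (a * b - 1) + s = 0"
proof -
  have nz: "a * b - 1 \<noteq> 0" "a\<^sup>2 - 1 \<noteq> 0" "b\<^sup>2 - 1 \<noteq> 0" "a - b \<noteq> 0" using assms by auto
  have "b / (b\<^sup>2 - 1) - a / (a\<^sup>2 - 1) = (a - b) * ((a * b + 1) / ((a\<^sup>2 - 1) * (b\<^sup>2 - 1)))"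
    using nz by (simp add: divide_simps) (simp add: algebra_simps power2_eq_square)
  then have "(b * (s + 1 / (b\<^sup>2 - 1)) - a * (s + 1 / (a\<^sup>2 - 1))) = (a - b) * ((a * b + 1) / ((a\<^sup>2 - 1) * (b\<^sup>2 - 1)) - s)"
    by (simp add: algebra_simps)
  then have 1: "(b * (s + 1 / (b\<^sup>2 - 1)) - a * (s + 1 / (a\<^sup>2 - 1))) / (a - b) = (a * b + 1) / ((a\<^sup>2 - 1) * (b\<^sup>2 - 1)) - s"
    using nz by simp
  define A B C where "A = a\<^sup>2 - 1" and "B = b\<^sup>2 - 1" and "C = a * b - 1"
  have nz': "A \<noteq> 0" "B \<noteq> 0" "C \<noteq> 0" using nz by (auto simp: A_def B_def C_def)
  have e: "(C + 2) * C = A * B + A + B" unfolding A_def B_def C_def by (simp add: algebra_simps power2_eq_square)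
  have "(C + 2) / (A * B) - 1 / (A * C) - 1 / (C * B) - 1 / C = ((C + 2) * C - B - A - A * B) / (A * B * C)"
    using nz' by (simp add: field_simps)
  also have "\<dots> = 0" unfolding e by simp
  also have "C + 2 = a * b + 1" by (simp add: C_def)
  finally have "(a * b + 1) / (A * B) - 1 / (A * C) - 1 / (C * B) - 1 / C = 0" .
  then show ?thesis unfolding 1 unfolding A_def B_def C_def by (simp add: algebra_simps)
qed

text \<open>Of the four products of the two terms in \<open>G i l\<close> and \<open>G l j\<close>,
  only the one without a Kronecker delta remains a sum over \<open>l\<close>.\<close>

lemma GG_expand:
  assumes i: "i \<in> {1..r}" and j: "j \<in> {1..r}"
  shows "(\<Sum>l\<in>{1..r}. G i l * G l j)
    = z\<^sup>2 * (\<gamma> j * (\<Sum>l\<in>{1..r}. \<gamma> l / ((u i * u l - 1) * (u j * u l - 1)))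
       - \<gamma> j / ((u i * u i - 1) * (u i * u j - 1)) - \<gamma> j / ((u i * u j - 1) * (u j * u j - 1))
       + (if i = j then 1 / (u i * u i - 1)\<^sup>2 else 0))"
proof -
  have "(\<Sum>l\<in>{1..r}. G i l * G l j) = (\<Sum>l\<in>{1..r}. z\<^sup>2 * (\<gamma> j * (\<gamma> l / ((u i * u l - 1) * (u j * u l - 1))))
     - (if i = l then z\<^sup>2 * (\<gamma> j / ((u i * u l - 1) * (u l * u j - 1))) else 0)
     - (if j = l then z\<^sup>2 * (\<gamma> j / ((u i * u l - 1) * (u l * u j - 1))) else 0)
     + (if i = l then (if j = l then z\<^sup>2 / ((u i * u l - 1) * (u l * u j - 1)) else 0) else 0))"
    unfolding G_def
    by (rule sum.cong)
       (auto simp: power2_eq_square algebra_simps diff_divide_distrib add_divide_distrib)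
  also have "\<dots> = z\<^sup>2 * (\<gamma> j * (\<Sum>l\<in>{1..r}. \<gamma> l / ((u i * u l - 1) * (u j * u l - 1))))
     - z\<^sup>2 * (\<gamma> j / ((u i * u i - 1) * (u i * u j - 1)))
     - z\<^sup>2 * (\<gamma> j / ((u i * u j - 1) * (u j * u j - 1)))
     + (if j = i then z\<^sup>2 / ((u i * u i - 1) * (u i * u j - 1)) else 0)"
    unfolding sum.distrib sum_subtractf sum_distrib_left[symmetric] using i j by simp
  finally show ?thesis by (auto simp: algebra_simps power2_eq_square)
qed

text \<open>The matrix form of \<open>g\<^sup>2 - z g + z \<rho>\<^sup>-\<^sup>1 e = 1\<close>,
  which by \<open>g e = \<rho>\<^sup>-\<^sup>1 e\<close> says \<open>g (g - z (1 - e)) = 1\<close>.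
  Off the diagonal, partial fractions reduce the sum over \<open>l\<close> to two instances of
  \<open>lin\<close>; on the diagonal the denominator is a square and \<open>quad\<close>
  enters.\<close>

lemma G_square:
  assumes i: "i \<in> {1..r}" and j: "j \<in> {1..r}"
  shows "(\<Sum>l\<in>{1..r}. G i l * G l j) - z * G i j + z * \<gamma> j / \<rho> = (if i = j then 1 else 0)"
proof (cases "i = j")
  case False
  let ?a = "u i" and ?b = "u j" and ?s = "1 / (z * \<rho>)"
  have ab: "?a \<noteq> ?b" using False u_inj i j by (auto dest: inj_onD)
  have nz: "?a * u l - 1 \<noteq> 0" "?b * u l - 1 \<noteq> 0" if "l \<in> {1..r}" for l
    using uu_neq i j that by auto
  have "(\<Sum>l\<in>{1..r}. \<gamma> l / ((?a * u l - 1) * (?b * u l - 1)))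
     = (\<Sum>l\<in>{1..r}. (?b * (\<gamma> l / (?b * u l - 1)) - ?a * (\<gamma> l / (?a * u l - 1))) / (?a - ?b))"
  proof (rule sum.cong[OF refl])
    fix l assume l: "l \<in> {1..r}"
    define A B where "A = ?a * u l - 1" and "B = ?b * u l - 1"
    have nz': "A \<noteq> 0" "B \<noteq> 0" "?a - ?b \<noteq> 0" using nz[OF l] ab by (auto simp: A_def B_def)
    have "?b * A - ?a * B = ?a - ?b" by (simp add: A_def B_def algebra_simps)
    moreover have "(?b * (\<gamma> l / B) - ?a * (\<gamma> l / A)) / (?a - ?b) = \<gamma> l * (?b * A - ?a * B) / (A * B * (?a - ?b))"
      using nz' by (simp add: field_simps)
    ultimately show "\<gamma> l / ((?a * u l - 1) * (?b * u l - 1)) = (?b * (\<gamma> l / (?b * u l - 1)) - ?a * (\<gamma> l / (?a * u l - 1))) / (?a - ?b)"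
      using nz' by (simp add: A_def B_def)
  qed
  also have "\<dots> = (?b * (?s + 1 / (?b\<^sup>2 - 1)) - ?a * (?s + 1 / (?a\<^sup>2 - 1))) / (?a - ?b)"
    unfolding sum_divide_distrib[symmetric] sum_subtractf sum_distrib_left[symmetric] lin[OF i] lin[OF j] ..
  finally have 1: "(\<Sum>l\<in>{1..r}. \<gamma> l / ((?a * u l - 1) * (?b * u l - 1))) = \<dots>" .
  define T where "T = (?b * (?s + 1 / (?b\<^sup>2 - 1)) - ?a * (?s + 1 / (?a\<^sup>2 - 1))) / (?a - ?b)"
  have "(\<Sum>l\<in>{1..r}. G i l * G l j) - z * G i j + z * \<gamma> j / \<rho>
    = z\<^sup>2 * \<gamma> j * (T - 1 / ((?a\<^sup>2 - 1) * (?a * ?b - 1)) - 1 / ((?a * ?b - 1) * (?b\<^sup>2 - 1)) - 1 / (?a * ?b - 1) + ?s)"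
    unfolding GG_expand[OF i j] 1 T_def[symmetric] using False z_nz \<rho>_nz
    by (simp add: G_def right_diff_distrib distrib_left power2_eq_square mult.assoc)
  also have "\<dots> = z\<^sup>2 * \<gamma> j * 0"
    unfolding T_def by (subst frac_off_diag) (use uu_neq i j ab in \<open>auto simp: power2_eq_square\<close>)
  finally show ?thesis using False by simp
next
  case True
  define x where "x = u i"
  have x: "x\<^sup>2 - 1 \<noteq> 0" using uu_neq[OF i i] by (simp add: x_def power2_eq_square)
  define A where "A = x\<^sup>2 - 1"
  have A: "A \<noteq> 0" "x\<^sup>2 = A + 1" using x by (auto simp: A_def)
  define B where "B = (\<Sum>l\<in>{1..r}. \<gamma> l / (u i * u l - 1)\<^sup>2)"
  have B: "\<gamma> i * B = \<gamma> i * ((A + 2) / A\<^sup>2 - 1 / (\<rho> * z)) + 1 / z\<^sup>2 - (A + 1) / A\<^sup>2"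
    using quad[OF i] unfolding B_def x_def[symmetric] A_def by simp
  have xx: "u i * u i - 1 = A" by (simp add: A_def x_def power2_eq_square)
  have "(\<Sum>l\<in>{1..r}. G i l * G l i) - z * G i i + z * \<gamma> i / \<rho>
    = z\<^sup>2 * (\<gamma> i * B - \<gamma> i / (A * A) - \<gamma> i / (A * A) + 1 / A\<^sup>2) - z * (z * (\<gamma> i - 1) / A) + z * \<gamma> i / \<rho>"
    unfolding GG_expand[OF i i] B_def unfolding G_def xx by (simp add: power2_eq_square)
  also have "\<dots> = 1"
    unfolding B using A(1) z_nz \<rho>_nz by (simp add: field_simps power2_eq_square)
  finally show ?thesis using True by simp
qed

lemma GK:
  assumes i: "i \<in> {1..r}" and j: "j \<in> {1..r}"
  shows "(\<Sum>l\<in>{1..r}. G i l * K l j) = (if i = j then 1 else 0)"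
proof -
  have "(\<Sum>l\<in>{1..r}. G i l * K l j) = (\<Sum>l\<in>{1..r}. G i l * G l j - (if l = j then z * G i l else 0) + z * \<gamma> j * G i l)"
    unfolding K_def by (rule sum.cong) (auto simp: algebra_simps)
  also have "\<dots> = (\<Sum>l\<in>{1..r}. G i l * G l j) - z * G i j + z * \<gamma> j * (1 / \<rho>)"
    unfolding sum.distrib sum_subtractf sum_distrib_left[symmetric] G_ones[OF i] using j by simp
  finally show ?thesis using G_square[OF i j] by simp
qed

lemma KG:
  assumes i: "i \<in> {1..r}" and j: "j \<in> {1..r}"
  shows "(\<Sum>l\<in>{1..r}. K i l * G l j) = (if i = j then 1 else 0)"
proof -
  have "(\<Sum>l\<in>{1..r}. K i l * G l j) = (\<Sum>l\<in>{1..r}. G i l * G l j - (if i = l then z * G l j else 0) + z * (\<gamma> l * G l j))"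
    unfolding K_def by (rule sum.cong) (auto simp: algebra_simps)
  also have "\<dots> = (\<Sum>l\<in>{1..r}. G i l * G l j) - z * G i j + z * (\<gamma> j / \<rho>)"
    unfolding sum.distrib sum_subtractf sum_distrib_left[symmetric] gamma_G[OF j] using i by simp
  finally show ?thesis using G_square[OF i j] by simp
qed

lemma K_ones:
  assumes i: "i \<in> {1..r}" shows "(\<Sum>j\<in>{1..r}. K i j) = \<rho>"
proof -
  have "(\<Sum>j\<in>{1..r}. K i j) * (1 / \<rho>) = (\<Sum>j\<in>{1..r}. K i j * (\<Sum>l\<in>{1..r}. G j l))"
    unfolding sum_distrib_right by (rule sum.cong) (simp_all add: G_ones del: One_nat_def)
  also have "\<dots> = (\<Sum>l\<in>{1..r}. \<Sum>j\<in>{1..r}. K i j * G j l)"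
    unfolding sum_distrib_left by (rule sum.swap)
  also have "\<dots> = (\<Sum>l\<in>{1..r}. if i = l then 1 else 0)"
    by (rule sum.cong) (simp_all add: KG[OF i] del: One_nat_def)
  finally show ?thesis using \<rho>_nz i by (simp add: field_simps)
qed

lemma d_0: "d 0 = (\<Sum>j\<in>{1..r}. \<gamma> j)" by (simp add: d_def)

text \<open>A row sum of \<open>K = G - z (1 - e)\<close>, computed by \<open>K_ones\<close> and by
  \<open>G_ones\<close>. The ground relation is thus a consequence of the representation.\<close>

lemma ground: "1 / \<rho> - \<rho> = z * (1 - d 0)"
proof -
  have 1: "1 \<in> {1..r}" using r_pos by simp
  have "\<rho> = (\<Sum>j\<in>{1..r}. K 1 j)" using K_ones[OF 1] ..
  also have "\<dots> = (\<Sum>j\<in>{1..r}. G 1 j - (if 1 = j then z else 0) + z * \<gamma> j)"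
    unfolding K_def by (rule sum.cong) (auto simp: algebra_simps)
  also have "\<dots> = 1 / \<rho> - z + z * d 0"
    unfolding sum.distrib sum_subtractf sum_distrib_left[symmetric] G_ones[OF 1] d_0 using 1 by simp
  finally show ?thesis by (simp add: algebra_simps)
qed

lemma gamma_K:
  assumes j: "j \<in> {1..r}" shows "(\<Sum>i\<in>{1..r}. \<gamma> i * K i j) = \<rho> * \<gamma> j"
proof -
  have "(\<Sum>i\<in>{1..r}. \<gamma> i * K i j) = (\<Sum>i\<in>{1..r}. \<gamma> i * G i j - (if i = j then z * \<gamma> i else 0) + z * \<gamma> j * \<gamma> i)"
    unfolding K_def by (rule sum.cong) (auto simp: algebra_simps)
  also have "\<dots> = \<gamma> j / \<rho> - z * \<gamma> j + z * \<gamma> j * d 0"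
    unfolding sum.distrib sum_subtractf sum_distrib_left[symmetric] gamma_G[OF j] d_0 using j by simp
  also have "\<dots> = \<gamma> j * (1 / \<rho> - z * (1 - d 0))" by (simp add: algebra_simps)
  finally show ?thesis unfolding ground[symmetric] by simp
qed

text \<open>The matrix counterpart of the formula for \<open>g v_j\<close>: \<open>u G u = K\<close>
  gives \<open>G u^(j+1) = u\<^sup>-\<^sup>1 K u^j\<close>, and \<open>K\<close> differs from
  \<open>G\<close> by a scalar matrix and a multiple of \<open>e\<close>.\<close>

lemma G_power_vec:
  assumes i: "i \<in> {1..r}"
  shows "(\<Sum>l\<in>{1..r}. G i l * u l ^ j) = u i powi (- int j) / \<rho>
    + z * (\<Sum>k\<in>{..<j}. d (int (j - 1 - k)) * u i powi (- int k - 1) - u i powi (int j - 2 * int k - 2))"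
proof (induction j)
  case 0
  then show ?case using G_ones[OF i] by simp
next
  case (Suc j)
  have ui: "u i \<noteq> 0" using u_nz[OF i] .
  have "u i * (\<Sum>l\<in>{1..r}. G i l * u l ^ Suc j) = (\<Sum>l\<in>{1..r}. K i l * u l ^ j)"
    unfolding sum_distrib_left by (rule sum.cong) (auto simp: uG_u[OF i, symmetric] mult_ac)
  also have "\<dots> = (\<Sum>l\<in>{1..r}. G i l * u l ^ j - (if i = l then z * u l ^ j else 0) + z * (\<gamma> l * u l powi (int j)))"
    unfolding K_def by (rule sum.cong) (auto simp: algebra_simps)
  also have "\<dots> = (\<Sum>l\<in>{1..r}. G i l * u l ^ j) - z * u i ^ j + z * d (int j)"
    unfolding sum.distrib sum_subtractf sum_distrib_left[symmetric] d_def using i by simp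
  finally have "(\<Sum>l\<in>{1..r}. G i l * u l ^ Suc j)
      = ((\<Sum>l\<in>{1..r}. G i l * u l ^ j) + z * (d (int j) - u i powi int j)) * u i powi (- 1)"
    using ui by (simp add: field_simps)
  also have "\<dots> = u i powi (- int j) * u i powi (- 1) / \<rho>
    + z * ((\<Sum>k\<in>{..<j}. d (int (j - 1 - k)) * (u i powi (- int k - 1) * u i powi (- 1)) - u i powi (int j - 2 * int k - 2) * u i powi (- 1))
    + (d (int j) * u i powi (- 1) - u i powi (int j) * u i powi (- 1)))"
    unfolding Suc by (simp add: algebra_simps sum_distrib_left sum_distrib_right)
  also have "\<dots> = u i powi (- int (Suc j)) / \<rho>
    + z * ((\<Sum>k\<in>{..<j}. d (int (Suc j - 1 - Suc k)) * u i powi (- int (Suc k) - 1) - u i powi (int (Suc j) - 2 * int (Suc k) - 2))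
    + (d (int (Suc j - 1 - 0)) * u i powi (- int 0 - 1) - u i powi (int (Suc j) - 2 * int 0 - 2)))"
    unfolding power_int_add[OF disjI1[OF ui], symmetric] by (simp add: algebra_simps)
  finally show ?case
    unfolding sum.lessThan_Suc_shift by (simp only: add.commute)
qed

text \<open>The recursion that defines the negative \<open>\<delta>\<close>. The row
  \<open>\<gamma>\<close> times \<open>G\<close> times the vector of the \<open>u^j\<close> is
  evaluated from the left by \<open>gamma_G\<close> and from the right by
  \<open>G_power_vec\<close>.\<close>

lemma d_neg:
  assumes "j \<ge> 1"
  shows "d (- int j) = (1 / \<rho>)\<^sup>2 * d (int j)
    + (- z) * (1 / \<rho>) * (\<Sum>k\<in>{1..int j - 1}. d k * d (k - int j) - d (2 * k - int j))"
proof -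
  have "d (int j) / \<rho> = (\<Sum>l\<in>{1..r}. (\<Sum>i\<in>{1..r}. \<gamma> i * G i l) * u l ^ j)"
    unfolding d_def by (simp add: gamma_G sum_divide_distrib del: One_nat_def)
  also have "\<dots> = (\<Sum>i\<in>{1..r}. \<gamma> i * (\<Sum>l\<in>{1..r}. G i l * u l ^ j))"
    unfolding sum_distrib_left sum_distrib_right by (subst sum.swap) (simp add: mult.assoc)
  also have "\<dots> = (\<Sum>i\<in>{1..r}. \<gamma> i * u i powi (- int j) / \<rho>
     + z * (\<Sum>k\<in>{..<j}. d (int (j - 1 - k)) * (\<gamma> i * u i powi (- int k - 1)) - \<gamma> i * u i powi (int j - 2 * int k - 2)))"
  proof (rule sum.cong[OF refl])
    fix i assume i: "i \<in> {1..r}"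
    show "\<gamma> i * (\<Sum>l\<in>{1..r}. G i l * u l ^ j) = \<gamma> i * u i powi (- int j) / \<rho>
     + z * (\<Sum>k\<in>{..<j}. d (int (j - 1 - k)) * (\<gamma> i * u i powi (- int k - 1)) - \<gamma> i * u i powi (int j - 2 * int k - 2))"
      unfolding G_power_vec[OF i] by (simp add: algebra_simps sum_distrib_left)
  qed
  also have "\<dots> = d (- int j) / \<rho> + z * (\<Sum>k\<in>{..<j}. d (int (j - 1 - k)) * d (- int k - 1) - d (int j - 2 * int k - 2))"
    unfolding d_def[of "- _ - 1"] d_def[of "_ - 2"] d_def[of "- int j"]
    unfolding sum.distrib sum_divide_distrib[symmetric] sum_distrib_left[symmetric]
    by (subst sum.swap) (simp add: sum_subtractf sum_distrib_left)
  also have "(\<Sum>k\<in>{..<j}. d (int (j - 1 - k)) * d (- int k - 1) - d (int j - 2 * int k - 2))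
    = (\<Sum>k\<in>{0..int j - 1}. d k * d (k - int j) - d (2 * k - int j))"
    by (rule sum.reindex_bij_witness[where i = "\<lambda>k. nat (int j - 1 - k)" and j = "\<lambda>k. int (j - 1 - k)"])
       (auto simp: of_nat_diff algebra_simps, metis minus_diff_commute)
  \<comment> \<open>The term \<open>k = 0\<close> contains \<open>d (- int j)\<close> itself.
    Together with the leading term it has the coefficient \<open>1 / \<rho> - z * (1 - d 0)\<close>,
    which is \<open>\<rho>\<close> by \<open>ground\<close>.\<close>
  also have "{0..int j - 1} = insert 0 {1..int j - 1}" using assms by auto
  also have "(\<Sum>k\<in>insert 0 {1..int j - 1}. d k * d (k - int j) - d (2 * k - int j))
    = (d 0 * d (- int j) - d (- int j)) + (\<Sum>k\<in>{1..int j - 1}. d k * d (k - int j) - d (2 * k - int j))"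
    by (subst sum.insert) auto
  finally have "d (int j) / \<rho> = d (- int j) * (1 / \<rho> - z * (1 - d 0))
     + z * (\<Sum>k\<in>{1..int j - 1}. d k * d (k - int j) - d (2 * k - int j))" by (simp add: algebra_simps)
  then have "d (int j) / \<rho> = d (- int j) * \<rho> + z * (\<Sum>k\<in>{1..int j - 1}. d k * d (k - int j) - d (2 * k - int j))"
    unfolding ground[symmetric] by simp
  then show ?thesis using \<rho>_nz by (simp add: field_simps power2_eq_square)
qed

end

context gamma_data begin

lemma cell_rep: "cell_rep r u \<gamma> z \<rho>"
  by unfold_locales
     (use r_pos u_inj in \<open>simp_all add: z_nz \<rho>_nz u_nz uu_neq gamma_linear[simplified] gamma_quadratic[simplified]\<close>)

lemma cell_rep_twist: "cell_rep r u \<gamma> (- z) (- \<rho>)"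
  by unfold_locales
     (use r_pos u_inj in \<open>simp_all add: z_nz \<rho>_nz u_nz uu_neq gamma_linear[simplified] gamma_quadratic[simplified]\<close>)

end

section \<open>Points with values in a field\<close>

locale field_point = cring S for S :: "('a, 'm) ring_scheme" (structure) +
  fixes \<phi> :: "'a \<Rightarrow> 'f::field"
  assumes phi_hom: "\<phi> \<in> ring_hom S ring_of_type_algebra"
begin

lemma phi_add: "x \<in> carrier S \<Longrightarrow> y \<in> carrier S \<Longrightarrow> \<phi> (x \<oplus> y) = \<phi> x + \<phi> y"
  and phi_mult: "x \<in> carrier S \<Longrightarrow> y \<in> carrier S \<Longrightarrow> \<phi> (x \<otimes> y) = \<phi> x * \<phi> y"
  and phi_one: "\<phi> \<one> = 1"
  using ring_hom_add[OF phi_hom] ring_hom_mult[OF phi_hom] ring_hom_one[OF phi_hom]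
  by (auto simp: ring_of_type_algebra_def)

lemma phi_zero: "\<phi> \<zero> = 0"
  by (metis add_cancel_right_left l_zero phi_add zero_closed)

lemma phi_neg: "x \<in> carrier S \<Longrightarrow> \<phi> (\<ominus> x) = - \<phi> x"
  using phi_add[of x "\<ominus> x"] by (simp add: r_neg phi_zero eq_neg_iff_add_eq_0 add.commute)

lemma phi_diff: "x \<in> carrier S \<Longrightarrow> y \<in> carrier S \<Longrightarrow> \<phi> (x \<ominus> y) = \<phi> x - \<phi> y"
  by (simp add: minus_eq phi_add phi_neg)

lemma phi_pow: "x \<in> carrier S \<Longrightarrow> \<phi> (x [^] (n::nat)) = \<phi> x ^ n"
  by (induction n) (simp_all add: phi_one phi_mult)

lemma phi_inv: "x \<in> Units S \<Longrightarrow> \<phi> (inv x) = inverse (\<phi> x)"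
  by (metis Units_closed Units_inv_closed Units_r_inv inverse_unique phi_mult phi_one)

lemma phi_sum: "(\<And>i. i \<in> A \<Longrightarrow> f i \<in> carrier S) \<Longrightarrow> \<phi> (\<Oplus>i\<in>A. f i) = (\<Sum>i\<in>A. \<phi> (f i))"
proof (induction A rule: infinite_finite_induct)
  case (insert x F)
  then have "f \<in> F \<rightarrow> carrier S" "f x \<in> carrier S" by auto
  then show ?case using insert by (simp add: phi_add finsum_closed)
qed (simp_all add: phi_zero finsum_infinite)

lemma phi_prod: "finite A \<Longrightarrow> (\<And>i. i \<in> A \<Longrightarrow> f i \<in> carrier S) \<Longrightarrow> \<phi> (\<Otimes>i\<in>A. f i) = (\<Prod>i\<in>A. \<phi> (f i))"
proof (induction A rule: finite_induct)
  case (insert x F)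
  then have "f \<in> F \<rightarrow> carrier S" "f x \<in> carrier S" by auto
  then show ?case using insert by (simp add: phi_mult finprod_closed)
qed (simp_all add: phi_one)

end

section \<open>Linear independence from the cell representation\<close>

text \<open>A field-valued point of the ground ring at which the cell representation exists; a ring
  may have several of them. \<open>delta0_nz\<close> provides some
  \<open>\<gamma> b \<noteq> 0\<close>, that is a nonzero column of \<open>e\<close>.\<close>

locale rep_point = W2_alg r S + field_point S \<phi> + C: cell_rep r u \<gamma> z \<rho>
  for r and S :: "('a, 'm) param_ring_scheme" (structure) and \<phi> :: "'a \<Rightarrow> 'f::field"
  and u \<gamma> :: "nat \<Rightarrow> 'f" and z \<rho> :: 'f +
  assumes phi_rho: "\<phi> (par_rho S) = \<rho>"
    and phi_q: "\<phi> (par_q S) - inverse (\<phi> (par_q S)) = z"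
    and phi_u: "\<And>i. i \<in> {1..r} \<Longrightarrow> \<phi> (par_u S i) = u i"
    and phi_delta: "\<And>j. \<phi> (par_delta S j) = (\<Sum>l\<in>{1..r}. \<gamma> l * u l ^ j)"
    and delta0_nz: "(\<Sum>l\<in>{1..r}. \<gamma> l) \<noteq> 0"
begin

fun mat :: "W2_gen \<Rightarrow> nat \<Rightarrow> nat \<Rightarrow> 'f" where
  "mat Gen_y i j = (if i = j then u i else 0)"
| "mat Gen_y_inv i j = (if i = j then 1 / u i else 0)"
| "mat Gen_g i j = C.G i j"
| "mat Gen_g_inv i j = C.K i j"
| "mat Gen_e i j = \<gamma> j"

primrec act :: "W2_gen list \<Rightarrow> nat \<Rightarrow> nat \<Rightarrow> 'f" where
  "act [] i j = (if i = j then 1 else 0)"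
| "act (x # w) i j = (\<Sum>l\<in>{1..r}. mat x i l * act w l j)"

text \<open>Matrices are functions on all pairs of indices, but products sum over
  \<open>{1..r}\<close> only; therefore the statements about products restrict the row
  index.\<close>

definition Rep :: "(W2_gen list \<Rightarrow> 'a) \<Rightarrow> nat \<Rightarrow> nat \<Rightarrow> 'f" where
  "Rep f i j = (\<Sum>w | f w \<noteq> \<zero>. \<phi> (f w) * act w i j)"

lemma act_append:
  assumes "i \<in> {1..r}"
  shows "act (v @ w) i j = (\<Sum>l\<in>{1..r}. act v i l * act w l j)"
  using assms
proof (induction v arbitrary: i)
  case Nil
  then show ?case by (simp add: if_distrib[of "\<lambda>t. t * _"] cong: if_cong)
next
  case (Cons x v)
  have "act ((x # v) @ w) i j = (\<Sum>l\<in>{1..r}. mat x i l * (\<Sum>k\<in>{1..r}. act v l k * act w k j))"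
    unfolding append_Cons act.simps by (rule sum.cong) (simp_all add: Cons.IH del: One_nat_def)
  also have "\<dots> = (\<Sum>k\<in>{1..r}. (\<Sum>l\<in>{1..r}. mat x i l * act v l k) * act w k j)"
    unfolding sum_distrib_left sum_distrib_right by (subst sum.swap) (simp add: mult.assoc)
  finally show ?case by simp
qed

lemma Rep_superset:
  assumes "finite B" "{w. f w \<noteq> \<zero>} \<subseteq> B"
  shows "Rep f i j = (\<Sum>w\<in>B. \<phi> (f w) * act w i j)"
  unfolding Rep_def by (rule sum.mono_neutral_left) (use assms in \<open>auto simp: phi_zero\<close>)

lemma Rep_add:
  assumes "f \<in> carrier A" "h \<in> carrier A"
  shows "Rep (f \<oplus>\<^bsub>A\<^esub> h) i j = Rep f i j + Rep h i j"
proof -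
  let ?B = "{w. f w \<noteq> \<zero>} \<union> {w. h w \<noteq> \<zero>}"
  have fin: "finite ?B" using assms by (simp add: free_algebra_simps)
  have "Rep (f \<oplus>\<^bsub>A\<^esub> h) i j = (\<Sum>w\<in>?B. \<phi> (f w \<oplus> h w) * act w i j)"
    using fin unfolding free_algebra_simps by (intro Rep_superset) auto
  also have "\<dots> = (\<Sum>w\<in>?B. \<phi> (f w) * act w i j) + (\<Sum>w\<in>?B. \<phi> (h w) * act w i j)"
    using assms by (simp add: free_algebra_simps phi_add distrib_right sum.distrib)
  also have "\<dots> = Rep f i j + Rep h i j"
    using Rep_superset[OF fin, of f] Rep_superset[OF fin, of h] by simp
  finally show ?thesis .
qed

lemma Rep_zero: "Rep \<zero>\<^bsub>A\<^esub> i j = 0"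
  by (simp add: Rep_def free_algebra_simps)

lemma Rep_neg: "f \<in> carrier A \<Longrightarrow> Rep (\<ominus>\<^bsub>A\<^esub> f) i j = - Rep f i j"
  using Rep_add[of f "\<ominus>\<^bsub>A\<^esub> f" i j] A.r_neg[of f] Rep_zero[of i j]
  by (simp add: eq_neg_iff_add_eq_0 add.commute)

lemma Rep_diff: "f \<in> carrier A \<Longrightarrow> h \<in> carrier A \<Longrightarrow> Rep (f \<ominus>\<^bsub>A\<^esub> h) i j = Rep f i j - Rep h i j"
  by (simp add: A.minus_eq Rep_add Rep_neg)

text \<open>A word with a cut position corresponds to the pair of its two parts, which turns the
  convolution into a double sum over the supports.\<close>

lemma Rep_mult:
  assumes f: "f \<in> carrier A" and h: "h \<in> carrier A" and i: "i \<in> {1..r}"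
  shows "Rep (f \<otimes>\<^bsub>A\<^esub> h) i j = (\<Sum>l\<in>{1..r}. Rep f i l * Rep h l j)"
proof -
  let ?U = "{w. f w \<noteq> \<zero>}" and ?V = "{w. h w \<noteq> \<zero>}"
  let ?P = "(\<lambda>(a, b). a @ b) ` (?U \<times> ?V)"
  have wf: "word_fun f" "word_fun h" and fin: "finite ?U" "finite ?V"
    using f h by (auto simp: free_algebra_simps)
  have finP: "finite ?P" using fin by blast
  have conv: "\<phi> (word_conv f h w) = (\<Sum>k\<in>{..length w}. \<phi> (f (take k w)) * \<phi> (h (drop k w)))" for w
    unfolding word_conv_def using wf by (subst phi_sum) (auto simp: phi_mult)
  have "Rep (f \<otimes>\<^bsub>A\<^esub> h) i j = (\<Sum>w\<in>?P. \<phi> (word_conv f h w) * act w i j)"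
    unfolding free_algebra_simps(2) using finP word_conv_support[OF wf] by (intro Rep_superset)
  also have "\<dots> = (\<Sum>w\<in>?P. \<Sum>k\<in>{..length w}. \<phi> (f (take k w)) * \<phi> (h (drop k w)) * act w i j)"
    unfolding conv sum_distrib_right ..
  also have "\<dots> = (\<Sum>(w, k)\<in>Sigma ?P (\<lambda>w. {..length w}). \<phi> (f (take k w)) * \<phi> (h (drop k w)) * act w i j)"
    using finP by (intro sum.Sigma) auto
  also have "\<dots> = (\<Sum>(w, k)\<in>(\<lambda>(a, b). (a @ b, length a)) ` (?U \<times> ?V). \<phi> (f (take k w)) * \<phi> (h (drop k w)) * act w i j)"
  proof (rule sum.mono_neutral_right)
    show "finite (Sigma ?P (\<lambda>w. {..length w}))" using finP by blast
    show "\<forall>p\<in>Sigma ?P (\<lambda>w. {..length w}) - (\<lambda>(a, b). (a @ b, length a)) ` (?U \<times> ?V).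
      (case p of (w, k) \<Rightarrow> \<phi> (f (take k w)) * \<phi> (h (drop k w)) * act w i j) = 0"
    proof clarify
      fix w k assume wk: "(w, k) \<notin> (\<lambda>(a, b). (a @ b, length a)) ` (?U \<times> ?V)" "k \<le> length w"
      have "f (take k w) = \<zero> \<or> h (drop k w) = \<zero>"
      proof (rule ccontr)
        assume "\<not> ?thesis"
        then have "(w, k) \<in> (\<lambda>(a, b). (a @ b, length a)) ` (?U \<times> ?V)"
          using wk(2) by (intro image_eqI[of _ _ "(take k w, drop k w)"]) auto
        then show False using wk(1) by simp
      qed
      then show "\<phi> (f (take k w)) * \<phi> (h (drop k w)) * act w i j = 0" by (auto simp: phi_zero)
    qed
  qed auto
  also have "\<dots> = (\<Sum>(a, b)\<in>?U \<times> ?V. \<phi> (f a) * \<phi> (h b) * act (a @ b) i j)"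
    by (subst sum.reindex) (auto simp: inj_on_def intro!: sum.cong)
  also have "\<dots> = (\<Sum>a\<in>?U. \<Sum>b\<in>?V. \<Sum>l\<in>{1..r}. (\<phi> (f a) * act a i l) * (\<phi> (h b) * act b l j))"
    unfolding sum.cartesian_product[symmetric] act_append[OF i] sum_distrib_left
    by (simp add: mult_ac)
  also have "\<dots> = (\<Sum>l\<in>{1..r}. Rep f i l * Rep h l j)"
    unfolding Rep_def sum_product by (subst sum.swap, subst sum.swap[of _ "{1..r}"]) (rule refl)
  finally show ?thesis .
qed

lemma Rep_const: "c \<in> carrier S \<Longrightarrow> Rep (free_const S c) i j = (if i = j then \<phi> c else 0)"
  by (subst Rep_superset[of "{[]}"]) (auto simp: free_const_def)

lemma Rep_one: "Rep \<one>\<^bsub>A\<^esub> i j = (if i = j then 1 else 0)"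
  using Rep_const[OF one_closed] by (simp add: free_algebra_simps(3) phi_one)

lemma Rep_gen: "j \<in> {1..r} \<Longrightarrow> Rep (free_gen S x) i j = mat x i j"
  by (subst Rep_superset[of "{[x]}"])
     (auto simp: free_gen_def phi_one if_distrib[of "\<lambda>t. _ * t"] cong: if_cong)

lemma Rep_y_pow:
  assumes "i \<in> {1..r}" "j \<in> {1..r}"
  shows "Rep (free_gen S Gen_y [^]\<^bsub>A\<^esub> (n::nat)) i j = (if i = j then u i ^ n else 0)"
  using assms
proof (induction n arbitrary: i j)
  case 0
  then show ?case by (simp add: Rep_one)
next
  case (Suc n)
  have "Rep (free_gen S Gen_y [^]\<^bsub>A\<^esub> Suc n) i j
      = (\<Sum>l\<in>{1..r}. Rep (free_gen S Gen_y [^]\<^bsub>A\<^esub> n) i l * Rep (free_gen S Gen_y) l j)"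
    unfolding A.nat_pow_Suc by (rule Rep_mult) (use Suc in \<open>auto intro: free_gen_closed\<close>)
  also have "\<dots> = (\<Sum>l\<in>{1..r}. if i = l then u i ^ n * (if l = j then u l else 0) else 0)"
    using Suc by (intro sum.cong) (auto simp: Rep_gen simp del: One_nat_def)
  also have "\<dots> = (if i = j then u i ^ Suc n else 0)" using Suc.prems by simp
  finally show ?case .
qed

lemma W2_relations_Rep:
  assumes ab: "(a, b) \<in> W2_relations r S" and i: "i \<in> {1..r}" and j: "j \<in> {1..r}"
  shows "Rep a i j = Rep b i j"
proof -
  let ?I = "{1..r}"
  define Y Y' G G' E where "Y = free_gen S Gen_y" and "Y' = free_gen S Gen_y_inv"
    and "G = free_gen S Gen_g" and "G' = free_gen S Gen_g_inv" and "E = free_gen S Gen_e"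
  note gens = Y_def Y'_def G_def G'_def E_def
  define \<D> :: "nat \<Rightarrow> nat \<Rightarrow> 'f" where "\<D> i j = (if i = j then 1 else 0)" for i j
  have gc [simp]: "Y \<in> carrier A" "Y' \<in> carrier A" "G \<in> carrier A" "G' \<in> carrier A" "E \<in> carrier A"
    by (simp_all add: gens free_gen_closed)
  have par: "par_rho S \<in> carrier S" "inv (par_rho S) \<in> carrier S" "par_q S \<ominus> inv (par_q S) \<in> carrier S"
    "\<And>j. par_delta S j \<in> carrier S" "\<And>i. i \<in> ?I \<Longrightarrow> par_u S i \<in> carrier S"
    using rho_unit q_unit delta_closed u_unit by auto
  have cc [simp]: "c \<in> carrier S \<Longrightarrow> free_const S c \<in> carrier A" for c by (rule free_const_closed)
  have vY: "Rep Y a b = (if a = b then u a else 0)" and vY': "Rep Y' a b = (if a = b then 1 / u a else 0)"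
    and vG: "Rep G a b = C.G a b" and vG': "Rep G' a b = C.K a b" and vE: "Rep E a b = \<gamma> b"
    if "b \<in> ?I" for a b using Rep_gen[OF that] by (simp_all add: gens)
  have mult: "Rep (f \<otimes>\<^bsub>A\<^esub> h) a b = (\<Sum>l\<in>?I. Rep f a l * Rep h l b)"
    if "f \<in> carrier A" "h \<in> carrier A" "a \<in> ?I" for f h a b using Rep_mult[OF that] .
  have diagL: "Rep (f \<otimes>\<^bsub>A\<^esub> h) a b = t a * Rep h a b"
    if "\<And>a b. b \<in> ?I \<Longrightarrow> Rep f a b = (if a = b then t a else 0)" "f \<in> carrier A" "h \<in> carrier A" "a \<in> ?I" for f h a b t
  proof -
    have "Rep (f \<otimes>\<^bsub>A\<^esub> h) a b = (\<Sum>l\<in>?I. if a = l then t a * Rep h l b else 0)"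
      unfolding mult[OF that(2-4)] by (rule sum.cong) (simp_all add: that(1) del: One_nat_def)
    then show ?thesis using that(4) by simp
  qed
  have diagR: "Rep (f \<otimes>\<^bsub>A\<^esub> Y) a b = Rep f a b * u b" if "f \<in> carrier A" "a \<in> ?I" "b \<in> ?I" for f a b
  proof -
    have "Rep (f \<otimes>\<^bsub>A\<^esub> Y) a b = (\<Sum>l\<in>?I. if l = b then Rep f a l * u b else 0)"
      unfolding mult[OF that(1) gc(1) that(2)] using that(3) by (intro sum.cong) (simp_all add: vY del: One_nat_def)
    then show ?thesis using that(3) by simp
  qed
  have YL: "Rep (Y \<otimes>\<^bsub>A\<^esub> h) a b = u a * Rep h a b" if "h \<in> carrier A" "a \<in> ?I" for h a b
    by (rule diagL) (use that vY in auto)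
  have cL: "Rep (free_const S c \<otimes>\<^bsub>A\<^esub> h) a b = \<phi> c * Rep h a b" if "h \<in> carrier A" "c \<in> carrier S" "a \<in> ?I" for h a b c
    by (rule diagL) (use that in \<open>auto simp: Rep_const\<close>)
  \<comment> \<open>With \<open>y g y = g\<^sup>-\<^sup>1\<close> the braid relation becomes the
    equality of two products that are both 1, and the relations for \<open>e y g y\<close> and
    \<open>y g y e\<close> become eigenvector equations of \<open>K\<close>.\<close>
  have YGY: "Rep (Y \<otimes>\<^bsub>A\<^esub> G \<otimes>\<^bsub>A\<^esub> Y) a b = C.K a b" if "a \<in> ?I" "b \<in> ?I" for a b
    using that by (simp add: diagR YL vG C.uG_u[symmetric] del: One_nat_def)
  have phz: "\<phi> (par_q S \<ominus> inv (par_q S)) = z"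
    unfolding phi_diff[OF Units_closed[OF q_unit] Units_inv_closed[OF q_unit]] phi_inv[OF q_unit] by (rule phi_q)
  have phr: "\<phi> (inv (par_rho S)) = 1 / \<rho>"
    unfolding phi_inv[OF rho_unit] phi_rho by (rule inverse_eq_divide)
  have K1: "Rep (Y \<otimes>\<^bsub>A\<^esub> G \<otimes>\<^bsub>A\<^esub> Y \<otimes>\<^bsub>A\<^esub> G) i j = \<D> i j"
    using i j by (simp add: mult[of "Y \<otimes>\<^bsub>A\<^esub> G \<otimes>\<^bsub>A\<^esub> Y"] YGY vG C.KG \<D>_def del: One_nat_def)
  have "G \<otimes>\<^bsub>A\<^esub> Y \<otimes>\<^bsub>A\<^esub> G \<otimes>\<^bsub>A\<^esub> Y = G \<otimes>\<^bsub>A\<^esub> (Y \<otimes>\<^bsub>A\<^esub> G \<otimes>\<^bsub>A\<^esub> Y)" by (simp add: A.m_assoc)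
  then have K2: "Rep (G \<otimes>\<^bsub>A\<^esub> Y \<otimes>\<^bsub>A\<^esub> G \<otimes>\<^bsub>A\<^esub> Y) i j = \<D> i j"
    using i j by (simp add: mult[of G] YGY vG C.GK \<D>_def del: One_nat_def)
  have "E \<otimes>\<^bsub>A\<^esub> Y \<otimes>\<^bsub>A\<^esub> G \<otimes>\<^bsub>A\<^esub> Y = E \<otimes>\<^bsub>A\<^esub> (Y \<otimes>\<^bsub>A\<^esub> G \<otimes>\<^bsub>A\<^esub> Y)" by (simp add: A.m_assoc)
  then have K3: "Rep (E \<otimes>\<^bsub>A\<^esub> Y \<otimes>\<^bsub>A\<^esub> G \<otimes>\<^bsub>A\<^esub> Y) i j = \<rho> * \<gamma> j"
    using i j by (simp add: mult[of E] YGY vE C.gamma_K del: One_nat_def)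
  have K4: "Rep (Y \<otimes>\<^bsub>A\<^esub> G \<otimes>\<^bsub>A\<^esub> Y \<otimes>\<^bsub>A\<^esub> E) i j = \<rho> * \<gamma> j"
    using i j by (simp add: mult[of "Y \<otimes>\<^bsub>A\<^esub> G \<otimes>\<^bsub>A\<^esub> Y"] YGY vE sum_distrib_right[symmetric] C.K_ones del: One_nat_def)
  have K5: "Rep (G \<otimes>\<^bsub>A\<^esub> E) i j = 1 / \<rho> * \<gamma> j"
    using i j by (simp add: mult vG vE sum_distrib_right[symmetric] C.G_ones del: One_nat_def)
  have K6: "Rep (E \<otimes>\<^bsub>A\<^esub> G) i j = 1 / \<rho> * \<gamma> j"
    using i j by (simp add: mult vG vE C.gamma_G del: One_nat_def)
  have K7: "Rep (E \<otimes>\<^bsub>A\<^esub> E) i j = \<phi> (par_delta S 0) * \<gamma> j"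
    using i j by (simp add: mult vE phi_delta sum_distrib_right[symmetric] del: One_nat_def)
  have K8: "Rep (G \<ominus>\<^bsub>A\<^esub> G') i j = z * (\<D> i j - \<gamma> j)"
    using i j by (simp add: Rep_diff vG vG' C.K_def \<D>_def del: One_nat_def)
  have K9: "Rep (E \<otimes>\<^bsub>A\<^esub> (Y [^]\<^bsub>A\<^esub> n) \<otimes>\<^bsub>A\<^esub> E) i j = \<phi> (par_delta S n) * \<gamma> j" for n :: nat
  proof -
    have "Rep (E \<otimes>\<^bsub>A\<^esub> (Y [^]\<^bsub>A\<^esub> n)) i l = \<gamma> l * u l ^ n" if l: "l \<in> ?I" for l
    proof -
      have "Rep (E \<otimes>\<^bsub>A\<^esub> (Y [^]\<^bsub>A\<^esub> n)) i l = (\<Sum>k\<in>?I. if k = l then \<gamma> k * u k ^ n else 0)"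
        using i l unfolding mult[OF gc(5) A.nat_pow_closed[OF gc(1)] i]
        by (intro sum.cong) (simp_all add: vE Y_def Rep_y_pow del: One_nat_def)
      then show ?thesis using l by simp
    qed
    then show ?thesis
      using i j by (simp add: mult[of "E \<otimes>\<^bsub>A\<^esub> (Y [^]\<^bsub>A\<^esub> n)"] vE phi_delta sum_distrib_right[symmetric] del: One_nat_def)
  qed
  have K10: "Rep (Y \<otimes>\<^bsub>A\<^esub> Y') i j = \<D> i j" "Rep (Y' \<otimes>\<^bsub>A\<^esub> Y) i j = \<D> i j"
    using i j C.u_nz[OF i] by (auto simp: YL diagR vY' \<D>_def simp del: One_nat_def)
  have K11: "Rep (G \<otimes>\<^bsub>A\<^esub> G') i j = \<D> i j" "Rep (G' \<otimes>\<^bsub>A\<^esub> G) i j = \<D> i j"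
    using i j by (simp_all add: mult vG vG' C.GK C.KG \<D>_def del: One_nat_def)
  have fold: "foldr (\<lambda>i p. (Y \<ominus>\<^bsub>A\<^esub> free_const S (par_u S i)) \<otimes>\<^bsub>A\<^esub> p) is \<one>\<^bsub>A\<^esub> \<in> carrier A \<and>
    (\<forall>a\<in>?I. Rep (foldr (\<lambda>i p. (Y \<ominus>\<^bsub>A\<^esub> free_const S (par_u S i)) \<otimes>\<^bsub>A\<^esub> p) is \<one>\<^bsub>A\<^esub>) a j
      = prod_list (map (\<lambda>k. u a - u k) is) * \<D> a j)"
    if "set is \<subseteq> ?I" for "is"
    using that
  proof (induction "is")
    case Nil
    then show ?case by (simp add: Rep_one \<D>_def)
  next
    case (Cons k "is")
    then have k: "k \<in> ?I" by simp
    have dl: "Rep (Y \<ominus>\<^bsub>A\<^esub> free_const S (par_u S k)) a b = (if a = b then u a - u k else 0)" if "b \<in> ?I" for a b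
      using that par(5)[OF k] by (simp add: Rep_diff vY Rep_const phi_u[OF k])
    have cl: "Y \<ominus>\<^bsub>A\<^esub> free_const S (par_u S k) \<in> carrier A" using par(5)[OF k] by simp
    show ?case using Cons diagL[OF dl cl] cl by (simp add: mult.assoc)
  qed
  have "set [1..<Suc r] \<subseteq> ?I" by auto
  \<comment> \<open>The polynomial relation for \<open>y\<close> acts diagonally; the entry at
    \<open>i\<close> contains the factor \<open>u i - u i\<close>.\<close>
  moreover have "prod_list (map (\<lambda>k. u i - u k) [1..<Suc r]) = 0"
    unfolding prod_list_zero_iff set_map set_upt using i by (intro image_eqI[of _ _ i]) auto
  ultimately have K12: "Rep (foldr (\<lambda>i p. (Y \<ominus>\<^bsub>A\<^esub> free_const S (par_u S i)) \<otimes>\<^bsub>A\<^esub> p) [1..<Suc r] \<one>\<^bsub>A\<^esub>) i j = 0"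
    using fold i by (metis mult_zero_left)
  have K13: "Rep (free_const S (par_q S \<ominus> inv (par_q S)) \<otimes>\<^bsub>A\<^esub> (\<one>\<^bsub>A\<^esub> \<ominus>\<^bsub>A\<^esub> E)) i j = z * (\<D> i j - \<gamma> j)"
    using i j par by (simp add: cL phz Rep_diff Rep_one vE \<D>_def del: One_nat_def)
  have K14: "Rep (free_const S c \<otimes>\<^bsub>A\<^esub> E) i j = \<phi> c * \<gamma> j" if "c \<in> carrier S" for c
    using i j that by (simp add: cL vE del: One_nat_def)
  have D1: "Rep \<one>\<^bsub>A\<^esub> i j = \<D> i j" by (simp add: Rep_one \<D>_def)
  show ?thesis
    using ab unfolding W2_relations_def Let_def gens[symmetric]
    by (auto simp: K1 K2 K3 K4 K5 K6 K7 K8 K9 K10 K11 K12 K13 K14 D1 Rep_zero phi_rho phr par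
        simp del: One_nat_def upt_Suc)
qed

text \<open>The elements with zero matrix form an ideal of the free algebra that contains all
  differences of relations, so the representation descends to \<open>W2\<close>.\<close>

lemma W2_ideal_Rep:
  assumes "f \<in> W2_ideal r S" "i \<in> {1..r}" "j \<in> {1..r}"
  shows "Rep f i j = 0"
proof -
  define J where "J = {f \<in> carrier A. \<forall>i\<in>{1..r}. \<forall>j\<in>{1..r}. Rep f i j = 0}"
  have "ideal J A"
  proof (rule idealI[OF A.ring_axioms])
    show "subgroup J (add_monoid A)"
      by (rule A.add.subgroupI) (auto simp: J_def Rep_add Rep_neg Rep_zero simp flip: a_inv_def)
  qed (auto simp: J_def Rep_mult simp del: One_nat_def)
  moreover have "{a \<ominus>\<^bsub>A\<^esub> b | a b. (a, b) \<in> W2_relations r S} \<subseteq> J"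
    using W2_relations_closed W2_relations_Rep unfolding J_def by (auto simp: Rep_diff simp del: One_nat_def)
  ultimately have "W2_ideal r S \<subseteq> J"
    unfolding W2_ideal_def by (rule A.genideal_minimal)
  then show ?thesis using assms unfolding J_def by blast
qed

text \<open>Column \<open>b\<close> of the matrix of the linear combination has the entries
  \<open>\<gamma> b\<close> times the value at \<open>u a\<close> of the polynomial with
  coefficients \<open>\<phi> (c i)\<close>. For \<open>\<gamma> b \<noteq> 0\<close> this polynomial
  of degree below \<open>r\<close> has the \<open>r\<close> distinct roots
  \<open>u a\<close>.\<close>

lemma independent_point:
  assumes c: "\<And>i. i < r \<Longrightarrow> c i \<in> carrier S"
    and zero: "(\<Oplus>\<^bsub>W2 r S\<^esub>i\<in>{..<r}. W2_scalar r S (c i) \<otimes>\<^bsub>W2 r S\<^esub>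
            (W2_gen r S Gen_y [^]\<^bsub>W2 r S\<^esub> (i::nat) \<otimes>\<^bsub>W2 r S\<^esub> W2_gen r S Gen_e)) = \<zero>\<^bsub>W2 r S\<^esub>"
    and i: "i < r"
  shows "\<phi> (c i) = 0"
proof -
  let ?t = "\<lambda>i. free_const S (c i) \<otimes>\<^bsub>A\<^esub> (free_gen S Gen_y [^]\<^bsub>A\<^esub> i \<otimes>\<^bsub>A\<^esub> free_gen S Gen_e)"
  have gc [simp]: "free_gen S x \<in> carrier A" for x by (rule free_gen_closed)
  have cc [simp]: "i < r \<Longrightarrow> free_const S (c i) \<in> carrier A" for i using c by (intro free_const_closed)
  have hpow: "quot (x [^]\<^bsub>A\<^esub> n) = quot x [^]\<^bsub>W2 r S\<^esub> n" if "x \<in> carrier A" for x and n :: nat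
    using that by (induction n) auto
  have t: "?t \<in> {..<n} \<rightarrow> carrier A" if "n \<le> r" for n using that by auto
  have sum: "quot (\<Oplus>\<^bsub>A\<^esub>i\<in>{..<n}. ?t i) = (\<Oplus>\<^bsub>W2 r S\<^esub>i\<in>{..<n}. quot (?t i)) \<and>
     (\<forall>a b. Rep (\<Oplus>\<^bsub>A\<^esub>i\<in>{..<n}. ?t i) a b = (\<Sum>i<n. Rep (?t i) a b))" if "n \<le> r" for n
    using that
  proof (induction n)
    case 0
    then show ?case by (simp add: Rep_zero)
  next
    case (Suc n)
    have cl: "(\<Oplus>\<^bsub>A\<^esub>i\<in>{..<n}. ?t i) \<in> carrier A" using t[of n] Suc.prems by (intro A.finsum_closed) auto
    have "(\<Oplus>\<^bsub>A\<^esub>i\<in>{..<Suc n}. ?t i) = ?t n \<oplus>\<^bsub>A\<^esub> (\<Oplus>\<^bsub>A\<^esub>i\<in>{..<n}. ?t i)"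
      unfolding lessThan_Suc by (rule A.finsum_insert) (use Suc.prems in auto)
    moreover have "(\<Oplus>\<^bsub>W2 r S\<^esub>i\<in>{..<Suc n}. quot (?t i)) = quot (?t n) \<oplus>\<^bsub>W2 r S\<^esub> (\<Oplus>\<^bsub>W2 r S\<^esub>i\<in>{..<n}. quot (?t i))"
      unfolding lessThan_Suc by (rule W.finsum_insert) (use Suc.prems in auto)
    moreover have "?t n \<in> carrier A" using Suc.prems by auto
    ultimately show ?case using Suc cl by (simp add: Rep_add add.commute)
  qed
  have "(\<Oplus>\<^bsub>W2 r S\<^esub>i\<in>{..<r}. quot (?t i)) = (\<Oplus>\<^bsub>W2 r S\<^esub>i\<in>{..<r}. W2_scalar r S (c i) \<otimes>\<^bsub>W2 r S\<^esub>
            (W2_gen r S Gen_y [^]\<^bsub>W2 r S\<^esub> (i::nat) \<otimes>\<^bsub>W2 r S\<^esub> W2_gen r S Gen_e))"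
    by (rule W.finsum_cong') (auto simp: gen_quot hpow)
  then have "quot (\<Oplus>\<^bsub>A\<^esub>i\<in>{..<r}. ?t i) = \<zero>\<^bsub>W2 r S\<^esub>" using zero sum[of r] by simp
  moreover have cl: "(\<Oplus>\<^bsub>A\<^esub>i\<in>{..<r}. ?t i) \<in> carrier A" using t[of r] by (intro A.finsum_closed) auto
  ultimately have "(\<Oplus>\<^bsub>A\<^esub>i\<in>{..<r}. ?t i) \<in> W2_ideal r S"
    using I.rcos_const_imp_mem[of "\<Oplus>\<^bsub>A\<^esub>i\<in>{..<r}. ?t i"] unfolding quot_def W2_def FactRing_def by auto
  note mem = this
  have R0: "(\<Sum>i<r. Rep (?t i) a b) = 0" if "a \<in> {1..r}" "b \<in> {1..r}" for a b
  proof -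
    have "Rep (\<Oplus>\<^bsub>A\<^esub>i\<in>{..<r}. ?t i) a b = (\<Sum>i<r. Rep (?t i) a b)" using sum[of r] by blast
    then show ?thesis using W2_ideal_Rep[OF mem that] by metis
  qed
  obtain b where b: "b \<in> {1..r}" "\<gamma> b \<noteq> 0" using delta0_nz by (rule sum.not_neutral_contains_not_neutral)
  define p where "p = (\<Sum>i<r. Polynomial.monom (\<phi> (c i)) i)"
  have roots: "poly p (u a) = 0" if a: "a \<in> {1..r}" for a
  proof -
    have "Rep (?t i) a b = \<phi> (c i) * u a ^ i * \<gamma> b" if "i < r" for i
    proof -
      have "Rep (?t i) a b = (\<Sum>l\<in>{1..r}. Rep (free_const S (c i)) a l *
          (\<Sum>k\<in>{1..r}. Rep (free_gen S Gen_y [^]\<^bsub>A\<^esub> i) l k * Rep (free_gen S Gen_e) k b))"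
        using that a by (simp add: Rep_mult del: One_nat_def)
      also have "\<dots> = (\<Sum>l\<in>{1..r}. if a = l then \<phi> (c i) * (u l ^ i * \<gamma> b) else 0)"
      proof (rule sum.cong[OF refl])
        fix l assume l: "l \<in> {1..r}"
        have "(\<Sum>k\<in>{1..r}. Rep (free_gen S Gen_y [^]\<^bsub>A\<^esub> i) l k * Rep (free_gen S Gen_e) k b)
           = (\<Sum>k\<in>{1..r}. if l = k then u l ^ i * \<gamma> b else 0)"
          using l b by (intro sum.cong refl) (simp add: Rep_y_pow Rep_gen del: One_nat_def)
        then show "Rep (free_const S (c i)) a l * (\<Sum>k\<in>{1..r}. Rep (free_gen S Gen_y [^]\<^bsub>A\<^esub> i) l k * Rep (free_gen S Gen_e) k b)
          = (if a = l then \<phi> (c i) * (u l ^ i * \<gamma> b) else 0)"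
          using l c[OF that] by (simp add: Rep_const)
      qed
      also have "\<dots> = \<phi> (c i) * u a ^ i * \<gamma> b" using a by simp
      finally show ?thesis .
    qed
    then have "(\<Sum>i<r. \<phi> (c i) * u a ^ i) * \<gamma> b = 0"
      using R0[OF a b(1)] by (simp add: sum_distrib_right)
    then show ?thesis using b(2) by (simp add: p_def poly_sum poly_monom)
  qed
  have "p = 0"
  proof (rule poly_eqI_degree[of "u ` {1..r}"])
    have "Polynomial.degree p \<le> r - 1" unfolding p_def by (rule degree_sum_le) (auto intro: order_trans[OF Polynomial.degree_monom_le])
    then show "Polynomial.degree p < card (u ` {1..r})" using C.r_pos C.u_inj by (simp add: card_image)
  qed (use roots C.r_pos C.u_inj in \<open>auto simp: card_image\<close>)
  then have "poly.coeff p i = 0" by simp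
  then show ?thesis using i by (simp add: p_def coeff_sum)
qed

end

section \<open>Weak admissibility from points\<close>

lemma prod_diff_elem_sym:
  fixes x :: "'f::comm_ring_1" and u :: "nat \<Rightarrow> 'f"
  shows "(\<Prod>l\<in>{1..r}. x - u l)
     = (\<Sum>k\<in>{0..r}. (- 1) ^ (r - k) * (\<Sum>A | A \<subseteq> {1..r} \<and> card A = r - k. \<Prod>j\<in>A. u j) * x ^ k)"
proof -
  let ?I = "{1..r}"
  let ?f = "\<lambda>A. (- 1) ^ card A * (\<Prod>j\<in>A. u j) * x ^ (r - card A)"
  have "(\<Prod>l\<in>?I. x - u l) = (\<Prod>l\<in>?I. - u l + x)" by simp
  also have "\<dots> = (\<Sum>A\<in>Pow ?I. (\<Prod>l\<in>A. - u l) * (\<Prod>l\<in>?I - A. x))"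
    by (rule prod_add) simp
  also have "\<dots> = (\<Sum>A\<in>Pow ?I. ?f A)"
  proof (rule sum.cong[OF refl])
    fix A assume "A \<in> Pow ?I"
    then have "finite A" "card (?I - A) = r - card A" by (auto intro: finite_subset simp: card_Diff_subset finite_subset)
    moreover have "(\<Prod>l\<in>A. - u l) = (\<Prod>l\<in>A. (- 1) * u l)" by simp
    ultimately show "(\<Prod>l\<in>A. - u l) * (\<Prod>l\<in>?I - A. x) = ?f A"
      by (simp only: prod.distrib prod_constant)
  qed
  also have "\<dots> = (\<Sum>k\<in>{0..r}. \<Sum>A\<in>{A \<in> Pow ?I. r - card A = k}. ?f A)"
    by (rule sum.group[symmetric]) auto
  also have "\<dots> = (\<Sum>k\<in>{0..r}. (- 1) ^ (r - k) * (\<Sum>A | A \<subseteq> ?I \<and> card A = r - k. \<Prod>j\<in>A. u j) * x ^ k)"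
  proof (rule sum.cong[OF refl])
    fix k assume k: "k \<in> {0..r}"
    have le: "card A \<le> r" if "A \<subseteq> ?I" for A using card_mono[OF _ that] by simp
    have "{A \<in> Pow ?I. r - card A = k} = {A. A \<subseteq> ?I \<and> card A = r - k}"
      using k le by (auto simp: le_imp_diff_is_add)
    moreover have "(\<Sum>A | A \<subseteq> ?I \<and> card A = r - k. ?f A)
       = (\<Sum>A | A \<subseteq> ?I \<and> card A = r - k. (- 1) ^ (r - k) * (\<Prod>j\<in>A. u j) * x ^ k)"
      using k by (intro sum.cong) auto
    ultimately show "(\<Sum>A\<in>{A \<in> Pow ?I. r - card A = k}. ?f A)
       = (- 1) ^ (r - k) * (\<Sum>A | A \<subseteq> ?I \<and> card A = r - k. \<Prod>j\<in>A. u j) * x ^ k"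
      by (simp only: sum_distrib_left sum_distrib_right)
  qed
  finally show ?thesis .
qed

context ground_ring begin

lemma q_diff_closed: "q_diff S \<in> carrier S"
  unfolding q_diff_def using q_unit by auto

lemma deltaZ_closed: "deltaZ S a \<in> carrier S"
proof (induction "nat (- a)" arbitrary: a rule: less_induct)
  case less
  have cl [simp]: "par_delta S j \<in> carrier S" "inv (par_rho S) \<in> carrier S" "par_q S \<in> carrier S" "inv (par_q S) \<in> carrier S" for j
    using delta_closed rho_unit q_unit by auto
  have "deltaZ S (k + a) \<in> carrier S" "deltaZ S (2 * k + a) \<in> carrier S" if "k \<in> {1..- a - 1}" for k
    using that by (auto intro!: less)
  then show ?case
    by (subst deltaZ.simps) (auto intro!: finsum_closed)
qed

lemma u_closed: "i \<in> {1..r} \<Longrightarrow> par_u S i \<in> carrier S"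
  using u_unit by blast

lemma elem_sym_closed: "elem_sym S r (par_u S) i \<in> carrier S"
  unfolding elem_sym_def by (intro finsum_closed finprod_closed Pi_I u_closed) blast

end

context rep_point begin

text \<open>Both families obey the same recursion, \<open>deltaZ\<close> by definition and
  \<open>C.d\<close> by \<open>d_neg\<close>.\<close>

lemma phi_deltaZ: "\<phi> (deltaZ S a) = C.d a"
proof (induction "nat (- a)" arbitrary: a rule: less_induct)
  case less
  show ?case
  proof (cases "a \<ge> 0")
    case True
    then show ?thesis
      by (subst deltaZ.simps) (simp add: phi_delta C.d_def power_int_def)
  next
    case False
    have cl [simp]: "par_delta S j \<in> carrier S" "inv (par_rho S) \<in> carrier S" "par_q S \<in> carrier S" "inv (par_q S) \<in> carrier S" for j
      using delta_closed rho_unit q_unit by auto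
    have a: "a = - int (nat (- a))" using False by simp
    have dn: "\<phi> (par_delta S (nat k)) = C.d k" if "k \<ge> 0" for k
      using that by (simp add: phi_delta C.d_def power_int_def)
    have ih: "\<phi> (deltaZ S (k + a)) = C.d (k + a)" "\<phi> (deltaZ S (2 * k + a)) = C.d (2 * k + a)"
      if "k \<in> {1..- a - 1}" for k
      using that False by (auto intro!: less)
    have sum: "\<phi> (\<Oplus>k\<in>{1..- a - 1}. (par_delta S (nat k) \<otimes> deltaZ S (k + a)) \<ominus> deltaZ S (2 * k + a))
      = (\<Sum>k\<in>{1..- a - 1}. C.d k * C.d (k + a) - C.d (2 * k + a))"
      by (subst phi_sum) (auto simp: deltaZ_closed phi_diff phi_mult ih dn intro!: sum.cong)
    have cls: "(\<Oplus>k\<in>{1..- a - 1}. (par_delta S (nat k) \<otimes> deltaZ S (k + a)) \<ominus> deltaZ S (2 * k + a)) \<in> carrier S"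
      by (auto intro!: finsum_closed simp: deltaZ_closed)
    have qd: "\<phi> (inv (par_q S) \<ominus> par_q S) = - z"
      using phi_q by (simp add: phi_diff phi_inv[OF q_unit] algebra_simps)
    have ri: "\<phi> (inv (par_rho S)) = 1 / \<rho>"
      unfolding phi_inv[OF rho_unit] phi_rho by (rule inverse_eq_divide)
    have "\<phi> (deltaZ S a) = (1 / \<rho>)\<^sup>2 * C.d (- a)
      + (- z) * (1 / \<rho>) * (\<Sum>k\<in>{1..- a - 1}. C.d k * C.d (k + a) - C.d (2 * k + a))"
      using False cls
      by (subst deltaZ.simps) (simp add: phi_add phi_mult phi_pow qd ri sum dn)
    also have "\<dots> = C.d (- int (nat (- a)))"
      using C.d_neg[of "nat (- a)"] False by simp
    finally show ?thesis using False by simp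
  qed
qed

lemma phi_elem_sym:
  "\<phi> (elem_sym S r (par_u S) i) = (\<Sum>A | A \<subseteq> {1..r} \<and> card A = i. \<Prod>j\<in>A. u j)"
proof -
  have "\<phi> (elem_sym S r (par_u S) i) = (\<Sum>A | A \<subseteq> {1..r} \<and> card A = i. \<phi> (\<Otimes>j\<in>A. par_u S j))"
    unfolding elem_sym_def by (intro phi_sum finprod_closed Pi_I u_closed) blast
  also have "\<dots> = (\<Sum>A | A \<subseteq> {1..r} \<and> card A = i. \<Prod>j\<in>A. u j)"
  proof (rule sum.cong[OF refl], safe)
    fix A assume A: "A \<subseteq> {1..r}"
    then have "finite A" "\<And>j. j \<in> A \<Longrightarrow> par_u S j \<in> carrier S"
      by (auto intro: finite_subset intro!: u_closed)
    then have "\<phi> (\<Otimes>j\<in>A. par_u S j) = (\<Prod>j\<in>A. \<phi> (par_u S j))" by (intro phi_prod)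
    also have "\<dots> = (\<Prod>j\<in>A. u j)" using A by (intro prod.cong phi_u) auto
    finally show "\<phi> (\<Otimes>j\<in>A. par_u S j) = (\<Prod>j\<in>A. u j)" .
  qed
  finally show ?thesis .
qed

text \<open>After exchanging the sums, each \<open>\<gamma> j * u j powi a\<close> is multiplied by
  the value at \<open>u j\<close> of the polynomial with the roots \<open>u l\<close>.\<close>

lemma phi_weak:
  "\<phi> (\<Oplus>k\<in>{0..r}. (\<ominus> \<one>) [^] (r - k) \<otimes> elem_sym S r (par_u S) (r - k) \<otimes> deltaZ S (int k + a)) = 0"
proof -
  let ?e = "\<lambda>i. (\<Sum>A | A \<subseteq> {1..r} \<and> card A = i. \<Prod>j\<in>A. u j)"
  have "\<phi> (\<Oplus>k\<in>{0..r}. (\<ominus> \<one>) [^] (r - k) \<otimes> elem_sym S r (par_u S) (r - k) \<otimes> deltaZ S (int k + a))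
     = (\<Sum>k\<in>{0..r}. (- 1) ^ (r - k) * ?e (r - k) * C.d (int k + a))"
    by (subst phi_sum)
       (auto intro!: sum.cong simp: deltaZ_closed elem_sym_closed phi_mult phi_pow phi_neg phi_one phi_deltaZ phi_elem_sym)
  also have "\<dots> = (\<Sum>k\<in>{0..r}. \<Sum>j\<in>{1..r}. \<gamma> j * u j powi a * ((- 1) ^ (r - k) * ?e (r - k) * u j ^ k))"
  proof (rule sum.cong[OF refl])
    fix k
    have "C.d (int k + a) = (\<Sum>j\<in>{1..r}. \<gamma> j * u j powi a * u j ^ k)"
      unfolding C.d_def by (rule sum.cong) (auto simp: power_int_add C.u_nz)
    moreover have "c * (\<Sum>j\<in>{1..r}. \<gamma> j * u j powi a * u j ^ k) = (\<Sum>j\<in>{1..r}. \<gamma> j * u j powi a * (c * u j ^ k))" for c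
      by (simp add: sum_distrib_left mult_ac)
    ultimately show "(- 1) ^ (r - k) * ?e (r - k) * C.d (int k + a) = (\<Sum>j\<in>{1..r}. \<gamma> j * u j powi a * ((- 1) ^ (r - k) * ?e (r - k) * u j ^ k))"
      by (simp only:)
  qed
  also have "\<dots> = (\<Sum>j\<in>{1..r}. \<gamma> j * u j powi a * (\<Prod>l\<in>{1..r}. u j - u l))"
    unfolding prod_diff_elem_sym sum_distrib_left by (rule sum.swap)
  also have "\<dots> = 0"
  proof (rule sum.neutral, safe)
    fix j assume "j \<in> {1..r}"
    then have "(\<Prod>l\<in>{1..r}. u j - u l) = 0" by auto
    then show "\<gamma> j * u j powi a * (\<Prod>l\<in>{1..r}. u j - u l) = 0" by simp
  qed
  finally show ?thesis .
qed

end

section \<open>Rational functions\<close>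

definition of_mpoly :: "int_mpoly \<Rightarrow> ratfun" where "of_mpoly P = Fract P 1"

definition mono :: "(nat \<Rightarrow>\<^sub>0 nat) \<Rightarrow> ratfun" where "mono m = of_mpoly (Poly_Mapping.single m 1)"

lemma of_mpoly_add: "of_mpoly (P + Q) = of_mpoly P + of_mpoly Q"
  and of_mpoly_mult: "of_mpoly (P * Q) = of_mpoly P * of_mpoly Q"
  and of_mpoly_1: "of_mpoly 1 = 1" and of_mpoly_0: "of_mpoly 0 = 0"
  and of_mpoly_neg: "of_mpoly (- P) = - of_mpoly P"
  by (simp_all add: of_mpoly_def One_fract_def Zero_fract_def)

lemma of_mpoly_eq_iff: "of_mpoly P = of_mpoly Q \<longleftrightarrow> P = Q"
  by (simp add: of_mpoly_def eq_fract)

lemma mono_mult: "mono m * mono n = mono (m + n)"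
  by (simp add: mono_def of_mpoly_mult[symmetric] mult_single)

lemma mono_0: "mono 0 = 1"
  by (simp add: mono_def of_mpoly_1[symmetric] single_one)

lemma mono_eq_iff: "mono m = mono n \<longleftrightarrow> m = n"
  unfolding mono_def of_mpoly_eq_iff by (metis lookup_single_eq lookup_single_not_eq zero_neq_one)

text \<open>Together with \<open>mono_eq_iff\<close> this separates monomials up to sign, which
  settles the inequations needed between products of indeterminates.\<close>

lemma mono_neq_uminus: "mono m \<noteq> - mono n"
proof
  assume "mono m = - mono n"
  then have "Poly_Mapping.single m 1 = - (Poly_Mapping.single n 1 :: int_mpoly)"
    unfolding mono_def of_mpoly_neg[symmetric] of_mpoly_eq_iff .
  then have "Poly_Mapping.lookup (Poly_Mapping.single m 1 :: int_mpoly) m = - Poly_Mapping.lookup (Poly_Mapping.single n 1 :: int_mpoly) m"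
    by simp
  then show False by (cases "m = n") (auto simp: lookup_single)
qed

lemma mono_nz: "mono m \<noteq> 0"
  by (metis mono_eq_iff mono_mult mono_neq_uminus mult_zero_left neg_0_equal_iff_equal)

lemma indet_mono: "indet i = mono (Poly_Mapping.single i 1)"
  by (simp add: indet_def mono_def of_mpoly_def)

lemma prod_mono: "finite A \<Longrightarrow> (\<Prod>i\<in>A. mono (f i)) = mono (\<Sum>i\<in>A. f i)"
  by (induction A rule: finite_induct) (simp_all add: mono_0 mono_mult)

lemma prod_indet: "(\<Prod>j\<in>{1..r}. indet j) = mono (\<Sum>j\<in>{1..r}. Poly_Mapping.single j 1)"
  unfolding indet_mono by (rule prod_mono) simp

lemma lookup_sum_single:
  "Poly_Mapping.lookup (\<Sum>j\<in>{1..r::nat}. Poly_Mapping.single j (1::nat)) i = (if i \<in> {1..r} then 1 else 0)"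
  by (simp add: lookup_sum lookup_single when_def)

lemma gamma_data_indet:
  assumes "r \<ge> 1" shows "gamma_data r indet (indet 0)"
proof unfold_locales
  show "1 \<le> r" by (rule assms)
  show "(1::ratfun) \<noteq> - 1" using mono_neq_uminus[of 0 0] by (simp add: mono_0)
  show "indet 0 \<noteq> 0" "\<And>i. indet i \<noteq> 0" by (simp_all add: indet_mono mono_nz)
  have s: "Poly_Mapping.single i (1::nat) + Poly_Mapping.single j 1 \<noteq> 0" for i j :: nat
  proof
    assume "Poly_Mapping.single i (1::nat) + Poly_Mapping.single j 1 = 0"
    then have "Poly_Mapping.lookup (Poly_Mapping.single i (1::nat) + Poly_Mapping.single j 1) i = 0" by simp
    then show False by (simp add: lookup_add)
  qed
  then have "indet i * indet j \<noteq> 1" for i j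
    unfolding indet_mono mono_mult mono_0[symmetric] mono_eq_iff .
  then show "indet 0 * indet 0 \<noteq> 1" "\<And>i j. indet i * indet j \<noteq> 1" by auto
  show "inj_on indet {1..r}"
    by (rule inj_onI) (metis indet_mono mono_eq_iff lookup_single_eq lookup_single_not_eq zero_neq_one)
qed

locale universal_data = fixes r :: nat assumes r_ge: "r \<ge> 1"
begin

sublocale gamma_data r indet "indet 0" by (rule gamma_data_indet[OF r_ge])

lemma rho_bar: "rho_bar r = \<rho>"
  by (simp add: rho_bar_def \<rho>_def p_def Let_def)

lemma gamma_bar: "gamma_bar r j = \<gamma> j"
  by (simp add: gamma_bar_def \<gamma>_def rho_bar)

lemma delta_bar: "delta_bar r a = (\<Sum>l\<in>{1..r}. \<gamma> l * indet l ^ a)"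
  by (simp add: delta_bar_def gamma_bar)

sublocale C: cell_rep r indet \<gamma> z \<rho> by (rule cell_rep)
sublocale C': cell_rep r indet \<gamma> "- z" "- \<rho>" by (rule cell_rep_twist)

text \<open>With \<open>\<delta>\<^sub>0 = 0\<close> the ground relation would read
  \<open>1/\<rho> - \<rho> = q - 1/q\<close>, that is \<open>\<rho> = 1/q\<close> or
  \<open>\<rho> = - q\<close>. But \<open>\<rho>\<close> is \<open>u_1 ... u_r\<close> times a power
  of \<open>q\<close>, and \<open>u_1\<close> occurs because \<open>r \<ge> 1\<close>.\<close>

lemma delta_bar_0_nz: "delta_bar r 0 \<noteq> 0"
proof
  assume "delta_bar r 0 = 0"
  then have "1 / \<rho> - \<rho> = indet 0 - inverse (indet 0)"
    using C.ground unfolding C.d_0 z_def by (simp add: delta_bar)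
  moreover have "(\<rho> * indet 0 - 1) * (\<rho> + indet 0) = - (\<rho> * indet 0 * ((1 / \<rho> - \<rho>) - (indet 0 - inverse (indet 0))))"
    using \<rho>_nz q_nz by (simp add: algebra_simps)
  ultimately have "(\<rho> * indet 0 - 1) * (\<rho> + indet 0) = 0" by simp
  then have "\<rho> * indet 0 = 1 \<or> \<rho> = - indet 0" by (auto simp: eq_neg_iff_add_eq_0)
  moreover have pm: "p = mono (\<Sum>j\<in>{1..r}. Poly_Mapping.single j 1)" by (simp only: p_def prod_indet)
  moreover have nz: "(\<Sum>j\<in>{1..r}. Poly_Mapping.single j (1::nat)) + Poly_Mapping.single 0 n \<noteq> 0" for n
  proof
    assume "(\<Sum>j\<in>{1..r}. Poly_Mapping.single j (1::nat)) + Poly_Mapping.single 0 n = 0"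
    then have "Poly_Mapping.lookup ((\<Sum>j\<in>{1..r}. Poly_Mapping.single j (1::nat)) + Poly_Mapping.single 0 n) 1 = 0"
      by simp
    then show False unfolding lookup_add lookup_sum_single using r_ge by simp
  qed
  have "p * indet 0 \<noteq> 1" "p \<noteq> 1" "p \<noteq> - indet 0" "p \<noteq> - (indet 0 * indet 0)"
    using nz[of 1] nz[of 0] unfolding pm indet_mono mono_mult mono_0[symmetric] mono_eq_iff
    by (simp_all add: mono_neq_uminus)
  ultimately show False using q_nz
    unfolding \<rho>_def by (cases "odd r") (auto simp: field_simps)
qed

text \<open>For even \<open>r\<close> the two roots of the quadratic equation are
  \<open>p / q\<close> and \<open>- q p\<close>; their difference is
  \<open>p (q + 1/q)\<close>.\<close>

lemma two_q_nz: "indet 0 + inverse (indet 0) \<noteq> 0"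
proof
  assume "indet 0 + inverse (indet 0) = 0"
  then have "indet 0 * indet 0 = - 1" using q_nz by (simp add: field_simps eq_neg_iff_add_eq_0)
  then show False using mono_neq_uminus[of _ 0] unfolding indet_mono mono_mult mono_0 by blast
qed

end

section \<open>Subrings containing the parameters\<close>

lemma param_carrier_update_simps [simp]:
  "carrier (B\<lparr>carrier := H\<rparr>) = H"
  "par_rho (B\<lparr>carrier := H\<rparr>) = par_rho B" "par_q (B\<lparr>carrier := H\<rparr>) = par_q B"
  "par_delta (B\<lparr>carrier := H\<rparr>) = par_delta B" "par_u (B\<lparr>carrier := H\<rparr>) = par_u B"
  for B :: "('a, 'm) param_ring_scheme"
  by simp_all

context ground_ring begin

lemma subring_inv:
  assumes "subring H S" "x \<in> H" "x \<in> Units S" "inv x \<in> H"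
  shows "inv\<^bsub>S\<lparr>carrier := H\<rparr>\<^esub> x = inv x" "x \<in> Units (S\<lparr>carrier := H\<rparr>)"
proof -
  interpret H: ring "S\<lparr>carrier := H\<rparr>" by (rule subring_is_ring[OF assms(1)])
  have *: "x \<otimes> inv x = \<one>" "inv x \<otimes> x = \<one>" using assms(3) by auto
  then show "inv\<^bsub>S\<lparr>carrier := H\<rparr>\<^esub> x = inv x"
    using H.inv_char[of x "inv x"] assms by auto
  show "x \<in> Units (S\<lparr>carrier := H\<rparr>)"
    unfolding Units_def using * assms(2,4) by auto
qed

lemma subring_neg:
  assumes "subring H S" "x \<in> H"
  shows "\<ominus>\<^bsub>S\<lparr>carrier := H\<rparr>\<^esub> x = \<ominus> x"
proof -
  interpret H: ring "S\<lparr>carrier := H\<rparr>" by (rule subring_is_ring[OF assms(1)])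
  have "x \<in> carrier S" using subringE(1)[OF assms(1)] assms(2) by blast
  then show ?thesis
    using H.minus_equality[of "\<ominus> x" x] assms subringE(5)[OF assms(1)] by (simp add: l_neg)
qed

lemma subring_diff:
  assumes "subring H S" "x \<in> H" "y \<in> H"
  shows "x \<ominus>\<^bsub>S\<lparr>carrier := H\<rparr>\<^esub> y = x \<ominus> y"
  using assms by (simp add: a_minus_def subring_neg)

lemma param_gens_closed: "param_gens r S \<subseteq> carrier S"
  unfolding param_gens_def using rho_unit q_unit delta_closed delta0_unit u_unit by auto

text \<open>Inverses, generators and the generated subring do not change on passing to such an
  \<open>H\<close>. The \<open>\<delta>\<^sub>j\<close> are assumed separately because
  \<open>param_gens\<close> stops at index \<open>r - 1\<close>.\<close>

context
  fixes H assumes H: "subring H S" and gens: "param_gens r S \<subseteq> H" and deltas: "\<And>j. par_delta S j \<in> H"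
begin

lemma sub_units:
  "par_rho S \<in> H" "inv (par_rho S) \<in> H" "par_q S \<in> H" "inv (par_q S) \<in> H" "inv (par_delta S 0) \<in> H"
  "i \<in> {1..r} \<Longrightarrow> par_u S i \<in> H" "i \<in> {1..r} \<Longrightarrow> inv (par_u S i) \<in> H"
  using gens unfolding param_gens_def by blast+

lemma sub_inv:
  "inv\<^bsub>S\<lparr>carrier := H\<rparr>\<^esub> (par_rho S) = inv (par_rho S)" "inv\<^bsub>S\<lparr>carrier := H\<rparr>\<^esub> (par_q S) = inv (par_q S)"
  "inv\<^bsub>S\<lparr>carrier := H\<rparr>\<^esub> (par_delta S 0) = inv (par_delta S 0)"
  "i \<in> {1..r} \<Longrightarrow> inv\<^bsub>S\<lparr>carrier := H\<rparr>\<^esub> (par_u S i) = inv (par_u S i)"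
  using subring_inv(1)[OF H] sub_units deltas rho_unit q_unit delta0_unit u_unit by auto

lemma sub_ground_ring: "ground_ring r (S\<lparr>carrier := H\<rparr>)"
proof -
  interpret H: cring "S\<lparr>carrier := H\<rparr>"
    using subcring_iff[of H] subcringI'[OF H] subringE(1)[OF H] by blast
  have d: "inv (par_q S) \<ominus> par_q S \<in> H" "par_delta S 0 \<ominus> \<one> \<in> H"
    using subringE(3,5,7)[OF H] sub_units deltas by (auto simp: a_minus_def)
  show ?thesis
    by unfold_locales
      (use subring_inv(2)[OF H] sub_units deltas rho_unit q_unit delta0_unit u_unit ground_relation
        sub_inv subring_diff[OF H] subringE(3)[OF H] d in \<open>simp_all del: One_nat_def\<close>)
qed

lemma sub_param_gens: "param_gens r (S\<lparr>carrier := H\<rparr>) = param_gens r S"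
proof -
  have "{inv\<^bsub>S\<lparr>carrier := H\<rparr>\<^esub> (par_u S i) | i. i \<in> {1..r}} = {inv (par_u S i) | i. i \<in> {1..r}}"
    by (rule Collect_cong) (use sub_inv(4) in metis)
  then show ?thesis unfolding param_gens_def param_carrier_update_simps sub_inv(1-3) by simp
qed

lemma sub_generate: "generate_ring (S\<lparr>carrier := H\<rparr>) (param_gens r (S\<lparr>carrier := H\<rparr>)) = generate_ring S (param_gens r S)"
  unfolding sub_param_gens using subring_gen_equality[OF H gens] by simp

lemma sub_q_diff: "q_diff (S\<lparr>carrier := H\<rparr>) = q_diff S"
  unfolding q_diff_def using sub_inv subring_diff[OF H] sub_units by simp

end

lemma generated_subring: "subring (generate_ring S (param_gens r S)) S"
  by (rule generate_ring_is_subring[OF param_gens_closed])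

end

text \<open>The half \<open>a \<ge> 0\<close> of weak admissibility. It does not mention
  \<open>deltaZ\<close> and therefore passes easily to products and twists.\<close>

definition root_rec :: "nat \<Rightarrow> ('a, 'm) param_ring_scheme \<Rightarrow> bool" where
  "root_rec r S \<longleftrightarrow> (\<forall>a::nat. (\<Oplus>\<^bsub>S\<^esub>k\<in>{0..r}. (\<ominus>\<^bsub>S\<^esub> \<one>\<^bsub>S\<^esub>) [^]\<^bsub>S\<^esub> (r - k) \<otimes>\<^bsub>S\<^esub> elem_sym S r (par_u S) (r - k)
                \<otimes>\<^bsub>S\<^esub> par_delta S (k + a)) = \<zero>\<^bsub>S\<^esub>)"

lemma weakly_admissible_root_rec: "weakly_admissible r S \<Longrightarrow> root_rec r S"
  unfolding weakly_admissible_def root_rec_def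
proof
  fix a :: nat
  assume *: "\<forall>a::int. (\<Oplus>\<^bsub>S\<^esub>k\<in>{0..r}. (\<ominus>\<^bsub>S\<^esub> \<one>\<^bsub>S\<^esub>) [^]\<^bsub>S\<^esub> (r - k) \<otimes>\<^bsub>S\<^esub> elem_sym S r (par_u S) (r - k)
                \<otimes>\<^bsub>S\<^esub> deltaZ S (int k + a)) = \<zero>\<^bsub>S\<^esub>"
  have "deltaZ S (int k + int a) = par_delta S (k + a)" for k
    by (subst deltaZ.simps) (simp add: nat_add_distrib)
  then show "(\<Oplus>\<^bsub>S\<^esub>k\<in>{0..r}. (\<ominus>\<^bsub>S\<^esub> \<one>\<^bsub>S\<^esub>) [^]\<^bsub>S\<^esub> (r - k) \<otimes>\<^bsub>S\<^esub> elem_sym S r (par_u S) (r - k)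
                \<otimes>\<^bsub>S\<^esub> par_delta S (k + a)) = \<zero>\<^bsub>S\<^esub>"
    using *[rule_format, of "int a"] by simp
qed

context cring begin

lemma elem_sym_0: "elem_sym R r u 0 = \<one>"
proof -
  have "{A. A \<subseteq> {1..r} \<and> card A = 0} = {{}}" by (auto dest: finite_subset)
  then show ?thesis unfolding elem_sym_def by simp
qed

end

context ground_ring begin

text \<open>The leading coefficient of the recursion is 1, so it expresses \<open>\<delta>\<^sub>r\<^sub>+\<^sub>a\<close> through smaller ones.\<close>

lemma root_rec_solve:
  assumes "root_rec r S"
  shows "par_delta S (r + a) = \<ominus> (\<Oplus>k\<in>{..<r}. (\<ominus> \<one>) [^] (r - k) \<otimes> elem_sym S r (par_u S) (r - k) \<otimes> par_delta S (k + a))"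
proof -
  let ?t = "\<lambda>k. (\<ominus> \<one>) [^] (r - k) \<otimes> elem_sym S r (par_u S) (r - k) \<otimes> par_delta S (k + a)"
  have cl [simp]: "?t k \<in> carrier S" for k using elem_sym_closed delta_closed by auto
  have "{0..r} = insert r {..<r}" by auto
  then have "\<zero> = ?t r \<oplus> (\<Oplus>k\<in>{..<r}. ?t k)"
    using assms unfolding root_rec_def by (metis (no_types, lifting) cl finite_lessThan finsum_insert lessThan_iff less_irrefl Pi_I)
  then have "par_delta S (r + a) \<oplus> (\<Oplus>k\<in>{..<r}. ?t k) = \<zero>" using delta_closed by (simp add: elem_sym_0)
  then show ?thesis using delta_closed by (intro sum_zero_eq_neg finsum_closed) auto
qed

lemma subring_finsum:
  assumes "subring H S" "\<And>i. i \<in> I \<Longrightarrow> f i \<in> H"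
  shows "(\<Oplus>i\<in>I. f i) \<in> H"
  using assms(2)
proof (induction I rule: infinite_finite_induct)
  case (insert x F)
  then have "f \<in> F \<rightarrow> carrier S" "f x \<in> carrier S" using subringE(1)[OF assms(1)] by auto
  then show ?case using insert subringE(7)[OF assms(1)] by simp
qed (simp_all add: subringE(2)[OF assms(1)] finsum_infinite)

lemma subring_finprod:
  assumes "subring H S" "\<And>i. i \<in> I \<Longrightarrow> f i \<in> H"
  shows "(\<Otimes>i\<in>I. f i) \<in> H"
  using assms(2)
proof (induction I rule: infinite_finite_induct)
  case (insert x F)
  then have "f \<in> F \<rightarrow> carrier S" "f x \<in> carrier S" using subringE(1)[OF assms(1)] by auto
  then show ?case using insert subringE(6)[OF assms(1)] by simp
qed (simp_all add: subringE(3)[OF assms(1)])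

lemma subring_pow:
  assumes "subring H S" "x \<in> H" shows "x [^] (n::nat) \<in> H"
  by (induction n) (use assms subringE(3,6)[OF assms(1)] in auto)

lemma subring_elem_sym:
  assumes "subring H S" "\<And>i. i \<in> {1..r} \<Longrightarrow> par_u S i \<in> H"
  shows "elem_sym S r (par_u S) i \<in> H"
  unfolding elem_sym_def by (intro subring_finsum subring_finprod assms) auto

lemma subring_delta:
  assumes H: "subring H S" and u: "\<And>i. i \<in> {1..r} \<Longrightarrow> par_u S i \<in> H" and rec: "root_rec r S"
    and small: "\<And>j. j < r \<Longrightarrow> par_delta S j \<in> H"
  shows "par_delta S j \<in> H"
proof (induction j rule: less_induct)
  case (less j)
  show ?case
  proof (cases "j < r")
    case False
    then have j: "r + (j - r) = j" by simp
    have "k + (j - r) < j" if "k < r" for k using that False by simp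
    then have "(\<Oplus>k\<in>{..<r}. (\<ominus> \<one>) [^] (r - k) \<otimes> elem_sym S r (par_u S) (r - k) \<otimes> par_delta S (k + (j - r))) \<in> H"
      using less subringE(3,5,6)[OF H]
      by (intro subring_finsum[OF H]) (auto intro!: subringE(6)[OF H] subring_pow[OF H] subring_elem_sym[OF H u] subringE(5)[OF H] subringE(3)[OF H])
    then show ?thesis using root_rec_solve[OF rec, of "j - r"] subringE(5)[OF H] unfolding j by simp
  qed (rule small)
qed

text \<open>The generators stop at index \<open>r - 1\<close>; the recursion supplies all further
  \<open>\<delta>\<^sub>j\<close>.\<close>

lemma generated_delta:
  assumes "r \<ge> 1" "root_rec r S"
  shows "par_delta S j \<in> generate_ring S (param_gens r S)"
proof (rule subring_delta[OF generated_subring _ assms(2)])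
  fix i assume "i \<in> {1..r}"
  then show "par_u S i \<in> generate_ring S (param_gens r S)"
    by (intro generate_ring.incl) (auto simp: param_gens_def)
next
  fix j assume "j < r"
  then have "par_delta S j \<in> param_gens r S"
    by (cases "j = 0") (auto simp: param_gens_def)
  then show "par_delta S j \<in> generate_ring S (param_gens r S)" by (rule generate_ring.incl)
qed

end

section \<open>The relations used for universality\<close>

abbreviation root_a :: "nat \<Rightarrow> ('a, 'm) param_ring_scheme \<Rightarrow> nat \<Rightarrow> 'a" where
  "root_a r S \<equiv> root_coeff S (par_u S) [1..<Suc r]"

text \<open>What universality uses of admissibility. Linear independence is replaced by the
  relations that it implies: these are equations and pass to products and to the twist, which is not
  evident for \<open>W2_independent\<close> itself.\<close>

definition wy_params :: "nat \<Rightarrow> ('a, 'm) param_ring_scheme \<Rightarrow> bool" where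
  "wy_params r S \<longleftrightarrow> ground_ring r S \<and> (\<forall>x\<in>carrier S. q_diff S \<otimes>\<^bsub>S\<^esub> x = \<zero>\<^bsub>S\<^esub> \<longrightarrow> x = \<zero>\<^bsub>S\<^esub>)
     \<and> root_rec r S
     \<and> (\<forall>k<r. wy_expr r S (inv\<^bsub>S\<^esub> (par_rho S)) (q_diff S) (par_delta S) (root_a r S) k = \<zero>\<^bsub>S\<^esub>)"

lemma admissible_wy_params:
  assumes "r \<ge> 1" "admissible r S"
  shows "wy_params r S"
proof -
  interpret ground_ring r S using assms by (simp add: admissible_def)
  interpret W2_alg r S by unfold_locales
  show ?thesis
    unfolding wy_params_def
    using assms weakly_admissible_root_rec admissible_wy_relation ground_ring_axioms
    by (auto simp: admissible_def)
qed

text \<open>All scalars of the relations that involve \<open>\<rho>\<close> and \<open>q\<close> change sign under the twist.\<close>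

lemma wy_params_twist:
  fixes S :: "('a, 'm) param_ring_scheme" (structure)
  assumes "wy_params r S" "r \<ge> 1"
  shows "wy_params r (param_twist S)"
proof -
  interpret ground_ring r S using assms by (simp add: wy_params_def)
  let ?T = "param_twist S"
  have ops [simp]: "carrier ?T = carrier S" "monoid.mult ?T = monoid.mult S" "one ?T = one S"
    "ring.zero ?T = ring.zero S" "add ?T = add S"
    "par_rho ?T = \<ominus> (par_rho S)" "par_q ?T = inv (par_q S)" "par_delta ?T = par_delta S" "par_u ?T = par_u S"
    by (simp_all add: param_twist_def)
  have units: "Units ?T = Units S" by (simp add: Units_def)
  have invT: "inv\<^bsub>?T\<^esub> x = inv x" for x by (simp add: m_inv_def)
  have negT: "\<ominus>\<^bsub>?T\<^esub> x = \<ominus> x" for x by (simp add: a_inv_def m_inv_def)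
  have diffT: "x \<ominus>\<^bsub>?T\<^esub> y = x \<ominus> y" for x y by (simp add: a_minus_def negT)
  have powT: "x [^]\<^bsub>?T\<^esub> (n::nat) = x [^] n" for x n by (simp add: nat_pow_def)
  have sumT: "finsum ?T f I = finsum S f I" for f :: "'i \<Rightarrow> 'a" and I by (simp add: finsum_def finprod_def)
  have prodT: "finprod ?T f I = finprod S f I" for f :: "'i \<Rightarrow> 'a" and I by (simp add: finprod_def)
  have cl: "par_rho S \<in> carrier S" "inv (par_rho S) \<in> carrier S" "par_q S \<in> carrier S" "inv (par_q S) \<in> carrier S"
    "\<And>j. par_delta S j \<in> carrier S" "inv (par_rho S) \<otimes> par_rho S = \<one>"
    using rho_unit q_unit delta_closed by auto
  have nr: "\<ominus> (par_rho S) \<in> Units S" "inv (\<ominus> (par_rho S)) = \<ominus> (inv (par_rho S))"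
  proof -
    have "\<ominus> (par_rho S) \<otimes> \<ominus> (inv (par_rho S)) = \<one>" "\<ominus> (inv (par_rho S)) \<otimes> \<ominus> (par_rho S) = \<one>"
      using cl rho_unit by (simp_all add: l_minus r_minus)
    then show "\<ominus> (par_rho S) \<in> Units S" "inv (\<ominus> (par_rho S)) = \<ominus> (inv (par_rho S))"
      using cl by (auto simp: Units_def intro!: inv_char)
  qed
  have qd: "q_diff ?T = \<ominus> (q_diff S)" "q_diff S \<in> carrier S"
    unfolding q_diff_def diffT invT ops using cl Units_inv_inv[OF q_unit] by (simp_all add: minus_eq minus_add a_comm)
  have "cring ?T"
    by (rule cringI) (auto simp: l_distr r_distr m_ac intro!: abelian_groupI comm_monoidI a_comm a_assoc bexI[of _ "\<ominus> _"] l_neg)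
  moreover have "ground_ring_axioms r ?T"
  proof
    show "par_rho ?T \<in> Units ?T" using nr units by simp
    show "par_q ?T \<in> Units ?T" "par_delta ?T 0 \<in> Units ?T" using q_unit delta0_unit units by simp_all
    show "par_delta ?T j \<in> carrier ?T" for j using cl by simp
    show "par_u ?T i \<in> Units ?T" if "i \<in> {1..r}" for i using u_unit[OF that] units by simp
    have "inv (par_q S) \<in> carrier S" "par_delta S 0 \<in> carrier S" using cl by auto
    have "\<ominus> (inv (par_rho S)) \<ominus> \<ominus> (par_rho S) = \<ominus> (inv (par_rho S) \<ominus> par_rho S)"
      using cl by (simp add: minus_eq minus_add)
    also have "\<dots> = \<ominus> ((inv (par_q S) \<ominus> par_q S) \<otimes> (par_delta S 0 \<ominus> \<one>))" unfolding ground_relation ..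
    also have "\<dots> = (par_q S \<ominus> inv (par_q S)) \<otimes> (par_delta S 0 \<ominus> \<one>)"
    proof -
      have "\<ominus> ((x \<ominus> y) \<otimes> w) = (y \<ominus> x) \<otimes> w" if "x \<in> carrier S" "y \<in> carrier S" "w \<in> carrier S" for x y w
        using that by algebra
      then show ?thesis using cl by simp
    qed
    finally show "inv\<^bsub>?T\<^esub> par_rho ?T \<ominus>\<^bsub>?T\<^esub> par_rho ?T = (inv\<^bsub>?T\<^esub> par_q ?T \<ominus>\<^bsub>?T\<^esub> par_q ?T) \<otimes>\<^bsub>?T\<^esub> (par_delta ?T 0 \<ominus>\<^bsub>?T\<^esub> \<one>\<^bsub>?T\<^esub>)"
      unfolding invT diffT ops nr Units_inv_inv[OF q_unit] .
  qed
  ultimately have "ground_ring r ?T" by (simp add: ground_ring_def)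
  moreover have "\<forall>x\<in>carrier ?T. q_diff ?T \<otimes>\<^bsub>?T\<^esub> x = \<zero>\<^bsub>?T\<^esub> \<longrightarrow> x = \<zero>\<^bsub>?T\<^esub>"
    using assms(1) qd unfolding wy_params_def by (auto simp: l_minus)
  moreover have es: "elem_sym ?T r (par_u S) i = elem_sym S r (par_u S) i" for i
    unfolding elem_sym_def sumT prodT ..
  have "root_rec r ?T"
    using assms(1) unfolding wy_params_def root_rec_def sumT negT powT ops es by blast
  moreover have rc: "root_coeff ?T u is j = root_coeff S u is j" for u "is" j
    by (induction "is" arbitrary: j) (simp_all add: diffT)
  have acl: "root_a r S j \<in> carrier S" for j by (rule root_coeff_closed) (auto intro: u_closed)
  have wc: "wy_corr ?T r j i = wy_corr S r j i" "wy_corr S r j i \<in> carrier S" for j i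
    unfolding wy_corr_def diffT ops by auto
  have "wy_expr r ?T (inv\<^bsub>?T\<^esub> (par_rho ?T)) (q_diff ?T) (par_delta ?T) (root_a r ?T) k = \<zero>\<^bsub>?T\<^esub>" if k: "k < r" for k
  proof -
    let ?A = "root_a r S (k + 1) \<ominus> root_a r S 0 \<otimes> root_a r S (r - 1 - k)"
    let ?B = "\<Oplus>j\<in>{..r}. root_a r S j \<otimes> ((if k < j then par_delta S (j - 1 - k) else \<zero>) \<ominus> wy_corr S r j (- int k))"
    have AB: "?A \<in> carrier S" "?B \<in> carrier S" using acl wc cl by (auto intro!: finsum_closed)
    have "inv (par_rho S) \<otimes> ?A \<oplus> q_diff S \<otimes> ?B = \<zero>"
      using assms(1) k unfolding wy_params_def wy_expr_def by blast
    moreover have "\<ominus> x \<otimes> A \<oplus> \<ominus> y \<otimes> B = \<ominus> (x \<otimes> A \<oplus> y \<otimes> B)"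
      if "x \<in> carrier S" "y \<in> carrier S" "A \<in> carrier S" "B \<in> carrier S" for x y A B using that by algebra
    ultimately have "\<ominus> (inv (par_rho S)) \<otimes> ?A \<oplus> \<ominus> (q_diff S) \<otimes> ?B = \<zero>"
      using AB cl qd by simp
    then show ?thesis unfolding wy_expr_def sumT diffT invT ops nr qd rc wc .
  qed
  ultimately show ?thesis unfolding wy_params_def by blast
qed

section \<open>Products and homomorphisms of parameter rings\<close>

lemma param_prod_simps [simp]:
  "carrier (param_prod S T) = carrier S \<times> carrier T"
  "x \<otimes>\<^bsub>param_prod S T\<^esub> y = (fst x \<otimes>\<^bsub>S\<^esub> fst y, snd x \<otimes>\<^bsub>T\<^esub> snd y)"
  "x \<oplus>\<^bsub>param_prod S T\<^esub> y = (fst x \<oplus>\<^bsub>S\<^esub> fst y, snd x \<oplus>\<^bsub>T\<^esub> snd y)"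
  "\<one>\<^bsub>param_prod S T\<^esub> = (\<one>\<^bsub>S\<^esub>, \<one>\<^bsub>T\<^esub>)" "\<zero>\<^bsub>param_prod S T\<^esub> = (\<zero>\<^bsub>S\<^esub>, \<zero>\<^bsub>T\<^esub>)"
  "par_rho (param_prod S T) = (par_rho S, par_rho T)" "par_q (param_prod S T) = (par_q S, par_q T)"
  "par_delta (param_prod S T) j = (par_delta S j, par_delta T j)"
  "par_u (param_prod S T) i = (par_u S i, par_u T i)"
  by (cases x, cases y, simp add: param_prod_def RDirProd_def DirProd_def monoid.defs)+

lemma param_prod_cring:
  assumes "cring S" "cring T" shows "cring (param_prod S T)"
proof -
  interpret S: cring S by (rule assms)
  interpret T: cring T by (rule assms)
  show ?thesis
  proof (rule cringI)
    show "abelian_group (param_prod S T)"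
    proof (rule abelian_groupI)
      fix x assume "x \<in> carrier (param_prod S T)"
      then show "\<exists>y\<in>carrier (param_prod S T). y \<oplus>\<^bsub>param_prod S T\<^esub> x = \<zero>\<^bsub>param_prod S T\<^esub>"
        by (intro bexI[of _ "(\<ominus>\<^bsub>S\<^esub> fst x, \<ominus>\<^bsub>T\<^esub> snd x)"]) (auto simp: S.l_neg T.l_neg)
    qed (auto simp: S.a_ac T.a_ac)
    show "comm_monoid (param_prod S T)"
      by (rule comm_monoidI) (auto simp: S.m_ac T.m_ac)
  qed (auto simp: S.l_distr T.l_distr)
qed

lemma param_prod_neg:
  assumes "cring S" "cring T" "x \<in> carrier S" "y \<in> carrier T"
  shows "\<ominus>\<^bsub>param_prod S T\<^esub> (x, y) = (\<ominus>\<^bsub>S\<^esub> x, \<ominus>\<^bsub>T\<^esub> y)"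
proof -
  interpret S: cring S by (rule assms)
  interpret T: cring T by (rule assms)
  interpret P: cring "param_prod S T" by (rule param_prod_cring[OF assms(1,2)])
  show ?thesis using assms(3,4) by (intro P.minus_equality) (auto simp: S.l_neg T.l_neg)
qed

lemma param_prod_inv:
  assumes "cring S" "cring T" "x \<in> Units S" "y \<in> Units T"
  shows "inv\<^bsub>param_prod S T\<^esub> (x, y) = (inv\<^bsub>S\<^esub> x, inv\<^bsub>T\<^esub> y)" "(x, y) \<in> Units (param_prod S T)"
proof -
  interpret S: cring S by (rule assms)
  interpret T: cring T by (rule assms)
  interpret P: cring "param_prod S T" by (rule param_prod_cring[OF assms(1,2)])
  show "inv\<^bsub>param_prod S T\<^esub> (x, y) = (inv\<^bsub>S\<^esub> x, inv\<^bsub>T\<^esub> y)"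
    using assms(3,4) by (intro P.inv_char) auto
  show "(x, y) \<in> Units (param_prod S T)"
  proof -
    let ?i = "(inv\<^bsub>S\<^esub> x, inv\<^bsub>T\<^esub> y)"
    have "(x, y) \<in> carrier (param_prod S T)" "?i \<in> carrier (param_prod S T)"
      "?i \<otimes>\<^bsub>param_prod S T\<^esub> (x, y) = \<one>\<^bsub>param_prod S T\<^esub>" "(x, y) \<otimes>\<^bsub>param_prod S T\<^esub> ?i = \<one>\<^bsub>param_prod S T\<^esub>"
      using assms(3,4) by auto
    then show ?thesis unfolding Units_def by blast
  qed
qed

lemma param_prod_diff:
  assumes "cring S" "cring T" "x \<in> carrier S" "y \<in> carrier T"
  shows "w \<ominus>\<^bsub>param_prod S T\<^esub> (x, y) = (fst w \<ominus>\<^bsub>S\<^esub> x, snd w \<ominus>\<^bsub>T\<^esub> y)"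
  using assms by (simp add: a_minus_def param_prod_neg)

lemma param_prod_ground:
  assumes "ground_ring r S" "ground_ring r T"
  shows "ground_ring r (param_prod S T)"
proof -
  interpret S: ground_ring r S by (rule assms)
  interpret T: ground_ring r T by (rule assms)
  interpret P: cring "param_prod S T" by (rule param_prod_cring) unfold_locales
  note u = param_prod_inv[OF S.is_cring T.is_cring]
  show ?thesis
  proof unfold_locales
    show "inv\<^bsub>param_prod S T\<^esub> par_rho (param_prod S T) \<ominus>\<^bsub>param_prod S T\<^esub> par_rho (param_prod S T) =
      (inv\<^bsub>param_prod S T\<^esub> par_q (param_prod S T) \<ominus>\<^bsub>param_prod S T\<^esub> par_q (param_prod S T)) \<otimes>\<^bsub>param_prod S T\<^esub>
      (par_delta (param_prod S T) 0 \<ominus>\<^bsub>param_prod S T\<^esub> \<one>\<^bsub>param_prod S T\<^esub>)"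
      using S.rho_unit T.rho_unit S.q_unit T.q_unit S.ground_relation T.ground_relation
        S.Units_closed[OF S.rho_unit] T.Units_closed[OF T.rho_unit] S.Units_closed[OF S.q_unit] T.Units_closed[OF T.q_unit]
      by (simp add: u param_prod_diff[OF S.is_cring T.is_cring])
  qed (auto simp: u(2) S.rho_unit T.rho_unit S.q_unit T.q_unit S.delta0_unit T.delta0_unit S.u_unit T.u_unit
       S.delta_closed T.delta_closed)
qed

text \<open>Strict homomorphisms, which preserve \<open>\<rho>\<close> and \<open>q\<close> exactly;
  the intended instances are the two projections of a product.\<close>

locale param_hom = ground_ring r T + R: ground_ring r R
  for r and T :: "('a, 'm) param_ring_scheme" (structure) and R :: "('b, 'n) param_ring_scheme" +
  fixes f :: "'a \<Rightarrow> 'b"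
  assumes f_hom: "f \<in> ring_hom T R"
    and f_rho: "f (par_rho T) = par_rho R" and f_q: "f (par_q T) = par_q R"
    and f_delta: "\<And>j. f (par_delta T j) = par_delta R j"
    and f_u: "\<And>i. i \<in> {1..r} \<Longrightarrow> f (par_u T i) = par_u R i"
begin

sublocale ring_hom_cring T R f
  by (rule ring_hom_cringI[OF is_cring R.is_cring f_hom])

lemma f_inv: "x \<in> Units T \<Longrightarrow> f (inv x) = inv\<^bsub>R\<^esub> (f x)"
proof -
  assume x: "x \<in> Units T"
  have "f x \<otimes>\<^bsub>R\<^esub> f (inv x) = \<one>\<^bsub>R\<^esub>" "f (inv x) \<otimes>\<^bsub>R\<^esub> f x = \<one>\<^bsub>R\<^esub>"
    unfolding hom_mult[OF Units_closed[OF x] Units_inv_closed[OF x], symmetric]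
      hom_mult[OF Units_inv_closed[OF x] Units_closed[OF x], symmetric]
    using x by simp_all
  then show ?thesis using x by (intro R.inv_char[symmetric]) auto
qed

lemma f_diff: "x \<in> carrier T \<Longrightarrow> y \<in> carrier T \<Longrightarrow> f (x \<ominus> y) = f x \<ominus>\<^bsub>R\<^esub> f y"
  by (simp add: minus_eq R.minus_eq)

lemma f_q_diff: "f (q_diff T) = q_diff R"
  unfolding q_diff_def f_diff[OF Units_closed[OF q_unit] Units_inv_closed[OF q_unit]] f_inv[OF q_unit] f_q ..

lemma f_pow: "x \<in> carrier T \<Longrightarrow> f (x [^] (n::nat)) = f x [^]\<^bsub>R\<^esub> n"
  by (induction n) auto

lemma f_finsum:
  assumes "\<And>i. i \<in> I \<Longrightarrow> g i \<in> carrier T" "\<And>i. i \<in> I \<Longrightarrow> f (g i) = h i"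
  shows "f (finsum T g I) = finsum R h I"
proof -
  have "f (finsum T g I) = finsum R (f \<circ> g) I" using assms by (intro hom_finsum) auto
  also have "\<dots> = finsum R h I" using assms by (intro R.finsum_cong') (auto simp flip: assms(2))
  finally show ?thesis .
qed

lemma f_finprod:
  assumes "\<And>i. i \<in> I \<Longrightarrow> g i \<in> carrier T" "\<And>i. i \<in> I \<Longrightarrow> f (g i) = h i"
  shows "f (finprod T g I) = finprod R h I"
proof -
  have "f (finprod T g I) = finprod R (f \<circ> g) I" using assms by (intro hom_finprod) auto
  also have "\<dots> = finprod R h I" using assms by (intro R.finprod_cong') (auto simp flip: assms(2))
  finally show ?thesis .
qed

lemma f_elem_sym: "f (elem_sym T r (par_u T) i) = elem_sym R r (par_u R) i"
  unfolding elem_sym_def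
proof (rule f_finsum)
  fix A assume "A \<in> {A. A \<subseteq> {1..r} \<and> card A = i}"
  then have A: "\<And>j. j \<in> A \<Longrightarrow> j \<in> {1..r}" by auto
  show "(\<Otimes>j\<in>A. par_u T j) \<in> carrier T" using u_closed A by (intro finprod_closed) auto
  show "f (\<Otimes>j\<in>A. par_u T j) = (\<Otimes>\<^bsub>R\<^esub>j\<in>A. par_u R j)"
    using A u_closed f_u by (intro f_finprod) blast+
qed

lemma f_root_rec_sum:
  "f (\<Oplus>k\<in>{0..r}. (\<ominus> \<one>) [^] (r - k) \<otimes> elem_sym T r (par_u T) (r - k) \<otimes> par_delta T (k + a))
   = (\<Oplus>\<^bsub>R\<^esub>k\<in>{0..r}. (\<ominus>\<^bsub>R\<^esub> \<one>\<^bsub>R\<^esub>) [^]\<^bsub>R\<^esub> (r - k) \<otimes>\<^bsub>R\<^esub> elem_sym R r (par_u R) (r - k) \<otimes>\<^bsub>R\<^esub> par_delta R (k + a))"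
  by (rule f_finsum) (simp_all add: elem_sym_closed delta_closed f_pow f_elem_sym f_delta)

lemma root_a_closed: "root_a r T j \<in> carrier T"
  by (rule root_coeff_closed) (auto intro: u_closed)

lemma f_root_a: "f (root_a r T j) = root_a r R j"
proof -
  have "f (root_coeff T (par_u T) is j) = root_coeff R (par_u R) is j" if "set is \<subseteq> {1..r}" for "is"
    using that
  proof (induction "is" arbitrary: j)
    case (Cons i "is")
    then have "root_coeff T (par_u T) is j \<in> carrier T" for j by (intro root_coeff_closed Pi_I u_closed) auto
    moreover have "par_u T i \<in> carrier T" using Cons.prems by (intro u_closed) auto
    ultimately show ?case using Cons f_u[of i] by (simp add: f_diff)
  qed simp
  then show ?thesis by (simp add: subset_iff del: upt_Suc)
qed

lemma f_wy_corr: "wy_corr T r j i \<in> carrier T" "f (wy_corr T r j i) = wy_corr R r j i"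
  unfolding wy_corr_def by (auto simp: f_diff)

lemma f_wy_expr:
  "f (wy_expr r T (inv (par_rho T)) (q_diff T) (par_delta T) (root_a r T) k)
   = wy_expr r R (inv\<^bsub>R\<^esub> (par_rho R)) (q_diff R) (par_delta R) (root_a r R) k"
proof -
  let ?t = "\<lambda>j. root_a r T j \<otimes> ((if k < j then par_delta T (j - 1 - k) else \<zero>) \<ominus> wy_corr T r j (- int k))"
  have t: "?t j \<in> carrier T" for j using root_a_closed f_wy_corr delta_closed by auto
  have s: "(\<Oplus>j\<in>{..r}. ?t j) \<in> carrier T" using t by (intro finsum_closed) auto
  have "f (\<Oplus>j\<in>{..r}. ?t j) = (\<Oplus>\<^bsub>R\<^esub>j\<in>{..r}. root_a r R j \<otimes>\<^bsub>R\<^esub> ((if k < j then par_delta R (j - 1 - k) else \<zero>\<^bsub>R\<^esub>)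
      \<ominus>\<^bsub>R\<^esub> wy_corr R r j (- int k)))"
    using t by (intro f_finsum) (simp_all add: f_diff f_wy_corr f_root_a root_a_closed delta_closed f_delta del: upt_Suc One_nat_def)
  then show ?thesis
    unfolding wy_expr_def using s rho_unit q_diff_closed
    by (simp add: f_diff f_inv f_rho f_q_diff f_root_a root_a_closed del: upt_Suc One_nat_def)
qed

end

lemma param_prod_homs:
  assumes "ground_ring r S" "ground_ring r T"
  shows "param_hom r (param_prod S T) S fst" "param_hom r (param_prod S T) T snd"
  by (intro param_hom.intro param_hom_axioms.intro param_prod_ground assms ring_hom_memI; auto)+

lemma param_prod_wy_params:
  assumes "wy_params r S" "wy_params r T"
  shows "wy_params r (param_prod S T)"
proof -
  have gs: "ground_ring r S" "ground_ring r T" using assms by (auto simp: wy_params_def)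
  interpret f: param_hom r "param_prod S T" S fst by (rule param_prod_homs[OF gs])
  interpret g: param_hom r "param_prod S T" T snd by (rule param_prod_homs[OF gs])
  have zero: "x = \<zero>\<^bsub>param_prod S T\<^esub>" if "fst x = \<zero>\<^bsub>S\<^esub>" "snd x = \<zero>\<^bsub>T\<^esub>" for x using that by (simp add: prod_eq_iff)
  show ?thesis unfolding wy_params_def
  proof (intro conjI ballI impI allI)
    fix x assume x: "x \<in> carrier (param_prod S T)" "q_diff (param_prod S T) \<otimes>\<^bsub>param_prod S T\<^esub> x = \<zero>\<^bsub>param_prod S T\<^esub>"
    then have "fst (q_diff (param_prod S T)) \<otimes>\<^bsub>S\<^esub> fst x = \<zero>\<^bsub>S\<^esub>" "snd (q_diff (param_prod S T)) \<otimes>\<^bsub>T\<^esub> snd x = \<zero>\<^bsub>T\<^esub>" by auto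
    then show "x = \<zero>\<^bsub>param_prod S T\<^esub>"
      unfolding f.f_q_diff g.f_q_diff using assms x(1) by (intro zero) (auto simp: wy_params_def)
  next
    show "root_rec r (param_prod S T)" unfolding root_rec_def
      by (intro allI zero; simp only: f.f_root_rec_sum g.f_root_rec_sum)
         (use assms in \<open>auto simp: wy_params_def root_rec_def\<close>)
  next
    fix k assume "k < r"
    then show "wy_expr r (param_prod S T) (inv\<^bsub>param_prod S T\<^esub> par_rho (param_prod S T)) (q_diff (param_prod S T))
       (par_delta (param_prod S T)) (root_a r (param_prod S T)) k = \<zero>\<^bsub>param_prod S T\<^esub>"
      using assms by (intro zero; simp only: f.f_wy_expr g.f_wy_expr) (auto simp: wy_params_def)
  qed (rule param_prod_ground[OF gs])
qed

section \<open>Admissibility from field-valued points\<close>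

text \<open>The points in \<open>P\<close> are jointly injective. Each of them sends the sums of
  weak admissibility and the coefficients of a linear relation to 0 in the field, and injectivity
  turns this into 0 in \<open>T\<close>. Regularity of \<open>q - 1/q\<close> follows in the same
  way, as its values are nonzero.\<close>

lemma admissible_from_points:
  fixes T :: "('a, 'm) param_ring_scheme" and P :: "('a \<Rightarrow> 'f::field) set"
  assumes "ground_ring r T"
    and points: "\<And>\<phi>. \<phi> \<in> P \<Longrightarrow> \<exists>u \<gamma> z \<rho>. rep_point r T \<phi> u \<gamma> z \<rho>"
    and inj: "\<And>x. x \<in> carrier T \<Longrightarrow> (\<And>\<phi>. \<phi> \<in> P \<Longrightarrow> \<phi> x = 0) \<Longrightarrow> x = \<zero>\<^bsub>T\<^esub>"
    and "P \<noteq> {}"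
  shows "admissible r T"
proof -
  interpret T: ground_ring r T by (rule assms(1))
  have z: "\<phi> (q_diff T) \<noteq> 0 \<and> (\<forall>x\<in>carrier T. \<forall>y\<in>carrier T. \<phi> (x \<otimes>\<^bsub>T\<^esub> y) = \<phi> x * \<phi> y) \<and> \<phi> \<zero>\<^bsub>T\<^esub> = 0" if "\<phi> \<in> P" for \<phi>
  proof -
    obtain u \<gamma> z \<rho> where "rep_point r T \<phi> u \<gamma> z \<rho>" using points[OF \<open>\<phi> \<in> P\<close>] by blast
    then interpret rep_point r T \<phi> u \<gamma> z \<rho> .
    have "\<phi> (q_diff T) = z"
      unfolding q_diff_def phi_diff[OF T.Units_closed[OF T.q_unit] T.Units_inv_closed[OF T.q_unit]] phi_inv[OF T.q_unit]
      by (rule phi_q)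
    then show ?thesis using C.z_nz phi_mult phi_zero by auto
  qed
  obtain \<phi>0 where \<phi>0: "\<phi>0 \<in> P" using \<open>P \<noteq> {}\<close> by blast
  have "q_diff T \<noteq> \<zero>\<^bsub>T\<^esub>" using z[OF \<phi>0] by auto
  moreover have "x = \<zero>\<^bsub>T\<^esub>" if "x \<in> carrier T" "q_diff T \<otimes>\<^bsub>T\<^esub> x = \<zero>\<^bsub>T\<^esub>" for x
    using that z T.q_diff_closed by (intro inj) (metis mult_eq_0_iff)+
  moreover have "weakly_admissible r T"
    unfolding weakly_admissible_def
  proof (intro allI inj)
    fix a :: int
    show "(\<Oplus>\<^bsub>T\<^esub>k\<in>{0..r}. (\<ominus>\<^bsub>T\<^esub> \<one>\<^bsub>T\<^esub>) [^]\<^bsub>T\<^esub> (r - k) \<otimes>\<^bsub>T\<^esub> elem_sym T r (par_u T) (r - k) \<otimes>\<^bsub>T\<^esub> deltaZ T (int k + a)) \<in> carrier T"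
      using T.elem_sym_closed T.deltaZ_closed by (intro T.finsum_closed) auto
    fix \<phi> assume "\<phi> \<in> P"
    then obtain u \<gamma> z \<rho> where "rep_point r T \<phi> u \<gamma> z \<rho>" using points by blast
    then interpret rep_point r T \<phi> u \<gamma> z \<rho> .
    show "\<phi> (\<Oplus>\<^bsub>T\<^esub>k\<in>{0..r}. (\<ominus>\<^bsub>T\<^esub> \<one>\<^bsub>T\<^esub>) [^]\<^bsub>T\<^esub> (r - k) \<otimes>\<^bsub>T\<^esub> elem_sym T r (par_u T) (r - k) \<otimes>\<^bsub>T\<^esub> deltaZ T (int k + a)) = 0"
      by (rule phi_weak)
  qed
  moreover have "W2_independent r T"
    unfolding W2_independent_def
  proof (intro allI impI inj)
    fix c i \<phi>
    assume c: "\<forall>i<r. c i \<in> carrier T" and i: "i < r" and zero: "(\<Oplus>\<^bsub>W2 r T\<^esub>i\<in>{..<r}. W2_scalar r T (c i) \<otimes>\<^bsub>W2 r T\<^esub>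
            (W2_gen r T Gen_y [^]\<^bsub>W2 r T\<^esub> (i::nat) \<otimes>\<^bsub>W2 r T\<^esub> W2_gen r T Gen_e)) = \<zero>\<^bsub>W2 r T\<^esub>"
    then show "c i \<in> carrier T" by blast
    assume "\<phi> \<in> P"
    then obtain u \<gamma> z \<rho> where "rep_point r T \<phi> u \<gamma> z \<rho>" using points by blast
    then interpret rep_point r T \<phi> u \<gamma> z \<rho> .
    show "\<phi> (c i) = 0" using independent_point[OF _ zero i] c by blast
  qed
  ultimately show ?thesis unfolding admissible_def using assms(1) by blast
qed

section \<open>The ambient field and its square\<close>

text \<open>All parameters other than \<open>\<rho>\<close> and \<open>q\<close> are shared by the
  field and its twisted copy, so both are instances of one definition.\<close>

definition F_par :: "nat \<Rightarrow> ratfun \<Rightarrow> ratfun \<Rightarrow> ratfun param_ring" where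
  "F_par r \<rho> q = \<lparr> carrier = UNIV, monoid.mult = (*), one = 1, ring.zero = 0, add = (+),
       par_rho = \<rho>, par_q = q, par_delta = delta_bar r, par_u = indet \<rparr>"

lemma F_par_simps [simp]:
  "carrier (F_par r \<rho> q) = UNIV" "x \<otimes>\<^bsub>F_par r \<rho> q\<^esub> y = x * y" "x \<oplus>\<^bsub>F_par r \<rho> q\<^esub> y = x + y"
  "\<one>\<^bsub>F_par r \<rho> q\<^esub> = 1" "\<zero>\<^bsub>F_par r \<rho> q\<^esub> = 0"
  "par_rho (F_par r \<rho> q) = \<rho>" "par_q (F_par r \<rho> q) = q" "par_delta (F_par r \<rho> q) = delta_bar r"
  "par_u (F_par r \<rho> q) = indet"
  by (simp_all add: F_par_def)

lemma F_par_cring: "cring (F_par r \<rho> q)"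
proof (rule cringI)
  show "abelian_group (F_par r \<rho> q)"
  proof (rule abelian_groupI)
    fix x show "\<exists>y\<in>carrier (F_par r \<rho> q). y \<oplus>\<^bsub>F_par r \<rho> q\<^esub> x = \<zero>\<^bsub>F_par r \<rho> q\<^esub>"
      by (intro bexI[of _ "- x"]) auto
  qed (auto simp: add_ac)
  show "comm_monoid (F_par r \<rho> q)" by (rule comm_monoidI) (auto simp: mult_ac)
qed (auto simp: algebra_simps)

lemma F_par_Units [simp]: "x \<in> Units (F_par r \<rho> q) \<longleftrightarrow> x \<noteq> 0"
proof
  show "x \<noteq> 0 \<Longrightarrow> x \<in> Units (F_par r \<rho> q)" unfolding Units_def by (auto intro!: exI[of _ "inverse x"])
qed (auto simp: Units_def)

lemma F_par_inv [simp]: "x \<noteq> 0 \<Longrightarrow> inv\<^bsub>F_par r \<rho> q\<^esub> x = inverse x"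
proof -
  interpret cring "F_par r \<rho> q" by (rule F_par_cring)
  show "x \<noteq> 0 \<Longrightarrow> inv\<^bsub>F_par r \<rho> q\<^esub> x = inverse x" by (rule inv_char) auto
qed

lemma F_par_neg [simp]: "\<ominus>\<^bsub>F_par r \<rho> q\<^esub> x = - x"
proof -
  interpret cring "F_par r \<rho> q" by (rule F_par_cring)
  show ?thesis by (rule minus_equality) auto
qed

lemma F_par_diff [simp]: "x \<ominus>\<^bsub>F_par r \<rho> q\<^esub> y = x - y"
  by (simp add: a_minus_def)

lemma sub_F_par_hom: "id \<in> ring_hom ((F_par r \<rho> q)\<lparr>carrier := H\<rparr>) ring_of_type_algebra"
  by (rule ring_hom_memI) (auto simp: ring_of_type_algebra_def)

context universal_data begin

abbreviation "F \<equiv> F_par r \<rho> (indet 0)"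
abbreviation "F' \<equiv> F_par r (- \<rho>) (inverse (indet 0))"
abbreviation "FF \<equiv> param_prod F F'"

lemma indet_nz: "indet i \<noteq> 0" by (simp add: indet_mono mono_nz)

lemma F_ground: "ground_ring r F" "ground_ring r F'"
proof -
  interpret F: cring F by (rule F_par_cring)
  interpret F': cring F' by (rule F_par_cring)
  have g: "1 / \<rho> - \<rho> = (inverse (indet 0) - indet 0) * (delta_bar r 0 - 1)"
    using C.ground unfolding C.d_0 z_def delta_bar by (simp add: algebra_simps)
  show "ground_ring r F" "ground_ring r F'"
    by (unfold_locales; use g \<rho>_nz indet_nz delta_bar_0_nz in \<open>simp add: divide_inverse algebra_simps\<close>)+
qed

lemma sum_gamma_nz: "(\<Sum>l\<in>{1..r}. \<gamma> l) \<noteq> 0"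
  using delta_bar_0_nz by (simp add: delta_bar)

lemma point_F:
  assumes "ground_ring r T" "\<phi> \<in> ring_hom T ring_of_type_algebra" "\<phi> (par_rho T) = \<rho>" "\<phi> (par_q T) = indet 0"
    "\<And>j. \<phi> (par_delta T j) = delta_bar r j" "\<And>i. i \<in> {1..r} \<Longrightarrow> \<phi> (par_u T i) = indet i"
  shows "rep_point r T \<phi> indet \<gamma> z \<rho>"
proof -
  interpret ground_ring r T by (rule assms(1))
  show ?thesis
    by unfold_locales (use assms sum_gamma_nz in \<open>simp_all add: z_def delta_bar del: One_nat_def\<close>)
qed

lemma point_F':
  assumes "ground_ring r T" "\<phi> \<in> ring_hom T ring_of_type_algebra" "\<phi> (par_rho T) = - \<rho>" "\<phi> (par_q T) = inverse (indet 0)"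
    "\<And>j. \<phi> (par_delta T j) = delta_bar r j" "\<And>i. i \<in> {1..r} \<Longrightarrow> \<phi> (par_u T i) = indet i"
  shows "rep_point r T \<phi> indet \<gamma> (- z) (- \<rho>)"
proof -
  interpret ground_ring r T by (rule assms(1))
  show ?thesis
    by unfold_locales (use assms sum_gamma_nz in \<open>simp_all add: z_def delta_bar del: One_nat_def\<close>)
qed

lemma admissible_sub_F:
  assumes "ground_ring r (F\<lparr>carrier := V\<rparr>)"
  shows "admissible r (F\<lparr>carrier := V\<rparr>)"
proof (rule admissible_from_points[OF assms, of "{id}"])
  have "rep_point r (F\<lparr>carrier := V\<rparr>) id indet \<gamma> z \<rho>"
    by (rule point_F[OF assms sub_F_par_hom]) simp_all
  then show "\<exists>u \<gamma> z \<rho>. rep_point r (F\<lparr>carrier := V\<rparr>) \<phi> u \<gamma> z \<rho>" if "\<phi> \<in> {id}" for \<phi>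
    using that by blast
qed simp_all

text \<open>The two projections are jointly injective; the second one is a point with the twisted
  parameters.\<close>

lemma admissible_sub_FF:
  assumes "ground_ring r (FF\<lparr>carrier := V\<rparr>)"
  shows "admissible r (FF\<lparr>carrier := V\<rparr>)"
proof (rule admissible_from_points[OF assms, of "{fst, snd}"])
  have h: "fst \<in> ring_hom (FF\<lparr>carrier := V\<rparr>) ring_of_type_algebra" "snd \<in> ring_hom (FF\<lparr>carrier := V\<rparr>) ring_of_type_algebra"
    by (rule ring_hom_memI; simp add: ring_of_type_algebra_def)+
  have "rep_point r (FF\<lparr>carrier := V\<rparr>) fst indet \<gamma> z \<rho>"
    by (rule point_F[OF assms h(1)]) simp_all
  moreover have "rep_point r (FF\<lparr>carrier := V\<rparr>) snd indet \<gamma> (- z) (- \<rho>)"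
    by (rule point_F'[OF assms h(2)]) simp_all
  ultimately show "\<exists>u \<gamma> z \<rho>. rep_point r (FF\<lparr>carrier := V\<rparr>) \<phi> u \<gamma> z \<rho>" if "\<phi> \<in> {fst, snd}" for \<phi>
    using that by blast
qed (auto simp: prod_eq_iff)

lemma FF_ground: "ground_ring r FF"
  by (rule param_prod_ground[OF F_ground])

lemma F_wy: "wy_params r F" and FF_wy: "wy_params r FF"
proof -
  have e: "F\<lparr>carrier := UNIV\<rparr> = F" "FF\<lparr>carrier := UNIV\<rparr> = FF" by (simp_all add: F_par_def param_prod_def RDirProd_carrier)
  have "admissible r F" "admissible r FF"
    using admissible_sub_F[of UNIV, unfolded e] admissible_sub_FF[of UNIV, unfolded e] F_ground FF_ground by auto
  then show "wy_params r F" "wy_params r FF" by (auto intro: admissible_wy_params[OF r_ge])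
qed

end

section \<open>The rings $\overline S$, $\overline R_+$ and $\overline R_0$\<close>

context ground_ring begin

lemma subring_root_coeff:
  assumes "subring V S" "\<And>i. i \<in> set is \<Longrightarrow> u i \<in> V"
  shows "root_coeff S u is j \<in> V"
  using assms(2)
proof (induction "is" arbitrary: j)
  case (Cons i "is")
  then show ?case using subringE(2,5,6,7)[OF assms(1)] by (auto simp: minus_eq)
qed (use subringE(2,3)[OF assms(1)] in auto)

text \<open>The relation with index \<open>k = r - 1 - j\<close> has \<open>\<delta>\<^sub>j\<close> in its top summand and only smaller
  \<open>\<delta>\<close> elsewhere; it determines \<open>\<delta>\<^sub>j\<close> up to division by \<open>q - q\<^sup>-\<^sup>1\<close>.\<close>

lemma wy_delta_closed:
  assumes V: "subring V S" and u: "\<And>i. i \<in> {1..r} \<Longrightarrow> par_u S i \<in> V"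
    and rho: "inv (par_rho S) \<in> V" and z: "q_diff S \<in> V"
    and div: "\<And>x. x \<in> carrier S \<Longrightarrow> q_diff S \<otimes> x \<in> V \<Longrightarrow> x \<in> V"
    and wy: "\<And>k. k < r \<Longrightarrow> wy_expr r S (inv (par_rho S)) (q_diff S) (par_delta S) (root_a r S) k = \<zero>"
    and j: "j < r"
  shows "par_delta S j \<in> V"
  using j
proof (induction j rule: less_induct)
  case (less j)
  define k where "k = r - 1 - j"
  have k: "k < r" "r - 1 - k = j" using less.prems by (auto simp: k_def)
  let ?a = "root_a r S"
  define t where "t l = ?a l \<otimes> ((if k < l then par_delta S (l - 1 - k) else \<zero>) \<ominus> wy_corr S r l (- int k))" for l
  define w where "w = wy_corr S r r (- int k)"
  have sub: "x \<in> V \<Longrightarrow> x \<in> carrier S" for x using subringE(1)[OF V] by blast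
  have aV: "?a l \<in> V" for l by (rule subring_root_coeff[OF V]) (auto intro: u)
  have diffV: "x \<ominus> y \<in> V" if "x \<in> V" "y \<in> V" for x y
    using that subringE(5,7)[OF V] by (simp add: minus_eq)
  have wV: "wy_corr S r l i \<in> V" for l i
    unfolding wy_corr_def using subringE(2,3)[OF V] by (auto intro!: diffV)
  have tV: "t l \<in> V" if "l < r" for l
  proof -
    have "par_delta S (l - 1 - k) \<in> V" if "k < l"
      using that \<open>l < r\<close> k by (intro less.IH) auto
    then show ?thesis unfolding t_def using aV wV subringE(2)[OF V] by (intro subringE(6)[OF V] diffV) auto
  qed
  define s where "s = (\<Oplus>l\<in>{..<r}. t l)"
  have sV: "s \<in> V" unfolding s_def by (rule subring_finsum[OF V]) (use tV in auto)
  have ar: "?a r = \<one>" using root_coeff_top[of "par_u S" "[1..<Suc r]"] u_closed by (auto simp del: upt_Suc)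
  have tr: "t r = par_delta S j \<ominus> w"
    unfolding t_def w_def ar k(2) using k delta_closed sub[OF wV] by simp
  define b where "b = inv (par_rho S) \<otimes> (?a (k + 1) \<ominus> ?a 0 \<otimes> ?a (r - 1 - k))"
  have bV: "b \<in> V" unfolding b_def using aV rho by (intro subringE(6)[OF V] diffV)
  have wV': "w \<in> V" unfolding w_def by (rule wV)
  have "(\<Oplus>l\<in>{..r}. t l) = t r \<oplus> s"
  proof -
    have "{..r} = insert r {..<r}" by auto
    moreover have "t r \<in> carrier S" unfolding tr using delta_closed sub[OF wV'] by simp
    ultimately show ?thesis unfolding s_def using sub[OF tV] by (simp add: finsum_insert)
  qed
  then have "b \<oplus> q_diff S \<otimes> (par_delta S j \<ominus> w \<oplus> s) = \<zero>"
    using wy[OF k(1)] unfolding wy_expr_def b_def[symmetric] t_def[symmetric] tr by simp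
  moreover have "q_diff S \<otimes> par_delta S j = (b \<oplus> q_diff S \<otimes> (par_delta S j \<ominus> w \<oplus> s)) \<oplus> (q_diff S \<otimes> (w \<ominus> s) \<ominus> b)"
  proof -
    have "zz \<otimes> d = (bb \<oplus> zz \<otimes> (d \<ominus> ww \<oplus> ss)) \<oplus> (zz \<otimes> (ww \<ominus> ss) \<ominus> bb)"
      if "zz \<in> carrier S" "d \<in> carrier S" "bb \<in> carrier S" "ww \<in> carrier S" "ss \<in> carrier S" for zz d bb ww ss
      using that by algebra
    from this[OF sub[OF z] delta_closed sub[OF bV] sub[OF wV'] sub[OF sV]] show ?thesis .
  qed
  ultimately have "q_diff S \<otimes> par_delta S j = q_diff S \<otimes> (w \<ominus> s) \<ominus> b"
    using sub[OF z] sub[OF bV] sub[OF wV'] sub[OF sV] by simp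
  then have "q_diff S \<otimes> par_delta S j \<in> V"
    using z wV' sV bV by (simp add: diffV subringE(6)[OF V])
  then show ?case by (rule div[OF delta_closed])
qed

end

section \<open>The three rings as subrings of the field and of its square\<close>

context universal_data begin

definition KS :: "ratfun set" where
  "KS = generate_ring F (S0_carrier r \<union> {inverse (delta_bar r 0)})"

sublocale F: ground_ring r F by (rule F_ground)
sublocale F': ground_ring r F' by (rule F_ground)
sublocale FF: ground_ring r FF by (rule FF_ground)

text \<open>\<open>S_bar\<close> is defined by generation in \<open>ring_of_type_algebra\<close>,
  the subrings below by generation in \<open>F\<close>. The operations coincide, so the closures are
  compared rule by rule.\<close>

lemma generate_F: "generate_ring ring_of_type_algebra V = generate_ring F V"
proof -
  interpret R: cring "ring_of_type_algebra :: ratfun ring" by (rule cring_from_type_algebra)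
  have ops: "x \<oplus>\<^bsub>ring_of_type_algebra\<^esub> y = x + y" "x \<otimes>\<^bsub>ring_of_type_algebra\<^esub> y = x * y"
    "\<one>\<^bsub>ring_of_type_algebra\<^esub> = 1" "\<zero>\<^bsub>ring_of_type_algebra\<^esub> = 0" "carrier ring_of_type_algebra = UNIV" for x y :: ratfun
    by (simp_all add: ring_of_type_algebra_def)
  have neg: "\<ominus>\<^bsub>ring_of_type_algebra\<^esub> x = - x" for x :: ratfun
    by (rule R.minus_equality) (simp_all add: ops)
  show ?thesis
  proof (intro equalityI subsetI)
    fix x assume "x \<in> generate_ring ring_of_type_algebra V"
    then show "x \<in> generate_ring F V"
    proof (induction rule: generate_ring.induct)
      case one
      then show ?case using generate_ring.one[of F V] by (simp add: ops)
    next
      case (a_inv h)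
      then show ?case using generate_ring.a_inv[of h F V] by (simp add: neg)
    next
      case (eng_add h1 h2)
      then show ?case using generate_ring.eng_add[of h1 F V h2] by (simp add: ops)
    next
      case (eng_mult h1 h2)
      then show ?case using generate_ring.eng_mult[of h1 F V h2] by (simp add: ops)
    qed (rule generate_ring.incl)
  next
    fix x assume "x \<in> generate_ring F V"
    then show "x \<in> generate_ring ring_of_type_algebra V"
    proof (induction rule: generate_ring.induct)
      case one
      then show ?case using generate_ring.one[of ring_of_type_algebra V] by (simp add: ops)
    next
      case (a_inv h)
      then show ?case using generate_ring.a_inv[of h ring_of_type_algebra V] by (simp add: neg)
    next
      case (eng_add h1 h2)
      then show ?case using generate_ring.eng_add[of h1 ring_of_type_algebra V h2] by (simp add: ops)
    next
      case (eng_mult h1 h2)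
      then show ?case using generate_ring.eng_mult[of h1 ring_of_type_algebra V h2] by (simp add: ops)
    qed (rule generate_ring.incl)
  qed
qed

lemma S_bar_eq: "S_bar r = F\<lparr>carrier := KS\<rparr>"
  by (simp add: S_bar_def F_par_def KS_def generate_F[unfolded F_par_def] rho_bar)

lemma KS_subring: "subring KS F"
  unfolding KS_def by (rule F.generate_ring_is_subring) simp

lemma KS_ops: "1 \<in> KS" "x \<in> KS \<Longrightarrow> y \<in> KS \<Longrightarrow> x * y \<in> KS" "x \<in> KS \<Longrightarrow> y \<in> KS \<Longrightarrow> x + y \<in> KS"
  "x \<in> KS \<Longrightarrow> - x \<in> KS" "x \<in> KS \<Longrightarrow> y \<in> KS \<Longrightarrow> x - y \<in> KS"
  using subringE(3,5,6,7)[OF KS_subring] by (auto simp: diff_conv_add_uminus simp del: add_uminus_conv_diff)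

lemma KS_prod: "(\<And>i. i \<in> I \<Longrightarrow> f i \<in> KS) \<Longrightarrow> (\<Prod>i\<in>I. f i) \<in> KS"
  by (induction I rule: infinite_finite_induct) (auto intro: KS_ops)

lemma KS_gens:
  "i \<in> {0..r} \<Longrightarrow> indet i \<in> KS" "i \<in> {0..r} \<Longrightarrow> inverse (indet i) \<in> KS"
  "inverse (inverse (indet 0) - indet 0) \<in> KS" "inverse (delta_bar r 0) \<in> KS"
proof -
  have S0: "x \<in> KS" if "x \<in> {indet i | i. i \<in> {0..r}} \<union> {inverse (indet i) | i. i \<in> {0..r}}
      \<union> {inverse (inverse (indet 0) - indet 0)}" for x
  proof -
    have "x \<in> S0_carrier r" unfolding S0_carrier_def using that by (rule generate_ring.incl)
    then show ?thesis unfolding KS_def by (intro generate_ring.incl UnI1)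
  qed
  show "i \<in> {0..r} \<Longrightarrow> indet i \<in> KS" "i \<in> {0..r} \<Longrightarrow> inverse (indet i) \<in> KS"
    "inverse (inverse (indet 0) - indet 0) \<in> KS" by (rule S0; blast)+
  show "inverse (delta_bar r 0) \<in> KS" unfolding KS_def by (rule generate_ring.incl) simp
qed

lemma KS_rho: "\<rho> \<in> KS" "inverse \<rho> \<in> KS"
proof -
  have p: "p \<in> KS" unfolding p_def by (rule KS_prod) (use KS_gens in auto)
  have "inverse p = (\<Prod>l\<in>{1..r}. inverse (indet l))" unfolding p_def by (simp add: prod_inversef[symmetric] o_def)
  then have p': "inverse p \<in> KS" using KS_prod[of "{1..r}" "\<lambda>l. inverse (indet l)"] KS_gens(2) by auto
  show "\<rho> \<in> KS" "inverse \<rho> \<in> KS" unfolding \<rho>_def using p p' KS_gens(1,2)[of 0]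
    by (auto intro: KS_ops)
qed

lemma q_diff_F: "q_diff F = z" by (simp add: q_diff_def z_def indet_nz)

lemma KS_inverse_z: "inverse z \<in> KS"
proof -
  have "inverse z = - inverse (inverse (indet 0) - indet 0)"
    unfolding z_def by (metis inverse_minus_eq minus_diff_eq)
  then show ?thesis using KS_gens(3) KS_ops(4) by simp
qed

text \<open>Each \<open>\<gamma> j\<close> has the denominators \<open>u j - u l\<close>, so
  membership is not visible from the defining sum. The relations express
  \<open>z \<delta>\<^sub>j\<close> for \<open>j < r\<close> through elements of \<open>KS\<close>
  and smaller \<open>\<delta>\<close>, and \<open>z\<close> is invertible in
  \<open>KS\<close>.\<close>

lemma KS_delta: "delta_bar r j \<in> KS"
proof -
  have rec: "root_rec r F" and wy: "\<And>k. k < r \<Longrightarrow> wy_expr r F (inv\<^bsub>F\<^esub> (par_rho F)) (q_diff F) (par_delta F) (root_a r F) k = \<zero>\<^bsub>F\<^esub>"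
    using F_wy by (auto simp: wy_params_def)
  have zK: "z \<in> KS" "inverse z \<in> KS"
  proof -
    show "z \<in> KS" unfolding z_def using KS_gens(1,2)[of 0] by (auto intro: KS_ops)
    show "inverse z \<in> KS" by (rule KS_inverse_z)
  qed
  have "par_delta F j \<in> KS"
  proof (rule F.subring_delta[OF KS_subring _ rec])
    show "par_u F i \<in> KS" if "i \<in> {1..r}" for i using KS_gens(1) that by simp
    show "par_delta F j \<in> KS" if "j < r" for j
    proof (rule F.wy_delta_closed[OF KS_subring _ _ _ _ wy that])
      show "par_u F i \<in> KS" if "i \<in> {1..r}" for i using KS_gens(1) that by simp
      show "inv\<^bsub>F\<^esub> (par_rho F) \<in> KS" using KS_rho \<rho>_nz by simp
      show "q_diff F \<in> KS" using zK q_diff_F by simp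
      fix x assume "q_diff F \<otimes>\<^bsub>F\<^esub> x \<in> KS"
      then have "inverse z * (z * x) \<in> KS" by (intro KS_ops(2)[OF zK(2)]) (simp add: q_diff_F)
      then show "x \<in> KS" using z_nz by (simp add: mult.assoc[symmetric])
    qed
  qed
  then show ?thesis by simp
qed

lemma F_gens_KS: "param_gens r F \<subseteq> KS" "param_gens r F' \<subseteq> KS"
  using KS_rho KS_gens KS_delta KS_ops(4)[OF KS_rho(1)] KS_ops(4)[OF KS_rho(2)] \<rho>_nz indet_nz delta_bar_0_nz
  unfolding param_gens_def by (auto simp: inverse_minus_eq)

lemma S_bar_ground: "ground_ring r (S_bar r)"
  unfolding S_bar_eq by (rule F.sub_ground_ring[OF KS_subring F_gens_KS(1)]) (simp add: KS_delta)

lemma param_subring_sub: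
  "param_subring r (B\<lparr>carrier := V\<rparr>) = B\<lparr>carrier := generate_ring (B\<lparr>carrier := V\<rparr>) (param_gens r (B\<lparr>carrier := V\<rparr>))\<rparr>"
  by (simp add: param_subring_def)

abbreviation "GF \<equiv> generate_ring F (param_gens r F)"
abbreviation "GFF \<equiv> generate_ring FF (param_gens r FF)"

text \<open>The parameters generate the same subring in \<open>S_bar r\<close> as in
  \<open>F\<close>, so \<open>KS\<close> disappears from the description.\<close>

lemma R_plus_eq: "R_plus r = F\<lparr>carrier := GF\<rparr>"
  unfolding R_plus_def S_bar_eq param_subring_sub
  by (subst F.sub_generate[OF KS_subring F_gens_KS(1)]) (simp_all add: KS_delta)

lemma twist_S_bar_eq: "param_twist (S_bar r) = F'\<lparr>carrier := KS\<rparr>"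
proof -
  have "\<ominus>\<^bsub>S_bar r\<^esub> \<rho> = - \<rho>"
    unfolding S_bar_eq using F.subring_neg[OF KS_subring KS_rho(1)] by simp
  moreover have "inv\<^bsub>S_bar r\<^esub> indet 0 = inverse (indet 0)"
    unfolding S_bar_eq using F.subring_inv(1)[OF KS_subring, of "indet 0"] KS_gens(1,2)[of 0] indet_nz by simp
  ultimately show ?thesis
    unfolding param_twist_def by (simp add: S_bar_eq F_par_def)
qed

lemma prod_S_bar_eq: "param_prod (S_bar r) (param_twist (S_bar r)) = FF\<lparr>carrier := KS \<times> KS\<rparr>"
  unfolding twist_S_bar_eq unfolding S_bar_eq
  by (simp add: param_prod_def RDirProd_def DirProd_def monoid.defs F_par_def)

lemma FF_neg: "\<ominus>\<^bsub>FF\<^esub> x = (- fst x, - snd x)"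
  using param_prod_neg[OF F.is_cring F'.is_cring, of "fst x" "snd x"] by simp

lemma FF_inv: "fst x \<noteq> 0 \<Longrightarrow> snd x \<noteq> 0 \<Longrightarrow> inv\<^bsub>FF\<^esub> x = (inverse (fst x), inverse (snd x))"
  using param_prod_inv[OF F.is_cring F'.is_cring, of "fst x" "snd x"] by simp

lemma KS2_subring: "subring (KS \<times> KS) FF"
  by (rule FF.subringI) (auto simp: FF_neg intro: KS_ops)

lemma FF_gens_KS: "param_gens r FF \<subseteq> KS \<times> KS"
  using KS_rho KS_gens KS_delta KS_ops(4)[OF KS_rho(1)] KS_ops(4)[OF KS_rho(2)] \<rho>_nz indet_nz delta_bar_0_nz
  unfolding param_gens_def by (auto simp: FF_inv inverse_minus_eq)

lemma R_zero_eq: "R_zero r = FF\<lparr>carrier := GFF\<rparr>"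
  unfolding R_zero_def prod_S_bar_eq param_subring_sub
  by (subst FF.sub_generate[OF KS2_subring FF_gens_KS]) (simp_all add: KS_delta)

lemma GF_delta: "par_delta F j \<in> GF"
  using F.generated_delta[OF r_ge] F_wy by (simp add: wy_params_def)

lemma GFF_delta: "par_delta FF j \<in> GFF"
  by (rule FF.generated_delta[OF r_ge]) (use FF_wy in \<open>simp add: wy_params_def\<close>)

lemma GF_gens: "param_gens r F \<subseteq> GF" and GFF_gens: "param_gens r FF \<subseteq> GFF"
  by (auto intro: generate_ring.incl)

lemma R_plus_ground: "ground_ring r (R_plus r)"
  unfolding R_plus_eq by (rule F.sub_ground_ring[OF F.generated_subring GF_gens GF_delta])

lemma R_zero_ground: "ground_ring r (R_zero r)"
  unfolding R_zero_eq by (rule FF.sub_ground_ring[OF FF.generated_subring GFF_gens GFF_delta])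

lemma R_plus_admissible: "admissible r (R_plus r)"
  using R_plus_ground unfolding R_plus_eq by (rule admissible_sub_F)

lemma R_zero_admissible: "admissible r (R_zero r)"
  using R_zero_ground unfolding R_zero_eq by (rule admissible_sub_FF)

lemma R_plus_domain: "domain (R_plus r)"
proof -
  interpret ground_ring r "R_plus r" by (rule R_plus_ground)
  show ?thesis
    by (rule domain.intro[OF is_cring], unfold_locales) (auto simp: R_plus_eq)
qed

lemma R_plus_generated: "carrier (R_plus r) = generate_ring (R_plus r) (param_gens r (R_plus r))"
  unfolding R_plus_eq F.sub_generate[OF F.generated_subring GF_gens GF_delta] by simp

lemma R_zero_generated: "carrier (R_zero r) = generate_ring (R_zero r) (param_gens r (R_zero r))"
  unfolding R_zero_eq FF.sub_generate[OF FF.generated_subring GFF_gens GFF_delta] by simp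

lemma fst_GFF: "x \<in> GFF \<Longrightarrow> fst x \<in> GF"
proof (induction rule: generate_ring.induct)
  case one
  then show ?case using generate_ring.one[of F] by simp
next
  case (incl h)
  then have "fst h \<in> param_gens r F"
    using \<rho>_nz indet_nz delta_bar_0_nz unfolding param_gens_def by (auto simp: FF_inv)
  then show ?case by (rule generate_ring.incl)
next
  case (a_inv h)
  then show ?case using generate_ring.a_inv[of _ F] by (simp add: FF_neg)
next
  case (eng_add h1 h2)
  then show ?case using generate_ring.eng_add[of _ F] by simp
next
  case (eng_mult h1 h2)
  then show ?case using generate_ring.eng_mult[of _ F] by simp
qed

text \<open>The first factor of the product carries the untwisted parameters, so the projection is
  strict.\<close>

lemma R_zero_to_R_plus: "ground_morphism r (R_zero r) (R_plus r) fst"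
  unfolding ground_morphism_def
proof (intro conjI)
  show "fst \<in> ring_hom (R_zero r) (R_plus r)"
    by (rule ring_hom_memI) (auto simp: R_zero_eq R_plus_eq fst_GFF)
qed (simp_all add: R_zero_ground R_plus_ground, simp_all add: R_zero_eq R_plus_eq)

end

section \<open>Evaluation of integer polynomials\<close>

lemma poly_mapping_sum_single:
  "P = (\<Sum>m\<in>Poly_Mapping.keys P. Poly_Mapping.single m (Poly_Mapping.lookup P m))"
  by (rule poly_mapping_eqI) (simp add: lookup_sum lookup_single when_def in_keys_iff)

context cring begin

lemma int_mult_0: "[(0::int)] \<cdot> a = \<zero>"
  by (simp add: add_pow_def int_pow_def nat_pow_def)

definition mono_eval :: "(nat \<Rightarrow> 'a) \<Rightarrow> (nat \<Rightarrow>\<^sub>0 nat) \<Rightarrow> 'a" where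
  "mono_eval x m = (\<Otimes>i\<in>Poly_Mapping.keys m. x i [^] Poly_Mapping.lookup m i)"

lemma mpoly_eval_mono: "mpoly_eval R x P = (\<Oplus>m\<in>Poly_Mapping.keys P. [Poly_Mapping.lookup P m] \<cdot> mono_eval x m)"
  by (simp add: mpoly_eval_def mono_eval_def)

context
  fixes x :: "nat \<Rightarrow> 'a" assumes x [simp]: "\<And>i. x i \<in> carrier R"
begin

lemma mono_eval_superset:
  assumes "finite B" "Poly_Mapping.keys m \<subseteq> B"
  shows "mono_eval x m = (\<Otimes>i\<in>B. x i [^] Poly_Mapping.lookup m i)"
  unfolding mono_eval_def
proof (rule finprod_mono_neutral_cong_left[OF assms])
  fix i assume "i \<in> B - Poly_Mapping.keys m"
  then have "Poly_Mapping.lookup m i = 0" by (simp add: in_keys_iff)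
  then show "x i [^] Poly_Mapping.lookup m i = \<one>" by simp
qed simp_all

lemma mono_eval_closed [simp]: "mono_eval x m \<in> carrier R"
  unfolding mono_eval_def by (rule finprod_closed) auto

lemma mono_eval_add: "mono_eval x (m + n) = mono_eval x m \<otimes> mono_eval x n"
proof -
  let ?B = "Poly_Mapping.keys m \<union> Poly_Mapping.keys n"
  have "mono_eval x (m + n) = (\<Otimes>i\<in>?B. x i [^] Poly_Mapping.lookup (m + n) i)"
    by (rule mono_eval_superset) (use keys_add[of m n] in auto)
  also have "\<dots> = (\<Otimes>i\<in>?B. x i [^] Poly_Mapping.lookup m i \<otimes> x i [^] Poly_Mapping.lookup n i)"
    by (rule finprod_cong') (auto simp: lookup_add nat_pow_mult)
  also have "\<dots> = mono_eval x m \<otimes> mono_eval x n"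
    by (subst finprod_multf) (auto simp: mono_eval_superset[of ?B])
  finally show ?thesis .
qed

lemma int_mult_closed [simp]: "a \<in> carrier R \<Longrightarrow> [(k::int)] \<cdot> a \<in> carrier R"
  by (rule add.int_pow_closed)

lemma mpoly_eval_superset:
  assumes "finite B" "Poly_Mapping.keys P \<subseteq> B"
  shows "mpoly_eval R x P = (\<Oplus>m\<in>B. [Poly_Mapping.lookup P m] \<cdot> mono_eval x m)"
  unfolding mpoly_eval_mono
proof (rule add.finprod_mono_neutral_cong_left[OF assms])
  fix m assume "m \<in> B - Poly_Mapping.keys P"
  then have "Poly_Mapping.lookup P m = 0" by (simp add: in_keys_iff)
  then show "[Poly_Mapping.lookup P m] \<cdot> mono_eval x m = \<zero>" by (simp add: int_mult_0)
qed simp_all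

lemma mpoly_eval_closed [simp]: "mpoly_eval R x P \<in> carrier R"
  unfolding mpoly_eval_mono by (rule finsum_closed) auto

lemma mpoly_eval_add: "mpoly_eval R x (P + Q) = mpoly_eval R x P \<oplus> mpoly_eval R x Q"
proof -
  let ?B = "Poly_Mapping.keys P \<union> Poly_Mapping.keys Q"
  have "mpoly_eval R x (P + Q) = (\<Oplus>m\<in>?B. [Poly_Mapping.lookup (P + Q) m] \<cdot> mono_eval x m)"
    by (rule mpoly_eval_superset) (use keys_add[of P Q] in auto)
  also have "\<dots> = (\<Oplus>m\<in>?B. [Poly_Mapping.lookup P m] \<cdot> mono_eval x m \<oplus> [Poly_Mapping.lookup Q m] \<cdot> mono_eval x m)"
    by (rule finsum_cong') (auto simp: lookup_add add.int_pow_mult)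
  also have "\<dots> = mpoly_eval R x P \<oplus> mpoly_eval R x Q"
    by (subst finsum_addf) (auto simp: mpoly_eval_superset[of ?B])
  finally show ?thesis .
qed

lemma mpoly_eval_single: "mpoly_eval R x (Poly_Mapping.single m c) = [c] \<cdot> mono_eval x m"
  by (subst mpoly_eval_superset[of "{m}"]) auto

lemma mpoly_eval_0: "mpoly_eval R x 0 = \<zero>"
  by (simp add: mpoly_eval_def)

lemma mpoly_eval_sum: "finite A \<Longrightarrow> mpoly_eval R x (\<Sum>i\<in>A. f i) = (\<Oplus>i\<in>A. mpoly_eval R x (f i))"
  by (induction A rule: finite_induct) (simp_all add: mpoly_eval_0 mpoly_eval_add)

lemma int_mult_mult:
  assumes "a \<in> carrier R" "b \<in> carrier R"
  shows "[(k * l :: int)] \<cdot> (a \<otimes> b) = ([k] \<cdot> a) \<otimes> ([l] \<cdot> b)"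
  using assms by (simp add: add_pow_ldistr_int add_pow_rdistr_int add.int_pow_pow mult.commute)

lemma mpoly_eval_mult: "mpoly_eval R x (P * Q) = mpoly_eval R x P \<otimes> mpoly_eval R x Q"
proof -
  let ?s = "\<lambda>P m. Poly_Mapping.single m (Poly_Mapping.lookup P m) :: int_mpoly"
  let ?t = "\<lambda>P m. [Poly_Mapping.lookup P m] \<cdot> mono_eval x m"
  have "P * Q = (\<Sum>m\<in>Poly_Mapping.keys P. ?s P m) * (\<Sum>n\<in>Poly_Mapping.keys Q. ?s Q n)"
    using poly_mapping_sum_single[of P] poly_mapping_sum_single[of Q] by simp
  also have "\<dots> = (\<Sum>m\<in>Poly_Mapping.keys P. \<Sum>n\<in>Poly_Mapping.keys Q.
      Poly_Mapping.single (m + n) (Poly_Mapping.lookup P m * Poly_Mapping.lookup Q n))"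
    unfolding sum_product mult_single ..
  finally have "mpoly_eval R x (P * Q) = (\<Oplus>m\<in>Poly_Mapping.keys P. \<Oplus>n\<in>Poly_Mapping.keys Q. ?t P m \<otimes> ?t Q n)"
    by (simp add: mpoly_eval_sum mpoly_eval_single mono_eval_add int_mult_mult)
  also have "\<dots> = (\<Oplus>m\<in>Poly_Mapping.keys P. ?t P m \<otimes> (\<Oplus>n\<in>Poly_Mapping.keys Q. ?t Q n))"
    by (intro finsum_cong' finsum_rdistr[symmetric]) (auto intro!: finsum_closed)
  also have "\<dots> = (\<Oplus>m\<in>Poly_Mapping.keys P. ?t P m) \<otimes> (\<Oplus>n\<in>Poly_Mapping.keys Q. ?t Q n)"
    by (rule finsum_ldistr[symmetric]) (auto intro!: finsum_closed)
  finally show ?thesis unfolding mpoly_eval_mono .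
qed

lemma mono_eval_0: "mono_eval x 0 = \<one>" by (simp add: mono_eval_def)

lemma mpoly_eval_1: "mpoly_eval R x 1 = \<one>"
  using mpoly_eval_single[of 0 1] by (simp add: mono_eval_0 single_one add.int_pow_1)

lemma mpoly_eval_neg: "mpoly_eval R x (- P) = \<ominus> mpoly_eval R x P"
  using mpoly_eval_add[of P "- P"] by (intro minus_equality[symmetric]) (simp_all add: mpoly_eval_0 a_comm)

lemma mpoly_eval_var: "mpoly_eval R x (Poly_Mapping.single (Poly_Mapping.single i 1) 1) = x i"
  by (simp add: mpoly_eval_single mono_eval_def add.int_pow_1)

end
end

context field_point begin

lemma phi_int_mult: "a \<in> carrier S \<Longrightarrow> \<phi> ([(k::int)] \<cdot> a) = of_int k * \<phi> a"
proof (induction k rule: int_induct[where k = 0])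
  case base
  then show ?case by (simp add: int_mult_0 phi_zero)
next
  case (step1 i)
  then have "[(i + 1)] \<cdot> a = [i] \<cdot> a \<oplus> a" using add.int_pow_mult[of a i 1] by (simp add: add.int_pow_1)
  then show ?case using step1 by (simp add: phi_add add.int_pow_closed algebra_simps)
next
  case (step2 i)
  then have "[i] \<cdot> a = [(i - 1)] \<cdot> a \<oplus> a" using add.int_pow_mult[of a "i - 1" 1] by (simp add: add.int_pow_1)
  then have "\<phi> ([i] \<cdot> a) = \<phi> ([(i - 1)] \<cdot> a) + \<phi> a" using step2 by (simp add: phi_add add.int_pow_closed)
  then show ?case using step2 by (simp add: algebra_simps)
qed

lemma phi_mpoly_eval:
  assumes "\<And>m i. m \<in> Poly_Mapping.keys P \<Longrightarrow> i \<in> Poly_Mapping.keys m \<Longrightarrow> x i \<in> carrier S"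
  shows "\<phi> (mpoly_eval S x P) = (\<Sum>m\<in>Poly_Mapping.keys P. of_int (Poly_Mapping.lookup P m) *
     (\<Prod>i\<in>Poly_Mapping.keys m. \<phi> (x i) ^ Poly_Mapping.lookup m i))"
proof -
  have m: "(\<Otimes>i\<in>Poly_Mapping.keys m. x i [^] Poly_Mapping.lookup m i) \<in> carrier S"
    "\<phi> (\<Otimes>i\<in>Poly_Mapping.keys m. x i [^] Poly_Mapping.lookup m i) = (\<Prod>i\<in>Poly_Mapping.keys m. \<phi> (x i) ^ Poly_Mapping.lookup m i)"
    if "m \<in> Poly_Mapping.keys P" for m
    using assms[OF that] by (auto intro!: finprod_closed simp: phi_prod phi_pow)
  then show ?thesis unfolding mpoly_eval_def
    by (subst phi_sum) (auto intro!: sum.cong add.int_pow_closed simp: phi_int_mult)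
qed

end

lemma of_mpoly_sum: "of_mpoly (\<Sum>i\<in>A. f i) = (\<Sum>i\<in>A. of_mpoly (f i))"
  by (induction A rule: infinite_finite_induct) (simp_all add: of_mpoly_0 of_mpoly_add)

lemma of_mpoly_of_int: "of_mpoly (of_int k) = of_int k"
proof -
  have n: "of_mpoly (of_nat n) = of_nat n" for n
    by (induction n) (simp_all add: of_mpoly_0 of_mpoly_1 of_mpoly_add)
  show ?thesis by (cases k) (simp_all add: n of_mpoly_neg flip: of_nat_Suc)
qed

lemma of_mpoly_single: "of_mpoly (Poly_Mapping.single m c) = of_int c * mono m"
proof -
  have "Poly_Mapping.single m c = of_int c * Poly_Mapping.single m (1::int)"
    by (simp add: single_of_int[symmetric] mult_single)
  then show ?thesis by (simp add: of_mpoly_mult of_mpoly_of_int mono_def)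
qed

lemma of_mpoly_expand: "of_mpoly P = (\<Sum>m\<in>Poly_Mapping.keys P. of_int (Poly_Mapping.lookup P m) * mono m)"
  by (subst poly_mapping_sum_single[of P]) (simp only: of_mpoly_sum of_mpoly_single)

lemma indet_power: "indet i ^ n = mono (Poly_Mapping.single i n)"
  by (induction n) (simp_all add: mono_0 indet_mono mono_mult flip: single_add)

lemma mono_expand:
  assumes "finite B" "Poly_Mapping.keys m \<subseteq> B"
  shows "mono m = (\<Prod>i\<in>B. indet i ^ Poly_Mapping.lookup m i)"
proof -
  have "mono m = mono (\<Sum>i\<in>Poly_Mapping.keys m. Poly_Mapping.single i (Poly_Mapping.lookup m i))"
    using poly_mapping_sum_single[of m] by simp
  also have "\<dots> = (\<Prod>i\<in>Poly_Mapping.keys m. indet i ^ Poly_Mapping.lookup m i)"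
    unfolding indet_power by (simp add: prod_mono)
  also have "\<dots> = (\<Prod>i\<in>B. indet i ^ Poly_Mapping.lookup m i)"
    by (rule prod.mono_neutral_left) (use assms in \<open>auto simp: in_keys_iff\<close>)
  finally show ?thesis .
qed

text \<open>The value of \<open>P\<close> at \<open>(q\<^sup>-\<^sup>1, u\<^sub>1, u\<^sub>2, \<dots>)\<close>.\<close>

definition twist_value :: "int_mpoly \<Rightarrow> ratfun" where
  "twist_value P = (\<Sum>m\<in>Poly_Mapping.keys P. of_int (Poly_Mapping.lookup P m) *
     (\<Prod>i\<in>Poly_Mapping.keys m. (if i = 0 then inverse (indet 0) else indet i) ^ Poly_Mapping.lookup m i))"

text \<open>Multiplication by a large power of \<open>q\<close> turns the value into a polynomial whose monomials
  have the exponent of \<open>q\<close> reversed.\<close>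

lemma twist_value_eq_0:
  assumes "twist_value P = 0" shows "P = 0"
proof -
  let ?K = "Poly_Mapping.keys P"
  let ?y = "\<lambda>i. if i = 0 then inverse (indet 0) else indet i"
  have q: "indet 0 \<noteq> 0" by (simp add: indet_mono mono_nz)
  define N where "N = (\<Sum>m\<in>?K. Poly_Mapping.lookup m 0)"
  have N: "Poly_Mapping.lookup m 0 \<le> N" if "m \<in> ?K" for m
    unfolding N_def using that by (intro member_le_sum) auto
  define rev where "rev m = Poly_Mapping.update 0 (N - Poly_Mapping.lookup m 0) m" for m :: "nat \<Rightarrow>\<^sub>0 nat"
  have lrev: "Poly_Mapping.lookup (rev m) i = (if i = 0 then N - Poly_Mapping.lookup m 0 else Poly_Mapping.lookup m i)" for m i
    by (simp add: rev_def lookup_update)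
  have inj: "inj_on rev ?K"
  proof (rule inj_onI, rule poly_mapping_eqI)
    fix m n i assume mn: "m \<in> ?K" "n \<in> ?K" "rev m = rev n"
    then have "Poly_Mapping.lookup (rev m) i = Poly_Mapping.lookup (rev n) i" by simp
    then show "Poly_Mapping.lookup m i = Poly_Mapping.lookup n i"
      using N[OF mn(1)] N[OF mn(2)] by (auto simp: lrev split: if_splits)
  qed
  have "indet 0 ^ N * (\<Prod>i\<in>Poly_Mapping.keys m. ?y i ^ Poly_Mapping.lookup m i) = mono (rev m)" if m: "m \<in> ?K" for m
  proof -
    let ?B = "insert 0 (Poly_Mapping.keys m)"
    let ?C = "Poly_Mapping.keys m - {0}"
    have "(\<Prod>i\<in>Poly_Mapping.keys m. ?y i ^ Poly_Mapping.lookup m i) = (\<Prod>i\<in>?B. ?y i ^ Poly_Mapping.lookup m i)"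
      by (rule prod.mono_neutral_left) (auto simp: in_keys_iff)
    also have "\<dots> = inverse (indet 0) ^ Poly_Mapping.lookup m 0 * (\<Prod>i\<in>?C. indet i ^ Poly_Mapping.lookup m i)"
      by (subst prod.insert_remove) (auto intro!: prod.cong)
    finally have 1: "(\<Prod>i\<in>Poly_Mapping.keys m. ?y i ^ Poly_Mapping.lookup m i) = \<dots>" .
    have "mono (rev m) = (\<Prod>i\<in>?B. indet i ^ Poly_Mapping.lookup (rev m) i)"
      by (rule mono_expand) (auto simp: in_keys_iff lrev split: if_splits)
    also have "\<dots> = indet 0 ^ (N - Poly_Mapping.lookup m 0) * (\<Prod>i\<in>?C. indet i ^ Poly_Mapping.lookup m i)"
      by (subst prod.insert_remove) (auto simp: lrev intro!: prod.cong)
    also have "indet 0 ^ (N - Poly_Mapping.lookup m 0) = indet 0 ^ N * inverse (indet 0) ^ Poly_Mapping.lookup m 0"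
      using N[OF m] q by (simp add: power_diff field_simps)
    finally show ?thesis unfolding 1 by simp
  qed
  then have "indet 0 ^ N * twist_value P = (\<Sum>m\<in>?K. of_int (Poly_Mapping.lookup P m) * mono (rev m))"
    unfolding twist_value_def sum_distrib_left by (intro sum.cong) (auto simp: mult.left_commute)
  also have "\<dots> = of_mpoly (\<Sum>m\<in>?K. Poly_Mapping.single (rev m) (Poly_Mapping.lookup P m))"
    by (simp add: of_mpoly_sum of_mpoly_single)
  finally have "of_mpoly (\<Sum>m\<in>?K. Poly_Mapping.single (rev m) (Poly_Mapping.lookup P m)) = of_mpoly 0"
    using assms by (simp add: of_mpoly_0)
  then have zero: "(\<Sum>m\<in>?K. Poly_Mapping.single (rev m) (Poly_Mapping.lookup P m)) = 0"
    unfolding of_mpoly_eq_iff .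
  show ?thesis
  proof (rule ccontr)
    assume "P \<noteq> 0"
    then obtain n where n: "n \<in> ?K" by (metis all_not_in_conv keys_eq_empty)
    have "0 = Poly_Mapping.lookup (\<Sum>m\<in>?K. Poly_Mapping.single (rev m) (Poly_Mapping.lookup P m)) (rev n)"
      using zero by simp
    also have "\<dots> = (\<Sum>m\<in>?K. if m = n then Poly_Mapping.lookup P m else 0)"
      unfolding lookup_sum using n inj by (intro sum.cong) (auto simp: lookup_single when_def dest: inj_onD)
    also have "\<dots> = Poly_Mapping.lookup P n" using n by simp
    finally show False using n by (simp add: in_keys_iff)
  qed
qed

context universal_data begin

lemma value_indet: "(\<Sum>m\<in>Poly_Mapping.keys P. of_int (Poly_Mapping.lookup P m) *
     (\<Prod>i\<in>Poly_Mapping.keys m. indet i ^ Poly_Mapping.lookup m i)) = of_mpoly P"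
  unfolding of_mpoly_expand by (rule sum.cong) (simp_all add: mono_expand[OF finite_keys order_refl])

text \<open>At a point that sends \<open>q\<close> and the \<open>u_i\<close> to indeterminates, the
  value of \<open>P\<close> is \<open>P\<close> itself, regarded as a rational function.\<close>

lemma alg_independent_sub:
  assumes "ground_ring r T" "\<phi> \<in> ring_hom T ring_of_type_algebra" "\<phi> (par_q T) = indet 0"
    "\<And>i. i \<in> {1..r} \<Longrightarrow> \<phi> (par_u T i) = indet i"
  shows "alg_independent_int T {0..r} (qu_family T)"
  unfolding alg_independent_int_def
proof (intro allI impI)
  interpret ground_ring r T by (rule assms(1))
  interpret field_point T \<phi> by unfold_locales (rule assms(2))
  fix P :: int_mpoly
  assume P: "\<forall>m\<in>Poly_Mapping.keys P. Poly_Mapping.keys m \<subseteq> {0..r}" and zero: "mpoly_eval T (qu_family T) P = \<zero>\<^bsub>T\<^esub>"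
  have qu: "qu_family T i \<in> carrier T \<and> \<phi> (qu_family T i) = indet i" if "i \<in> {0..r}" for i
    using that assms(3,4) q_unit u_unit[of i] by (auto simp: qu_family_def)
  have "\<phi> (mpoly_eval T (qu_family T) P) = (\<Sum>m\<in>Poly_Mapping.keys P. of_int (Poly_Mapping.lookup P m) *
     (\<Prod>i\<in>Poly_Mapping.keys m. \<phi> (qu_family T i) ^ Poly_Mapping.lookup m i))"
    by (rule phi_mpoly_eval) (use P qu in blast)
  also have "\<dots> = of_mpoly P"
    unfolding value_indet[symmetric]
  proof (rule sum.cong[OF refl])
    fix m assume "m \<in> Poly_Mapping.keys P"
    then have "\<phi> (qu_family T i) = indet i" if "i \<in> Poly_Mapping.keys m" for i using P qu that by blast
    then show "of_int (Poly_Mapping.lookup P m) * (\<Prod>i\<in>Poly_Mapping.keys m. \<phi> (qu_family T i) ^ Poly_Mapping.lookup m i)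
      = of_int (Poly_Mapping.lookup P m) * (\<Prod>i\<in>Poly_Mapping.keys m. indet i ^ Poly_Mapping.lookup m i)" by simp
  qed
  finally have "of_mpoly P = of_mpoly 0" unfolding zero phi_zero of_mpoly_0 ..
  then show "P = 0" unfolding of_mpoly_eq_iff .
qed

lemma R_plus_alg_independent: "alg_independent_int (R_plus r) {0..r} (qu_family (R_plus r))"
proof (rule alg_independent_sub[OF R_plus_ground, of id])
  show "id \<in> ring_hom (R_plus r) ring_of_type_algebra" unfolding R_plus_eq by (rule sub_F_par_hom)
qed (simp_all add: R_plus_eq)

lemma R_zero_alg_independent: "alg_independent_int (R_zero r) {0..r} (qu_family (R_zero r))"
proof (rule alg_independent_sub[OF R_zero_ground, of fst])
  show "fst \<in> ring_hom (R_zero r) ring_of_type_algebra"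
    unfolding R_zero_eq by (rule ring_hom_memI) (simp_all add: ring_of_type_algebra_def)
qed (simp_all add: R_zero_eq)

end

section \<open>The universal property\<close>

text \<open>At the lowest exponent \<open>1 - r\<close>: the string of length \<open>j\<close>
  reaches it only for \<open>j = r\<close>, the string of length \<open>r div 2\<close> only for
  \<open>j = 0\<close> and even \<open>r\<close>.\<close>

lemma wy_corr_last:
  fixes S :: "('a, 'm) ring_scheme" (structure)
  assumes "cring S" "j \<le> r" "r \<ge> 1"
  shows "wy_corr S r j (- int (r - 1)) = (if j = r then \<one> else \<zero>) \<ominus> (if even r \<and> j = 0 then \<one> else \<zero>)"
proof -
  have "(even (J - 1 + (N - 1)) \<and> 0 \<le> J - 1 + (N - 1) \<and> J - 1 + (N - 1) < 2 * J) = (J = N)"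
    "(even (J - 1 + (N - 1)) \<and> 0 \<le> J - 1 + (N - 1) \<and> J - 1 + (N - 1) < 2 * M) = (even N \<and> J = 0)"
    if "0 \<le> J" "J \<le> N" "1 \<le> N" "2 * M \<le> N" "N \<le> 2 * M + 1" for J N M :: int
    using that by presburger+
  moreover have "2 * int (r div 2) \<le> int r" "int r \<le> 2 * int (r div 2) + 1" by linarith+
  moreover have "0 \<le> int j" "int j \<le> int r" "1 \<le> int r" "- int (r - 1) = - (int r - 1)" using assms by auto
  ultimately have "(even (int j - 1 + (int r - 1)) \<and> 0 \<le> int j - 1 + (int r - 1) \<and> int j - 1 + (int r - 1) < 2 * int j) = (j = r)"
    "(even (int j - 1 + (int r - 1)) \<and> 0 \<le> int j - 1 + (int r - 1) \<and> int j - 1 + (int r - 1) < 2 * int (r div 2)) = (even r \<and> j = 0)"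
    by (metis int_int_eq, metis even_of_nat of_nat_eq_0_iff)
  then show ?thesis unfolding wy_corr_def \<open>- int (r - 1) = - (int r - 1)\<close> diff_minus_eq_add by (simp only:)
qed

section \<open>The quadratic equation for \<rho>\<close>

context ground_ring begin

abbreviation "u_prod \<equiv> \<Otimes>i\<in>{1..r}. par_u S i"

lemma u_prod_closed: "u_prod \<in> carrier S" using u_closed by (intro finprod_closed) auto

lemma root_a_0: "root_a r S 0 = (if even r then u_prod else \<ominus> u_prod)"
proof -
  have us: "par_u S \<in> set [1..<Suc r] \<rightarrow> carrier S" using u_closed by auto
  have *: "(\<Otimes>i\<in>{1..n}. \<ominus> par_u S i) = (if even n then \<Otimes>i\<in>{1..n}. par_u S i else \<ominus> (\<Otimes>i\<in>{1..n}. par_u S i))"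
    if "n \<le> r" for n
    using that
  proof (induction n)
    case (Suc n)
    have ins: "{1..Suc n} = insert (Suc n) {1..n}" by auto
    have cl: "par_u S i \<in> carrier S" if "i \<in> insert (Suc n) {1..n}" for i using that Suc.prems by (intro u_closed) auto
    have p: "(\<Otimes>i\<in>{1..n}. par_u S i) \<in> carrier S" using cl by (intro finprod_closed) auto
    show ?case unfolding ins using Suc cl p
      by (subst (1 2 3) finprod_insert) (auto simp: l_minus r_minus Pi_def)
  qed simp
  have "root_a r S 0 = (\<Otimes>i\<in>set [1..<Suc r]. \<ominus> par_u S i)"
    by (rule root_coeff_0[OF us]) simp
  also have "set [1..<Suc r] = {1..r}" by auto
  finally show ?thesis using *[of r] by simp
qed

text \<open>For \<open>k = r - 1\<close> the relation involves no \<open>\<delta>\<close> except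
  \<open>\<delta>\<^sub>0\<close>. It reads \<open>\<rho>\<^sup>-\<^sup>1 (1 - a_0\<^sup>2) + z
  (\<delta>\<^sub>0 - 1 + \<epsilon>) = 0\<close>, with \<open>\<epsilon> = a_0\<close> for even and
  0 for odd \<open>r\<close>. The ground relation replaces \<open>z (\<delta>\<^sub>0 - 1)\<close>
  by \<open>\<rho> - \<rho>\<^sup>-\<^sup>1\<close>, and multiplication by \<open>\<rho>\<close>
  finishes.\<close>

lemma rho_quadratic:
  assumes wy: "wy_params r S" and r: "r \<ge> 1"
  shows "par_rho S \<otimes> par_rho S \<oplus> (if even r then q_diff S \<otimes> u_prod \<otimes> par_rho S else \<zero>) = u_prod \<otimes> u_prod"
proof -
  let ?a = "root_a r S" and ?z = "q_diff S"
  have k: "r - 1 < r" using r by simp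
  have cl [simp]: "?a j \<in> carrier S" for j by (rule root_coeff_closed) (auto intro: u_closed)
  have zc [simp]: "?z \<in> carrier S" by (rule q_diff_closed)
  have rc [simp]: "par_rho S \<in> carrier S" "inv (par_rho S) \<in> carrier S" "par_delta S 0 \<in> carrier S"
    using rho_unit delta_closed by auto
  have ar: "?a r = \<one>" using root_coeff_top[of "par_u S" "[1..<Suc r]"] u_closed by (auto simp del: upt_Suc)
  define a0 where "a0 = ?a 0"
  have a0c [simp]: "a0 \<in> carrier S" unfolding a0_def by (rule cl)
  define \<epsilon> where "\<epsilon> = (if even r then a0 else \<zero>)"
  have \<epsilon>c [simp]: "\<epsilon> \<in> carrier S" unfolding \<epsilon>_def by simp
  have "(\<Oplus>j\<in>{..r}. ?a j \<otimes> ((if r - 1 < j then par_delta S (j - 1 - (r - 1)) else \<zero>) \<ominus> wy_corr S r j (- int (r - 1))))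
     = (\<Oplus>j\<in>{..r}. (if j = r then par_delta S 0 \<ominus> \<one> else \<zero>) \<oplus> (if j = 0 then \<epsilon> else \<zero>))"
  proof (rule finsum_cong')
    fix j assume "j \<in> {..r}"
    then have j: "j \<le> r" by simp
    show "?a j \<otimes> ((if r - 1 < j then par_delta S (j - 1 - (r - 1)) else \<zero>) \<ominus> wy_corr S r j (- int (r - 1)))
      = (if j = r then par_delta S 0 \<ominus> \<one> else \<zero>) \<oplus> (if j = 0 then \<epsilon> else \<zero>)"
      unfolding wy_corr_last[OF is_cring j r] using j r
      by (cases "j = r") (auto simp: ar \<epsilon>_def a0_def minus_eq l_minus r_minus minus_add simp del: upt_Suc One_nat_def)
  qed auto
  also have "\<dots> = (\<Oplus>j\<in>{..r}. if j = r then par_delta S 0 \<ominus> \<one> else \<zero>) \<oplus> (\<Oplus>j\<in>{..r}. if j = 0 then \<epsilon> else \<zero>)"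
    by (rule finsum_addf) auto
  also have "(\<Oplus>j\<in>{..r}. if j = r then par_delta S 0 \<ominus> \<one> else \<zero>) = par_delta S 0 \<ominus> \<one>"
    by (rule finsum_if_unique) auto
  also have "(\<Oplus>j\<in>{..r}. if j = 0 then \<epsilon> else \<zero>) = \<epsilon>"
    by (rule finsum_if_unique) auto
  finally have s: "(\<Oplus>j\<in>{..r}. ?a j \<otimes> ((if r - 1 < j then par_delta S (j - 1 - (r - 1)) else \<zero>) \<ominus> wy_corr S r j (- int (r - 1))))
     = par_delta S 0 \<ominus> \<one> \<oplus> \<epsilon>" .
  have e: "r - 1 + 1 = r" "r - 1 - (r - 1) = 0" using r by auto
  have "wy_expr r S (inv (par_rho S)) ?z (par_delta S) ?a (r - 1) = \<zero>"
    using wy k unfolding wy_params_def by blast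
  then have 1: "inv (par_rho S) \<otimes> (\<one> \<ominus> a0 \<otimes> a0) \<oplus> ?z \<otimes> (par_delta S 0 \<ominus> \<one> \<oplus> \<epsilon>) = \<zero>"
    unfolding wy_expr_def e s ar a0_def[symmetric] .
  have neg: "(x \<ominus> y) \<otimes> w = \<ominus> ((y \<ominus> x) \<otimes> w)" "\<ominus> (x \<ominus> y) = y \<ominus> x" if "x \<in> carrier S" "y \<in> carrier S" "w \<in> carrier S" for x y w
    using that by algebra+
  have qc: "par_q S \<in> carrier S" "inv (par_q S) \<in> carrier S" using q_unit by auto
  have 2: "?z \<otimes> (par_delta S 0 \<ominus> \<one>) = par_rho S \<ominus> inv (par_rho S)"
    unfolding q_diff_def using neg(1)[OF qc, of "par_delta S 0 \<ominus> \<one>"] neg(2)[of "inv (par_rho S)" "par_rho S" \<one>]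
    by (simp add: ground_relation[symmetric])
  have "\<rho> \<otimes> (\<rho>' \<otimes> (\<one> \<ominus> a \<otimes> a) \<oplus> (zz \<otimes> d \<oplus> zz \<otimes> e)) = (\<rho> \<otimes> \<rho>') \<otimes> (\<one> \<ominus> a \<otimes> a) \<oplus> \<rho> \<otimes> (zz \<otimes> d) \<oplus> zz \<otimes> e \<otimes> \<rho>"
    if "\<rho> \<in> carrier S" "\<rho>' \<in> carrier S" "a \<in> carrier S" "zz \<in> carrier S" "d \<in> carrier S" "e \<in> carrier S" for \<rho> \<rho>' a zz d e
    using that by algebra
  from this[of "par_rho S" "inv (par_rho S)" "a0" ?z "par_delta S 0 \<ominus> \<one>" \<epsilon>]
  have "par_rho S \<otimes> \<zero> = (par_rho S \<otimes> inv (par_rho S)) \<otimes> (\<one> \<ominus> a0 \<otimes> a0) \<oplus> par_rho S \<otimes> (par_rho S \<ominus> inv (par_rho S)) \<oplus> ?z \<otimes> \<epsilon> \<otimes> par_rho S"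
    unfolding 2[symmetric] 1[symmetric] by (simp add: r_distr)
  also have "\<dots> = (\<one> \<ominus> a0 \<otimes> a0) \<oplus> (par_rho S \<otimes> par_rho S \<ominus> \<one>) \<oplus> ?z \<otimes> \<epsilon> \<otimes> par_rho S"
    using rho_unit by (simp add: minus_eq r_distr r_minus)
  also have "\<dots> = (par_rho S \<otimes> par_rho S \<oplus> ?z \<otimes> \<epsilon> \<otimes> par_rho S) \<ominus> a0 \<otimes> a0"
  proof -
    have "(\<one> \<ominus> A) \<oplus> (B \<ominus> \<one>) \<oplus> C = (B \<oplus> C) \<ominus> A" if "A \<in> carrier S" "B \<in> carrier S" "C \<in> carrier S" for A B C
      using that by algebra
    then show ?thesis by simp
  qed
  finally have "(par_rho S \<otimes> par_rho S \<oplus> ?z \<otimes> \<epsilon> \<otimes> par_rho S) \<ominus> a0 \<otimes> a0 = \<zero>" by simp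
  then have "par_rho S \<otimes> par_rho S \<oplus> ?z \<otimes> \<epsilon> \<otimes> par_rho S = a0 \<otimes> a0" by simp
  moreover have "a0 \<otimes> a0 = u_prod \<otimes> u_prod"
    unfolding a0_def root_a_0 using u_prod_closed by (auto simp: l_minus r_minus)
  moreover have "?z \<otimes> \<epsilon> \<otimes> par_rho S = (if even r then ?z \<otimes> u_prod \<otimes> par_rho S else \<zero>)"
    unfolding \<epsilon>_def a0_def root_a_0 by simp
  ultimately show ?thesis by simp
qed

end

context param_hom begin

lemma f_int_mult: "a \<in> carrier T \<Longrightarrow> f ([(k::int)] \<cdot> a) = [k] \<cdot>\<^bsub>R\<^esub> f a"
proof (induction k rule: int_induct[where k = 0])
  case base
  then show ?case by (simp add: int_mult_0 R.int_mult_0)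
next
  case (step1 i)
  then have "[(i + 1)] \<cdot> a = [i] \<cdot> a \<oplus> a" "[(i + 1)] \<cdot>\<^bsub>R\<^esub> f a = [i] \<cdot>\<^bsub>R\<^esub> f a \<oplus>\<^bsub>R\<^esub> f a"
    using add.int_pow_mult[of a i 1] R.add.int_pow_mult[of "f a" i 1] by (simp_all add: add.int_pow_1 R.add.int_pow_1)
  then show ?case using step1 by (simp add: add.int_pow_closed)
next
  case (step2 i)
  then have "[i] \<cdot> a = [(i - 1)] \<cdot> a \<oplus> a" "[i] \<cdot>\<^bsub>R\<^esub> f a = [(i - 1)] \<cdot>\<^bsub>R\<^esub> f a \<oplus>\<^bsub>R\<^esub> f a"
    using add.int_pow_mult[of a "i - 1" 1] R.add.int_pow_mult[of "f a" "i - 1" 1] by (simp_all add: add.int_pow_1 R.add.int_pow_1)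
  then have "f ([(i - 1)] \<cdot> a) \<oplus>\<^bsub>R\<^esub> f a = [(i - 1)] \<cdot>\<^bsub>R\<^esub> f a \<oplus>\<^bsub>R\<^esub> f a"
    using step2 by (metis add.int_pow_closed hom_add)
  then show ?case using step2 R.add.right_cancel by (simp add: add.int_pow_closed R.add.int_pow_closed)
qed

lemma f_mpoly_eval:
  assumes "\<And>i. x i \<in> carrier T" "\<And>i. f (x i) = y i"
  shows "f (mpoly_eval T x P) = mpoly_eval R y P"
  unfolding mpoly_eval_def
proof (rule f_finsum)
  fix m :: "nat \<Rightarrow>\<^sub>0 nat"
  have m: "(\<Otimes>i\<in>Poly_Mapping.keys m. x i [^] Poly_Mapping.lookup m i) \<in> carrier T"
    by (intro finprod_closed Pi_I nat_pow_closed assms(1))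
  then show "[Poly_Mapping.lookup P m] \<cdot> (\<Otimes>i\<in>Poly_Mapping.keys m. x i [^] Poly_Mapping.lookup m i) \<in> carrier T"
    by (rule add.int_pow_closed)
  have "f (\<Otimes>i\<in>Poly_Mapping.keys m. x i [^] Poly_Mapping.lookup m i) = (\<Otimes>\<^bsub>R\<^esub>i\<in>Poly_Mapping.keys m. y i [^]\<^bsub>R\<^esub> Poly_Mapping.lookup m i)"
    using assms by (intro f_finprod) (auto simp: f_pow)
  then show "f ([Poly_Mapping.lookup P m] \<cdot> (\<Otimes>i\<in>Poly_Mapping.keys m. x i [^] Poly_Mapping.lookup m i))
     = [Poly_Mapping.lookup P m] \<cdot>\<^bsub>R\<^esub> (\<Otimes>\<^bsub>R\<^esub>i\<in>Poly_Mapping.keys m. y i [^]\<^bsub>R\<^esub> Poly_Mapping.lookup m i)"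
    using m by (simp add: f_int_mult)
qed

end

definition X_poly :: "nat \<Rightarrow> int_mpoly" where
  "X_poly i = Poly_Mapping.single (Poly_Mapping.single i 1) 1"

definition u_poly :: "nat \<Rightarrow> int_mpoly" where "u_poly r = (\<Prod>i\<in>{1..r}. X_poly i)"

text \<open>Elements of the form \<open>q\<^sup>-\<^sup>N(\<alpha> + \<beta>\<rho>)\<close> with polynomials \<open>\<alpha>, \<beta>\<close> in \<open>q, u\<^sub>1, \<dots>, u\<^sub>r\<close> form a subring
  because \<open>\<rho>\<close> satisfies a monic quadratic equation; all parameters are quotients of such elements.\<close>

locale quadratic_params = ground_ring r T for r and T :: "('a, 'm) param_ring_scheme" (structure) +
  fixes x :: "nat \<Rightarrow> 'a"
  assumes r_pos: "r \<ge> 1" and wy: "wy_params r T"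
    and x_closed: "\<And>i. x i \<in> carrier T"
    and x_q: "x 0 = par_q T" and x_u: "\<And>i. i \<in> {1..r} \<Longrightarrow> x i = par_u T i"
begin

abbreviation "e \<equiv> mpoly_eval T x"

lemmas e_simps = mpoly_eval_add[OF x_closed] mpoly_eval_mult[OF x_closed] mpoly_eval_1[OF x_closed]
  mpoly_eval_0[OF x_closed] mpoly_eval_neg[OF x_closed]

lemma e_closed [simp]: "e P \<in> carrier T" by (rule mpoly_eval_closed[OF x_closed])

lemma e_X: "e (X_poly i) = x i" unfolding X_poly_def by (rule mpoly_eval_var[OF x_closed])

lemma e_u_poly: "e (u_poly r) = u_prod"
proof -
  have "e (\<Prod>i\<in>A. X_poly i) = (\<Otimes>i\<in>A. x i)" if "finite A" for A
    using that by (induction A rule: finite_induct) (auto simp: e_simps e_X x_closed)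
  then have "e (u_poly r) = (\<Otimes>i\<in>{1..r}. x i)" unfolding u_poly_def by simp
  also have "\<dots> = u_prod" by (rule finprod_cong') (auto simp: x_u u_closed)
  finally show ?thesis .
qed

lemma e_pow: "e (P ^ n) = e P [^] n"
  by (induction n) (simp_all add: e_simps m_comm)

text \<open>The coefficients in \<open>q \<rho>\<^sup>2 = rr0 + rr1 \<rho>\<close>. The factor
  \<open>q\<close> clears the inverse of \<open>q\<close> in \<open>z\<close>, so that both are
  polynomials.\<close>

definition "rr0 = X_poly 0 * u_poly r * u_poly r"
definition "rr1 = (if even r then u_poly r - X_poly 0 * X_poly 0 * u_poly r else 0)"

lemma par_closed [simp]: "par_rho T \<in> carrier T" "par_q T \<in> carrier T" "inv (par_q T) \<in> carrier T" "inv (par_rho T) \<in> carrier T"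
  using rho_unit q_unit by auto

lemma q_rho_rho: "par_q T \<otimes> (par_rho T \<otimes> par_rho T) = e rr0 \<oplus> e rr1 \<otimes> par_rho T"
proof -
  let ?p = u_prod and ?q = "par_q T" and ?rho = "par_rho T"
  have p [simp]: "?p \<in> carrier T" by (rule u_prod_closed)
  have rr0: "e rr0 = ?q \<otimes> (?p \<otimes> ?p)" by (simp add: rr0_def e_simps e_X x_q e_u_poly m_assoc del: One_nat_def)
  show ?thesis
  proof (cases "even r")
    case False
    have "?rho \<otimes> ?rho = ?p \<otimes> ?p" using rho_quadratic[OF wy r_pos] False by simp
    then show ?thesis using False rr0 p by (simp add: rr1_def e_simps del: One_nat_def)
  next
    case True
    have 1: "?rho \<otimes> ?rho \<oplus> q_diff T \<otimes> ?p \<otimes> ?rho = ?p \<otimes> ?p" using rho_quadratic[OF wy r_pos] True by simp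
    have rr1: "e rr1 = ?p \<ominus> ?q \<otimes> ?q \<otimes> ?p"
      using True by (simp add: rr1_def e_simps e_X x_q e_u_poly minus_eq diff_conv_add_uminus del: add_uminus_conv_diff)
    have "q \<otimes> (\<rho> \<otimes> \<rho>) = q \<otimes> (\<rho> \<otimes> \<rho> \<oplus> (q \<ominus> q') \<otimes> p \<otimes> \<rho>) \<oplus> ((q \<otimes> q') \<otimes> p \<ominus> q \<otimes> q \<otimes> p) \<otimes> \<rho>"
      if "q \<in> carrier T" "q' \<in> carrier T" "\<rho> \<in> carrier T" "p \<in> carrier T" for q q' \<rho> p using that by algebra
    from this[of ?q "inv ?q" ?rho ?p] show ?thesis
      using 1 q_unit p unfolding rr0 rr1 q_diff_def by (simp del: One_nat_def)
  qed
qed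

definition AA :: "'a set" where
  "AA = {a \<in> carrier T. \<exists>(N::nat) \<alpha> \<beta>. par_q T [^] N \<otimes> a = e \<alpha> \<oplus> e \<beta> \<otimes> par_rho T}"

lemma AA_I: "a \<in> carrier T \<Longrightarrow> par_q T [^] (N::nat) \<otimes> a = e \<alpha> \<oplus> e \<beta> \<otimes> par_rho T \<Longrightarrow> a \<in> AA"
  unfolding AA_def by blast

lemma AA_subring: "subring AA T"
proof (rule subringI)
  show "AA \<subseteq> carrier T" by (auto simp: AA_def)
  show "\<one> \<in> AA" by (rule AA_I[of _ 0 1 0]) (simp_all add: e_simps)
  fix a assume a: "a \<in> AA"
  then obtain N \<alpha> \<beta> where N: "a \<in> carrier T" "par_q T [^] (N::nat) \<otimes> a = e \<alpha> \<oplus> e \<beta> \<otimes> par_rho T"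
    unfolding AA_def by blast
  show "\<ominus> a \<in> AA"
    by (rule AA_I[of _ N "- \<alpha>" "- \<beta>"]) (use N in \<open>simp_all add: e_simps r_minus l_minus minus_add\<close>)
  fix b assume "b \<in> AA"
  then obtain M \<alpha>' \<beta>' where M: "b \<in> carrier T" "par_q T [^] (M::nat) \<otimes> b = e \<alpha>' \<oplus> e \<beta>' \<otimes> par_rho T"
    unfolding AA_def by blast
  let ?q = "par_q T" and ?rho = "par_rho T"
  show "a \<oplus> b \<in> AA"
  proof (rule AA_I[of _ "N + M" "X_poly 0 ^ M * \<alpha> + X_poly 0 ^ N * \<alpha>'" "X_poly 0 ^ M * \<beta> + X_poly 0 ^ N * \<beta>'"])
    have "n \<otimes> m \<otimes> (a \<oplus> b) = m \<otimes> (n \<otimes> a) \<oplus> n \<otimes> (m \<otimes> b)" if "n \<in> carrier T" "m \<in> carrier T" for n m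
      using that N(1) M(1) by algebra
    then have "?q [^] (N + M) \<otimes> (a \<oplus> b) = ?q [^] M \<otimes> (?q [^] N \<otimes> a) \<oplus> ?q [^] N \<otimes> (?q [^] M \<otimes> b)"
      by (simp add: nat_pow_mult[symmetric])
    also have "\<dots> = ?q [^] M \<otimes> (e \<alpha> \<oplus> e \<beta> \<otimes> ?rho) \<oplus> ?q [^] N \<otimes> (e \<alpha>' \<oplus> e \<beta>' \<otimes> ?rho)"
      unfolding N(2) M(2) ..
    also have "\<dots> = (?q [^] M \<otimes> e \<alpha> \<oplus> ?q [^] N \<otimes> e \<alpha>') \<oplus> (?q [^] M \<otimes> e \<beta> \<oplus> ?q [^] N \<otimes> e \<beta>') \<otimes> ?rho"
    proof -
      have "m \<otimes> (a1 \<oplus> b1 \<otimes> \<rho>) \<oplus> n \<otimes> (a2 \<oplus> b2 \<otimes> \<rho>) = (m \<otimes> a1 \<oplus> n \<otimes> a2) \<oplus> (m \<otimes> b1 \<oplus> n \<otimes> b2) \<otimes> \<rho>"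
        if "m \<in> carrier T" "n \<in> carrier T" "a1 \<in> carrier T" "a2 \<in> carrier T" "b1 \<in> carrier T" "b2 \<in> carrier T" "\<rho> \<in> carrier T"
        for m n a1 a2 b1 b2 \<rho> using that by algebra
      then show ?thesis by simp
    qed
    finally show "?q [^] (N + M) \<otimes> (a \<oplus> b) = e (X_poly 0 ^ M * \<alpha> + X_poly 0 ^ N * \<alpha>') \<oplus> e (X_poly 0 ^ M * \<beta> + X_poly 0 ^ N * \<beta>') \<otimes> ?rho"
      by (simp add: e_simps e_pow e_X x_q)
  qed (use N M in simp)
  show "a \<otimes> b \<in> AA"
  \<comment> \<open>The product contains \<open>\<rho>\<^sup>2\<close>, and rewriting it costs one
    more power of \<open>q\<close>.\<close>
  proof (rule AA_I[of _ "Suc (N + M)" "X_poly 0 * \<alpha> * \<alpha>' + \<beta> * \<beta>' * rr0" "X_poly 0 * (\<alpha> * \<beta>' + \<beta> * \<alpha>') + \<beta> * \<beta>' * rr1"])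
    have "n \<otimes> m \<otimes> q \<otimes> (a \<otimes> b) = q \<otimes> ((n \<otimes> a) \<otimes> (m \<otimes> b))" if "n \<in> carrier T" "m \<in> carrier T" "q \<in> carrier T" for n m q
      using that N(1) M(1) by algebra
    then have "?q [^] Suc (N + M) \<otimes> (a \<otimes> b) = ?q \<otimes> ((?q [^] N \<otimes> a) \<otimes> (?q [^] M \<otimes> b))"
      by (simp add: nat_pow_mult[symmetric])
    also have "\<dots> = ?q \<otimes> ((e \<alpha> \<oplus> e \<beta> \<otimes> ?rho) \<otimes> (e \<alpha>' \<oplus> e \<beta>' \<otimes> ?rho))"
      unfolding N(2) M(2) ..
    also have "\<dots> = ?q \<otimes> e \<alpha> \<otimes> e \<alpha>' \<oplus> ?q \<otimes> (e \<alpha> \<otimes> e \<beta>' \<oplus> e \<beta> \<otimes> e \<alpha>') \<otimes> ?rho \<oplus> e \<beta> \<otimes> e \<beta>' \<otimes> (?q \<otimes> (?rho \<otimes> ?rho))"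
    proof -
      have "q \<otimes> ((a1 \<oplus> b1 \<otimes> \<rho>) \<otimes> (a2 \<oplus> b2 \<otimes> \<rho>)) = q \<otimes> a1 \<otimes> a2 \<oplus> q \<otimes> (a1 \<otimes> b2 \<oplus> b1 \<otimes> a2) \<otimes> \<rho> \<oplus> b1 \<otimes> b2 \<otimes> (q \<otimes> (\<rho> \<otimes> \<rho>))"
        if "q \<in> carrier T" "a1 \<in> carrier T" "a2 \<in> carrier T" "b1 \<in> carrier T" "b2 \<in> carrier T" "\<rho> \<in> carrier T"
        for q a1 a2 b1 b2 \<rho> using that by algebra
      then show ?thesis by simp
    qed
    also have "\<dots> = (?q \<otimes> e \<alpha> \<otimes> e \<alpha>' \<oplus> e \<beta> \<otimes> e \<beta>' \<otimes> e rr0) \<oplus> (?q \<otimes> (e \<alpha> \<otimes> e \<beta>' \<oplus> e \<beta> \<otimes> e \<alpha>') \<oplus> e \<beta> \<otimes> e \<beta>' \<otimes> e rr1) \<otimes> ?rho"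
    proof -
      have "A \<oplus> B \<otimes> \<rho> \<oplus> C \<otimes> (w1 \<oplus> w2 \<otimes> \<rho>) = (A \<oplus> C \<otimes> w1) \<oplus> (B \<oplus> C \<otimes> w2) \<otimes> \<rho>"
        if "A \<in> carrier T" "B \<in> carrier T" "C \<in> carrier T" "w1 \<in> carrier T" "w2 \<in> carrier T" "\<rho> \<in> carrier T"
        for A B C w1 w2 \<rho> using that by algebra
      then show ?thesis unfolding q_rho_rho by simp
    qed
    finally show "?q [^] Suc (N + M) \<otimes> (a \<otimes> b) = e (X_poly 0 * \<alpha> * \<alpha>' + \<beta> * \<beta>' * rr0) \<oplus> e (X_poly 0 * (\<alpha> * \<beta>' + \<beta> * \<alpha>') + \<beta> * \<beta>' * rr1) \<otimes> ?rho"
      by (simp add: e_simps e_X x_q m_assoc)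
  qed (use N M in simp)
qed

definition nzd :: "'a \<Rightarrow> bool" where
  "nzd d \<longleftrightarrow> d \<in> carrier T \<and> (\<forall>y\<in>carrier T. d \<otimes> y = \<zero> \<longrightarrow> y = \<zero>)"

lemma nzd_mult: "nzd c \<Longrightarrow> nzd d \<Longrightarrow> nzd (c \<otimes> d)"
  unfolding nzd_def by (metis m_assoc m_closed)

lemma nzd_unit: "c \<in> Units T \<Longrightarrow> nzd c"
  unfolding nzd_def by (metis Units_closed Units_l_cancel r_null zero_closed)

text \<open>Denominators are non-zero-divisors and not only units, because
  \<open>\<delta>\<^sub>j\<close> is known only through \<open>z \<delta>\<^sub>j\<close>, and
  \<open>z\<close> need not be invertible.\<close>

definition QQ :: "'a set" where
  "QQ = {x \<in> carrier T. \<exists>c\<in>AA. \<exists>d\<in>AA. nzd d \<and> d \<otimes> x = c}"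

lemma AA_closed: "a \<in> AA \<Longrightarrow> a \<in> carrier T" by (simp add: AA_def)

lemma QQ_I: "w \<in> carrier T \<Longrightarrow> c \<in> AA \<Longrightarrow> d \<in> AA \<Longrightarrow> nzd d \<Longrightarrow> d \<otimes> w = c \<Longrightarrow> w \<in> QQ"
  unfolding QQ_def by blast

lemma QQ_subring: "subring QQ T"
proof (rule subringI)
  note AA = subringE(3,5,6,7)[OF AA_subring]
  show "QQ \<subseteq> carrier T" by (auto simp: QQ_def)
  show "\<one> \<in> QQ" by (rule QQ_I[of _ \<one> \<one>]) (auto simp: AA nzd_unit)
  fix a assume "a \<in> QQ"
  then obtain c d where a: "a \<in> carrier T" "c \<in> AA" "d \<in> AA" "nzd d" "d \<otimes> a = c" unfolding QQ_def by blast
  note cl = a(1) AA_closed[OF a(2)] AA_closed[OF a(3)]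
  show "\<ominus> a \<in> QQ" by (rule QQ_I[of _ "\<ominus> c" d]) (use a cl AA in \<open>auto simp: r_minus\<close>)
  fix b assume "b \<in> QQ"
  then obtain c' d' where b: "b \<in> carrier T" "c' \<in> AA" "d' \<in> AA" "nzd d'" "d' \<otimes> b = c'" unfolding QQ_def by blast
  note cl' = b(1) AA_closed[OF b(2)] AA_closed[OF b(3)]
  have "(d \<otimes> d') \<otimes> (a \<otimes> b) = (d \<otimes> a) \<otimes> (d' \<otimes> b)" using cl cl' by algebra
  then show "a \<otimes> b \<in> QQ" by (intro QQ_I[of _ "c \<otimes> c'" "d \<otimes> d'"]) (use a b cl cl' AA nzd_mult in auto)
  have "(d \<otimes> d') \<otimes> (a \<oplus> b) = (d \<otimes> a) \<otimes> d' \<oplus> d \<otimes> (d' \<otimes> b)" using cl cl' by algebra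
  then show "a \<oplus> b \<in> QQ" by (intro QQ_I[of _ "c \<otimes> d' \<oplus> d \<otimes> c'" "d \<otimes> d'"]) (use a b cl cl' AA nzd_mult in auto)
qed

lemma AA_QQ: "a \<in> AA \<Longrightarrow> a \<in> QQ"
  by (rule QQ_I[of _ a \<one>]) (auto simp: AA_closed subringE(3)[OF AA_subring] nzd_unit)

text \<open>This closure property yields the inverses of the parameters as well as the hypothesis
  \<open>div\<close> of \<open>wy_delta_closed\<close>.\<close>

lemma QQ_div:
  assumes y: "y \<in> QQ" "nzd y" and w: "w \<in> carrier T" "y \<otimes> w \<in> QQ"
  shows "w \<in> QQ"
proof -
  note AA = subringE(3,5,6,7)[OF AA_subring]
  obtain c d where 1: "y \<in> carrier T" "c \<in> AA" "d \<in> AA" "nzd d" "d \<otimes> y = c" using y(1) unfolding QQ_def by blast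
  obtain c' d' where 2: "c' \<in> AA" "d' \<in> AA" "nzd d'" "d' \<otimes> (y \<otimes> w) = c'" using w(2) unfolding QQ_def by blast
  note cl = w(1) 1(1) AA_closed[OF 1(2)] AA_closed[OF 1(3)] AA_closed[OF 2(1)] AA_closed[OF 2(2)]
  have "(d' \<otimes> (d \<otimes> y)) \<otimes> w = d \<otimes> (d' \<otimes> (y \<otimes> w))" using cl by algebra
  moreover have "nzd (d \<otimes> y)" using 1 y nzd_mult by blast
  ultimately show ?thesis
    by (intro QQ_I[of _ "d \<otimes> c'" "d' \<otimes> c"]) (use 1 2 w AA nzd_mult in auto)
qed

lemma QQ_inv: "y \<in> QQ \<Longrightarrow> y \<in> Units T \<Longrightarrow> inv y \<in> QQ"
  by (rule QQ_div[of y]) (auto simp: nzd_unit subringE(3)[OF QQ_subring])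

lemma gens_QQ: "param_gens r T \<subseteq> QQ" and delta_QQ: "par_delta T j \<in> QQ"
proof -
  have eA: "e P \<in> QQ" for P by (rule AA_QQ, rule AA_I[of _ 0 P 0]) (simp_all add: e_simps)
  have q: "par_q T \<in> QQ" using eA[of "X_poly 0"] by (simp add: e_X x_q)
  have u: "par_u T i \<in> QQ" if "i \<in> {1..r}" for i using eA[of "X_poly i"] x_u[OF that] by (simp add: e_X)
  have rho: "par_rho T \<in> QQ" by (rule AA_QQ, rule AA_I[of _ 0 0 1]) (simp_all add: e_simps)
  note inv = QQ_inv[OF q q_unit] QQ_inv[OF rho rho_unit] QQ_inv[OF u u_unit]
  have z: "q_diff T \<in> QQ" unfolding q_diff_def minus_eq
    by (intro subringE(5,7)[OF QQ_subring] q inv)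
  have nz: "nzd (q_diff T)" using wy q_diff_closed unfolding wy_params_def nzd_def by blast
  have small: "par_delta T j \<in> QQ" if "j < r" for j
  proof (rule wy_delta_closed[OF QQ_subring u inv(2) z _ _ that])
    show "w \<in> QQ" if "w \<in> carrier T" "q_diff T \<otimes> w \<in> QQ" for w by (rule QQ_div[OF z nz that])
    show "wy_expr r T (inv (par_rho T)) (q_diff T) (par_delta T) (root_a r T) k = \<zero>" if "k < r" for k
      using wy that unfolding wy_params_def by blast
  qed
  have rec: "root_rec r T" using wy unfolding wy_params_def by blast
  have d: "par_delta T j \<in> QQ" for j
    by (rule subring_delta[OF QQ_subring u rec small])
  then show "par_delta T j \<in> QQ" .
  have "{par_q T, inv (par_q T), par_rho T, inv (par_rho T), par_delta T 0, inv (par_delta T 0)} \<subseteq> QQ"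
    using q rho inv(1,2) d QQ_inv[OF d delta0_unit] by simp
  moreover have "{par_delta T j | j. j \<in> {1..<r}} \<subseteq> QQ" using d by auto
  moreover have "{par_u T i | i. i \<in> {1..r}} \<subseteq> QQ" by (rule subsetI, elim CollectE exE conjE) (simp only: u)
  moreover have "{inv (par_u T i) | i. i \<in> {1..r}} \<subseteq> QQ" by (rule subsetI, elim CollectE exE conjE) (simp only: inv(3))
  ultimately show "param_gens r T \<subseteq> QQ" unfolding param_gens_def by (intro Un_least)
qed

lemma generated_QQ: "generate_ring T (param_gens r T) \<subseteq> QQ"
  by (rule generate_ring_min_subring1[OF param_gens_closed QQ_subring gens_QQ])

end

text \<open>The graph is the subring of \<open>R \<times> S\<close> generated by the pairs of
  parameters. It is total over the generated subring of \<open>R\<close>, as every generator of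
  \<open>R\<close> lifts, and single-valued by \<open>transfer\<close>; the only relations of
  \<open>R\<close> to be examined are those linear in \<open>\<rho>\<close>.\<close>

theorem universal_map:
  fixes R :: "('a, 'm) param_ring_scheme" and S :: "('b, 'n) param_ring_scheme"
  assumes r: "r \<ge> 1" and wyR: "wy_params r R" and wyS: "wy_params r S"
    and y: "\<And>i. y i \<in> carrier R" "y 0 = par_q R" "\<And>i. i \<in> {1..r} \<Longrightarrow> y i = par_u R i"
    and w: "\<And>i. w i \<in> carrier S" "w 0 = par_q S" "\<And>i. i \<in> {1..r} \<Longrightarrow> w i = par_u S i"
    and transfer: "\<And>\<alpha> \<beta>. mpoly_eval R y \<alpha> \<oplus>\<^bsub>R\<^esub> mpoly_eval R y \<beta> \<otimes>\<^bsub>R\<^esub> par_rho R = \<zero>\<^bsub>R\<^esub> \<Longrightarrow>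
        mpoly_eval S w \<alpha> \<oplus>\<^bsub>S\<^esub> mpoly_eval S w \<beta> \<otimes>\<^bsub>S\<^esub> par_rho S = \<zero>\<^bsub>S\<^esub>"
  shows "\<exists>\<phi>. \<phi> \<in> ring_hom (R\<lparr>carrier := generate_ring R (param_gens r R)\<rparr>) S \<and> \<phi> (par_rho R) = par_rho S
     \<and> \<phi> (par_q R) = par_q S \<and> (\<forall>j. \<phi> (par_delta R j) = par_delta S j) \<and> (\<forall>i\<in>{1..r}. \<phi> (par_u R i) = par_u S i)"
proof -
  let ?T = "param_prod R S"
  have gR: "ground_ring r R" and gS: "ground_ring r S" using wyR wyS by (auto simp: wy_params_def)
  interpret f: param_hom r ?T R fst by (rule param_prod_homs[OF gR gS])
  interpret g: param_hom r ?T S snd by (rule param_prod_homs[OF gR gS])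
  interpret Q: quadratic_params r ?T "\<lambda>i. (y i, w i)"
    by unfold_locales (use r param_prod_wy_params[OF wyR wyS] y w in auto)
  let ?G = "generate_ring ?T (param_gens r ?T)" and ?H = "generate_ring R (param_gens r R)"
  have G_carrier: "a \<in> carrier R" "s \<in> carrier S" if "(a, s) \<in> ?G" for a s
    using subringE(1)[OF f.generated_subring] that by auto
  \<comment> \<open>Single-valuedness over 0. After multiplication by a non-zero-divisor
    \<open>d\<close> of the product and a power of \<open>q\<close>, the pair has the form
    \<open>\<alpha> + \<beta> \<rho>\<close> with the same polynomials in both components. The first
    component vanishes, hence by \<open>transfer\<close> also the second, and \<open>d\<close> is
    cancelled.\<close>
  have zero: "s = \<zero>\<^bsub>S\<^esub>" if "(\<zero>\<^bsub>R\<^esub>, s) \<in> ?G" for s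
  proof -
    have s: "s \<in> carrier S" using G_carrier(2)[OF that] .
    have "(\<zero>\<^bsub>R\<^esub>, s) \<in> Q.QQ" using Q.generated_QQ that by blast
    then obtain c d where cd: "c \<in> Q.AA" "d \<in> Q.AA" "Q.nzd d" "d \<otimes>\<^bsub>?T\<^esub> (\<zero>\<^bsub>R\<^esub>, s) = c"
      unfolding Q.QQ_def by blast
    have dc: "d \<in> carrier ?T" "c \<in> carrier ?T" using cd(1,2) Q.AA_closed by auto
    have c0: "fst c = \<zero>\<^bsub>R\<^esub>" using cd(4) dc(1) by auto
    obtain N \<alpha> \<beta> where N: "par_q ?T [^]\<^bsub>?T\<^esub> (N::nat) \<otimes>\<^bsub>?T\<^esub> c = Q.e \<alpha> \<oplus>\<^bsub>?T\<^esub> Q.e \<beta> \<otimes>\<^bsub>?T\<^esub> par_rho ?T"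
      using cd(1) unfolding Q.AA_def by blast
    have cl: "(y i, w i) \<in> carrier ?T" for i using y w by simp
    have e: "fst (Q.e P) = mpoly_eval R y P" "snd (Q.e P) = mpoly_eval S w P" for P
      by (rule f.f_mpoly_eval g.f_mpoly_eval; use cl in simp)+
    have qN: "par_q ?T [^]\<^bsub>?T\<^esub> N \<in> carrier ?T" by (rule f.nat_pow_closed) (rule Q.par_closed)
    then have "fst (par_q ?T [^]\<^bsub>?T\<^esub> N \<otimes>\<^bsub>?T\<^esub> c) = \<zero>\<^bsub>R\<^esub>" using c0 by auto
    then have "mpoly_eval R y \<alpha> \<oplus>\<^bsub>R\<^esub> mpoly_eval R y \<beta> \<otimes>\<^bsub>R\<^esub> par_rho R = \<zero>\<^bsub>R\<^esub>"
      unfolding N by (simp add: e)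
    then have "mpoly_eval S w \<alpha> \<oplus>\<^bsub>S\<^esub> mpoly_eval S w \<beta> \<otimes>\<^bsub>S\<^esub> par_rho S = \<zero>\<^bsub>S\<^esub>" by (rule transfer)
    then have "snd (par_q ?T [^]\<^bsub>?T\<^esub> N \<otimes>\<^bsub>?T\<^esub> c) = \<zero>\<^bsub>S\<^esub>" unfolding N by (simp add: e)
    then have "par_q ?T [^]\<^bsub>?T\<^esub> N \<otimes>\<^bsub>?T\<^esub> c = \<zero>\<^bsub>?T\<^esub>"
      using \<open>fst (par_q ?T [^]\<^bsub>?T\<^esub> N \<otimes>\<^bsub>?T\<^esub> c) = \<zero>\<^bsub>R\<^esub>\<close> by (simp add: prod_eq_iff)
    moreover have "par_q ?T [^]\<^bsub>?T\<^esub> N \<in> Units ?T" by (intro f.Units_pow_closed f.q_unit)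
    ultimately have "c = \<zero>\<^bsub>?T\<^esub>" using Q.nzd_unit dc(2) unfolding Q.nzd_def by blast
    moreover have "(\<zero>\<^bsub>R\<^esub>, s) \<in> carrier ?T" using s by simp
    ultimately have "(\<zero>\<^bsub>R\<^esub>, s) = \<zero>\<^bsub>?T\<^esub>" using cd(3,4) unfolding Q.nzd_def by blast
    then show ?thesis by simp
  qed
  have unique: "s = s'" if "(a, s) \<in> ?G" "(a, s') \<in> ?G" for a s s'
  proof -
    note c = G_carrier[OF that(1)] G_carrier[OF that(2)]
    have "(a, s) \<oplus>\<^bsub>?T\<^esub> \<ominus>\<^bsub>?T\<^esub> (a, s') \<in> ?G" using that by (intro generate_ring.eng_add generate_ring.a_inv)
    moreover have "(a, s) \<oplus>\<^bsub>?T\<^esub> \<ominus>\<^bsub>?T\<^esub> (a, s') = (\<zero>\<^bsub>R\<^esub>, s \<ominus>\<^bsub>S\<^esub> s')"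
      using c by (simp add: param_prod_neg[OF f.R.is_cring g.R.is_cring] f.R.r_neg g.R.minus_eq)
    ultimately have "s \<ominus>\<^bsub>S\<^esub> s' = \<zero>\<^bsub>S\<^esub>" using zero by simp
    then show ?thesis using c by simp
  qed
  have gens: "\<exists>s. (a, s) \<in> param_gens r ?T" if a: "a \<in> param_gens r R" for a
  proof -
    note inv = param_prod_inv(1)[OF f.R.is_cring g.R.is_cring]
    have i: "inv\<^bsub>?T\<^esub> par_q ?T = (inv\<^bsub>R\<^esub> par_q R, inv\<^bsub>S\<^esub> par_q S)" "inv\<^bsub>?T\<^esub> par_rho ?T = (inv\<^bsub>R\<^esub> par_rho R, inv\<^bsub>S\<^esub> par_rho S)"
      "inv\<^bsub>?T\<^esub> par_delta ?T 0 = (inv\<^bsub>R\<^esub> par_delta R 0, inv\<^bsub>S\<^esub> par_delta S 0)"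
      "\<And>i. i \<in> {1..r} \<Longrightarrow> inv\<^bsub>?T\<^esub> par_u ?T i = (inv\<^bsub>R\<^esub> par_u R i, inv\<^bsub>S\<^esub> par_u S i)"
      using f.R.q_unit g.R.q_unit f.R.rho_unit g.R.rho_unit f.R.delta0_unit g.R.delta0_unit f.R.u_unit g.R.u_unit
      by (simp_all add: inv del: One_nat_def)
    consider "a = par_q R" | "a = inv\<^bsub>R\<^esub> par_q R" | "a = par_rho R" | "a = inv\<^bsub>R\<^esub> par_rho R"
      | "a = par_delta R 0" | "a = inv\<^bsub>R\<^esub> par_delta R 0" | j where "a = par_delta R j" "j \<in> {1..<r}"
      | i where "a = par_u R i" "i \<in> {1..r}" | i where "a = inv\<^bsub>R\<^esub> par_u R i" "i \<in> {1..r}"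
      using a unfolding param_gens_def by blast
    then show ?thesis
    proof cases
      case 1
      then have "(a, par_q S) = par_q ?T" by simp
      then show ?thesis unfolding param_gens_def by blast
    next
      case 2
      then have "(a, inv\<^bsub>S\<^esub> par_q S) = inv\<^bsub>?T\<^esub> par_q ?T" using i by simp
      then show ?thesis unfolding param_gens_def by blast
    next
      case 3
      then have "(a, par_rho S) = par_rho ?T" by simp
      then show ?thesis unfolding param_gens_def by blast
    next
      case 4
      then have "(a, inv\<^bsub>S\<^esub> par_rho S) = inv\<^bsub>?T\<^esub> par_rho ?T" using i by simp
      then show ?thesis unfolding param_gens_def by blast
    next
      case 5
      then have "(a, par_delta S 0) = par_delta ?T 0" by simp
      then show ?thesis unfolding param_gens_def by blast
    next
      case 6
      then have "(a, inv\<^bsub>S\<^esub> par_delta S 0) = inv\<^bsub>?T\<^esub> par_delta ?T 0" using i by simp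
      then show ?thesis unfolding param_gens_def by blast
    next
      case (7 j)
      then have "(a, par_delta S j) = par_delta ?T j" by simp
      then show ?thesis using 7(2) unfolding param_gens_def by blast
    next
      case (8 i)
      then have "(a, par_u S i) = par_u ?T i" by simp
      then show ?thesis using 8(2) unfolding param_gens_def by blast
    next
      case (9 j)
      then have "(a, inv\<^bsub>S\<^esub> par_u S j) = inv\<^bsub>?T\<^esub> par_u ?T j" using i(4) by simp
      then show ?thesis using 9(2) unfolding param_gens_def by blast
    qed
  qed
  have ex: "\<exists>s. (a, s) \<in> ?G" if "a \<in> ?H" for a
    using that
  proof (induction rule: generate_ring.induct)
    case one
    have "(\<one>\<^bsub>R\<^esub>, \<one>\<^bsub>S\<^esub>) \<in> ?G" using generate_ring.one[of ?T] by simp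
    then show ?case by blast
  next
    case (incl h)
    then show ?case using gens generate_ring.incl[of _ "param_gens r ?T" ?T] by blast
  next
    case (a_inv h)
    then obtain s where s: "(h, s) \<in> ?G" by blast
    then have "\<ominus>\<^bsub>?T\<^esub> (h, s) \<in> ?G" by (rule generate_ring.a_inv)
    then show ?case using G_carrier[OF s] by (auto simp: param_prod_neg[OF f.R.is_cring g.R.is_cring])
  next
    case (eng_add h1 h2)
    then obtain s1 s2 where "(h1, s1) \<in> ?G" "(h2, s2) \<in> ?G" by blast
    then have "(h1, s1) \<oplus>\<^bsub>?T\<^esub> (h2, s2) \<in> ?G" by (rule generate_ring.eng_add)
    then show ?case by auto
  next
    case (eng_mult h1 h2)
    then obtain s1 s2 where "(h1, s1) \<in> ?G" "(h2, s2) \<in> ?G" by blast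
    then have "(h1, s1) \<otimes>\<^bsub>?T\<^esub> (h2, s2) \<in> ?G" by (rule generate_ring.eng_mult)
    then show ?case by auto
  qed
  define \<phi> where "\<phi> a = (SOME s. (a, s) \<in> ?G)" for a
  have \<phi>: "\<phi> a = s" if "(a, s) \<in> ?G" for a s
    using someI[of "\<lambda>s. (a, s) \<in> ?G", OF that] unique that unfolding \<phi>_def by blast
  have \<phi>G: "(a, \<phi> a) \<in> ?G" if "a \<in> ?H" for a using ex[OF that] \<phi> by blast
  have "\<phi> \<in> ring_hom (R\<lparr>carrier := ?H\<rparr>) S"
  proof (rule ring_hom_memI)
    fix a assume a: "a \<in> carrier (R\<lparr>carrier := ?H\<rparr>)"
    then show "\<phi> a \<in> carrier S" using \<phi>G[of a] G_carrier by simp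
    fix b assume b: "b \<in> carrier (R\<lparr>carrier := ?H\<rparr>)"
    have "(a, \<phi> a) \<otimes>\<^bsub>?T\<^esub> (b, \<phi> b) \<in> ?G" "(a, \<phi> a) \<oplus>\<^bsub>?T\<^esub> (b, \<phi> b) \<in> ?G"
      using \<phi>G[of a] \<phi>G[of b] a b by (auto intro: generate_ring.eng_mult generate_ring.eng_add simp del: param_prod_simps)
    then show "\<phi> (a \<otimes>\<^bsub>R\<lparr>carrier := ?H\<rparr>\<^esub> b) = \<phi> a \<otimes>\<^bsub>S\<^esub> \<phi> b" "\<phi> (a \<oplus>\<^bsub>R\<lparr>carrier := ?H\<rparr>\<^esub> b) = \<phi> a \<oplus>\<^bsub>S\<^esub> \<phi> b"
      using \<phi> by simp_all
  next
    show "\<phi> \<one>\<^bsub>R\<lparr>carrier := ?H\<rparr>\<^esub> = \<one>\<^bsub>S\<^esub>" using generate_ring.one[of ?T] \<phi> by simp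
  qed
  moreover have "(par_rho R, par_rho S) \<in> ?G" "(par_q R, par_q S) \<in> ?G"
    by (rule generate_ring.incl; simp add: param_gens_def)+
  moreover have "(par_u R i, par_u S i) \<in> ?G" if "i \<in> {1..r}" for i
  proof (rule generate_ring.incl)
    have "par_u ?T i \<in> param_gens r ?T" unfolding param_gens_def using that by blast
    then show "(par_u R i, par_u S i) \<in> param_gens r ?T" by simp
  qed
  moreover have "(par_delta R j, par_delta S j) \<in> ?G" for j
    using f.generated_delta[OF r, of j] param_prod_wy_params[OF wyR wyS] by (simp add: wy_params_def)
  ultimately show ?thesis using \<phi> by blast
qed

lemma ground_morphism_comp:
  assumes "ground_morphism r A B f" "ground_morphism r B D g"
  shows "ground_morphism r A D (g \<circ> f)"
proof -
  interpret A: ground_ring r A using assms by (simp add: ground_morphism_def)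
  interpret B: ground_ring r B using assms by (simp add: ground_morphism_def)
  interpret D: ground_ring r D using assms by (simp add: ground_morphism_def)
  have g: "g \<in> ring_hom B D" using assms by (simp add: ground_morphism_def)
  interpret g: ring_hom_cring B D g by (rule ring_hom_cringI[OF B.is_cring D.is_cring g])
  have qB: "par_q B \<in> carrier B" "inv\<^bsub>B\<^esub> par_q B \<in> carrier B" "par_rho B \<in> carrier B" using B.q_unit B.rho_unit by auto
  have qD: "par_q D \<in> carrier D" "inv\<^bsub>D\<^esub> par_q D \<in> carrier D" "par_rho D \<in> carrier D" using D.q_unit D.rho_unit by auto
  have invs: "g (inv\<^bsub>B\<^esub> par_q B) = inv\<^bsub>D\<^esub> (g (par_q B))"
  proof -
    have "g (par_q B) \<otimes>\<^bsub>D\<^esub> g (inv\<^bsub>B\<^esub> par_q B) = \<one>\<^bsub>D\<^esub>" "g (inv\<^bsub>B\<^esub> par_q B) \<otimes>\<^bsub>D\<^esub> g (par_q B) = \<one>\<^bsub>D\<^esub>"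
      unfolding g.hom_mult[OF qB(1,2), symmetric] g.hom_mult[OF qB(2,1), symmetric] using B.q_unit by simp_all
    then show ?thesis using qB by (intro D.inv_char[symmetric]) auto
  qed
  have inv_neg: "inv\<^bsub>D\<^esub> (\<ominus>\<^bsub>D\<^esub> x) = \<ominus>\<^bsub>D\<^esub> (inv\<^bsub>D\<^esub> x)" if "x \<in> Units D" for x
    using that D.Units_closed[OF that] D.Units_inv_closed[OF that]
    by (intro D.inv_char) (simp_all add: D.l_minus D.r_minus)
  have inv_qD: "inv\<^bsub>D\<^esub> (inv\<^bsub>D\<^esub> par_q D) = par_q D" "inv\<^bsub>D\<^esub> par_q D \<in> Units D" using D.q_unit by auto
  have "(g \<circ> f) \<in> ring_hom A D" using assms by (intro ring_hom_trans[of f A B]) (auto simp: ground_morphism_def)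
  then show ?thesis
    using assms qB qD unfolding ground_morphism_def
    by (auto simp: invs inv_neg[OF D.q_unit] inv_neg[OF inv_qD(2)] inv_qD)
qed

lemma ring_hom_twist: "ring_hom A (param_twist S) = ring_hom A S"
  by (simp add: ring_hom_def param_twist_def)

lemma of_mpoly_X: "of_mpoly (X_poly i) = indet i"
  by (simp add: X_poly_def indet_mono mono_def)

lemma of_mpoly_u_poly: "of_mpoly (u_poly r) = (\<Prod>i\<in>{1..r}. indet i)"
proof -
  have "of_mpoly (\<Prod>i\<in>A. X_poly i) = (\<Prod>i\<in>A. indet i)" if "finite A" for A
    using that by (induction A rule: finite_induct) (simp_all add: of_mpoly_1 of_mpoly_mult of_mpoly_X)
  then show ?thesis by (simp add: u_poly_def)
qed

section \<open>Relations linear in \<rho> over integer polynomials, and the maps out of the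
  universal rings\<close>

context universal_data begin

definition yF :: "nat \<Rightarrow> ratfun" where "yF = indet"
definition yFF :: "nat \<Rightarrow> ratfun \<times> ratfun" where
  "yFF i = (indet i, if i = 0 then inverse (indet 0) else indet i)"
text \<open>\<open>universal_map\<close> evaluates at families over all natural numbers; the default
  1 at indices above \<open>r\<close> keeps every value in the carrier.\<close>

definition wS :: "('a, 'm) param_ring_scheme \<Rightarrow> nat \<Rightarrow> 'a" where
  "wS S i = (if i = 0 then par_q S else if i \<in> {1..r} then par_u S i else \<one>\<^bsub>S\<^esub>)"

lemma wS:
  assumes "ground_ring r S"
  shows "wS S i \<in> carrier S" "wS S 0 = par_q S" "i \<in> {1..r} \<Longrightarrow> wS S i = par_u S i"
proof -
  interpret ground_ring r S by (rule assms)
  show "wS S i \<in> carrier S" "wS S 0 = par_q S" "i \<in> {1..r} \<Longrightarrow> wS S i = par_u S i"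
    unfolding wS_def using q_unit u_closed[of i] by auto
qed

lemma eval_S_u_poly:
  fixes S :: "('a, 'm) param_ring_scheme" (structure)
  assumes "ground_ring r S"
  shows "mpoly_eval S (wS S) (u_poly r) = (\<Otimes>\<^bsub>S\<^esub>i\<in>{1..r}. par_u S i)"
proof -
  interpret ground_ring r S by (rule assms)
  note w = wS[OF assms]
  have e: "mpoly_eval S (wS S) (X_poly i) = wS S i" for i
    unfolding X_poly_def by (rule mpoly_eval_var[OF w(1)])
  have "mpoly_eval S (wS S) (\<Prod>i\<in>B. X_poly i) = (\<Otimes>i\<in>B. wS S i)" if "finite B" for B
    using that by (induction B rule: finite_induct) (auto simp: mpoly_eval_1[OF w(1)] mpoly_eval_mult[OF w(1)] e w(1))
  then have "mpoly_eval S (wS S) (u_poly r) = (\<Otimes>i\<in>{1..r}. wS S i)" unfolding u_poly_def by simp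
  also have "\<dots> = (\<Otimes>i\<in>{1..r}. par_u S i)" by (rule finprod_cong') (auto simp: w(3) u_closed)
  finally show ?thesis .
qed

lemma eval_F: "mpoly_eval F yF P = of_mpoly P"
proof -
  interpret field_point F id
    by (rule field_point.intro[OF F.is_cring], unfold_locales) (rule ring_hom_memI; simp add: ring_of_type_algebra_def)
  have "id (mpoly_eval F yF P) = of_mpoly P"
    unfolding value_indet[symmetric] by (subst phi_mpoly_eval) (simp_all add: yF_def)
  then show ?thesis by simp
qed

lemma eval_FF: "fst (mpoly_eval FF yFF P) = of_mpoly P" "snd (mpoly_eval FF yFF P) = twist_value P"
proof -
  interpret f: field_point FF fst
    by (rule field_point.intro[OF FF.is_cring], unfold_locales) (rule ring_hom_memI; simp add: ring_of_type_algebra_def)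
  interpret g: field_point FF snd
    by (rule field_point.intro[OF FF.is_cring], unfold_locales) (rule ring_hom_memI; simp add: ring_of_type_algebra_def)
  show "fst (mpoly_eval FF yFF P) = of_mpoly P"
    unfolding value_indet[symmetric] by (subst f.phi_mpoly_eval) (simp_all add: yFF_def)
  show "snd (mpoly_eval FF yFF P) = twist_value P"
    unfolding twist_value_def by (subst g.phi_mpoly_eval) (simp_all add: yFF_def)
qed

text \<open>Inherited from evaluation in \<open>FF\<close>, whose second component is
  \<open>twist_value\<close>.\<close>

lemma twist_value_hom:
  "twist_value (P + Q) = twist_value P + twist_value Q" "twist_value (P * Q) = twist_value P * twist_value Q"
  "twist_value (- P) = - twist_value P"
  "twist_value (X_poly 0) = inverse (indet 0)" "twist_value (u_poly r) = p"
proof -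
  have y: "yFF i \<in> carrier FF" for i by simp
  show "twist_value (P + Q) = twist_value P + twist_value Q"
    unfolding eval_FF(2)[symmetric] by (simp add: FF.mpoly_eval_add[OF y])
  have m: "twist_value (P * Q) = twist_value P * twist_value Q" for P Q
    unfolding eval_FF(2)[symmetric] by (simp add: FF.mpoly_eval_mult[OF y])
  then show "twist_value (P * Q) = twist_value P * twist_value Q" .
  show "twist_value (- P) = - twist_value P"
    unfolding eval_FF(2)[symmetric] by (simp add: FF.mpoly_eval_neg[OF y] FF_neg)
  have tx: "twist_value (X_poly i) = (if i = 0 then inverse (indet 0) else indet i)" for i
    unfolding eval_FF(2)[symmetric] X_poly_def FF.mpoly_eval_var[OF y] by (simp add: yFF_def)
  then show "twist_value (X_poly 0) = inverse (indet 0)" by simp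
  have one: "twist_value 1 = 1" unfolding eval_FF(2)[symmetric] by (simp add: FF.mpoly_eval_1[OF y])
  have "twist_value (\<Prod>i\<in>B. X_poly i) = (\<Prod>i\<in>B. indet i)" if "finite B" "0 \<notin> B" for B
    using that by (induction B rule: finite_induct) (auto simp: one m tx)
  then show "twist_value (u_poly r) = p" unfolding u_poly_def p_def by simp
qed

text \<open>The second component is the relation at \<open>(-\<rho>, 1/q)\<close>. Injectivity of
  \<open>twist_value\<close> makes it an identity of polynomials,
  \<open>\<alpha> = \<beta> p\<close> for odd and \<open>\<alpha> = \<beta> q p\<close> for even
  \<open>r\<close>. The first component then leaves \<open>2 \<beta> p = 0\<close> or
  \<open>\<beta> p (q + 1/q) = 0\<close>.\<close>

lemma transfer_FF:
  assumes "mpoly_eval FF yFF \<alpha> \<oplus>\<^bsub>FF\<^esub> mpoly_eval FF yFF \<beta> \<otimes>\<^bsub>FF\<^esub> par_rho FF = \<zero>\<^bsub>FF\<^esub>"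
  shows "\<alpha> = 0 \<and> \<beta> = 0"
proof -
  let ?b = "of_mpoly \<beta>"
  have 1: "of_mpoly \<alpha> + ?b * \<rho> = 0" and 2: "twist_value \<alpha> - twist_value \<beta> * \<rho> = 0"
    using assms by (auto simp: prod_eq_iff eval_FF)
  have "?b = 0"
  proof (cases "odd r")
    case True
    have "twist_value (\<alpha> + - (\<beta> * u_poly r)) = 0"
      using 2 True unfolding twist_value_hom by (simp add: \<rho>_def)
    then have "\<alpha> = \<beta> * u_poly r" using twist_value_eq_0 by (metis add.inverse_inverse eq_neg_iff_add_eq_0)
    then have "of_mpoly \<alpha> = ?b * p" by (simp add: of_mpoly_mult of_mpoly_u_poly p_def)
    then have "2 * (?b * p) = 0" using 1 True by (simp add: \<rho>_def)
    then show ?thesis using two_nz p_nz by simp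
  next
    case False
    \<comment> \<open>\<open>\<rho> = p / q\<close> is the twisted value of the polynomial
      \<open>q p\<close>, which turns the relation into one between polynomials.\<close>
    have "twist_value (\<alpha> + - (\<beta> * (X_poly 0 * u_poly r))) = 0"
      using 2 False unfolding twist_value_hom by (simp add: \<rho>_def)
    then have "\<alpha> = \<beta> * (X_poly 0 * u_poly r)" using twist_value_eq_0 by (metis add.inverse_inverse eq_neg_iff_add_eq_0)
    then have "of_mpoly \<alpha> = ?b * (indet 0 * p)" by (simp add: of_mpoly_mult of_mpoly_u_poly of_mpoly_X p_def)
    then have "?b * p * (indet 0 + inverse (indet 0)) = 0" using 1 False by (simp add: \<rho>_def algebra_simps)
    then show ?thesis using two_q_nz p_nz by simp
  qed
  then have "of_mpoly \<alpha> = of_mpoly 0" "of_mpoly \<beta> = of_mpoly 0" using 1 by (simp_all add: of_mpoly_0)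
  then show ?thesis unfolding of_mpoly_eq_iff by simp
qed

lemma map_R_zero:
  fixes S :: "('b, 'n) param_ring_scheme"
  assumes "wy_params r S"
  shows "\<exists>\<phi>. ground_morphism r (R_zero r) S \<phi>"
proof -
  have gS: "ground_ring r S" using assms by (simp add: wy_params_def)
  interpret S: ground_ring r S by (rule gS)
  note w = wS[OF gS]
  have 0: "mpoly_eval S (wS S) 0 = \<zero>\<^bsub>S\<^esub>" by (rule S.mpoly_eval_0[OF w(1)])
  have "\<exists>\<phi>. \<phi> \<in> ring_hom (FF\<lparr>carrier := GFF\<rparr>) S \<and> \<phi> (par_rho FF) = par_rho S
     \<and> \<phi> (par_q FF) = par_q S \<and> (\<forall>j. \<phi> (par_delta FF j) = par_delta S j) \<and> (\<forall>i\<in>{1..r}. \<phi> (par_u FF i) = par_u S i)"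
  proof (rule universal_map[OF r_ge FF_wy assms, of yFF "wS S"])
    fix \<alpha> \<beta> assume "mpoly_eval FF yFF \<alpha> \<oplus>\<^bsub>FF\<^esub> mpoly_eval FF yFF \<beta> \<otimes>\<^bsub>FF\<^esub> par_rho FF = \<zero>\<^bsub>FF\<^esub>"
    then have "\<alpha> = 0 \<and> \<beta> = 0" by (rule transfer_FF)
    then show "mpoly_eval S (wS S) \<alpha> \<oplus>\<^bsub>S\<^esub> mpoly_eval S (wS S) \<beta> \<otimes>\<^bsub>S\<^esub> par_rho S = \<zero>\<^bsub>S\<^esub>"
      using 0 S.Units_closed[OF S.rho_unit] by simp
  qed (use w in \<open>auto simp: yFF_def\<close>)
  then obtain \<phi> where \<phi>: "\<phi> \<in> ring_hom (FF\<lparr>carrier := GFF\<rparr>) S" "\<phi> (par_rho FF) = par_rho S"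
     "\<phi> (par_q FF) = par_q S" "\<forall>j. \<phi> (par_delta FF j) = par_delta S j" "\<forall>i\<in>{1..r}. \<phi> (par_u FF i) = par_u S i"
    by blast
  have "ground_morphism r (R_zero r) S \<phi>"
    unfolding ground_morphism_def using R_zero_ground gS \<phi> unfolding R_zero_eq by (simp del: param_prod_simps)
  then show ?thesis by blast
qed

text \<open>In the field, \<open>\<alpha> + \<beta> \<rho> = 0\<close> is equivalent to
  \<open>\<alpha> + \<beta> p = 0\<close> or \<open>q \<alpha> + \<beta> p = 0\<close>, according to
  parity. As an identity of integer polynomials it holds in every ring, and the assumption on
  \<open>\<rho>\<close> translates it back in \<open>S\<close>.\<close>

lemma map_R_plus:
  fixes S :: "('b, 'n) param_ring_scheme"
  assumes wy: "wy_params r S"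
    and rho: "(if odd r then par_rho S else par_q S \<otimes>\<^bsub>S\<^esub> par_rho S) = (\<Otimes>\<^bsub>S\<^esub>i\<in>{1..r}. par_u S i)"
  shows "\<exists>\<phi>. \<phi> \<in> ring_hom (R_plus r) S \<and> \<phi> (par_rho (R_plus r)) = par_rho S
     \<and> \<phi> (par_q (R_plus r)) = par_q S \<and> (\<forall>j. \<phi> (par_delta (R_plus r) j) = par_delta S j)
     \<and> (\<forall>i\<in>{1..r}. \<phi> (par_u (R_plus r) i) = par_u S i)"
proof -
  have gS: "ground_ring r S" using wy by (simp add: wy_params_def)
  interpret S: ground_ring r S by (rule gS)
  note w = wS[OF gS]
  let ?e = "mpoly_eval S (wS S)"
  note e = S.mpoly_eval_add[OF w(1)] S.mpoly_eval_mult[OF w(1)] S.mpoly_eval_0[OF w(1)] eval_S_u_poly[OF gS]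
  have ec: "?e P \<in> carrier S" for P by (rule S.mpoly_eval_closed[OF w(1)])
  have eX: "?e (X_poly 0) = par_q S" unfolding X_poly_def S.mpoly_eval_var[OF w(1)] by (rule w(2))
  have rc: "par_rho S \<in> carrier S" "par_q S \<in> carrier S" using S.rho_unit S.q_unit by auto
  have "\<exists>\<phi>. \<phi> \<in> ring_hom (F\<lparr>carrier := GF\<rparr>) S \<and> \<phi> (par_rho F) = par_rho S
     \<and> \<phi> (par_q F) = par_q S \<and> (\<forall>j. \<phi> (par_delta F j) = par_delta S j) \<and> (\<forall>i\<in>{1..r}. \<phi> (par_u F i) = par_u S i)"
  proof (rule universal_map[OF r_ge F_wy wy, of yF "wS S"])
    fix \<alpha> \<beta> assume "mpoly_eval F yF \<alpha> \<oplus>\<^bsub>F\<^esub> mpoly_eval F yF \<beta> \<otimes>\<^bsub>F\<^esub> par_rho F = \<zero>\<^bsub>F\<^esub>"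
    then have 1: "of_mpoly \<alpha> + of_mpoly \<beta> * \<rho> = 0" by (simp add: eval_F)
    show "?e \<alpha> \<oplus>\<^bsub>S\<^esub> ?e \<beta> \<otimes>\<^bsub>S\<^esub> par_rho S = \<zero>\<^bsub>S\<^esub>"
    proof (cases "odd r")
      case True
      have "of_mpoly (\<alpha> + \<beta> * u_poly r) = of_mpoly 0"
        using 1 True by (simp add: of_mpoly_add of_mpoly_mult of_mpoly_u_poly of_mpoly_0 \<rho>_def p_def)
      then have "?e (\<alpha> + \<beta> * u_poly r) = ?e 0" unfolding of_mpoly_eq_iff by simp
      then show ?thesis using True rho by (simp add: e)
    next
      case False
      have up: "of_mpoly (u_poly r) = p" by (simp only: of_mpoly_u_poly p_def)
      have "indet 0 * \<rho> = p" using False q_nz by (simp add: \<rho>_def)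
      then have "of_mpoly (X_poly 0 * \<alpha> + \<beta> * u_poly r) = indet 0 * (of_mpoly \<alpha> + of_mpoly \<beta> * \<rho>)"
        by (simp add: of_mpoly_add of_mpoly_mult up of_mpoly_X algebra_simps)
      also have "\<dots> = of_mpoly 0" using 1 by (simp add: of_mpoly_0)
      finally have "of_mpoly (X_poly 0 * \<alpha> + \<beta> * u_poly r) = of_mpoly 0" .
      then have "?e (X_poly 0 * \<alpha> + \<beta> * u_poly r) = ?e 0" unfolding of_mpoly_eq_iff by simp
      then have 2: "par_q S \<otimes>\<^bsub>S\<^esub> ?e \<alpha> \<oplus>\<^bsub>S\<^esub> ?e \<beta> \<otimes>\<^bsub>S\<^esub> (par_q S \<otimes>\<^bsub>S\<^esub> par_rho S) = \<zero>\<^bsub>S\<^esub>"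
        using False rho by (simp add: e eX)
      have "par_q S \<otimes>\<^bsub>S\<^esub> (?e \<alpha> \<oplus>\<^bsub>S\<^esub> ?e \<beta> \<otimes>\<^bsub>S\<^esub> par_rho S) = par_q S \<otimes>\<^bsub>S\<^esub> ?e \<alpha> \<oplus>\<^bsub>S\<^esub> ?e \<beta> \<otimes>\<^bsub>S\<^esub> (par_q S \<otimes>\<^bsub>S\<^esub> par_rho S)"
        using ec rc by (simp add: S.r_distr S.m_lcomm)
      then have "par_q S \<otimes>\<^bsub>S\<^esub> (?e \<alpha> \<oplus>\<^bsub>S\<^esub> ?e \<beta> \<otimes>\<^bsub>S\<^esub> par_rho S) = par_q S \<otimes>\<^bsub>S\<^esub> \<zero>\<^bsub>S\<^esub>" using 2 rc by simp
      then show ?thesis by (subst (asm) S.Units_l_cancel[OF S.q_unit]) (use ec rc in auto)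
    qed
  qed (use w in \<open>auto simp: yF_def\<close>)
  then show ?thesis unfolding R_plus_eq by simp
qed

text \<open>The quadratic equation says \<open>(\<rho> - p)(-\<rho> - p) = 0\<close> or
  \<open>(q \<rho> - p)(-\<rho>/q - p) = 0\<close>. The second factor is the first one at the
  twisted parameters.\<close>

lemma rho_branches:
  fixes S :: "('b, 'n) param_ring_scheme" (structure)
  assumes wy: "wy_params r S" and dom: "domain S"
  shows "(if odd r then par_rho S else par_q S \<otimes> par_rho S) = (\<Otimes>i\<in>{1..r}. par_u S i)
    \<or> (if odd r then \<ominus> par_rho S else inv (par_q S) \<otimes> \<ominus> par_rho S) = (\<Otimes>i\<in>{1..r}. par_u S i)"
proof -
  interpret ground_ring r S using wy by (simp add: wy_params_def)
  interpret domain S by (rule dom)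
  let ?p = "\<Otimes>i\<in>{1..r}. par_u S i" and ?q = "par_q S" and ?r = "par_rho S"
  have cl: "?r \<in> carrier S" "?q \<in> carrier S" "inv ?q \<in> carrier S" "?p \<in> carrier S" "?q \<otimes> inv ?q = \<one>"
    using rho_unit q_unit u_prod_closed by auto
  note quad = rho_quadratic[OF wy r_ge]
  show ?thesis
  proof (cases "odd r")
    case True
    have "(x \<ominus> w) \<otimes> (\<ominus> x \<ominus> w) = w \<otimes> w \<ominus> x \<otimes> x" if "x \<in> carrier S" "w \<in> carrier S" for x w using that by algebra
    from this[OF cl(1,4)] have "(?r \<ominus> ?p) \<otimes> (\<ominus> ?r \<ominus> ?p) = \<zero>" using quad True cl by (simp add: r_right_minus_eq)
    then have "?r \<ominus> ?p = \<zero> \<or> \<ominus> ?r \<ominus> ?p = \<zero>" using cl by (intro integral) auto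
    then show ?thesis using True cl by simp
  next
    case False
    have "(q \<otimes> x \<ominus> w) \<otimes> (q' \<otimes> (\<ominus> x) \<ominus> w) = w \<otimes> w \<ominus> (q \<otimes> q') \<otimes> (x \<otimes> x) \<ominus> (q \<ominus> q') \<otimes> w \<otimes> x"
      if "x \<in> carrier S" "w \<in> carrier S" "q \<in> carrier S" "q' \<in> carrier S" for x w q q' using that by algebra
    from this[OF cl(1,4,2,3)] have "(?q \<otimes> ?r \<ominus> ?p) \<otimes> (inv ?q \<otimes> (\<ominus> ?r) \<ominus> ?p) = ?p \<otimes> ?p \<ominus> ?r \<otimes> ?r \<ominus> (?q \<ominus> inv ?q) \<otimes> ?p \<otimes> ?r"
      using cl by simp
    also have "\<dots> = ?p \<otimes> ?p \<ominus> (?r \<otimes> ?r \<oplus> (?q \<ominus> inv ?q) \<otimes> ?p \<otimes> ?r)"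
    proof -
      have "a \<ominus> b \<ominus> c = a \<ominus> (b \<oplus> c)" if "a \<in> carrier S" "b \<in> carrier S" "c \<in> carrier S" for a b c using that by algebra
      then show ?thesis using cl by simp
    qed
    also have "\<dots> = \<zero>" using quad False cl by (simp add: q_diff_def)
    finally have "?q \<otimes> ?r \<ominus> ?p = \<zero> \<or> inv ?q \<otimes> (\<ominus> ?r) \<ominus> ?p = \<zero>" using cl by (intro integral) auto
    then show ?thesis using False cl by simp
  qed
qed

lemma map_R_plus_domain:
  fixes S :: "('b, 'n) param_ring_scheme"
  assumes wy: "wy_params r S" and dom: "domain S"
  shows "\<exists>\<chi>. ground_morphism r (R_plus r) S \<chi>"
proof -
  have gS: "ground_ring r S" using wy by (simp add: wy_params_def)
  consider "(if odd r then par_rho S else par_q S \<otimes>\<^bsub>S\<^esub> par_rho S) = (\<Otimes>\<^bsub>S\<^esub>i\<in>{1..r}. par_u S i)"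
    | "(if odd r then \<ominus>\<^bsub>S\<^esub> par_rho S else inv\<^bsub>S\<^esub> (par_q S) \<otimes>\<^bsub>S\<^esub> \<ominus>\<^bsub>S\<^esub> par_rho S) = (\<Otimes>\<^bsub>S\<^esub>i\<in>{1..r}. par_u S i)"
    using rho_branches[OF wy dom] by blast
  then show ?thesis
  proof cases
    case 1
    from map_R_plus[OF wy this] show ?thesis
      unfolding ground_morphism_def using R_plus_ground gS by blast
  next
    case 2
    \<comment> \<open>The twist leaves the ring operations alone. A strict map into it sends
      \<open>\<rho>\<close> to \<open>-\<rho>\<close> and \<open>q\<close> to \<open>1/q\<close> in
      terms of \<open>S\<close>, which a ground morphism may do.\<close>
    let ?T = "param_twist S"
    have T: "par_rho ?T = \<ominus>\<^bsub>S\<^esub> par_rho S" "par_q ?T = inv\<^bsub>S\<^esub> par_q S" "par_u ?T = par_u S"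
      "par_delta ?T = par_delta S" "monoid.mult ?T = monoid.mult S"
      "finprod ?T f I = finprod S f I" for f :: "nat \<Rightarrow> 'b" and I
      by (simp_all add: param_twist_def finprod_def)
    have "(if odd r then par_rho ?T else par_q ?T \<otimes>\<^bsub>?T\<^esub> par_rho ?T) = (\<Otimes>\<^bsub>?T\<^esub>i\<in>{1..r}. par_u ?T i)"
      unfolding T by (rule 2)
    from map_R_plus[OF wy_params_twist[OF wy r_ge] this]
    obtain \<chi> where "\<chi> \<in> ring_hom (R_plus r) S" "\<chi> (par_rho (R_plus r)) = \<ominus>\<^bsub>S\<^esub> par_rho S"
      "\<chi> (par_q (R_plus r)) = inv\<^bsub>S\<^esub> par_q S" "\<forall>j. \<chi> (par_delta (R_plus r) j) = par_delta S j"
      "\<forall>i\<in>{1..r}. \<chi> (par_u (R_plus r) i) = par_u S i"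
      unfolding T ring_hom_twist by blast
    then have "ground_morphism r (R_plus r) S \<chi>"
      unfolding ground_morphism_def using R_plus_ground gS by blast
    then show ?thesis by blast
  qed
qed

end

section \<open>The localization of $\overline R_+$\<close>

text \<open>The isomorphism is easier to construct into the localization, where the ground ring
  axioms are not yet known. They are transported along \<open>h\<close>, and the inverse has the
  required direction.\<close>

lemma ground_iso_inverse:
  fixes A :: "('a, 'm) param_ring_scheme" and B :: "('b, 'n) param_ring_scheme"
  assumes gA: "ground_ring r A" and h: "h \<in> ring_iso A B" and B: "cring B"
    and par: "h (par_rho A) = par_rho B" "h (par_q A) = par_q B" "\<And>j. h (par_delta A j) = par_delta B j"
      and par_u: "\<And>i. i \<in> {1..r} \<Longrightarrow> h (par_u A i) = par_u B i"
  shows "ground_iso r B A (inv_into (carrier A) h)"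
proof -
  interpret A: ground_ring r A by (rule gA)
  interpret h: ring_hom_cring A B h
    by (rule ring_hom_cringI[OF A.is_cring B]) (use h in \<open>simp add: ring_iso_def\<close>)
  have units: "h x \<in> Units B \<and> inv\<^bsub>B\<^esub> (h x) = h (inv\<^bsub>A\<^esub> x)" if x: "x \<in> Units A" for x
  proof -
    have c: "x \<in> carrier A" "inv\<^bsub>A\<^esub> x \<in> carrier A" using x by auto
    have e: "h x \<otimes>\<^bsub>B\<^esub> h (inv\<^bsub>A\<^esub> x) = \<one>\<^bsub>B\<^esub>" "h (inv\<^bsub>A\<^esub> x) \<otimes>\<^bsub>B\<^esub> h x = \<one>\<^bsub>B\<^esub>"
      unfolding h.hom_mult[OF c, symmetric] h.hom_mult[OF c(2,1), symmetric] using x by simp_all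
    have "h x \<in> Units B" unfolding Units_def using e c by auto
    then show ?thesis using e c by (auto intro!: h.S.inv_char)
  qed
  have sub: "h (x \<ominus>\<^bsub>A\<^esub> y) = h x \<ominus>\<^bsub>B\<^esub> h y" if "x \<in> carrier A" "y \<in> carrier A" for x y
    using that by (simp add: a_minus_def)
  have c: "par_rho A \<in> carrier A" "inv\<^bsub>A\<^esub> par_rho A \<in> carrier A" "par_q A \<in> carrier A" "inv\<^bsub>A\<^esub> par_q A \<in> carrier A"
    using A.rho_unit A.q_unit by auto
  have gB: "ground_ring r B"
  proof (rule ground_ring.intro[OF B], unfold_locales)
    show "par_rho B \<in> Units B" "par_q B \<in> Units B" "par_delta B 0 \<in> Units B" "\<And>j. par_delta B j \<in> carrier B"
      unfolding par[symmetric] using units A.rho_unit A.q_unit A.delta0_unit A.delta_closed by auto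
    show "par_u B i \<in> Units B" if "i \<in> {1..r}" for i
      using units[OF A.u_unit[OF that]] unfolding par_u[OF that] by simp
    have "h (inv\<^bsub>A\<^esub> par_rho A \<ominus>\<^bsub>A\<^esub> par_rho A) = h ((inv\<^bsub>A\<^esub> par_q A \<ominus>\<^bsub>A\<^esub> par_q A) \<otimes>\<^bsub>A\<^esub> (par_delta A 0 \<ominus>\<^bsub>A\<^esub> \<one>\<^bsub>A\<^esub>))"
      using A.ground_relation by simp
    then show "inv\<^bsub>B\<^esub> par_rho B \<ominus>\<^bsub>B\<^esub> par_rho B = (inv\<^bsub>B\<^esub> par_q B \<ominus>\<^bsub>B\<^esub> par_q B) \<otimes>\<^bsub>B\<^esub> (par_delta B 0 \<ominus>\<^bsub>B\<^esub> \<one>\<^bsub>B\<^esub>)"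
      using c A.delta_closed[of 0] units[OF A.rho_unit] units[OF A.q_unit] by (simp add: sub par)
  qed
  have bij: "bij_betw h (carrier A) (carrier B)" and inj: "inj_on h (carrier A)"
    using ring_iso_memE(5)[OF h] by (auto simp: bij_betw_def)
  have "inv_into (carrier A) h \<in> ring_iso B A" by (rule ring_iso_set_sym[OF A.ring_axioms h])
  moreover have "inv_into (carrier A) h (h x) = x" if "x \<in> carrier A" for x using inj that by simp
  moreover from this have "inv_into (carrier A) h (par_u B i) = par_u A i" if "i \<in> {1..r}" for i
    using A.Units_closed[OF A.u_unit[OF that]] unfolding par_u[OF that, symmetric] by blast
  ultimately show ?thesis
    unfolding ground_iso_def ground_morphism_def par[symmetric]
    using gA gB A.rho_unit A.q_unit A.delta_closed A.u_unit bij_betw_inv_into[OF bij] by (auto simp: ring_iso_def)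
qed

section \<open>Fractions whose denominators are powers of \<open>z\<close>\<close>

context universal_data begin

text \<open>The class in the localization that represents the field element \<open>s\<close>,
  described without the choice of a numerator. Since \<open>z\<close> is nonzero in a field, the
  annihilating power in \<open>frac_class\<close> can be cancelled.\<close>

definition fractions :: "ratfun \<Rightarrow> (ratfun \<times> nat) set" where
  "fractions s = {(b, n). b \<in> GF \<and> b = s * z ^ n}"

lemma GF_subring: "subring GF F" by (rule F.generated_subring)

lemma GF_ops: "1 \<in> GF" "x \<in> GF \<Longrightarrow> y \<in> GF \<Longrightarrow> x * y \<in> GF" "x \<in> GF \<Longrightarrow> y \<in> GF \<Longrightarrow> x + y \<in> GF" "x \<in> GF \<Longrightarrow> - x \<in> GF"
  using subringE(3,5,6,7)[OF GF_subring] by auto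

lemma z_GF: "z \<in> GF" "z ^ n \<in> GF"
proof -
  have "indet 0 \<in> GF" "inverse (indet 0) \<in> GF"
    by (rule generate_ring.incl; simp add: param_gens_def indet_nz)+
  then show z: "z \<in> GF" unfolding z_def using GF_ops(3)[of "indet 0" "- inverse (indet 0)"] GF_ops(4) by simp
  show "z ^ n \<in> GF" by (induction n) (use z GF_ops in auto)
qed

lemma pow_R_plus: "x [^]\<^bsub>R_plus r\<^esub> (n::nat) = x ^ n"
proof (induction n)
  case 0
  then show ?case by (simp add: nat_pow_def R_plus_eq)
next
  case (Suc n)
  then show ?case by (simp add: nat_pow_def R_plus_eq mult.commute)
qed

lemma frac_class_eq:
  assumes "a \<in> GF"
  shows "frac_class (R_plus r) z a m = fractions (a / z ^ m)"
proof -
  interpret R: ground_ring r "R_plus r" by (rule R_plus_ground)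
  have ops: "x \<ominus>\<^bsub>R_plus r\<^esub> y = x - y" if "x \<in> GF" "y \<in> GF" for x y
    unfolding R_plus_eq using F.subring_diff[OF GF_subring that] by simp
  have "(b \<in> carrier (R_plus r) \<and> (\<exists>k::nat. z [^]\<^bsub>R_plus r\<^esub> k \<otimes>\<^bsub>R_plus r\<^esub> ((a \<otimes>\<^bsub>R_plus r\<^esub> z [^]\<^bsub>R_plus r\<^esub> n)
      \<ominus>\<^bsub>R_plus r\<^esub> (b \<otimes>\<^bsub>R_plus r\<^esub> z [^]\<^bsub>R_plus r\<^esub> m)) = \<zero>\<^bsub>R_plus r\<^esub>)) \<longleftrightarrow> b \<in> GF \<and> b = a / z ^ m * z ^ n" for b n
  proof (cases "b \<in> GF")
    case True
    have R: "x \<otimes>\<^bsub>R_plus r\<^esub> y = x * y" "\<zero>\<^bsub>R_plus r\<^esub> = 0" "carrier (R_plus r) = GF" for x y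
      by (simp_all add: R_plus_eq)
    have "(a * z ^ n) \<ominus>\<^bsub>R_plus r\<^esub> (b * z ^ m) = a * z ^ n - b * z ^ m" using assms True GF_ops(2) z_GF by (intro ops) auto
    then show ?thesis
      using True z_nz by (auto simp: R pow_R_plus field_simps)
  qed (simp add: R_plus_eq)
  then show ?thesis unfolding frac_class_def fractions_def by simp
qed

text \<open>Beyond elements of \<open>GF\<close>, the generators of \<open>KS\<close> contain only
  \<open>1 / (1/q - q) = - 1 / z\<close>.\<close>

lemma KS_fractions: "KS = {a / z ^ n | a n. a \<in> GF}"
proof
  have "inverse z ^ n \<in> KS" for n by (induction n) (auto intro: KS_ops KS_inverse_z)
  moreover have "GF \<subseteq> KS" by (rule F.generate_ring_min_subring1[OF _ KS_subring F_gens_KS(1)]) simp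
  ultimately show "{a / z ^ n | a n. a \<in> GF} \<subseteq> KS"
    using KS_ops(2) by (auto simp: divide_inverse power_inverse)
next
  let ?D = "{a / z ^ n | a n. a \<in> GF}"
  have D: "a / z ^ n \<in> ?D" if "a \<in> GF" for a n using that by blast
  have GD: "GF \<subseteq> ?D" using D[of _ 0] by auto
  have sub: "subring ?D F"
  proof (rule F.subringI)
    show "?D \<subseteq> carrier F" by simp
    show "\<one>\<^bsub>F\<^esub> \<in> ?D" using GD GF_ops(1) by auto
    show "\<ominus>\<^bsub>F\<^esub> x \<in> ?D" if "x \<in> ?D" for x
    proof -
      from \<open>x \<in> ?D\<close> obtain a n where "a \<in> GF" "x = a / z ^ n" by blast
      then show ?thesis using D[OF GF_ops(4)[of a], of n] by simp
    qed
    fix x y assume "x \<in> ?D" "y \<in> ?D"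
    then obtain a n b m where a: "a \<in> GF" "x = a / z ^ n" and b: "b \<in> GF" "y = b / z ^ m" by blast
    have "x * y = (a * b) / z ^ (n + m)" using a b by (simp add: power_add)
    then show "x \<otimes>\<^bsub>F\<^esub> y \<in> ?D" using D[OF GF_ops(2)[OF a(1) b(1)], of "n + m"] by simp
    have "x + y = (a * z ^ m + b * z ^ n) / z ^ (n + m)" using a b z_nz by (simp add: power_add add_divide_distrib)
    then show "x \<oplus>\<^bsub>F\<^esub> y \<in> ?D" using D[of "a * z ^ m + b * z ^ n" "n + m"] a b GF_ops z_GF by simp
  qed
  have gens: "indet i \<in> GF" "inverse (indet i) \<in> GF" if "i \<in> {0..r}" for i
  proof -
    have "indet i \<in> param_gens r F" "inverse (indet i) \<in> param_gens r F"
      unfolding param_gens_def using that indet_nz by (cases "i = 0"; auto)+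
    then show "indet i \<in> GF" "inverse (indet i) \<in> GF" by (auto intro: generate_ring.incl)
  qed
  have "inverse (inverse (indet 0) - indet 0) = (- 1) / z ^ 1"
    unfolding z_def by (simp add: divide_inverse) (metis inverse_minus_eq minus_diff_eq)
  then have zi: "inverse (inverse (indet 0) - indet 0) \<in> ?D" using D[OF GF_ops(4)[OF GF_ops(1)], of 1] by simp
  have "inverse (delta_bar r 0) \<in> GF"
    by (rule generate_ring.incl) (simp add: param_gens_def delta_bar_0_nz)
  moreover have "S0_carrier r \<subseteq> ?D"
    unfolding S0_carrier_def generate_F
    by (rule F.generate_ring_min_subring1[OF _ sub]) (use gens zi GD in auto)
  ultimately show "KS \<subseteq> ?D"
    unfolding KS_def by (intro F.generate_ring_min_subring1[OF _ sub]) (use GD in auto)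
qed

lemma fractions_nonempty: "s \<in> KS \<Longrightarrow> \<exists>n. s * z ^ n \<in> GF \<and> (s * z ^ n, n) \<in> fractions s"
proof -
  assume "s \<in> KS"
  then obtain a n where "a \<in> GF" "s = a / z ^ n" unfolding KS_fractions by blast
  then show ?thesis using z_nz by (intro exI[of _ n]) (simp add: fractions_def)
qed

lemma q_diff_R_plus: "q_diff (R_plus r) = z"
  unfolding R_plus_eq F.sub_q_diff[OF GF_subring GF_gens GF_delta] by (rule q_diff_F)

abbreviation "L \<equiv> localize (R_plus r) z"

lemma fractions_iso: "fractions \<in> ring_iso (S_bar r) L"
proof (rule ring_iso_memI)
  have carrier_L: "carrier L = fractions ` KS"
  proof -
    have "carrier L = {frac_class (R_plus r) z a n | a n. a \<in> GF}" by (simp add: localize_def R_plus_eq)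
    also have "\<dots> = {fractions (a / z ^ n) | a n. a \<in> GF}" by (rule Collect_cong) (use frac_class_eq in metis)
    also have "\<dots> = fractions ` KS" unfolding KS_fractions by blast
    finally show ?thesis .
  qed
  show "fractions x \<in> carrier L" if "x \<in> carrier (S_bar r)" for x
    using that by (simp add: carrier_L S_bar_eq)
  have "inj_on fractions KS"
  proof (rule inj_onI)
    fix s t assume "s \<in> KS" "t \<in> KS" "fractions s = fractions t"
    then obtain n where "(s * z ^ n, n) \<in> fractions t" using fractions_nonempty by blast
    then show "s = t" using z_nz by (simp add: fractions_def)
  qed
  then show "bij_betw fractions (carrier (S_bar r)) (carrier L)" by (simp add: bij_betw_def carrier_L S_bar_eq)
  show "fractions \<one>\<^bsub>S_bar r\<^esub> = \<one>\<^bsub>L\<^esub>"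
    using frac_class_eq[OF GF_ops(1), of 0] by (simp add: localize_def S_bar_eq R_plus_eq)
  fix s t assume "s \<in> carrier (S_bar r)" "t \<in> carrier (S_bar r)"
  then have st: "s \<in> KS" "t \<in> KS" by (simp_all add: S_bar_eq)
  \<comment> \<open>Sums and products of classes are unions over all pairs of representatives; a
    union of equal sets over nonempty index sets is that set.\<close>
  have const: "(\<Union>x\<in>fractions s. \<Union>y\<in>fractions t. k x y) = v" if "\<And>x y. x \<in> fractions s \<Longrightarrow> y \<in> fractions t \<Longrightarrow> k x y = v"
    for k and v :: "(ratfun \<times> nat) set"
    using that fractions_nonempty[OF st(1)] fractions_nonempty[OF st(2)] by blast
  show "fractions (s \<otimes>\<^bsub>S_bar r\<^esub> t) = fractions s \<otimes>\<^bsub>L\<^esub> fractions t"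
  proof -
    have "frac_class (R_plus r) z (fst x * fst y) (snd x + snd y) = fractions (s * t)"
      if "x \<in> fractions s" "y \<in> fractions t" for x y
    proof -
      have xy: "fst x \<in> GF" "fst y \<in> GF" "fst x = s * z ^ snd x" "fst y = t * z ^ snd y"
        using that by (auto simp: fractions_def)
      then have c: "fst x * fst y \<in> GF" using GF_ops(2) by blast
      have "fst x * fst y = (s * t) * z ^ (snd x + snd y)" unfolding xy(3,4) by (simp add: power_add algebra_simps)
      then have "fst x * fst y / z ^ (snd x + snd y) = s * t" using z_nz by simp
      then show ?thesis unfolding frac_class_eq[OF c] by simp
    qed
    from const[OF this] show ?thesis by (simp add: localize_def S_bar_eq R_plus_eq)
  qed
  show "fractions (s \<oplus>\<^bsub>S_bar r\<^esub> t) = fractions s \<oplus>\<^bsub>L\<^esub> fractions t"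
  proof -
    have "frac_class (R_plus r) z (fst x * z ^ snd y + fst y * z ^ snd x) (snd x + snd y) = fractions (s + t)"
      if "x \<in> fractions s" "y \<in> fractions t" for x y
    proof -
      have xy: "fst x \<in> GF" "fst y \<in> GF" "fst x = s * z ^ snd x" "fst y = t * z ^ snd y" using that by (auto simp: fractions_def)
      then have c: "fst x * z ^ snd y + fst y * z ^ snd x \<in> GF" by (intro GF_ops(2,3) z_GF)
      have "fst x * z ^ snd y + fst y * z ^ snd x = (s + t) * z ^ (snd x + snd y)"
        unfolding xy(3,4) by (simp add: power_add algebra_simps)
      then have "(fst x * z ^ snd y + fst y * z ^ snd x) / z ^ (snd x + snd y) = s + t" using z_nz by simp
      then show ?thesis unfolding frac_class_eq[OF c] by simp
    qed
    from const[OF this] show ?thesis by (simp add: localize_def S_bar_eq pow_R_plus) (simp add: R_plus_eq)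
  qed
qed

lemma localize_R_plus_iso: "\<exists>\<psi>. ground_iso r (localize (R_plus r) (q_diff (R_plus r))) (S_bar r) \<psi>"
proof -
  interpret S: ground_ring r "S_bar r" by (rule S_bar_ground)
  have incl: "fractions a = frac_class (R_plus r) z a 0" if "a \<in> GF" for a using frac_class_eq[OF that, of 0] by simp
  have "0 \<in> GF" using subringE(2)[OF GF_subring] by simp
  \<comment> \<open>\<open>ring_iso_imp_img_cring\<close> speaks of the codomain with its zero
    replaced by the image of zero; here both are the same class.\<close>
  then have "L\<lparr>ring.zero := fractions \<zero>\<^bsub>S_bar r\<^esub>\<rparr> = L"
    using incl[of 0] by (simp add: localize_def S_bar_eq R_plus_eq)
  with S.ring_iso_imp_img_cring[OF fractions_iso] have L: "cring L" by simp
  have "ground_iso r L (S_bar r) (inv_into (carrier (S_bar r)) fractions)"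
  proof (rule ground_iso_inverse[OF S_bar_ground fractions_iso L])
    have "\<rho> \<in> GF" "indet 0 \<in> GF" by (rule generate_ring.incl; simp add: param_gens_def)+
    then show "fractions (par_rho (S_bar r)) = par_rho L" "fractions (par_q (S_bar r)) = par_q L"
      using incl by (simp_all add: localize_def S_bar_eq R_plus_eq)
    show "fractions (par_delta (S_bar r) j) = par_delta L j" for j
      using incl GF_delta[of j] by (simp add: localize_def S_bar_eq R_plus_eq)
    show "fractions (par_u (S_bar r) i) = par_u L i" if "i \<in> {1..r}" for i
    proof -
      have "par_u F i \<in> GF" by (rule generate_ring.incl) (use that in \<open>auto simp: param_gens_def\<close>)
      then show ?thesis using incl by (simp add: localize_def S_bar_eq R_plus_eq)
    qed
  qed
  then show ?thesis unfolding q_diff_R_plus by blast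
qed

end

theorem theorem3p19:
  fixes r :: nat
  assumes "r \<ge> 1"
  shows "admissible r (R_zero r) \<and> admissible r (R_plus r) \<and> domain (R_plus r)
    \<and> (\<exists>\<pi>. ground_morphism r (R_zero r) (R_plus r) \<pi>)
    \<and> carrier (R_zero r) = generate_ring (R_zero r) (param_gens r (R_zero r))
    \<and> carrier (R_plus r) = generate_ring (R_plus r) (param_gens r (R_plus r))
    \<and> alg_independent_int (R_plus r) {0..r} (qu_family (R_plus r))
    \<and> alg_independent_int (R_zero r) {0..r} (qu_family (R_zero r))
    \<and> (\<forall>S :: 'b param_ring. admissible r S \<longrightarrow>
         (\<exists>\<phi>. ground_morphism r (R_zero r) S \<phi>))
    \<and> (\<forall>S :: 'b param_ring. admissible r S \<and> domain S \<longrightarrow>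
         (\<forall>\<pi>. ground_morphism r (R_zero r) (R_plus r) \<pi> \<longrightarrow>
            (\<exists>\<phi> \<chi>. ground_morphism r (R_zero r) S \<phi> \<and> ground_morphism r (R_plus r) S \<chi> \<and>
               (\<forall>x\<in>carrier (R_zero r). \<phi> x = \<chi> (\<pi> x)))))
    \<and> (\<exists>\<psi>. ground_iso r (localize (R_plus r) (q_diff (R_plus r))) (S_bar r) \<psi>)"
proof -
  interpret universal_data r by (rule universal_data.intro[OF assms])
  show ?thesis
  proof (intro conjI allI impI)
    show "\<exists>\<pi>. ground_morphism r (R_zero r) (R_plus r) \<pi>" using R_zero_to_R_plus by blast
  next
    show "\<exists>\<phi>. ground_morphism r (R_zero r) S \<phi>" if "admissible r S" for S :: "'b param_ring"
      by (rule map_R_zero[OF admissible_wy_params[OF assms that]])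
  next
    fix S :: "'b param_ring" and \<pi>
    assume S: "admissible r S \<and> domain S" and \<pi>: "ground_morphism r (R_zero r) (R_plus r) \<pi>"
    obtain \<chi> where \<chi>: "ground_morphism r (R_plus r) S \<chi>"
      using map_R_plus_domain[OF admissible_wy_params[OF assms]] S by blast
    \<comment> \<open>The morphism out of \<open>R_zero\<close> is taken to be the composite, so the
      factorization holds for every given \<open>\<pi>\<close>.\<close>
    have "ground_morphism r (R_zero r) S (\<chi> \<circ> \<pi>)" by (rule ground_morphism_comp[OF \<pi> \<chi>])
    then show "\<exists>\<phi> \<chi>. ground_morphism r (R_zero r) S \<phi> \<and> ground_morphism r (R_plus r) S \<chi> \<and>
               (\<forall>x\<in>carrier (R_zero r). \<phi> x = \<chi> (\<pi> x))"
      using \<chi> by (intro exI[of _ "\<chi> \<circ> \<pi>"] exI[of _ \<chi>]) simp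
  qed (rule R_zero_admissible R_plus_admissible R_plus_domain R_zero_generated R_plus_generated
      R_plus_alg_independent R_zero_alg_independent localize_R_plus_iso)+
qed

end
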